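(* Let $A=A_N$ and $B=B_N$ be random Hermitian $N\times N$ matrices such that: $A$ satisfies the injective-trace assumption at speed $M$ with constant $h_1$; $B$ satisfies the injective-trace assumption at speed $M$ with constant $h_2$; and both $A$ and $B$ satisfy the Frobenius assumption at speed $M$ with the same constant $C$ (both assumptions are defined in the context). Assume that one of $A$, $B$ is permutation invariant. Let $0\le c\le \frac{1}{h_1+h_2+6}$ and let $z\in\mathbb{C}$ with $\mathrm{Im}(z)>0$ and $$|z|^2>\max\{4C,2c^2\}=:r_0^2 .$$ Then $$\mathbb{E}\,\frac1N\big\|G_{a+b}(z)-G_{A+B}(z)\big\|_F^2\le \frac{4}{|z|^2}\left(\frac{r_0}{|z|}\right)^{2cM},$$ where $a+b$ is the free sum of $A$ and $B$ over the diagonal, constructed in the context, and $G_{A+B}(z),G_{a+b}(z)$ are the diagonal-valued Cauchy transforms at $zI$.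
   Context: Notation. $[N]=\{1,\dots,N\}$; $\mathcal{D}_N(\mathbb{C})$ is the algebra of diagonal $N\times N$ matrices; $\Delta(X)=(X_{i,j}\mathbf 1_{i=j})_{i,j}$; $\|X\|_F=\sqrt{\mathrm{Tr}(XX^* )}$. A random matrix $X$ is permutation invariant if $V_\sigma XV_\sigma^{-1}$ has the same law as $X$ for every permutation $\sigma$ of $[N]$, where $V_\sigma=(\mathbf 1_{i=\sigma(j)})_{i,j}$. Test graphs. A test graph $T=(V,E,\epsilon)$ in one variable is a finite directed multigraph (source and target maps $\mathrm{src},\mathrm{tar}:E\to V$) with labels $\epsilon:E\to\{1,*\}$. For a random $N\times N$ matrix $X$ put $$\mathrm{Tr}^0(T(X))=\sum_{\phi:V\to[N]\text{ injective}}\ \prod_{e\in E}X^{\epsilon(e)}(\phi(\mathrm{tar}(e)),\phi(\mathrm{src}(e))).$$ Injective-trace assumption. Let $M=M(N)$ be a sequence that goes to infinity with $N$ and is smaller than $\log N/\log\log N$. A sequence $X_N$ of random $N\times N$ matrices satisfies the injective-trace assumption at speed $M$ with constant $h>0$ if for every constant $c>0$ and every sequence of test graphs $T_N$ having $K(N)$ connected components $T_{k,N}=(V_{k,N},E_{k,N})$ with $\sum_{k=1}^{K(N)}|V_{k,N}|\le cM$ and $\sum_{k=1}^{K(N)}|E_{k,N}|\le cM$, one has $\mathbb{E}\big[N^{-K(N)}\mathrm{Tr}^0(T_N(X_N))\big]=O(N^{ch})$. Frobenius assumption. $X_N$ satisfies the Frobenius assumption at speed $M=M(N)\to\infty$ with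 constant $C>0$ (independent of $N$) if for all $N$, $\mathbb{E}\frac1N\|X_N^M\|_F^2\le C^M$. Construction of $a$, $b$ (done for each realization of $A,B$). Fix $x\in[N]$. Let $a,b$ also denote two formal symbols. For $n\ge1$ and $\star\in\{a,b\}$ let $V(n,\star)=\{(j_1,\dots,j_n,\star): j_i\in[N],\ x\ne j_1,\ j_1\neq j_2,\dots,j_{n-1}\neq j_n\}$, and let $V(0,a)=V(0,b)=\{x\}$. Let $V^x=\{x\}\sqcup\bigsqcup_{n\ge1}(V(n,a)\sqcup V(n,b))$ and $\mathcal{H}=\ell^2(V^x)$ with canonical basis $(\delta_v)$. The last index of $v=(j_1,\dots,j_n,\star)$ is $j(v)=j_n$, and $j(x)=x$. For $n\ge0$, $v=(j_1,\dots,j_n,b)\in V(n,b)$ and $w=(j_1,\dots,j_n,a)\in V(n,a)$ (read as $x$ if $n=0$), set $R_a(v)=\{v\}\sqcup\{(j_1,\dots,j_n,k,a):k\in[N]\setminus\{j(v)\}\}$ and $R_b(w)=\{w\}\sqcup\{(j_1,\dots,j_n,k,b):k\in[N]\setminus\{j(w)\}\}$. The sets $R_a(v)$ partition $V^x$, and so do the sets $R_b(w)$. The bounded self-adjoint operators $a,b$ on $\mathcal{H}$ are defined by $\langle a\delta_{v_1},\delta_{v_2}\rangle=A(j(v_2),j(v_1))$ if $v_1,v_2$ lie in a common set $R_a(v)$ and $0$ otherwise; $\langle b\delta_{w_1},\delta_{w_2}\rangle=B(j(w_2),j(w_1))$ if $w_1,w_2$ lie in a common set $R_b(w)$ and $0$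 otherwise. (Different choices of $x$ give the same construction up to renaming vertices.) The free sum over the diagonal of $A$ and $B$ is the operator $a+b$. For $T\in B(\mathcal{H})$, let $E_{\mathcal{D}_N(\mathbb{C})}(T)$ be the diagonal matrix with $i$-th diagonal entry $\langle T\delta_{(i,a)},\delta_{(i,a)}\rangle$, where for $i=x$ the symbol $(x,a)$ denotes the root vertex $x$. Cauchy transforms. $G_{A+B}(z)=\Delta((zI-A-B)^{-1})$ and $G_{a+b}(z)=E_{\mathcal{D}_N(\mathbb{C})}((z-a-b)^{-1})$.
   Formalization: A and B are assumed independent (the claim fails for A=B a randomly permuted perfect matching), and the bound is asserted for all sufficiently large N with z, c, h_1, h_2, C fixed (for a fixed N it can fail near an eigenvalue of A+B beyond r_0). *)

theory Defs
  imports
    "HOL-Probability.Probability"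
    "HOL-Combinatorics.Permutations"
    "HOL-Library.Landau_Symbols"
    "Jordan_Normal_Form.Schur_Decomposition"
    "Jordan_Normal_Form.Gauss_Jordan_Elimination"
    "Graph_Theory.Digraph_Component"
begin

text \<open>Throughout, the index set $[N]$ is \<^term>\<open>{..<N}\<close> (indices start at 0).\<close>

section \<open>Matrices\<close>

definition hermitian_mat :: "complex mat \<Rightarrow> bool" where
  "hermitian_mat X \<longleftrightarrow> mat_adjoint X = X"

definition mat_trace :: "complex mat \<Rightarrow> complex" where
  "mat_trace X = (\<Sum>i<dim_row X. X $$ (i, i))"

definition frobenius_norm :: "complex mat \<Rightarrow> real" where
  "frobenius_norm X = sqrt (Re (mat_trace (X * mat_adjoint X)))"

definition diag_part :: "complex mat \<Rightarrow> complex mat" where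
  "diag_part X = mat (dim_row X) (dim_col X) (\<lambda>(i, j). if i = j then X $$ (i, j) else 0)"

definition perm_mat :: "nat \<Rightarrow> (nat \<Rightarrow> nat) \<Rightarrow> complex mat" where
  "perm_mat N \<sigma> = mat N N (\<lambda>(i, j). if i = \<sigma> j then 1 else 0)"

text \<open>Only meaningful for invertible \<^term>\<open>X\<close>.\<close>

definition mat_inv :: "complex mat \<Rightarrow> complex mat" where
  "mat_inv X = the (mat_inverse X)"

section \<open>Random matrices\<close>

text \<open>The type of matrices carries no sigma-algebra, so measurability, laws and independence of
  random matrices are expressed through the family of their entries.\<close>

definition entry_space :: "nat \<Rightarrow> (nat \<times> nat \<Rightarrow> complex) measure" where
  "entry_space N = (\<Pi>\<^sub>M _\<in>{..<N} \<times> {..<N}. borel)"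

definition entries :: "nat \<Rightarrow> complex mat \<Rightarrow> nat \<times> nat \<Rightarrow> complex" where
  "entries N X = restrict (($$) X) ({..<N} \<times> {..<N})"

definition random_matrix :: "'w measure \<Rightarrow> nat \<Rightarrow> ('w \<Rightarrow> complex mat) \<Rightarrow> bool" where
  "random_matrix P N X \<longleftrightarrow>
     (\<forall>\<omega>\<in>space P. X \<omega> \<in> carrier_mat N N) \<and>
     (\<lambda>\<omega>. entries N (X \<omega>)) \<in> P \<rightarrow>\<^sub>M entry_space N"

definition matrix_law :: "'w measure \<Rightarrow> nat \<Rightarrow> ('w \<Rightarrow> complex mat) \<Rightarrow>
    (nat \<times> nat \<Rightarrow> complex) measure" where
  "matrix_law P N X = distr P (entry_space N) (\<lambda>\<omega>. entries N (X \<omega>))"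

definition independent_matrices :: "'w measure \<Rightarrow> nat \<Rightarrow>
    ('w \<Rightarrow> complex mat) \<Rightarrow> ('w \<Rightarrow> complex mat) \<Rightarrow> bool" where
  "independent_matrices P N X Y \<longleftrightarrow>
     prob_space.indep_var P (entry_space N) (\<lambda>\<omega>. entries N (X \<omega>))
                            (entry_space N) (\<lambda>\<omega>. entries N (Y \<omega>))"

definition permutation_invariant :: "'w measure \<Rightarrow> nat \<Rightarrow> ('w \<Rightarrow> complex mat) \<Rightarrow> bool" where
  "permutation_invariant P N X \<longleftrightarrow>
     (\<forall>\<sigma>. \<sigma> permutes {..<N} \<longrightarrow>
        matrix_law P N (\<lambda>\<omega>. perm_mat N \<sigma> * X \<omega> * mat_inv (perm_mat N \<sigma>)) = matrix_law P N X)"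

section \<open>Test graphs and the two moment assumptions\<close>

text \<open>A test graph is a finite directed multigraph \<^term>\<open>T\<close> (\<^term>\<open>tail T\<close> is the source map,
  \<^term>\<open>head T\<close> the target map) with a labelling of its arcs. Finite graphs may be taken to have
  natural numbers as vertices and arcs.\<close>

datatype exponent = One | Star

fun mat_exponent :: "complex mat \<Rightarrow> exponent \<Rightarrow> complex mat" where
  "mat_exponent X One = X"
| "mat_exponent X Star = mat_adjoint X"

type_synonym multigraph = "(nat, nat) pre_digraph"

definition injective_trace ::
    "nat \<Rightarrow> multigraph \<Rightarrow> (nat \<Rightarrow> exponent) \<Rightarrow> complex mat \<Rightarrow> complex" where
  "injective_trace N T \<epsilon> X =
     (\<Sum>\<phi> \<in> {\<phi> \<in> verts T \<rightarrow>\<^sub>E {..<N}. inj_on \<phi> (verts T)}.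
        \<Prod>e\<in>arcs T. mat_exponent X (\<epsilon> e) $$ (\<phi> (head T e), \<phi> (tail T e)))"

text \<open>The connected components of the underlying undirected graph are the strong components
  of the symmetrised graph.\<close>

definition num_components :: "multigraph \<Rightarrow> nat" where
  "num_components T = card (pre_digraph.sccs_verts (with_proj (mk_symmetric T)))"

definition admissible_speed :: "(nat \<Rightarrow> nat) \<Rightarrow> bool" where
  "admissible_speed M \<longleftrightarrow>
     filterlim M at_top sequentially \<and>
     (\<forall>\<^sub>F N in sequentially. real (M N) < ln (real N) / ln (ln (real N)))"

text \<open>The assertion that the expectations are $O(N^{ch})$ includes their existence (for large
  \<^term>\<open>N\<close>), since the Bochner integral of a non-integrable function is 0.\<close>

definition injective_trace_assumption ::
    "(nat \<Rightarrow> 'w measure) \<Rightarrow> (nat \<Rightarrow> 'w \<Rightarrow> complex mat) \<Rightarrow> (nat \<Rightarrow> nat) \<Rightarrow> real \<Rightarrow> bool" where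
  "injective_trace_assumption P X M h \<longleftrightarrow>
     (\<forall>c>0. \<forall>(T :: nat \<Rightarrow> multigraph) (\<epsilon> :: nat \<Rightarrow> nat \<Rightarrow> exponent).
        (\<forall>N. fin_digraph (T N) \<and>
             real (card (verts (T N))) \<le> c * real (M N) \<and>
             real (card (arcs (T N))) \<le> c * real (M N)) \<longrightarrow>
        (let f = (\<lambda>N \<omega>. injective_trace N (T N) (\<epsilon> N) (X N \<omega>) / of_nat N ^ num_components (T N)) in
           (\<forall>\<^sub>F N in sequentially. integrable (P N) (f N)) \<and>
           (\<lambda>N. \<integral>\<omega>. f N \<omega> \<partial>P N) \<in> O(\<lambda>N. of_real (real N powr (c * h)))))"

definition frobenius_assumption ::
    "(nat \<Rightarrow> 'w measure) \<Rightarrow> (nat \<Rightarrow> 'w \<Rightarrow> complex mat) \<Rightarrow> (nat \<Rightarrow> nat) \<Rightarrow> real \<Rightarrow> bool" where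
  "frobenius_assumption P X M C \<longleftrightarrow>
     (\<forall>N\<ge>1. let f = (\<lambda>\<omega>. 1 / real N * (frobenius_norm (X N \<omega> ^\<^sub>m M N))\<^sup>2) in
        integrable (P N) f \<and> (\<integral>\<omega>. f \<omega> \<partial>P N) \<le> C ^ M N)"

section \<open>The free sum over the diagonal\<close>

datatype sym = SymA | SymB

fun other_sym :: "sym \<Rightarrow> sym" where
  "other_sym SymA = SymB"
| "other_sym SymB = SymA"

text \<open>\<open>Root\<close> is the vertex $x$; \<open>Word js s\<close> with nonempty \<open>js\<close> is $(j_1,\dots,j_n,s)$.\<close>

datatype vertex = Root | Word "nat list" sym

definition level :: "nat \<Rightarrow> nat \<Rightarrow> nat \<Rightarrow> sym \<Rightarrow> vertex set" where
  "level N x n s =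
     (if n = 0 then {Root}
      else {Word js s | js. length js = n \<and> set js \<subseteq> {..<N} \<and> distinct_adj (x # js)})"

definition vertices :: "nat \<Rightarrow> nat \<Rightarrow> vertex set" where
  "vertices N x = (\<Union>n. \<Union>s. level N x n s)"

fun last_index :: "nat \<Rightarrow> vertex \<Rightarrow> nat" where
  "last_index x Root = x"
| "last_index x (Word js s) = last js"

fun extend :: "vertex \<Rightarrow> nat \<Rightarrow> sym \<Rightarrow> vertex" where
  "extend Root k s = Word [k] s"
| "extend (Word js s') k s = Word (js @ [k]) s"

text \<open>\<^term>\<open>block N x SymA v\<close> is $R_a(v)$, for \<^term>\<open>v\<close> in some \<^term>\<open>level N x n SymB\<close>;
  \<^term>\<open>block N x SymB w\<close> is $R_b(w)$, for \<^term>\<open>w\<close> in some \<^term>\<open>level N x n SymA\<close>.\<close>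

definition block :: "nat \<Rightarrow> nat \<Rightarrow> sym \<Rightarrow> vertex \<Rightarrow> vertex set" where
  "block N x s v = insert v ((\<lambda>k. extend v k s) ` ({..<N} - {last_index x v}))"

definition same_block :: "nat \<Rightarrow> nat \<Rightarrow> sym \<Rightarrow> vertex \<Rightarrow> vertex \<Rightarrow> bool" where
  "same_block N x s v\<^sub>1 v\<^sub>2 \<longleftrightarrow>
     (\<exists>n. \<exists>u\<in>level N x n (other_sym s). v\<^sub>1 \<in> block N x s u \<and> v\<^sub>2 \<in> block N x s u)"

text \<open>The Hilbert space $\ell^2(V)$ is represented by the square-summable functions that vanish
  outside \<^term>\<open>V\<close>; operators on it are functions on this set.\<close>

definition ell2 :: "'v set \<Rightarrow> ('v \<Rightarrow> complex) set" where
  "ell2 V = {f. (\<forall>v. v \<notin> V \<longrightarrow> f v = 0) \<and> (\<lambda>v. (cmod (f v))\<^sup>2) summable_on V}"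

definition ell2_inner :: "'v set \<Rightarrow> ('v \<Rightarrow> complex) \<Rightarrow> ('v \<Rightarrow> complex) \<Rightarrow> complex" where
  "ell2_inner V f g = (\<Sum>\<^sub>\<infinity>v\<in>V. f v * cnj (g v))"

definition delta :: "'v \<Rightarrow> 'v \<Rightarrow> complex" where
  "delta v = (\<lambda>w. if w = v then 1 else 0)"

text \<open>\<^term>\<open>block_operator N x SymA A\<close> is $a$ and \<^term>\<open>block_operator N x SymB B\<close> is $b$: the operator
  \<open>T\<close> with \<open>\<langle>T \<delta>\<^bsub>v1\<^esub>, \<delta>\<^bsub>v2\<^esub>\<rangle> = block_coeff N x s X v1 v2\<close>. Blocks are finite, so the
  sum below has finitely many nonzero terms.\<close>

definition block_coeff :: "nat \<Rightarrow> nat \<Rightarrow> sym \<Rightarrow> complex mat \<Rightarrow> vertex \<Rightarrow> vertex \<Rightarrow> complex" where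
  "block_coeff N x s X v\<^sub>1 v\<^sub>2 =
     (if same_block N x s v\<^sub>1 v\<^sub>2 then X $$ (last_index x v\<^sub>2, last_index x v\<^sub>1) else 0)"

definition block_operator ::
    "nat \<Rightarrow> nat \<Rightarrow> sym \<Rightarrow> complex mat \<Rightarrow> (vertex \<Rightarrow> complex) \<Rightarrow> (vertex \<Rightarrow> complex)" where
  "block_operator N x s X f = (\<lambda>v\<^sub>2. \<Sum>\<^sub>\<infinity>v\<^sub>1\<in>vertices N x. block_coeff N x s X v\<^sub>1 v\<^sub>2 * f v\<^sub>1)"

definition free_sum ::
    "nat \<Rightarrow> nat \<Rightarrow> complex mat \<Rightarrow> complex mat \<Rightarrow> (vertex \<Rightarrow> complex) \<Rightarrow> (vertex \<Rightarrow> complex)" where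
  "free_sum N x A B f = (\<lambda>v. block_operator N x SymA A f v + block_operator N x SymB B f v)"

text \<open>$(z-T)^{-1}$ on $\ell^2(V)$; meaningful when $z-T$ is a bijection of $\ell^2(V)$, in
  particular for self-adjoint bounded $T$ and non-real $z$.\<close>

definition op_resolvent :: "'v set \<Rightarrow> (('v \<Rightarrow> complex) \<Rightarrow> ('v \<Rightarrow> complex)) \<Rightarrow> complex \<Rightarrow>
    ('v \<Rightarrow> complex) \<Rightarrow> ('v \<Rightarrow> complex)" where
  "op_resolvent V T z = inv_into (ell2 V) (\<lambda>f v. z * f v - T f v)"

definition diag_vertex :: "nat \<Rightarrow> nat \<Rightarrow> vertex" where
  "diag_vertex x i = (if i = x then Root else Word [i] SymA)"

definition diag_expectation ::
    "nat \<Rightarrow> nat \<Rightarrow> ((vertex \<Rightarrow> complex) \<Rightarrow> (vertex \<Rightarrow> complex)) \<Rightarrow> complex mat" where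
  "diag_expectation N x T = mat N N (\<lambda>(i, j). if i = j
     then ell2_inner (vertices N x) (T (delta (diag_vertex x i))) (delta (diag_vertex x i)) else 0)"

section \<open>Diagonal-valued Cauchy transforms\<close>

definition cauchy_matrix_sum :: "nat \<Rightarrow> complex mat \<Rightarrow> complex mat \<Rightarrow> complex \<Rightarrow> complex mat" where
  "cauchy_matrix_sum N A B z = diag_part (mat_inv (z \<cdot>\<^sub>m 1\<^sub>m N - A - B))"

definition cauchy_free_sum ::
    "nat \<Rightarrow> nat \<Rightarrow> complex mat \<Rightarrow> complex mat \<Rightarrow> complex \<Rightarrow> complex mat" where
  "cauchy_free_sum N x A B z =
     diag_expectation N x (op_resolvent (vertices N x) (free_sum N x A B) z)"

end

theory Submission
  imports Defs "HOL-Library.Multiset" "HOL-Real_Asymp.Real_Asymp"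
begin

text \<open>
Expanding both resolvents, the difference of the diagonal entries at \<open>i\<close> is governed by
\<open>D k i\<close>, the sum of the weights of those closed walks from \<open>i\<close> to \<open>i\<close> of length \<open>k\<close> on
\<open>{..<N}\<close>, with steps labelled by the two matrices, whose lifts to the vertex tree of the free sum
do not close up. The square of \<open>D k i\<close> is a sum over closed walks of length \<open>2 * k\<close>. Independence
and permutation invariance of one matrix factor the mean of such a sum for a fixed pattern of
coincidences, and decomposing the edges of each label into trails bounds each factor by a power of
\<open>N\<close> with as many factors as trails, up to operator norms of size \<open>N powr (1 / (2 * M))\<close>. Because the
lift does not close, the total number of trails is at most the number of vertices, so one power of
\<open>N\<close> is gained: the normalised second moment is \<open>N powr (- 1 / 6)\<close> up to \<open>const ^ M\<close>, as long as
\<open>k \<le> M / 6\<close>. The remainder of the expansion is an even moment, which the Frobenius assumption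
bounds by interpolation between the exponents \<open>0\<close> and \<open>M\<close>. The strict inequality \<open>c < 1 / 6\<close>
leaves room for all constants.
\<close>

text \<open>No operator norm is bounded by hypothesis; only the mean Frobenius square of the M-th
  power is. Its root of order 2 * M bounds the norm of each realisation, but has controlled moments
  only up to order 2 * M. Norms therefore cost N powr (k / M) * C ^ k in a second moment of order k.

  Patterns cost more. With n = 2 * k there are up to m ^ n surjections onto m classes, and passing
  to injective labellings costs m ^ m for each letter. Dividing by \<open>fact m\<close> removes one
  m ^ m up to exp m. About (2 * k) ^ (4 * k) is left, at most N powr (4 * k / M) because M ^ M <= N.
  The total N powr (5 * k / M) is at most N powr (5 / 6) when 6 * k <= M, a factor N powr (1 / 6)
  below the normalisation N. This margin absorbs every const ^ M, since M = o(ln N). The same 6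
  fixes the truncation order K near M / 6, whose remainder (4 * C / |z|^2) ^ K beats the claimed
  rate if c < 1 / 6.

  Lifts are tracked as stacks seen from the starting vertex, so that closing does not depend on the
  root x and makes sense for abstract coincidence patterns.\<close>

section \<open>Matrix chains through a repeated vertex set\<close>

text \<open>A norm bound for the action on row vectors, so that one step of a chain is the map from
  y to y X. Only the upper bound \<open>r\<close> is available, hence it is carried beside the
  matrix.\<close>

definition opnorm_le :: "nat \<Rightarrow> real \<Rightarrow> (nat \<Rightarrow> nat \<Rightarrow> complex) \<Rightarrow> bool" where
  "opnorm_le N r X \<longleftrightarrow> 0 \<le> r \<and>
     (\<forall>y. (\<Sum>b<N. (cmod (\<Sum>a<N. y a * X a b))\<^sup>2) \<le> r\<^sup>2 * (\<Sum>a<N. (cmod (y a))\<^sup>2))"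

fun chain_value :: "('v \<Rightarrow> nat) \<Rightarrow> 'v \<Rightarrow> ((nat \<Rightarrow> nat \<Rightarrow> complex) \<times> real \<times> 'v) list \<Rightarrow> complex" where
  "chain_value \<phi> u [] = 1"
| "chain_value \<phi> u ((X, r, v) # ch) = X (\<phi> u) (\<phi> v) * chain_value \<phi> v ch"

abbreviation chain_vertices :: "'v \<Rightarrow> ((nat \<Rightarrow> nat \<Rightarrow> complex) \<times> real \<times> 'v) list \<Rightarrow> 'v set" where
  "chain_vertices u ch \<equiv> insert u ((\<lambda>s. snd (snd s)) ` set ch)"

abbreviation chain_norm :: "((nat \<Rightarrow> nat \<Rightarrow> complex) \<times> real \<times> 'v) list \<Rightarrow> real" where
  "chain_norm ch \<equiv> (\<Prod>s\<leftarrow>ch. fst (snd s))"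

lemma sum_PiE_insert:
  assumes "x \<notin> S"
  shows "sum h (PiE (insert x S) T) = (\<Sum>a\<in>T x. \<Sum>g\<in>PiE S T. h (g(x := a)))"
proof -
  have "sum h (PiE (insert x S) T) = sum h ((\<lambda>(y, g). g(x := y)) ` (T x \<times> PiE S T))"
    by (simp add: PiE_insert_eq)
  also have "\<dots> = (\<Sum>p\<in>T x \<times> PiE S T. h ((\<lambda>(y, g). g(x := y)) p))"
    by (subst sum.reindex) (use inj_combinator[OF assms] in \<open>auto simp: o_def\<close>)
  also have "\<dots> = (\<Sum>a\<in>T x. \<Sum>g\<in>PiE S T. h (g(x := a)))"
    by (simp add: sum.cartesian_product case_prod_unfold)
  finally show ?thesis .
qed

text \<open>Orthogonality of the characters of Z/N: a geometric sum whose ratio is an N-th root of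
  unity, equal to 1 only for a = b since |a - b| < N.\<close>

lemma sum_roots_of_unity:
  fixes a b N :: nat
  assumes "a < N" "b < N"
  shows "(\<Sum>t<N. cis (2 * pi * real t * real a / real N) * cnj (cis (2 * pi * real t * real b / real N)))
       = (if a = b then of_nat N else 0)"
proof -
  define w where "w = cis (2 * pi * (real a - real b) / real N)"
  have term_eq: "cis (2 * pi * real t * real a / real N) * cnj (cis (2 * pi * real t * real b / real N)) = w ^ t" for t
    unfolding w_def cis_cnj cis_mult Complex.DeMoivre
    by (rule arg_cong[where f = cis]) (simp add: field_simps flip: add_divide_distrib)
  have N0: "N > 0" using assms by auto
  show ?thesis
  proof (cases "a = b")
    case True
    then show ?thesis unfolding term_eq by (simp add: w_def)
  next
    case False
    have wN: "w ^ N = 1"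
    proof -
      have "w ^ N = cis (2 * pi * (real a - real b))"
        unfolding w_def Complex.DeMoivre using N0 by simp
      also have "\<dots> = 1"
        using cis_multiple_2pi[of "real a - real b"] by (simp add: Ints_diff)
      finally show ?thesis .
    qed
    have "w \<noteq> 1"
    proof
      assume "w = 1"
      then have "cos (2 * pi * (real a - real b) / real N) = 1"
        by (simp add: w_def complex_eq_iff)
      then obtain k :: int where k: "2 * pi * (real a - real b) / real N = real_of_int k * 2 * pi"
        using cos_one_2pi_int by blast
      then have "(2 * pi) * (real a - real b) = (2 * pi) * (real_of_int k * real N)"
        using N0 by (simp add: divide_eq_eq mult_ac)
      then have "real a - real b = real_of_int k * real N"
        by (simp only: mult_cancel_left) simp
      then have e: "int a - int b = k * int N"
        by (metis of_int_diff of_int_eq_iff of_int_mult of_int_of_nat_eq)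
      have "\<bar>int a - int b\<bar> < int N" using assms by linarith
      moreover have "k \<noteq> 0" using e False by auto
      ultimately show False
        using e by (smt (verit, best) mult_le_cancel_right1 mult_minus_left)
    qed
    then have "(\<Sum>t<N. w ^ t) = (w ^ N - 1) / (w - 1)"
      by (rule geometric_sum)
    then show ?thesis unfolding term_eq using False by (simp add: wN)
  qed
qed

lemma chain_value_cong:
  "(\<And>v. v \<in> chain_vertices u ch \<Longrightarrow> \<phi> v = \<psi> v) \<Longrightarrow> chain_value \<phi> u ch = chain_value \<psi> u ch"
proof (induction ch arbitrary: u)
  case (Cons s ch)
  obtain X r v where s: "s = (X, r, v)" by (cases s)
  show ?case unfolding s using Cons.IH[of v] Cons.prems unfolding s by auto
qed auto

lemma sum_cmod_square_mult_le:
  assumes "\<And>a. a < N \<Longrightarrow> cmod (e a) \<le> 1"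
  shows "(\<Sum>a<N. (cmod (y a * e a))\<^sup>2) \<le> (\<Sum>a<N. (cmod (y a))\<^sup>2)"
proof (rule sum_mono)
  fix a assume "a \<in> {..<N}"
  then have "cmod (y a * e a) \<le> cmod (y a)"
    using assms[of a] by (simp add: norm_mult mult_left_le)
  then show "(cmod (y a * e a))\<^sup>2 \<le> (cmod (y a))\<^sup>2" by (rule power_mono) simp
qed

lemma opnorm_le_sqrt:
  assumes "opnorm_le N r X"
  shows "sqrt (\<Sum>b<N. (cmod (\<Sum>a<N. y a * X a b))\<^sup>2) \<le> r * sqrt (\<Sum>a<N. (cmod (y a))\<^sup>2)"
proof -
  have "sqrt (\<Sum>b<N. (cmod (\<Sum>a<N. y a * X a b))\<^sup>2) \<le> sqrt (r\<^sup>2 * (\<Sum>a<N. (cmod (y a))\<^sup>2))"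
    using assms by (auto simp: opnorm_le_def)
  then show ?thesis using assms by (simp add: real_sqrt_mult opnorm_le_def)
qed

lemma chain_norm_nonneg:
  "(\<And>X r v. (X, r, v) \<in> set ch \<Longrightarrow> opnorm_le N r X) \<Longrightarrow> 0 \<le> chain_norm ch"
  by (rule prod_list_nonneg) (auto simp: opnorm_le_def)

text \<open>A vertex that the chain visits again is decoupled from its later visits by averaging over
  the characters of $\mathbb{Z}/N$; the price is only a unimodular weight.\<close>

lemma weighted_chain_bound:
  fixes d :: "'v \<Rightarrow> nat \<Rightarrow> complex"
  assumes "V = chain_vertices u ch"
    and "\<And>X r v. (X, r, v) \<in> set ch \<Longrightarrow> opnorm_le N r X"
    and "\<And>v a. v \<in> V \<Longrightarrow> a < N \<Longrightarrow> cmod (d v a) \<le> 1"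
  shows "cmod (\<Sum>\<phi>\<in>V \<rightarrow>\<^sub>E {..<N}. y (\<phi> u) * (\<Prod>v\<in>V. d v (\<phi> v)) * chain_value \<phi> u ch)
         \<le> sqrt (\<Sum>a<N. (cmod (y a))\<^sup>2) * sqrt (real N) * chain_norm ch"
  using assms
proof (induction ch arbitrary: u y d V)
  case Nil
  then have V: "V = {u}" by simp
  have "(\<Sum>\<phi>\<in>V \<rightarrow>\<^sub>E {..<N}. y (\<phi> u) * (\<Prod>v\<in>V. d v (\<phi> v)) * chain_value \<phi> u []) = (\<Sum>a<N. y a * d u a)"
    unfolding V by (subst sum_PiE_insert) auto
  also have "cmod \<dots> \<le> (\<Sum>a<N. cmod (y a) * cmod (d u a))"
    by (metis (no_types, lifting) norm_mult norm_sum sum.cong)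
  also have "\<dots> \<le> (\<Sum>a<N. \<bar>cmod (y a)\<bar> * \<bar>1\<bar>)"
    using Nil V by (intro sum_mono) (simp add: mult_left_le)
  \<comment> \<open>The factor sqrt N of the bound arises here, by pairing with a constant vector at
    the last vertex. All earlier steps cost only norms.\<close>
  also have "\<dots> \<le> L2_set (\<lambda>a. cmod (y a)) {..<N} * L2_set (\<lambda>a. 1) {..<N}"
    by (rule L2_set_mult_ineq)
  also have "\<dots> = sqrt (\<Sum>a<N. (cmod (y a))\<^sup>2) * sqrt (real N)"
    by (simp add: L2_set_def)
  finally show ?case by simp
next
  case (Cons s ch)
  obtain X r v where s: "s = (X, r, v)" by (cases s)
  define W where "W = chain_vertices v ch"
  have VW: "V = insert u W" using Cons.prems(1) by (auto simp: s W_def)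
  have finW: "finite W" by (simp add: W_def)
  have X: "opnorm_le N r X" using Cons.prems(2)[of X r v] by (simp add: s)
  then have r0: "0 \<le> r" by (simp add: opnorm_le_def)
  have ch: "\<And>X r v. (X, r, v) \<in> set ch \<Longrightarrow> opnorm_le N r X"
    using Cons.prems(2) by (meson list.set_intros(2))
  have cn: "0 \<le> chain_norm ch" using ch by (rule chain_norm_nonneg)
  show ?case
  proof (cases "u \<in> W")
    case False
    \<comment> \<open>\<open>u\<close> occurs only at the start, so its index can be summed out: the
      weighted start vector is moved through X and starts the shorter chain.\<close>
    define y' where "y' b = (\<Sum>a<N. (y a * d u a) * X a b)" for b
    have uv: "u \<noteq> v" using False by (auto simp: W_def)
    have "(\<Sum>\<phi>\<in>V \<rightarrow>\<^sub>E {..<N}. y (\<phi> u) * (\<Prod>v\<in>V. d v (\<phi> v)) * chain_value \<phi> u (s # ch))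
        = (\<Sum>a<N. \<Sum>g\<in>W \<rightarrow>\<^sub>E {..<N}. y a * (d u a * (\<Prod>v\<in>W. d v (g v))) * (X a (g v) * chain_value g v ch))"
      unfolding VW
    proof (subst sum_PiE_insert[OF False], intro sum.cong refl)
      fix a g
      have "(\<Prod>v\<in>insert u W. d v ((g(u := a)) v)) = d u a * (\<Prod>v\<in>W. d v (g v))"
        using False finW by (subst prod.insert) (auto intro!: prod.cong)
      moreover have "chain_value (g(u := a)) v ch = chain_value g v ch"
        by (rule chain_value_cong) (use False in \<open>auto simp: W_def\<close>)
      ultimately show "y ((g(u := a)) u) * (\<Prod>v\<in>insert u W. d v ((g(u := a)) v)) * chain_value (g(u := a)) u (s # ch)
         = y a * (d u a * (\<Prod>v\<in>W. d v (g v))) * (X a (g v) * chain_value g v ch)"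
        using uv by (simp add: s)
    qed
    also have "\<dots> = (\<Sum>g\<in>W \<rightarrow>\<^sub>E {..<N}. y' (g v) * (\<Prod>v\<in>W. d v (g v)) * chain_value g v ch)"
      by (subst sum.swap) (simp add: y'_def sum_distrib_right sum_distrib_left mult_ac)
    also have "cmod \<dots> \<le> sqrt (\<Sum>a<N. (cmod (y' a))\<^sup>2) * sqrt (real N) * chain_norm ch"
      by (rule Cons.IH) (use ch Cons.prems(3) VW in \<open>auto simp: W_def\<close>)
    also have "\<dots> \<le> (r * sqrt (\<Sum>a<N. (cmod (y a * d u a))\<^sup>2)) * sqrt (real N) * chain_norm ch"
      unfolding y'_def by (intro mult_right_mono opnorm_le_sqrt[OF X] cn) auto
    also have "\<dots> \<le> (r * sqrt (\<Sum>a<N. (cmod (y a))\<^sup>2)) * sqrt (real N) * chain_norm ch"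
      by (intro mult_right_mono mult_left_mono real_sqrt_le_mono sum_cmod_square_mult_le cn r0)
        (use Cons.prems(3) VW in auto)
    finally show ?thesis by (simp add: s mult_ac)
  next
    case True
    then have VW: "V = W" using VW by auto
    show ?thesis
    proof (cases "N = 0")
      case True
      have "V \<rightarrow>\<^sub>E {..<N} = {}" using \<open>u \<in> W\<close> VW True by (auto simp: PiE_eq_empty_iff)
      then show ?thesis using True by simp
    next
      case False
      \<comment> \<open>The first visit to \<open>u\<close> gets its own summation index a, tied to
        the index of the later visits by the orthogonality relation. One character joins the start
        vector, its conjugate joins the weight of \<open>u\<close>, and the induction hypothesis
        applies for each t.\<close>
      define \<zeta> where "\<zeta> t a = cis (2 * pi * real t * real a / real N)" for t a
      define y' where "y' t b = (\<Sum>a<N. (y a * \<zeta> t a) * X a b)" for t b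
      define d' where "d' t = d(u := (\<lambda>b. d u b * cnj (\<zeta> t b)))" for t
      define G where "G t = (\<Sum>\<phi>\<in>W \<rightarrow>\<^sub>E {..<N}. y' t (\<phi> v) * (\<Prod>v\<in>W. d' t v (\<phi> v)) * chain_value \<phi> v ch)" for t
      have \<zeta>1: "cmod (\<zeta> t a) = 1" for t a by (simp add: \<zeta>_def)
      have step: "of_nat N * (y (\<phi> u) * (\<Prod>v\<in>V. d v (\<phi> v)) * chain_value \<phi> u (s # ch))
         = (\<Sum>t<N. y' t (\<phi> v) * (\<Prod>v\<in>W. d' t v (\<phi> v)) * chain_value \<phi> v ch)"
        if \<phi>: "\<phi> \<in> W \<rightarrow>\<^sub>E {..<N}" for \<phi>
      proof -
        have u: "\<phi> u < N" using \<phi> \<open>u \<in> W\<close> by auto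
        have pr: "(\<Prod>v\<in>W. d' t v (\<phi> v)) = (\<Prod>v\<in>W. d v (\<phi> v)) * cnj (\<zeta> t (\<phi> u))" for t
        proof -
          have "(\<Prod>v\<in>W. d' t v (\<phi> v)) = (\<Prod>v\<in>W. d v (\<phi> v) * (if v = u then cnj (\<zeta> t (\<phi> u)) else 1))"
            by (intro prod.cong) (auto simp: d'_def)
          also have "\<dots> = (\<Prod>v\<in>W. d v (\<phi> v)) * cnj (\<zeta> t (\<phi> u))"
            using finW \<open>u \<in> W\<close> by (simp add: prod.distrib prod.delta)
          finally show ?thesis .
        qed
        have "(\<Sum>t<N. y' t (\<phi> v) * cnj (\<zeta> t (\<phi> u)))
            = (\<Sum>t<N. \<Sum>a<N. y a * X a (\<phi> v) * (\<zeta> t a * cnj (\<zeta> t (\<phi> u))))"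
          unfolding y'_def sum_distrib_right by (simp add: mult_ac)
        also have "\<dots> = (\<Sum>a<N. y a * X a (\<phi> v) * (\<Sum>t<N. \<zeta> t a * cnj (\<zeta> t (\<phi> u))))"
          by (subst sum.swap) (simp add: sum_distrib_left)
        also have "\<dots> = (\<Sum>a<N. y a * X a (\<phi> v) * (if a = \<phi> u then of_nat N else 0))"
          unfolding \<zeta>_def by (intro sum.cong refl arg_cong2[where f = "(*)"] sum_roots_of_unity) (use u in auto)
        also have "\<dots> = of_nat N * (y (\<phi> u) * X (\<phi> u) (\<phi> v))"
          using u by (simp add: if_distrib[of "\<lambda>x. _ * x"] sum.delta cong: if_cong)
        finally have key: "(\<Sum>t<N. y' t (\<phi> v) * cnj (\<zeta> t (\<phi> u))) = of_nat N * (y (\<phi> u) * X (\<phi> u) (\<phi> v))" .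
        have "(\<Sum>t<N. y' t (\<phi> v) * (\<Prod>v\<in>W. d' t v (\<phi> v)) * chain_value \<phi> v ch)
          = (\<Sum>t<N. y' t (\<phi> v) * cnj (\<zeta> t (\<phi> u))) * ((\<Prod>v\<in>W. d v (\<phi> v)) * chain_value \<phi> v ch)"
          by (subst sum_distrib_right, rule sum.cong[OF refl], simp only: pr mult_ac)
        also have "\<dots> = of_nat N * (y (\<phi> u) * (\<Prod>v\<in>V. d v (\<phi> v)) * chain_value \<phi> u (s # ch))"
          unfolding key by (simp add: s VW mult_ac)
        finally show ?thesis by simp
      qed
      define Z where "Z = (\<Sum>\<phi>\<in>V \<rightarrow>\<^sub>E {..<N}. y (\<phi> u) * (\<Prod>v\<in>V. d v (\<phi> v)) * chain_value \<phi> u (s # ch))"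
      have "of_nat N * Z = (\<Sum>\<phi>\<in>W \<rightarrow>\<^sub>E {..<N}. \<Sum>t<N. y' t (\<phi> v) * (\<Prod>v\<in>W. d' t v (\<phi> v)) * chain_value \<phi> v ch)"
        unfolding Z_def sum_distrib_left VW by (rule sum.cong[OF refl]) (rule step[unfolded VW])
      also have "\<dots> = (\<Sum>t<N. G t)"
        unfolding G_def by (rule sum.swap)
      finally have NZ: "of_nat N * Z = (\<Sum>t<N. G t)" .
      have Gt: "cmod (G t) \<le> r * sqrt (\<Sum>a<N. (cmod (y a))\<^sup>2) * sqrt (real N) * chain_norm ch" for t
      proof -
        have "cmod (G t) \<le> sqrt (\<Sum>a<N. (cmod (y' t a))\<^sup>2) * sqrt (real N) * chain_norm ch"
          unfolding G_def
        proof (rule Cons.IH)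
          show "cmod (d' t v a) \<le> 1" if "v \<in> W" "a < N" for v a
            using Cons.prems(3)[of v a] that VW \<zeta>1 by (auto simp: d'_def norm_mult)
        qed (use ch in \<open>auto simp: W_def\<close>)
        also have "\<dots> \<le> (r * sqrt (\<Sum>a<N. (cmod (y a * \<zeta> t a))\<^sup>2)) * sqrt (real N) * chain_norm ch"
          unfolding y'_def by (intro mult_right_mono opnorm_le_sqrt[OF X] cn) auto
        also have "\<dots> = (r * sqrt (\<Sum>a<N. (cmod (y a))\<^sup>2)) * sqrt (real N) * chain_norm ch"
          by (simp add: norm_mult \<zeta>1)
        finally show ?thesis .
      qed
      then have "cmod (\<Sum>t<N. G t) \<le> real (card {..<N}) * (r * sqrt (\<Sum>a<N. (cmod (y a))\<^sup>2) * sqrt (real N) * chain_norm ch)"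
        by (intro sum_norm_bound)
      then have "real N * cmod Z \<le> real N * (r * sqrt (\<Sum>a<N. (cmod (y a))\<^sup>2) * sqrt (real N) * chain_norm ch)"
        unfolding NZ[symmetric] norm_mult by simp
      then have "cmod Z \<le> r * sqrt (\<Sum>a<N. (cmod (y a))\<^sup>2) * sqrt (real N) * chain_norm ch"
        using False by (simp only: mult_le_cancel_left_pos[of "real N"])
      then show ?thesis unfolding Z_def by (simp add: s mult_ac)
    qed
  qed
qed

lemma chain_bound:
  fixes S :: "'v \<Rightarrow> nat set"
  assumes ch: "\<And>X r v. (X, r, v) \<in> set ch \<Longrightarrow> opnorm_le N r X"
    and S: "\<And>v. S v \<subseteq> {..<N}"
  shows "cmod (\<Sum>\<phi>\<in>PiE (chain_vertices u ch) S. chain_value \<phi> u ch) \<le> real N * chain_norm ch"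
proof -
  define V where "V = chain_vertices u ch"
  define d :: "'v \<Rightarrow> nat \<Rightarrow> complex" where "d v a = of_bool (a \<in> S v)" for v a
  have fin: "finite V" by (simp add: V_def)
  have "(\<Sum>\<phi>\<in>PiE V S. chain_value \<phi> u ch)
      = (\<Sum>\<phi>\<in>V \<rightarrow>\<^sub>E {..<N}. 1 * (\<Prod>v\<in>V. d v (\<phi> v)) * chain_value \<phi> u ch)"
  proof (rule sum.mono_neutral_cong_left)
    show "finite (V \<rightarrow>\<^sub>E {..<N})" using fin by (simp add: finite_PiE)
    show "PiE V S \<subseteq> V \<rightarrow>\<^sub>E {..<N}" using S by (intro PiE_mono)
    show "\<forall>\<phi>\<in>(V \<rightarrow>\<^sub>E {..<N}) - PiE V S. 1 * (\<Prod>v\<in>V. d v (\<phi> v)) * chain_value \<phi> u ch = 0"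
    proof
      fix \<phi> assume \<phi>: "\<phi> \<in> (V \<rightarrow>\<^sub>E {..<N}) - PiE V S"
      then obtain v where "v \<in> V" "\<phi> v \<notin> S v" by (auto simp: PiE_iff)
      then have "(\<Prod>v\<in>V. d v (\<phi> v)) = 0" using fin by (auto simp: d_def intro!: prod_zero)
      then show "1 * (\<Prod>v\<in>V. d v (\<phi> v)) * chain_value \<phi> u ch = 0" by simp
    qed
    show "chain_value \<phi> u ch = 1 * (\<Prod>v\<in>V. d v (\<phi> v)) * chain_value \<phi> u ch" if "\<phi> \<in> PiE V S" for \<phi>
    proof -
      have "(\<Prod>v\<in>V. d v (\<phi> v)) = 1" using that by (intro prod.neutral) (auto simp: d_def)
      then show ?thesis by simp
    qed
  qed
  also have "cmod \<dots> \<le> sqrt (\<Sum>a<N. (cmod 1)\<^sup>2) * sqrt (real N) * chain_norm ch"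
    by (rule weighted_chain_bound) (use ch in \<open>auto simp: V_def d_def\<close>)
  finally show ?thesis by (simp add: V_def)
qed

section \<open>Minimal trail decompositions\<close>

text \<open>Edges are undirected: a trail may read an edge from either end, as a matrix and its
  transpose will come with the same norm bound.\<close>

definition link :: "('e \<Rightarrow> 'v) \<Rightarrow> ('e \<Rightarrow> 'v) \<Rightarrow> 'e \<Rightarrow> 'v \<Rightarrow> 'v \<Rightarrow> bool" where
  "link a b l u v \<longleftrightarrow> (u = a l \<and> v = b l) \<or> (u = b l \<and> v = a l)"

definition other_end :: "('e \<Rightarrow> 'v) \<Rightarrow> ('e \<Rightarrow> 'v) \<Rightarrow> 'e \<Rightarrow> 'v \<Rightarrow> 'v" where
  "other_end a b l u = (if u = a l then b l else a l)"

fun trail :: "('e \<Rightarrow> 'v) \<Rightarrow> ('e \<Rightarrow> 'v) \<Rightarrow> 'v \<Rightarrow> 'e list \<Rightarrow> 'v \<Rightarrow> bool" where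
  "trail a b u [] w \<longleftrightarrow> u = w"
| "trail a b u (l # es) w \<longleftrightarrow> (\<exists>v. link a b l u v \<and> trail a b v es w)"

fun trail_vertices :: "('e \<Rightarrow> 'v) \<Rightarrow> ('e \<Rightarrow> 'v) \<Rightarrow> 'v \<Rightarrow> 'e list \<Rightarrow> 'v set" where
  "trail_vertices a b u [] = {u}"
| "trail_vertices a b u (l # es) = insert u (trail_vertices a b (other_end a b l u) es)"

lemma link_other_end: "link a b l u v \<Longrightarrow> v = other_end a b l u"
  by (auto simp: link_def other_end_def)

lemma link_commute: "link a b l u v \<longleftrightarrow> link a b l v u"
  by (auto simp: link_def)

lemma trail_append:
  "trail a b u (xs @ ys) w \<longleftrightarrow> (\<exists>v. trail a b u xs v \<and> trail a b v ys w)"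
  by (induction xs arbitrary: u) auto

lemma trail_rev: "trail a b u es w \<Longrightarrow> trail a b w (rev es) u"
proof (induction es arbitrary: u)
  case (Cons l es)
  then obtain v where "link a b l u v" "trail a b v es w" by auto
  then show ?case using Cons.IH[of v] link_commute[of a b l u v] by (auto simp: trail_append)
qed auto

lemma trail_vertices_append:
  "trail a b u xs v \<Longrightarrow>
     trail_vertices a b u (xs @ ys) = trail_vertices a b u xs \<union> trail_vertices a b v ys"
proof (induction xs arbitrary: u)
  case Nil
  then show ?case by (cases ys) auto
next
  case (Cons l xs)
  then obtain u' where "link a b l u u'" "trail a b u' xs v" by auto
  then show ?case using Cons.IH[of u'] link_other_end by fastforce
qed

lemma trail_ends_visited:
  assumes "trail a b u es w"
  shows "u \<in> trail_vertices a b u es" "w \<in> trail_vertices a b u es"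
proof -
  show "u \<in> trail_vertices a b u es" by (cases es) auto
  show "w \<in> trail_vertices a b u es"
    using trail_vertices_append[OF assms, of "[]"] by auto
qed

lemma trail_vertices_rev:
  "trail a b u es w \<Longrightarrow> trail_vertices a b w (rev es) = trail_vertices a b u es"
proof (induction es arbitrary: u)
  case (Cons l es)
  then obtain v where v: "link a b l u v" "trail a b v es w" by auto
  have lk: "link a b l v u" using v(1) by (simp add: link_commute)
  have "trail_vertices a b w (rev es @ [l]) = trail_vertices a b w (rev es) \<union> trail_vertices a b v [l]"
    by (rule trail_vertices_append) (rule trail_rev[OF v(2)])
  also have "\<dots> = trail_vertices a b v es \<union> {v, u}"
    using Cons.IH[OF v(2)] link_other_end[OF lk] by auto
  also have "\<dots> = insert u (trail_vertices a b v es)"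
    using trail_ends_visited[OF v(2)] by auto
  finally show ?case using link_other_end[OF v(1)] by simp
qed auto

lemma trail_split:
  assumes "trail a b u es w" "x \<in> trail_vertices a b u es"
  obtains es1 es2 where "es = es1 @ es2" "trail a b u es1 x" "trail a b x es2 w"
  using assms
proof (induction es arbitrary: u thesis)
  case Nil
  show ?case by (rule Nil.prems(1)[of "[]" "[]"]) (use Nil in auto)
next
  case (Cons l es)
  then obtain v where v: "link a b l u v" "trail a b v es w" by auto
  show ?case
  proof (cases "x = u")
    case True
    show ?thesis by (rule Cons.prems(1)[of "[]" "l # es"]) (use Cons True in auto)
  next
    case False
    then have "x \<in> trail_vertices a b v es" using Cons.prems(3) link_other_end[OF v(1)] by auto
    then obtain es1 es2 where "es = es1 @ es2" "trail a b v es1 x" "trail a b x es2 w"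
      using Cons.IH[OF _ v(2)] by blast
    then show ?thesis by (intro Cons.prems(1)[of "l # es1" es2]) (use v in auto)
  qed
qed

lemma trail_vertices_subset:
  assumes "trail a b u es w" "u \<in> V" "\<And>l. l \<in> set es \<Longrightarrow> a l \<in> V \<and> b l \<in> V"
  shows "trail_vertices a b u es \<subseteq> V"
  using assms
proof (induction es arbitrary: u)
  case (Cons l es)
  then obtain v where v: "link a b l u v" "trail a b v es w" by auto
  then have "v \<in> V" using Cons.prems(3)[of l] by (auto simp: link_def)
  then have "trail_vertices a b v es \<subseteq> V" using Cons.IH[OF v(2)] Cons.prems(3) by auto
  then show ?case using link_other_end[OF v(1)] Cons.prems(2) by auto
qed auto

lemma trail_edge_ends:
  assumes "trail a b u es w" "l \<in> set es"
  shows "a l \<in> trail_vertices a b u es" "b l \<in> trail_vertices a b u es"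
proof -
  have "a l \<in> trail_vertices a b u es \<and> b l \<in> trail_vertices a b u es"
    using assms
  proof (induction es arbitrary: u)
    case (Cons k es)
    then obtain v where v: "link a b k u v" "trail a b v es w" by auto
    show ?case
    proof (cases "l = k")
      case True
      then show ?thesis using v trail_ends_visited(1)[OF v(2)] link_other_end[OF v(1)]
        by (auto simp: link_def)
    next
      case False
      then show ?thesis using Cons.IH[OF v(2)] Cons.prems link_other_end[OF v(1)] by auto
    qed
  qed auto
  then show "a l \<in> trail_vertices a b u es" "b l \<in> trail_vertices a b u es" by auto
qed

text \<open>A passage through x uses two edge ends; only an initial or a final visit leaves a single
  one.\<close>

lemma trail_parity:
  "trail a b u es w \<Longrightarrow>
     even ((\<Sum>l\<leftarrow>es. of_bool (a l = x) + of_bool (b l = x)) + of_bool (u = x) + of_bool (w = x) :: nat)"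
proof (induction es arbitrary: u)
  case (Cons l es)
  then obtain v where v: "link a b l u v" "trail a b v es w" by auto
  show ?case using Cons.IH[OF v(2)] v(1) by (auto simp: link_def)
qed auto

type_synonym ('e, 'v) trail_data = "'v \<times> 'e list \<times> 'v"

text \<open>Trails without edges are allowed, so that vertices without edges can be covered too.
  Covering all of \<open>V\<close> matters because every vertex carries a summation index.\<close>

definition trail_decomposition ::
    "('e \<Rightarrow> 'v) \<Rightarrow> ('e \<Rightarrow> 'v) \<Rightarrow> 'v set \<Rightarrow> 'e set \<Rightarrow> ('e, 'v) trail_data multiset \<Rightarrow> bool" where
  "trail_decomposition a b V E Q \<longleftrightarrow>
     (\<forall>(u, es, w) \<in># Q. trail a b u es w \<and> u \<in> V) \<and>
     (\<Sum>(u, es, w) \<in># Q. mset es) = mset_set E \<and>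
     V \<subseteq> (\<Union>(u, es, w) \<in> set_mset Q. trail_vertices a b u es)"

lemma trail_decomposition_exists:
  assumes "finite V" "finite E" "\<And>l. l \<in> E \<Longrightarrow> a l \<in> V"
  shows "\<exists>Q. trail_decomposition a b V E Q"
proof -
  define Q where "Q = image_mset (\<lambda>x. (x, [], x)) (mset_set V) + image_mset (\<lambda>l. (a l, [l], b l)) (mset_set E)"
  have "trail_decomposition a b V E Q"
    unfolding trail_decomposition_def
  proof (intro conjI)
    show "\<forall>(u, es, w) \<in># Q. trail a b u es w \<and> u \<in> V"
      using assms by (auto simp: Q_def link_def)
    show "(\<Sum>(u, es, w) \<in># Q. mset es) = mset_set E"
      by (simp add: Q_def multiset.map_comp comp_def)
    show "V \<subseteq> (\<Union>(u, es, w) \<in> set_mset Q. trail_vertices a b u es)"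
      using assms by (force simp: Q_def)
  qed
  then show ?thesis ..
qed

lemma trail_decomposition_merge:
  assumes "trail_decomposition a b V E (add_mset (u1, es1, w1) (add_mset (u2, es2, w2) R))"
    and "trail a b u es w" "u \<in> V" "mset es = mset es1 + mset es2"
    and "trail_vertices a b u1 es1 \<union> trail_vertices a b u2 es2 \<subseteq> trail_vertices a b u es"
  shows "trail_decomposition a b V E (add_mset (u, es, w) R)"
  using assms unfolding trail_decomposition_def by (auto simp: add.assoc)

text \<open>Minimality enters only through the impossibility of merging two trails. This forces
  distinct trails to have disjoint ends and closed trails to meet no other trail, which determines
  the number of trails from the graph.\<close>

locale minimal_trails =
  fixes a b :: "'e \<Rightarrow> 'v" and V :: "'v set" and E :: "'e set" and Q :: "('e, 'v) trail_data multiset"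
  assumes finV: "finite V" and finE: "finite E"
    and ends: "\<And>l. l \<in> E \<Longrightarrow> a l \<in> V \<and> b l \<in> V"
    and decomp: "trail_decomposition a b V E Q"
    and minimal: "\<And>Q'. trail_decomposition a b V E Q' \<Longrightarrow> size Q \<le> size Q'"
begin

lemma no_merge:
  assumes "Q = add_mset (u1, es1, w1) (add_mset (u2, es2, w2) R)"
    and "trail a b u es w" "u \<in> V" "mset es = mset es1 + mset es2"
    and "trail_vertices a b u1 es1 \<union> trail_vertices a b u2 es2 \<subseteq> trail_vertices a b u es"
  shows False
  using minimal[OF trail_decomposition_merge[of a b V E u1 es1 w1 u2 es2 w2 R u es w]] assms decomp
  by auto

lemma trail_in_Q:
  assumes "(u, es, w) \<in># Q"
  shows "trail a b u es w" "u \<in> V" "trail_vertices a b u es \<subseteq> V" "set es \<subseteq> E"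
proof -
  show t: "trail a b u es w" "u \<in> V" using decomp assms by (auto simp: trail_decomposition_def)
  have "mset es \<subseteq># mset_set E"
  proof -
    obtain R where R: "Q = add_mset (u, es, w) R" using multi_member_split[OF assms] by blast
    have "(\<Sum>(u, es, w) \<in># Q. mset es) = mset_set E" using decomp by (auto simp: trail_decomposition_def)
    then have "mset es + (\<Sum>(u, es, w) \<in># R. mset es) = mset_set E" by (simp add: R)
    then show ?thesis by (metis mset_subset_eq_add_left)
  qed
  then show E: "set es \<subseteq> E" using set_mset_mono finE by fastforce
  show "trail_vertices a b u es \<subseteq> V"
    by (rule trail_vertices_subset[OF t]) (use E ends in auto)
qed

lemma joinable_False:
  assumes "Q = add_mset (u1, es1, w1) (add_mset (u2, es2, w2) R)" "w1 = u2"
  shows False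
proof -
  have t: "trail a b u1 es1 w1" "trail a b u2 es2 w2" "u1 \<in> V"
    using trail_in_Q[of u1 es1 w1] trail_in_Q[of u2 es2 w2] assms(1) by auto
  show False
    by (rule no_merge[OF assms(1), of u1 "es1 @ es2" w2])
      (use t assms(2) in \<open>auto simp: trail_append trail_vertices_append[OF t(1)]\<close>)
qed

text \<open>Reversal preserves minimality, so the argument for an end meeting a start covers all
  coincidences of ends.\<close>

lemma reverse_first:
  assumes "Q = add_mset (u, es, w) R"
  shows "minimal_trails a b V E (add_mset (w, rev es, u) R)"
proof -
  have t: "trail a b u es w" "u \<in> V" "trail_vertices a b u es \<subseteq> V" using trail_in_Q[of u es w] assms by auto
  have w: "w \<in> V" using trail_ends_visited(2)[OF t(1)] t(3) by auto
  have d: "trail_decomposition a b V E (add_mset (w, rev es, u) R)"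
    using decomp trail_rev[OF t(1)] trail_vertices_rev[OF t(1)] w
    unfolding assms trail_decomposition_def by auto
  show ?thesis
    by unfold_locales (use finV finE ends d minimal assms in auto)
qed

lemma endpoints_disjoint:
  assumes Q: "Q = add_mset (u1, es1, w1) (add_mset (u2, es2, w2) R)"
  shows "{u1, w1} \<inter> {u2, w2} = {}"
proof -
  have "w1 \<noteq> u2" using joinable_False[OF Q] by auto
  moreover have "w2 \<noteq> u1"
    using joinable_False[of u2 es2 w2 u1 es1 w1 R] Q by (auto simp: add_mset_commute)
  moreover have "u1 \<noteq> u2"
    using minimal_trails.joinable_False[OF reverse_first[OF Q], of w1 "rev es1" u1 u2 es2 w2 R] by auto
  moreover have "w1 \<noteq> w2"
  proof -
    have Q': "Q = add_mset (u2, es2, w2) (add_mset (u1, es1, w1) R)" using Q by (simp add: add_mset_commute)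
    show ?thesis
      using minimal_trails.joinable_False[OF reverse_first[OF Q'], of u1 es1 w1 w2 "rev es2" u2 R]
      by (auto simp: add_mset_commute)
  qed
  ultimately show ?thesis by auto
qed

text \<open>A closed trail can be rotated to start at a shared vertex and spliced into the other
  trail where that one passes it, which would save a trail.\<close>

lemma closed_disjoint:
  assumes Q: "Q = add_mset (u1, es1, u1) (add_mset (u2, es2, w2) R)"
  shows "trail_vertices a b u1 es1 \<inter> trail_vertices a b u2 es2 = {}"
proof (rule ccontr)
  assume "trail_vertices a b u1 es1 \<inter> trail_vertices a b u2 es2 \<noteq> {}"
  then obtain x where x: "x \<in> trail_vertices a b u1 es1" "x \<in> trail_vertices a b u2 es2" by auto
  have t: "trail a b u1 es1 u1" "trail a b u2 es2 w2" "u2 \<in> V"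
    using trail_in_Q[of u1 es1 u1] trail_in_Q[of u2 es2 w2] Q by auto
  obtain e1 e2 where e: "es1 = e1 @ e2" "trail a b u1 e1 x" "trail a b x e2 u1"
    using trail_split[OF t(1) x(1)] .
  obtain f1 f2 where f: "es2 = f1 @ f2" "trail a b u2 f1 x" "trail a b x f2 w2"
    using trail_split[OF t(2) x(2)] .
  have l: "trail a b x (e2 @ e1) x" using e by (auto simp: trail_append)
  show False
  proof (rule no_merge[OF Q, of u2 "f1 @ (e2 @ e1) @ f2" w2])
    show "trail a b u2 (f1 @ (e2 @ e1) @ f2) w2" using l f by (auto simp: trail_append)
    have "trail_vertices a b u2 (f1 @ (e2 @ e1) @ f2)
        = trail_vertices a b u2 f1 \<union> (trail_vertices a b x e2 \<union> trail_vertices a b u1 e1 \<union> trail_vertices a b x f2)"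
      by (simp only: trail_vertices_append[OF f(2)] trail_vertices_append[OF l] trail_vertices_append[OF e(3)])
    then show "trail_vertices a b u1 es1 \<union> trail_vertices a b u2 es2
        \<subseteq> trail_vertices a b u2 (f1 @ (e2 @ e1) @ f2)"
      using e f trail_vertices_append[OF e(2), of e2] trail_vertices_append[OF f(2), of f2] by auto
  qed (use t e f in auto)
qed

lemma split_off_two:
  assumes "\<tau>1 \<in># Q" "\<tau>2 \<in># Q" "\<tau>1 \<noteq> \<tau>2"
  obtains R where "Q = add_mset \<tau>1 (add_mset \<tau>2 R)"
  using assms by (metis insert_DiffM insert_noteq_member)

text \<open>Two copies of one trail would share their ends. Hence trails may be counted as elements
  of a set.\<close>

lemma Q_set: "Q = mset_set (set_mset Q)"
proof (rule multiset_eqI)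
  fix \<tau> :: "('e, 'v) trail_data"
  obtain u es w where \<tau>: "\<tau> = (u, es, w)" by (cases \<tau>)
  have "count Q \<tau> \<le> 1"
  proof (rule ccontr)
    assume "\<not> count Q \<tau> \<le> 1"
    then have "2 \<le> count Q \<tau>" by simp
    then have "replicate_mset 2 \<tau> \<subseteq># Q" by (simp add: count_le_replicate_mset_subset_eq)
    then obtain R where "Q = replicate_mset 2 \<tau> + R" by (metis subset_mset.add_diff_inverse)
    then have "Q = add_mset (u, es, w) (add_mset (u, es, w) R)"
      by (simp add: \<tau> numeral_2_eq_2)
    from endpoints_disjoint[OF this] show False by auto
  qed
  then show "count Q \<tau> = count (mset_set (set_mset Q)) \<tau>"
    by (cases "\<tau> \<in># Q") (auto simp: not_in_iff count_mset_set' dest: le_antisym)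
qed

section \<open>The number of trails in terms of odd vertices and label classes\<close>

definition degree :: "'v \<Rightarrow> nat" where
  "degree x = (\<Sum>l\<in>E. of_bool (a l = x) + of_bool (b l = x))"

definition "odd_vertices = {x \<in> V. odd (degree x)}"

definition "closed_trails = {\<tau> \<in> set_mset Q. fst \<tau> = snd (snd \<tau>)}"

definition "open_trails = {\<tau> \<in> set_mset Q. fst \<tau> \<noteq> snd (snd \<tau>)}"

lemma degree_parity: "even (degree x + (\<Sum>(u, es, w) \<in># Q. of_bool (u = x) + of_bool (w = x)))"
proof -
  let ?f = "\<lambda>l. of_bool (a l = x) + of_bool (b l = x) :: nat"
  have flat: "(\<Sum>l\<in>#(\<Sum>(u, es, w) \<in># Q'. mset es). ?f l) = (\<Sum>(u, es, w) \<in># Q'. \<Sum>l\<leftarrow>es. ?f l)"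
    for Q' :: "('e, 'v) trail_data multiset"
  proof (induction Q')
    case (add \<tau> Q')
    obtain u es w where \<tau>: "\<tau> = (u, es, w)" by (cases \<tau>)
    show ?case
      using add.IH sum_mset_sum_list[of "map ?f es"] by (simp add: \<tau>)
  qed simp
  have "degree x = (\<Sum>l\<in>#mset_set E. ?f l)"
    by (simp only: degree_def sum_unfold_sum_mset)
  also have "mset_set E = (\<Sum>(u, es, w) \<in># Q. mset es)"
    using decomp by (simp add: trail_decomposition_def)
  finally have deg: "degree x = (\<Sum>(u, es, w) \<in># Q. \<Sum>l\<leftarrow>es. ?f l)"
    by (simp only: flat)
  have "even ((\<Sum>(u, es, w) \<in># Q'. \<Sum>l\<leftarrow>es. ?f l) + (\<Sum>(u, es, w) \<in># Q'. of_bool (u = x) + of_bool (w = x)))"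
    if "\<forall>(u, es, w) \<in># Q'. trail a b u es w" for Q'
    using that
  proof (induction Q')
    case (add \<tau> Q')
    obtain u es w where \<tau>: "\<tau> = (u, es, w)" by (cases \<tau>)
    have "trail a b u es w" using add.prems by (simp add: \<tau>)
    from trail_parity[OF this, of x] add.IH add.prems show ?case
      unfolding \<tau> image_mset_add_mset sum_mset.add_mset prod.case by (simp only: even_add) auto
  qed simp
  moreover have "\<forall>(u, es, w) \<in># Q. trail a b u es w"
    using decomp by (auto simp: trail_decomposition_def)
  ultimately show ?thesis unfolding deg by blast
qed

text \<open>A vertex is an end of at most one trail, and that trail alone decides the parity: an
  open trail ends there once, a closed one twice.\<close>

lemma odd_vertex_iff: "odd (degree x) \<longleftrightarrow> (\<exists>(u, es, w) \<in> open_trails. x = u \<or> x = w)"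
proof (cases "\<exists>(u, es, w) \<in># Q. x = u \<or> x = w")
  case True
  then obtain u es w where uw: "(u, es, w) \<in># Q" "x = u \<or> x = w" by auto
  obtain R where R: "Q = add_mset (u, es, w) R" using multi_member_split[OF uw(1)] by blast
  have no: "x \<noteq> u' \<and> x \<noteq> w'" if r: "(u', es', w') \<in># R" for u' es' w'
  proof -
    obtain R' where "R = add_mset (u', es', w') R'" using multi_member_split[OF r] by blast
    then have "{u, w} \<inter> {u', w'} = {}" using endpoints_disjoint[of u es w u' es' w' R'] R by simp
    then show ?thesis using uw by auto
  qed
  have zero: "(\<Sum>(u, es, w) \<in># R. of_bool (u = x) + of_bool (w = x) :: nat) = 0"
    using no by (force simp: sum_mset_0_iff)
  have "even (degree x + (of_bool (u = x) + of_bool (w = x)))"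
    using degree_parity[of x] unfolding R image_mset_add_mset sum_mset.add_mset prod.case zero by simp
  then have "odd (degree x) \<longleftrightarrow> u \<noteq> w" using uw by auto
  moreover have "(\<exists>(u, es, w) \<in> open_trails. x = u \<or> x = w) \<longleftrightarrow> u \<noteq> w"
  proof
    assume "\<exists>(u, es, w) \<in> open_trails. x = u \<or> x = w"
    then obtain u' es' w' where o: "(u', es', w') \<in># Q" "u' \<noteq> w'" "x = u' \<or> x = w'"
      by (auto simp: open_trails_def)
    then have "(u', es', w') = (u, es, w)" using no[of u' es' w'] by (auto simp: R)
    then show "u \<noteq> w" using o by simp
  next
    assume "u \<noteq> w"
    then show "\<exists>(u, es, w) \<in> open_trails. x = u \<or> x = w" using uw by (auto simp: open_trails_def)
  qed
  ultimately show ?thesis by simp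
next
  case False
  then have zero: "(\<Sum>(u, es, w) \<in># Q. of_bool (u = x) + of_bool (w = x) :: nat) = 0"
    by (force simp: sum_mset_0_iff)
  have "even (degree x)" using degree_parity[of x] unfolding zero by simp
  then show ?thesis using False by (force simp: open_trails_def)
qed

lemma odd_vertices_eq: "odd_vertices = (\<Union>\<tau>\<in>open_trails. {fst \<tau>, snd (snd \<tau>)})"
proof -
  have "x \<in> V" if "(u, es, w) \<in> open_trails" "x = u \<or> x = w" for u es w x
    using trail_in_Q[of u es w] trail_ends_visited[of a b u es w] that by (auto simp: open_trails_def)
  then show ?thesis unfolding odd_vertices_def odd_vertex_iff by fastforce
qed

lemma card_odd_vertices: "card odd_vertices = 2 * card open_trails"
proof -
  have "card odd_vertices = (\<Sum>\<tau>\<in>open_trails. card {fst \<tau>, snd (snd \<tau>)})"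
    unfolding odd_vertices_eq
  proof (rule card_UN_disjoint)
    show "\<forall>i\<in>open_trails. \<forall>j\<in>open_trails. i \<noteq> j \<longrightarrow> {fst i, snd (snd i)} \<inter> {fst j, snd (snd j)} = {}"
    proof (intro ballI impI)
      fix i j assume ij: "i \<in> open_trails" "j \<in> open_trails" "i \<noteq> j"
      obtain u es w u' es' w' where e: "i = (u, es, w)" "j = (u', es', w')" by (cases i, cases j)
      obtain R where "Q = add_mset i (add_mset j R)"
        using split_off_two[of i j] ij by (auto simp: open_trails_def)
      then show "{fst i, snd (snd i)} \<inter> {fst j, snd (snd j)} = {}"
        using endpoints_disjoint[of u es w u' es' w' R] e by simp
    qed
  qed (auto simp: open_trails_def)
  also have "\<dots> = (\<Sum>\<tau>\<in>open_trails. 2)" by (rule sum.cong) (auto simp: open_trails_def)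
  finally show ?thesis by simp
qed

text \<open>A vertex is named after the closed trail through it, and all vertices on open trails
  share the class \<open>None\<close>. Lumping the open trails together is what later allows all odd
  vertices to be identified without changing a label.\<close>

definition label :: "'v \<Rightarrow> ('e, 'v) trail_data option" where
  "label x = (if \<exists>\<tau>\<in>closed_trails. x \<in> trail_vertices a b (fst \<tau>) (fst (snd \<tau>))
     then Some (THE \<tau>. \<tau> \<in> closed_trails \<and> x \<in> trail_vertices a b (fst \<tau>) (fst (snd \<tau>))) else None)"

lemma closed_unique:
  assumes "\<tau> \<in> closed_trails" "x \<in> trail_vertices a b (fst \<tau>) (fst (snd \<tau>))"
    and "\<tau>' \<in># Q" "x \<in> trail_vertices a b (fst \<tau>') (fst (snd \<tau>'))"
  shows "\<tau>' = \<tau>"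
proof (rule ccontr)
  assume ne: "\<tau>' \<noteq> \<tau>"
  obtain u es w where e: "\<tau> = (u, es, u)" using assms(1) by (cases \<tau>) (auto simp: closed_trails_def)
  obtain u' es' w' where e': "\<tau>' = (u', es', w')" by (cases \<tau>')
  obtain R where "Q = add_mset \<tau> (add_mset \<tau>' R)"
    using split_off_two[of \<tau> \<tau>'] ne assms by (auto simp: closed_trails_def)
  from closed_disjoint[OF this[unfolded e e']] show False using assms e e' by auto
qed

lemma label_closed:
  assumes "\<tau> \<in> closed_trails" "x \<in> trail_vertices a b (fst \<tau>) (fst (snd \<tau>))"
  shows "label x = Some \<tau>"
proof -
  have "(THE \<tau>. \<tau> \<in> closed_trails \<and> x \<in> trail_vertices a b (fst \<tau>) (fst (snd \<tau>))) = \<tau>"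
  proof (rule the_equality)
    fix \<tau>' assume "\<tau>' \<in> closed_trails \<and> x \<in> trail_vertices a b (fst \<tau>') (fst (snd \<tau>'))"
    then show "\<tau>' = \<tau>"
      by (elim conjE, intro closed_unique[OF assms]) (simp_all only: closed_trails_def mem_Collect_eq)
  qed (use assms in simp)
  then show ?thesis using assms by (auto simp: label_def)
qed

lemma label_open:
  assumes "\<tau> \<in> open_trails" "x \<in> trail_vertices a b (fst \<tau>) (fst (snd \<tau>))"
  shows "label x = None"
proof -
  have "\<not> (\<exists>\<tau>\<in>closed_trails. x \<in> trail_vertices a b (fst \<tau>) (fst (snd \<tau>)))"
    using closed_unique[of _ x \<tau>] assms by (auto simp: open_trails_def closed_trails_def)
  then show ?thesis by (simp add: label_def)
qed

lemma label_edge: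
  assumes "l \<in> E"
  shows "label (a l) = label (b l)"
proof -
  have "l \<in># (\<Sum>(u, es, w) \<in># Q. mset es)"
    using decomp assms finE by (simp add: trail_decomposition_def)
  then obtain u es w where \<tau>: "(u, es, w) \<in># Q" "l \<in> set es" by auto
  note ee = trail_edge_ends[OF trail_in_Q(1)[OF \<tau>(1)] \<tau>(2)]
  show ?thesis
  proof (cases "u = w")
    case True
    then show ?thesis using label_closed[of "(u, es, w)"] ee \<tau> by (simp add: closed_trails_def)
  next
    case False
    then show ?thesis using label_open[of "(u, es, w)"] ee \<tau> by (simp add: open_trails_def)
  qed
qed

lemma label_odd: "x \<in> odd_vertices \<Longrightarrow> label x = None"
  unfolding odd_vertices_eq
proof (elim UN_E)
  fix \<tau> assume \<tau>: "\<tau> \<in> open_trails" "x \<in> {fst \<tau>, snd (snd \<tau>)}"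
  obtain u es w where e: "\<tau> = (u, es, w)" by (cases \<tau>)
  have "trail a b u es w" using trail_in_Q(1) \<tau>(1) by (simp add: e open_trails_def)
  from trail_ends_visited[OF this] show "label x = None"
    using label_open[OF \<tau>(1)] \<tau>(2) e by auto
qed

lemma label_image: "label ` V = Some ` closed_trails \<union> (if odd_vertices = {} then {} else {None})"
proof
  show "label ` V \<subseteq> Some ` closed_trails \<union> (if odd_vertices = {} then {} else {None})"
  proof
    fix y assume "y \<in> label ` V"
    then obtain x where x: "x \<in> V" "y = label x" by auto
    then obtain u es w where \<tau>: "(u, es, w) \<in># Q" "x \<in> trail_vertices a b u es"
      using decomp by (auto simp: trail_decomposition_def)
    show "y \<in> Some ` closed_trails \<union> (if odd_vertices = {} then {} else {None})"
    proof (cases "u = w")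
      case True
      then show ?thesis using label_closed[of "(u, es, w)" x] \<tau> x by (auto simp: closed_trails_def)
    next
      case False
      then have o: "(u, es, w) \<in> open_trails" using \<tau> by (simp add: open_trails_def)
      then have "odd_vertices \<noteq> {}" by (auto simp: odd_vertices_eq)
      then show ?thesis using label_open[OF o, of x] \<tau> x by auto
    qed
  qed
  have "Some \<tau> \<in> label ` V" if "\<tau> \<in> closed_trails" for \<tau>
  proof -
    obtain u es w where e: "\<tau> = (u, es, w)" by (cases \<tau>)
    then have q: "(u, es, w) \<in># Q" using that by (auto simp: closed_trails_def)
    have "label u = Some \<tau>"
      by (rule label_closed[OF that]) (use trail_ends_visited[OF trail_in_Q(1)[OF q]] e in auto)
    then show ?thesis using trail_in_Q(2)[OF q] by force
  qed
  moreover have "None \<in> label ` V" if "odd_vertices \<noteq> {}"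
    using that label_odd by (force simp: odd_vertices_def)
  ultimately show "Some ` closed_trails \<union> (if odd_vertices = {} then {} else {None}) \<subseteq> label ` V"
    by auto
qed

text \<open>There is one class for each closed trail and one more if open trails exist, and each
  open trail has two odd vertices as ends. Doubling avoids a division.\<close>

lemma card_labels:
  "2 * card (label ` V) + card odd_vertices = 2 * size Q + (if odd_vertices = {} then 0 else 2)"
proof -
  have fin: "finite closed_trails" "finite open_trails" by (auto simp: closed_trails_def open_trails_def)
  have "size Q = card (set_mset Q)" using arg_cong[OF Q_set, of size] by simp
  also have "set_mset Q = closed_trails \<union> open_trails" by (auto simp: closed_trails_def open_trails_def)
  also have "card \<dots> = card closed_trails + card open_trails"
    by (rule card_Un_disjoint) (use fin in \<open>auto simp: closed_trails_def open_trails_def\<close>)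
  finally have s: "size Q = card closed_trails + card open_trails" .
  have "card (label ` V) = card closed_trails + (if odd_vertices = {} then 0 else 1)"
    unfolding label_image using fin by (auto simp: card_image card_insert_if)
  then show ?thesis using s card_odd_vertices by auto
qed

end

lemma minimal_trails_exist:
  assumes "finite V" "finite E" "\<And>l. l \<in> E \<Longrightarrow> a l \<in> V \<and> b l \<in> V"
  shows "\<exists>Q. minimal_trails a b V E Q"
proof -
  obtain Q0 where "trail_decomposition a b V E Q0"
    using trail_decomposition_exists[of V E a b] assms by auto
  then obtain Q where "trail_decomposition a b V E Q" "\<And>Q'. trail_decomposition a b V E Q' \<Longrightarrow> size Q \<le> size Q'"
    using ex_has_least_nat[of "trail_decomposition a b V E" Q0 size] by blast
  then have "minimal_trails a b V E Q" by unfold_locales (use assms in auto)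
  then show ?thesis ..
qed

section \<open>Graph sums bounded by N to the number of trails\<close>

fun trail_chain :: "('e \<Rightarrow> 'v) \<Rightarrow> ('e \<Rightarrow> 'v) \<Rightarrow> ('e \<Rightarrow> nat \<Rightarrow> nat \<Rightarrow> complex) \<Rightarrow> real \<Rightarrow>
    'v \<Rightarrow> 'e list \<Rightarrow> ((nat \<Rightarrow> nat \<Rightarrow> complex) \<times> real \<times> 'v) list" where
  "trail_chain a b Y \<rho> u [] = []"
| "trail_chain a b Y \<rho> u (l # es) =
     (if u = a l then Y l else (\<lambda>i j. Y l j i), \<rho>, other_end a b l u) # trail_chain a b Y \<rho> (other_end a b l u) es"

text \<open>Consecutive trails are concatenated by an all-ones matrix, which has norm \<open>N\<close>.\<close>

fun trails_chain :: "nat \<Rightarrow> ('e \<Rightarrow> 'v) \<Rightarrow> ('e \<Rightarrow> 'v) \<Rightarrow> ('e \<Rightarrow> nat \<Rightarrow> nat \<Rightarrow> complex) \<Rightarrow> real \<Rightarrow>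
    ('e, 'v) trail_data list \<Rightarrow> ((nat \<Rightarrow> nat \<Rightarrow> complex) \<times> real \<times> 'v) list" where
  "trails_chain N a b Y \<rho> [] = []"
| "trails_chain N a b Y \<rho> ((u, es, w) # ts) =
     ((\<lambda>i j. 1), real N, u) # trail_chain a b Y \<rho> u es @ trails_chain N a b Y \<rho> ts"

lemma trail_chain_vertices: "chain_vertices u (trail_chain a b Y \<rho> u es) = trail_vertices a b u es"
proof (induction es arbitrary: u)
  case (Cons l es)
  show ?case using Cons.IH[of "other_end a b l u"] by auto
qed auto

lemma trails_chain_vertices:
  "(\<lambda>s. snd (snd s)) ` set (trails_chain N a b Y \<rho> ts) = (\<Union>(u, es, w)\<in>set ts. trail_vertices a b u es)"
proof (induction ts)
  case (Cons \<tau> ts)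
  obtain u es w where \<tau>: "\<tau> = (u, es, w)" by (cases \<tau>)
  show ?case using Cons.IH trail_chain_vertices[of u a b Y \<rho> es] by (auto simp: \<tau> image_Un)
qed auto

text \<open>The chains appended later are empty or begin with an all-ones step, so their value does
  not depend on the vertex at which they start.\<close>

lemma chain_value_append:
  assumes "\<And>v. chain_value \<phi> v ch' = K"
  shows "chain_value \<phi> u (ch @ ch') = chain_value \<phi> u ch * K"
proof (induction ch arbitrary: u)
  case (Cons s ch)
  then show ?case by (cases s) (simp add: mult.assoc)
qed (use assms in auto)

lemma trail_chain_value:
  "trail a b u es w \<Longrightarrow> chain_value \<phi> u (trail_chain a b Y \<rho> u es) = (\<Prod>l\<leftarrow>es. Y l (\<phi> (a l)) (\<phi> (b l)))"
proof (induction es arbitrary: u)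
  case (Cons l es)
  then obtain v where v: "link a b l u v" "trail a b v es w" by auto
  show ?case using Cons.IH[OF v(2)] v(1) link_other_end[OF v(1)] by (auto simp: link_def)
qed auto

lemma trails_chain_value:
  assumes "\<forall>(u, es, w)\<in>set ts. trail a b u es w"
  shows "chain_value \<phi> v (trails_chain N a b Y \<rho> ts) = (\<Prod>(u, es, w)\<leftarrow>ts. \<Prod>l\<leftarrow>es. Y l (\<phi> (a l)) (\<phi> (b l)))"
  using assms
proof (induction ts arbitrary: v)
  case (Cons \<tau> ts)
  obtain u es w where \<tau>: "\<tau> = (u, es, w)" by (cases \<tau>)
  have "chain_value \<phi> v (trails_chain N a b Y \<rho> ts) = (\<Prod>(u, es, w)\<leftarrow>ts. \<Prod>l\<leftarrow>es. Y l (\<phi> (a l)) (\<phi> (b l)))" for v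
    using Cons by auto
  from chain_value_append[OF this] show ?case
    using Cons.prems trail_chain_value[of a b u es w \<phi> Y \<rho>] by (auto simp: \<tau>)
qed auto

lemma trail_chain_norm: "chain_norm (trail_chain a b Y \<rho> u es) = \<rho> ^ length es"
  by (induction es arbitrary: u) auto

lemma trails_chain_norm:
  "chain_norm (trails_chain N a b Y \<rho> ts) = real N ^ length ts * \<rho> ^ length (concat (map (\<lambda>(u, es, w). es) ts))"
proof (induction ts)
  case (Cons \<tau> ts)
  then show ?case by (cases \<tau>) (simp add: trail_chain_norm power_add)
qed auto

lemma opnorm_le_ones: "opnorm_le N (real N) (\<lambda>i j. 1)"
  unfolding opnorm_le_def
proof (intro conjI allI)
  fix y :: "nat \<Rightarrow> complex"
  have "(\<Sum>b<N. (cmod (\<Sum>a<N. y a * 1))\<^sup>2) = real N * (cmod (\<Sum>a<N. y a))\<^sup>2" by simp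
  also have "\<dots> \<le> real N * (\<Sum>a<N. cmod (y a) * 1)\<^sup>2"
    by (intro mult_left_mono power_mono) (auto intro: norm_sum)
  also have "\<dots> \<le> real N * ((\<Sum>a<N. (cmod (y a))\<^sup>2) * (\<Sum>a<N. 1\<^sup>2))"
    by (intro mult_left_mono Cauchy_Schwarz_ineq_sum) auto
  finally show "(\<Sum>b<N. (cmod (\<Sum>a<N. y a * 1))\<^sup>2) \<le> (real N)\<^sup>2 * (\<Sum>a<N. (cmod (y a))\<^sup>2)"
    by (simp add: power2_eq_square mult_ac)
qed auto

text \<open>The trail decides in which direction an edge is read, so both orientations must be
  bounded.\<close>

lemma trail_chain_opnorm:
  assumes "\<And>l. l \<in> set es \<Longrightarrow> opnorm_le N \<rho> (Y l) \<and> opnorm_le N \<rho> (\<lambda>i j. Y l j i)"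
    and "(X, r, v) \<in> set (trail_chain a b Y \<rho> u es)"
  shows "opnorm_le N r X"
  using assms
proof (induction es arbitrary: u)
  case (Cons l es)
  show ?case
  proof (cases "(X, r, v) \<in> set (trail_chain a b Y \<rho> (other_end a b l u) es)")
    case True
    then show ?thesis using Cons.IH Cons.prems(1) by (meson list.set_intros(2))
  next
    case False
    then show ?thesis using Cons.prems(1)[of l] Cons.prems(2) by (auto split: if_splits)
  qed
qed auto

lemma trails_chain_opnorm:
  assumes "\<And>l. l \<in> (\<Union>(u, es, w)\<in>set ts. set es) \<Longrightarrow> opnorm_le N \<rho> (Y l) \<and> opnorm_le N \<rho> (\<lambda>i j. Y l j i)"
    and "(X, r, v) \<in> set (trails_chain N a b Y \<rho> ts)"
  shows "opnorm_le N r X"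
  using assms
proof (induction ts)
  case (Cons \<tau> ts)
  obtain u es w where \<tau>: "\<tau> = (u, es, w)" by (cases \<tau>)
  consider "(X, r, v) = ((\<lambda>i j. 1), real N, u)" | "(X, r, v) \<in> set (trail_chain a b Y \<rho> u es)"
    | "(X, r, v) \<in> set (trails_chain N a b Y \<rho> ts)"
    using Cons.prems(2) by (auto simp: \<tau>)
  then show ?case
  proof cases
    case 1
    then show ?thesis using opnorm_le_ones by simp
  next
    case 2
    show ?thesis by (rule trail_chain_opnorm[OF _ 2]) (use Cons.prems(1) in \<open>auto simp: \<tau>\<close>)
  next
    case 3
    show ?thesis by (rule Cons.IH[OF _ 3]) (use Cons.prems(1) in auto)
  qed
qed auto

text \<open>All trails are strung into one chain through \<open>V\<close>. Each junction costs the
  norm N of the all-ones matrix and the chain itself one further N, in total one N per trail; every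
  edge costs \<open>\<rho>\<close>.\<close>

lemma (in minimal_trails) trail_sum_bound:
  fixes S :: "'v \<Rightarrow> nat set" and Y :: "'e \<Rightarrow> nat \<Rightarrow> nat \<Rightarrow> complex"
  assumes Y: "\<And>l. l \<in> E \<Longrightarrow> opnorm_le N \<rho> (Y l) \<and> opnorm_le N \<rho> (\<lambda>i j. Y l j i)"
    and S: "\<And>v. S v \<subseteq> {..<N}" and V: "V \<noteq> {}"
  shows "cmod (\<Sum>\<phi>\<in>PiE V S. \<Prod>l\<in>E. Y l (\<phi> (a l)) (\<phi> (b l))) \<le> real N ^ size Q * \<rho> ^ card E"
proof -
  obtain ts where ts: "mset ts = Q" using ex_mset by blast
  have "ts \<noteq> []" using ts V decomp by (auto simp: trail_decomposition_def)
  then obtain u es w ts' where ts': "ts = (u, es, w) # ts'" by (metis list.exhaust prod_cases3)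
  \<comment> \<open>The first trail keeps no all-ones step: the chain starts at its initial vertex,
    and \<open>chain_bound\<close> supplies the corresponding factor N.\<close>
  define ch where "ch = trail_chain a b Y \<rho> u es @ trails_chain N a b Y \<rho> ts'"
  have tr: "\<forall>(u, es, w)\<in>set ts. trail a b u es w"
    using decomp ts by (auto simp: trail_decomposition_def)
  have sub: "\<forall>(u, es, w)\<in>set ts. set es \<subseteq> E" using trail_in_Q ts by fastforce
  have edges: "mset (concat (map (\<lambda>(u, es, w). es) ts)) = mset_set E"
  proof -
    have "mset (concat (map (\<lambda>(u, es, w). es) ts)) = (\<Sum>(u, es, w)\<in>#mset ts. mset es)"
      by (induction ts) auto
    then show ?thesis using decomp ts by (simp add: trail_decomposition_def)
  qed
  have val: "chain_value \<phi> u ch = (\<Prod>l\<in>E. Y l (\<phi> (a l)) (\<phi> (b l)))" for \<phi>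
  proof -
    have "chain_value \<phi> u ch = (\<Prod>(u, es, w)\<leftarrow>ts. \<Prod>l\<leftarrow>es. Y l (\<phi> (a l)) (\<phi> (b l)))"
      using trails_chain_value[OF tr, of \<phi> u N Y \<rho>] by (simp add: ts' ch_def)
    also have "\<dots> = (\<Prod>l\<leftarrow>concat (map (\<lambda>(u, es, w). es) ts). Y l (\<phi> (a l)) (\<phi> (b l)))"
      by (induction ts) auto
    also have "\<dots> = (\<Prod>l\<in>#mset_set E. Y l (\<phi> (a l)) (\<phi> (b l)))"
      by (simp only: edges[symmetric] mset_map[symmetric] prod_mset_prod_list)
    finally show ?thesis by (simp add: prod_unfold_prod_mset)
  qed
  have verts: "chain_vertices u ch = V"
  proof -
    have "chain_vertices u ch = (\<Union>(u, es, w)\<in>set ts. trail_vertices a b u es)"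
      using trail_chain_vertices[of u a b Y \<rho> es] trails_chain_vertices[of N a b Y \<rho> ts']
      by (auto simp: ts' ch_def image_Un)
    also have "\<dots> = V" using decomp trail_in_Q(3) ts by (fastforce simp: trail_decomposition_def)
    finally show ?thesis .
  qed
  have op: "opnorm_le N r X" if X: "(X, r, v) \<in> set ch" for X r v
  proof (rule trails_chain_opnorm)
    show "(X, r, v) \<in> set (trails_chain N a b Y \<rho> ts)" using X by (auto simp: ts' ch_def)
    show "opnorm_le N \<rho> (Y l) \<and> opnorm_le N \<rho> (\<lambda>i j. Y l j i)"
      if "l \<in> (\<Union>(u, es, w)\<in>set ts. set es)" for l
      by (rule Y) (use that sub in blast)
  qed
  have "cmod (\<Sum>\<phi>\<in>PiE V S. chain_value \<phi> u ch) \<le> real N * chain_norm ch"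
    using chain_bound[of ch N S u] op S verts by simp
  also have "real N * chain_norm ch = chain_norm (trails_chain N a b Y \<rho> ts)"
    by (simp add: ts' ch_def)
  also have "\<dots> = real N ^ size Q * \<rho> ^ card E"
    using arg_cong[OF edges, of size] ts by (simp add: trails_chain_norm flip: size_mset del: size_mset)
  finally show ?thesis by (simp add: val)
qed

section \<open>Resolvents of Hermitian kernels\<close>

text \<open>Functions live on the whole type. The kernels vanish outside the relevant vertices, so
  the subset appears only in the comparison with \<open>ell2\<close>.\<close>

definition square_summable :: "('v \<Rightarrow> complex) \<Rightarrow> bool" where
  "square_summable f \<longleftrightarrow> (\<lambda>v. (cmod (f v))\<^sup>2) summable_on UNIV"

definition l2_sq :: "('v \<Rightarrow> complex) \<Rightarrow> real" where
  "l2_sq f = (\<Sum>\<^sub>\<infinity>v. (cmod (f v))\<^sup>2)"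

definition l2_ip :: "('v \<Rightarrow> complex) \<Rightarrow> ('v \<Rightarrow> complex) \<Rightarrow> complex" where
  "l2_ip f g = (\<Sum>\<^sub>\<infinity>v. f v * cnj (g v))"

lemma square_summable_bounded:
  assumes "\<And>F. finite F \<Longrightarrow> (\<Sum>v\<in>F. (cmod (f v))\<^sup>2) \<le> C"
  shows "square_summable f" "l2_sq f \<le> C"
proof -
  show s: "square_summable f"
    unfolding square_summable_def
    by (rule nonneg_bdd_above_summable_on) (use assms in \<open>auto intro!: bdd_aboveI[of _ C]\<close>)
  show "l2_sq f \<le> C"
    unfolding l2_sq_def by (rule infsum_le_finite_sums) (use s assms in \<open>auto simp: square_summable_def\<close>)
qed

lemma l2_sq_nonneg [simp]: "0 \<le> l2_sq f"
  unfolding l2_sq_def by (rule infsum_nonneg) auto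

lemma sum_le_l2_sq:
  assumes "square_summable f" "finite F"
  shows "(\<Sum>v\<in>F. (cmod (f v))\<^sup>2) \<le> l2_sq f"
  unfolding l2_sq_def by (rule finite_sum_le_infsum) (use assms in \<open>auto simp: square_summable_def\<close>)

lemma cmod_le_l2: "square_summable f \<Longrightarrow> cmod (f v) \<le> sqrt (l2_sq f)"
  using sum_le_l2_sq[of f "{v}"] by (simp add: real_le_rsqrt)

lemma L2_set_le_l2: "square_summable f \<Longrightarrow> finite F \<Longrightarrow> L2_set (\<lambda>v. cmod (f v)) F \<le> sqrt (l2_sq f)"
  unfolding L2_set_def using sum_le_l2_sq by simp

lemma l2_bounded:
  assumes "\<And>F. finite F \<Longrightarrow> L2_set (\<lambda>v. cmod (f v)) F \<le> C"
  shows "square_summable f" "sqrt (l2_sq f) \<le> C"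
proof -
  have C: "0 \<le> C" using assms[of "{}"] by simp
  have b: "(\<Sum>v\<in>F. (cmod (f v))\<^sup>2) \<le> C\<^sup>2" if "finite F" for F
    using assms[OF that] C unfolding L2_set_def by (metis real_sqrt_le_iff real_sqrt_abs abs_of_nonneg)
  show "square_summable f" by (rule square_summable_bounded(1)[OF b])
  show "sqrt (l2_sq f) \<le> C" using square_summable_bounded(2)[OF b] C by (simp add: real_le_lsqrt)
qed

lemma l2_triangle:
  assumes "square_summable f" "square_summable g"
  shows "square_summable (\<lambda>v. f v + g v)" "sqrt (l2_sq (\<lambda>v. f v + g v)) \<le> sqrt (l2_sq f) + sqrt (l2_sq g)"
proof -
  have b: "L2_set (\<lambda>v. cmod (f v + g v)) F \<le> sqrt (l2_sq f) + sqrt (l2_sq g)" if "finite F" for F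
  proof -
    have "L2_set (\<lambda>v. cmod (f v + g v)) F \<le> L2_set (\<lambda>v. cmod (f v) + cmod (g v)) F"
      by (rule L2_set_mono) (auto intro: norm_triangle_ineq)
    also have "\<dots> \<le> L2_set (\<lambda>v. cmod (f v)) F + L2_set (\<lambda>v. cmod (g v)) F"
      by (rule L2_set_triangle_ineq)
    also have "\<dots> \<le> sqrt (l2_sq f) + sqrt (l2_sq g)"
      using L2_set_le_l2 assms that by (intro add_mono) auto
    finally show ?thesis .
  qed
  show "square_summable (\<lambda>v. f v + g v)" "sqrt (l2_sq (\<lambda>v. f v + g v)) \<le> sqrt (l2_sq f) + sqrt (l2_sq g)"
    using l2_bounded[OF b] by auto
qed

lemma square_summable_cmult: "square_summable f \<Longrightarrow> square_summable (\<lambda>v. c * f v)"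
  unfolding square_summable_def by (simp add: norm_mult power_mult_distrib summable_on_cmult_right)

lemma l2_sq_cmult: "l2_sq (\<lambda>v. c * f v) = (cmod c)\<^sup>2 * l2_sq f"
  unfolding l2_sq_def by (simp add: norm_mult power_mult_distrib infsum_cmult_right')

lemma square_summable_lin:
  "square_summable f \<Longrightarrow> square_summable g \<Longrightarrow> square_summable (\<lambda>v. a * f v + b * g v)"
  by (intro l2_triangle(1) square_summable_cmult)

lemma square_summable_diff:
  "square_summable f \<Longrightarrow> square_summable g \<Longrightarrow> square_summable (\<lambda>v. f v - g v)"
  using square_summable_lin[of f g 1 "-1"] by simp

lemma square_summable_finite_support:
  assumes "finite F" "\<And>v. v \<notin> F \<Longrightarrow> f v = 0"
  shows "square_summable f"
proof -
  have "(\<lambda>v. (cmod (f v))\<^sup>2) summable_on F" using assms(1) by simp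
  then show ?thesis unfolding square_summable_def
    by (rule iffD1[OF summable_on_cong_neutral, rotated -1]) (use assms in auto)
qed

lemma abs_summable_ip:
  assumes "square_summable f" "square_summable g"
  shows "(\<lambda>v. norm (f v * cnj (g v))) summable_on UNIV"
  by (rule abs_summable_product)
    (use assms in \<open>simp_all add: square_summable_def norm_mult power2_eq_square\<close>)

lemma summable_ip:
  "square_summable f \<Longrightarrow> square_summable g \<Longrightarrow> (\<lambda>v. f v * cnj (g v)) summable_on UNIV"
  by (rule Infinite_Sum.abs_summable_summable[OF abs_summable_ip])

lemma l2_ip_self: "square_summable f \<Longrightarrow> l2_ip f f = of_real (l2_sq f)"
  unfolding l2_ip_def l2_sq_def square_summable_def
  by (intro infsumI) (simp add: complex_norm_square[symmetric] del: of_real_power, intro has_sum_of_real has_sum_infsum)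

lemma l2_ip_commute: "l2_ip g f = cnj (l2_ip f g)"
  unfolding l2_ip_def infsum_cnj[symmetric] by (simp add: mult.commute)

lemma l2_ip_lin:
  assumes "square_summable f" "square_summable g" "square_summable h"
  shows "l2_ip (\<lambda>v. a * f v + b * g v) h = a * l2_ip f h + b * l2_ip g h"
proof -
  have "l2_ip (\<lambda>v. a * f v + b * g v) h = (\<Sum>\<^sub>\<infinity>v. a * (f v * cnj (h v)) + b * (g v * cnj (h v)))"
    unfolding l2_ip_def by (simp add: algebra_simps)
  also have "\<dots> = (\<Sum>\<^sub>\<infinity>v. a * (f v * cnj (h v))) + (\<Sum>\<^sub>\<infinity>v. b * (g v * cnj (h v)))"
    by (intro infsum_add summable_on_cmult_right summable_ip assms)
  finally show ?thesis unfolding l2_ip_def by (simp add: infsum_cmult_right')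
qed

lemma l2_ip_lin_right:
  assumes "square_summable f" "square_summable g" "square_summable h"
  shows "l2_ip h (\<lambda>v. a * f v + b * g v) = cnj a * l2_ip h f + cnj b * l2_ip h g"
  using l2_ip_lin[OF assms, of a b] l2_ip_commute[of h] by simp

lemma l2_Cauchy_Schwarz:
  assumes "square_summable f" "square_summable g"
  shows "cmod (l2_ip f g) \<le> sqrt (l2_sq f) * sqrt (l2_sq g)"
proof -
  have "cmod (l2_ip f g) \<le> (\<Sum>\<^sub>\<infinity>v. cmod (f v * cnj (g v)))"
    unfolding l2_ip_def by (rule norm_infsum_bound) (rule abs_summable_ip[OF assms])
  also have "\<dots> \<le> sqrt (l2_sq f) * sqrt (l2_sq g)"
  proof (rule infsum_le_finite_sums)
    fix F :: "'a set" assume F: "finite F"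
    have "(\<Sum>v\<in>F. cmod (f v * cnj (g v))) = (\<Sum>v\<in>F. \<bar>cmod (f v)\<bar> * \<bar>cmod (g v)\<bar>)"
      by (simp add: norm_mult)
    also have "\<dots> \<le> L2_set (\<lambda>v. cmod (f v)) F * L2_set (\<lambda>v. cmod (g v)) F"
      by (rule L2_set_mult_ineq)
    also have "\<dots> \<le> sqrt (l2_sq f) * sqrt (l2_sq g)"
      by (intro mult_mono L2_set_le_l2 assms F) auto
    finally show "(\<Sum>v\<in>F. cmod (f v * cnj (g v))) \<le> sqrt (l2_sq f) * sqrt (l2_sq g)" .
  qed (rule abs_summable_ip[OF assms])
  finally show ?thesis .
qed

lemma l2_ip_finite_support:
  assumes "finite F" "\<And>v. v \<notin> F \<Longrightarrow> g v = 0"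
  shows "l2_ip f g = (\<Sum>v\<in>F. f v * cnj (g v))"
proof -
  have "l2_ip f g = (\<Sum>\<^sub>\<infinity>v\<in>F. f v * cnj (g v))"
    unfolding l2_ip_def by (rule infsum_cong_neutral) (use assms in auto)
  then show ?thesis using assms(1) by simp
qed

text \<open>One framework for the matrix sum on N points and the free sum on the infinite tree. The
  uniform row bound \<open>R\<close> gives boundedness, and finite rows keep the action a finite
  sum.\<close>

locale hermitian_kernel =
  fixes t :: "'v \<Rightarrow> 'v \<Rightarrow> complex" and nb :: "'v \<Rightarrow> 'v set" and R :: real
  assumes fin: "finite (nb v)" and supp: "w \<notin> nb v \<Longrightarrow> t v w = 0"
    and herm: "t w v = cnj (t v w)"
    and row: "(\<Sum>w\<in>nb v. cmod (t v w)) \<le> R"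
begin

definition ap :: "('v \<Rightarrow> complex) \<Rightarrow> 'v \<Rightarrow> complex" where
  "ap f v = (\<Sum>w\<in>nb v. t v w * f w)"

lemma R_nonneg: "0 \<le> R"
  using row[of undefined] sum_nonneg[of "nb undefined" "\<lambda>w. cmod (t undefined w)"] by simp

lemma column:
  assumes "finite F"
  shows "(\<Sum>v\<in>F. cmod (t v w)) \<le> R"
proof -
  have "(\<Sum>v\<in>F. cmod (t v w)) = (\<Sum>v\<in>F. cmod (t w v))"
    using herm[of _ w] by (metis complex_mod_cnj)
  also have "\<dots> = (\<Sum>v\<in>F \<inter> nb w. cmod (t w v))"
    using assms by (intro sum.mono_neutral_right) (auto simp: supp)
  also have "\<dots> \<le> (\<Sum>v\<in>nb w. cmod (t w v))" using fin by (intro sum_mono2) auto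
  also have "\<dots> \<le> R" by (rule row)
  finally show ?thesis .
qed

text \<open>Schur test: Cauchy-Schwarz in each row with weights sqrt |t v w|, then summation over v
  with the column bound, which agrees with the row bound by Hermitian symmetry.\<close>

lemma ap_l2:
  assumes f: "square_summable f"
  shows "square_summable (ap f)" "sqrt (l2_sq (ap f)) \<le> R * sqrt (l2_sq f)"
proof -
  have b: "(\<Sum>v\<in>F. (cmod (ap f v))\<^sup>2) \<le> R\<^sup>2 * l2_sq f" if F: "finite F" for F
  proof -
    define G where "G = (\<Union>v\<in>F. nb v)"
    have G: "finite G" using F fin by (simp add: G_def)
    have ptw: "(cmod (ap f v))\<^sup>2 \<le> R * (\<Sum>w\<in>G. cmod (t v w) * (cmod (f w))\<^sup>2)" if "v \<in> F" for v
    proof -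
      have "cmod (ap f v) \<le> (\<Sum>w\<in>nb v. cmod (t v w) * cmod (f w))"
        unfolding ap_def by (metis (no_types, lifting) norm_mult norm_sum sum.cong)
      also have "\<dots> = (\<Sum>w\<in>nb v. sqrt (cmod (t v w)) * (sqrt (cmod (t v w)) * cmod (f w)))"
        by (simp add: mult.assoc[symmetric])
      finally have "(cmod (ap f v))\<^sup>2 \<le> (\<Sum>w\<in>nb v. sqrt (cmod (t v w)) * (sqrt (cmod (t v w)) * cmod (f w)))\<^sup>2"
        by (intro power_mono) auto
      also have "\<dots> \<le> (\<Sum>w\<in>nb v. (sqrt (cmod (t v w)))\<^sup>2) * (\<Sum>w\<in>nb v. (sqrt (cmod (t v w)) * cmod (f w))\<^sup>2)"
        by (rule Cauchy_Schwarz_ineq_sum)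
      also have "\<dots> = (\<Sum>w\<in>nb v. cmod (t v w)) * (\<Sum>w\<in>nb v. cmod (t v w) * (cmod (f w))\<^sup>2)"
        by (simp add: power_mult_distrib)
      also have "\<dots> \<le> R * (\<Sum>w\<in>G. cmod (t v w) * (cmod (f w))\<^sup>2)"
        using that G by (intro mult_mono row sum_mono2 R_nonneg sum_nonneg) (auto simp: G_def)
      finally show ?thesis .
    qed
    have "(\<Sum>v\<in>F. (cmod (ap f v))\<^sup>2) \<le> (\<Sum>v\<in>F. R * (\<Sum>w\<in>G. cmod (t v w) * (cmod (f w))\<^sup>2))"
      by (rule sum_mono) (rule ptw)
    also have "\<dots> = R * (\<Sum>w\<in>G. \<Sum>v\<in>F. cmod (t v w) * (cmod (f w))\<^sup>2)"
      by (subst sum.swap) (simp add: sum_distrib_left)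
    also have "\<dots> = R * (\<Sum>w\<in>G. (\<Sum>v\<in>F. cmod (t v w)) * (cmod (f w))\<^sup>2)"
      by (simp add: sum_distrib_right)
    also have "\<dots> \<le> R * (\<Sum>w\<in>G. R * (cmod (f w))\<^sup>2)"
      by (intro mult_left_mono sum_mono mult_right_mono column[OF F] R_nonneg) auto
    also have "\<dots> = R\<^sup>2 * (\<Sum>w\<in>G. (cmod (f w))\<^sup>2)"
      by (simp add: power2_eq_square sum_distrib_left mult.assoc)
    also have "\<dots> \<le> R\<^sup>2 * l2_sq f" by (intro mult_left_mono sum_le_l2_sq[OF f G]) auto
    finally show ?thesis .
  qed
  show "square_summable (ap f)" by (rule square_summable_bounded(1)[OF b])
  have "sqrt (l2_sq (ap f)) \<le> sqrt (R\<^sup>2 * l2_sq f)"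
    using square_summable_bounded(2)[OF b] by simp
  then show "sqrt (l2_sq (ap f)) \<le> R * sqrt (l2_sq f)"
    using R_nonneg by (simp add: real_sqrt_mult)
qed

lemma ap_lin: "ap (\<lambda>v. a * f v + b * g v) = (\<lambda>v. a * ap f v + b * ap g v)"
  by (rule ext) (simp add: ap_def sum.distrib sum_distrib_left algebra_simps)

text \<open>The kernel of moduli obeys the same bounds and supplies the absolute summability for the
  interchange of sums in \<open>ap_symmetric\<close>.\<close>

lemma abs_kernel: "hermitian_kernel (\<lambda>v w. of_real (cmod (t v w))) nb R"
proof
  show "complex_of_real (cmod (t w v)) = cnj (complex_of_real (cmod (t v w)))" for v w
    using herm[of w v] by (metis complex_cnj_complex_of_real complex_mod_cnj)
qed (auto simp: fin supp row)

lemma ap_symmetric: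
  assumes f: "square_summable f" and g: "square_summable g"
  shows "l2_ip (ap f) g = l2_ip f (ap g)"
proof -
  interpret abs: hermitian_kernel "\<lambda>v w. of_real (cmod (t v w))" nb R by (rule abs_kernel)
  define F where "F v w = t v w * f w * cnj (g v)" for v w
  have inner: "(\<lambda>w. norm (F v w)) summable_on UNIV" "(\<Sum>\<^sub>\<infinity>w. norm (F v w)) = (\<Sum>w\<in>nb v. norm (F v w))" for v
  proof -
    have "(\<lambda>w. norm (F v w)) summable_on nb v" using fin by simp
    then show "(\<lambda>w. norm (F v w)) summable_on UNIV"
      by (rule iffD1[OF summable_on_cong_neutral, rotated -1]) (auto simp: F_def supp)
    have "(\<Sum>\<^sub>\<infinity>w. norm (F v w)) = (\<Sum>\<^sub>\<infinity>w\<in>nb v. norm (F v w))"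
      by (rule infsum_cong_neutral) (auto simp: F_def supp)
    then show "(\<Sum>\<^sub>\<infinity>w. norm (F v w)) = (\<Sum>w\<in>nb v. norm (F v w))" using fin by simp
  qed
  have abs: "(\<lambda>p. norm (case p of (v, w) \<Rightarrow> F v w)) summable_on UNIV \<times> UNIV"
  proof (rule iffD2[OF Infinite_Sum.abs_summable_on_Sigma_iff], intro conjI ballI)
    show "(\<lambda>w. norm (case (v, w) of (v, w) \<Rightarrow> F v w)) summable_on UNIV" for v using inner(1) by simp
    have fa: "square_summable (\<lambda>v. complex_of_real (cmod (f v)))" "square_summable (\<lambda>v. complex_of_real (cmod (g v)))"
      using f g by (auto simp: square_summable_def)
    have "(\<lambda>v. norm (abs.ap (\<lambda>v. of_real (cmod (f v))) v * cnj (complex_of_real (cmod (g v))))) summable_on UNIV"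
      by (intro abs_summable_ip abs.ap_l2 fa)
    moreover have "norm (abs.ap (\<lambda>v. of_real (cmod (f v))) v * cnj (complex_of_real (cmod (g v))))
        = norm (\<Sum>\<^sub>\<infinity>w. norm (F v w))" for v
    proof -
      have "abs.ap (\<lambda>v. of_real (cmod (f v))) v * cnj (complex_of_real (cmod (g v)))
         = of_real (\<Sum>w\<in>nb v. norm (F v w))"
        by (simp add: abs.ap_def F_def norm_mult sum_distrib_right)
      then show ?thesis unfolding inner(2) by (simp only: norm_of_real real_norm_def)
    qed
    ultimately show "(\<lambda>v. norm (\<Sum>\<^sub>\<infinity>w. norm (case (v, w) of (v, w) \<Rightarrow> F v w))) summable_on UNIV" by simp
  qed
  have sw: "(\<Sum>\<^sub>\<infinity>v. \<Sum>\<^sub>\<infinity>w. F v w) = (\<Sum>\<^sub>\<infinity>w. \<Sum>\<^sub>\<infinity>v. F v w)"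
    by (intro infsum_swap_banach) (rule Infinite_Sum.abs_summable_summable[OF abs])
  have L: "(\<Sum>\<^sub>\<infinity>w. F v w) = ap f v * cnj (g v)" for v
  proof -
    have "(\<Sum>\<^sub>\<infinity>w. F v w) = (\<Sum>\<^sub>\<infinity>w\<in>nb v. F v w)"
      by (rule infsum_cong_neutral) (auto simp: F_def supp)
    then show ?thesis using fin by (simp add: F_def ap_def sum_distrib_right)
  qed
  have Rr: "(\<Sum>\<^sub>\<infinity>v. F v w) = f w * cnj (ap g w)" for w
  proof -
    have "t v w = 0" if "v \<notin> nb w" for v using herm[of v w] supp[OF that] by simp
    then have "(\<Sum>\<^sub>\<infinity>v. F v w) = (\<Sum>\<^sub>\<infinity>v\<in>nb w. F v w)"
      by (intro infsum_cong_neutral) (auto simp: F_def)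
    also have "\<dots> = f w * cnj (ap g w)"
      using fin by (simp add: F_def ap_def sum_distrib_left herm[of _ w] mult_ac)
    finally show ?thesis .
  qed
  show ?thesis using sw unfolding L Rr l2_ip_def .
qed

section \<open>The resolvent: energy bound, uniqueness, existence\<close>

definition shifted :: "complex \<Rightarrow> ('v \<Rightarrow> complex) \<Rightarrow> 'v \<Rightarrow> complex" where
  "shifted z f v = z * f v - ap f v"

lemma shifted_l2:
  assumes f: "square_summable f"
  shows "square_summable (shifted z f)" "sqrt (l2_sq (shifted z f)) \<le> (cmod z + R) * sqrt (l2_sq f)"
proof -
  have eq: "shifted z f = (\<lambda>v. z * f v + (-1) * ap f v)" by (auto simp: shifted_def)
  note s = square_summable_cmult[OF f, of z] square_summable_cmult[OF ap_l2(1)[OF f], of "-1"]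
  show "square_summable (shifted z f)" unfolding eq by (rule l2_triangle(1)[OF s])
  have "sqrt (l2_sq (shifted z f)) \<le> cmod z * sqrt (l2_sq f) + sqrt (l2_sq (ap f))"
    using l2_triangle(2)[OF s] l2_sq_cmult[of "-1" "ap f"] unfolding eq by (simp add: l2_sq_cmult real_sqrt_mult)
  then show "sqrt (l2_sq (shifted z f)) \<le> (cmod z + R) * sqrt (l2_sq f)"
    using ap_l2(2)[OF f] by (simp add: algebra_simps)
qed

lemma shifted_adjoint:
  assumes "square_summable f" "square_summable g"
  shows "l2_ip (shifted z f) g = l2_ip f (shifted (cnj z) g)"
proof -
  have eq: "shifted z f = (\<lambda>v. z * f v + (-1) * ap f v)" for z f by (auto simp: shifted_def)
  show ?thesis unfolding eq
    by (simp only: l2_ip_lin[OF assms(1) ap_l2(1)[OF assms(1)] assms(2)]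
      l2_ip_lin_right[OF assms(2) ap_l2(1)[OF assms(2)] assms(1)] ap_symmetric[OF assms]) simp
qed

text \<open>By symmetry <t g, g> is real, so the imaginary part of <(z - t) g, g> is Im z times the
  squared norm of g; Cauchy-Schwarz does the rest. Injectivity, the resolvent bound and the
  remainder bound all come from here.\<close>

lemma energy_bound:
  assumes g: "square_summable g"
  shows "\<bar>Im z\<bar> * sqrt (l2_sq g) \<le> sqrt (l2_sq (shifted z g))"
proof -
  have eq: "shifted z g = (\<lambda>v. z * g v + (-1) * ap g v)" by (auto simp: shifted_def)
  have "Im (l2_ip (ap g) g) = 0"
    using ap_symmetric[OF g g] l2_ip_commute[of g "ap g"] by (metis complex_cnj_cancel_iff Im_complex_of_real Reals_cnj_iff complex_is_Real_iff)
  then have "Im (l2_ip (shifted z g) g) = Im z * l2_sq g"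
    unfolding eq l2_ip_lin[OF g ap_l2(1)[OF g] g] by (simp add: l2_ip_self[OF g])
  then have "\<bar>Im z\<bar> * l2_sq g \<le> cmod (l2_ip (shifted z g) g)"
    using abs_Im_le_cmod[of "l2_ip (shifted z g) g"] by (simp add: abs_mult)
  also have "\<dots> \<le> sqrt (l2_sq (shifted z g)) * sqrt (l2_sq g)"
    by (intro l2_Cauchy_Schwarz shifted_l2 g)
  finally have "(\<bar>Im z\<bar> * sqrt (l2_sq g)) * sqrt (l2_sq g) \<le> sqrt (l2_sq (shifted z g)) * sqrt (l2_sq g)"
    by (simp add: mult.assoc)
  then show ?thesis by (cases "l2_sq g = 0") (auto simp: less_le)
qed

lemma shifted_zero:
  assumes "square_summable g" "Im z \<noteq> 0" "\<And>v. shifted z g v = 0"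
  shows "g v = 0"
proof -
  have "shifted z g = (\<lambda>_. 0)" using assms(3) by auto
  then have "\<bar>Im z\<bar> * sqrt (l2_sq g) \<le> 0" using energy_bound[OF assms(1), of z] by (simp add: l2_sq_def)
  then have "sqrt (l2_sq g) \<le> 0" using assms(2) by (simp add: mult_le_0_iff)
  then show ?thesis using cmod_le_l2[OF assms(1), of v] by (metis norm_le_zero_iff order_trans)
qed

lemma resolvent_unique:
  assumes "square_summable f" "square_summable g" "Im z \<noteq> 0" "\<And>v. shifted z f v = shifted z g v"
  shows "f = g"
proof
  fix v
  have "shifted z (\<lambda>v. f v - g v) v = 0" for v
    using assms(4)[of v] ap_lin[of 1 f "-1" g] by (simp add: shifted_def algebra_simps)
  then show "f v = g v"
    using shifted_zero[OF square_summable_diff[OF assms(1,2)] assms(3)] by simp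
qed

text \<open>With g = (z - t) f and q = (cnj z - t) g one has <q, f> = |g|^2 and |q|^2 <= |g|^2 /
  \<open>\<eta>\<close>. Hence the squared norm drops by at least \<open>\<eta>\<close> |g|^2, and
  \<open>energy_bound\<close> bounds |g| below by |Im z| |f|.\<close>

lemma normal_step_contracts:
  assumes f: "square_summable f" and \<eta>: "\<eta> = 1 / (cmod z + R)\<^sup>2" and pos: "0 < cmod z + R"
  shows "l2_sq (\<lambda>v. f v - of_real \<eta> * shifted (cnj z) (shifted z f) v) \<le> (1 - \<eta> * (Im z)\<^sup>2) * l2_sq f"
    and "square_summable (\<lambda>v. f v - of_real \<eta> * shifted (cnj z) (shifted z f) v)"
proof -
  define g where "g = shifted z f"
  define q where "q = shifted (cnj z) g"
  have g: "square_summable g" and q: "square_summable q" unfolding g_def q_def by (intro shifted_l2 f)+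
  define h where "h = (\<lambda>v. 1 * f v + (- of_real \<eta>) * q v)"
  have h_eq: "(\<lambda>v. f v - of_real \<eta> * shifted (cnj z) (shifted z f) v) = h"
    by (auto simp: h_def q_def g_def)
  have h: "square_summable h" unfolding h_def by (rule square_summable_lin[OF f q])
  then show "square_summable (\<lambda>v. f v - of_real \<eta> * shifted (cnj z) (shifted z f) v)" unfolding h_eq .
  have qf: "l2_ip q f = of_real (l2_sq g)"
    unfolding q_def using shifted_adjoint[OF g f, of "cnj z"] l2_ip_self[OF g] by (simp add: g_def)
  then have fq: "l2_ip f q = of_real (l2_sq g)" using l2_ip_commute[of f q] by simp
  have "of_real (l2_sq h) = l2_ip h h" using l2_ip_self[OF h] by simp
  also have "\<dots> = l2_ip f h - of_real \<eta> * l2_ip q h"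
    using l2_ip_lin[OF f q h, of 1 "- of_real \<eta>"] by (simp add: h_def)
  also have "l2_ip f h = of_real (l2_sq f) - of_real \<eta> * of_real (l2_sq g)"
    using l2_ip_lin_right[OF f q f, of 1 "- of_real \<eta>"] by (simp add: h_def l2_ip_self[OF f] fq)
  also have "l2_ip q h = of_real (l2_sq g) - of_real \<eta> * of_real (l2_sq q)"
    using l2_ip_lin_right[OF f q q, of 1 "- of_real \<eta>"] by (simp add: h_def l2_ip_self[OF q] qf)
  finally have "complex_of_real (l2_sq h) = of_real (l2_sq f - 2 * \<eta> * l2_sq g + \<eta>\<^sup>2 * l2_sq q)"
    by (simp add: algebra_simps power2_eq_square)
  then have hh: "l2_sq h = l2_sq f - 2 * \<eta> * l2_sq g + \<eta>\<^sup>2 * l2_sq q" by (simp only: of_real_eq_iff)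
  have "(sqrt (l2_sq q))\<^sup>2 \<le> ((cmod z + R) * sqrt (l2_sq g))\<^sup>2"
    unfolding q_def using shifted_l2(2)[OF g, of "cnj z"] by (intro power_mono) auto
  then have "l2_sq q \<le> (cmod z + R)\<^sup>2 * l2_sq g" by (simp add: power_mult_distrib)
  then have "\<eta>\<^sup>2 * l2_sq q \<le> \<eta>\<^sup>2 * ((cmod z + R)\<^sup>2 * l2_sq g)" by (intro mult_left_mono) auto
  also have "\<dots> = \<eta> * l2_sq g" using pos by (simp add: \<eta> power2_eq_square)
  finally have 1: "l2_sq h \<le> l2_sq f - \<eta> * l2_sq g" using hh by simp
  have "(\<bar>Im z\<bar> * sqrt (l2_sq f))\<^sup>2 \<le> (sqrt (l2_sq g))\<^sup>2"
    unfolding g_def using energy_bound[OF f, of z] by (intro power_mono) auto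
  then have "(Im z)\<^sup>2 * l2_sq f \<le> l2_sq g" by (simp add: power_mult_distrib)
  then have "\<eta> * ((Im z)\<^sup>2 * l2_sq f) \<le> \<eta> * l2_sq g" by (intro mult_left_mono) (auto simp: \<eta>)
  with 1 show "l2_sq (\<lambda>v. f v - of_real \<eta> * shifted (cnj z) (shifted z f) v) \<le> (1 - \<eta> * (Im z)\<^sup>2) * l2_sq f"
    unfolding h_eq by (simp add: algebra_simps)
qed

text \<open>Richardson iteration for the normal equation \<open>(cnj z - t) (z - t) f = (cnj z - t) d\<close>; it gives
  the existence of the resolvent and exhibits it as a limit of polynomials in the entries.\<close>

fun richardson :: "complex \<Rightarrow> ('v \<Rightarrow> complex) \<Rightarrow> nat \<Rightarrow> 'v \<Rightarrow> complex" where
  "richardson z d 0 v = 0"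
| "richardson z d (Suc n) v = richardson z d n v
     - of_real (1 / (cmod z + R)\<^sup>2) * shifted (cnj z) (\<lambda>w. shifted z (richardson z d n) w - d w) v"

lemma resolvent_exists:
  assumes d: "square_summable d" and z: "Im z \<noteq> 0"
  obtains f where "square_summable f" "\<And>v. shifted z f v = d v" "\<And>v. (\<lambda>n. richardson z d n v) \<longlonglongrightarrow> f v"
proof -
  define \<eta> where "\<eta> = 1 / (cmod z + R)\<^sup>2"
  have pos: "0 < cmod z + R" using z R_nonneg by (metis add_pos_nonneg complex.sel(2) norm_eq_zero zero_complex.simps(2) zero_less_norm_iff)
  have \<eta>0: "0 < \<eta>" using pos by (simp add: \<eta>_def)
  define q where "q = 1 - \<eta> * (Im z)\<^sup>2"
  have q1: "q < 1" using \<eta>0 z by (simp add: q_def)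
  have q0: "0 \<le> q"
  proof -
    have "(Im z)\<^sup>2 \<le> (cmod z + R)\<^sup>2"
      using abs_Im_le_cmod[of z] R_nonneg by (intro power2_le_iff_abs_le[THEN iffD2]) auto
    then show ?thesis using pos by (simp add: q_def \<eta>_def field_simps)
  qed
  define F where "F n = richardson z d n" for n
  define e where "e n v = F (Suc n) v - F n v" for n v
  have sh_diff: "shifted w (\<lambda>v. a v - b v) v = shifted w a v - shifted w b v" for w a b v
    using ap_lin[of 1 a "-1" b] by (simp add: shifted_def algebra_simps)
  have e_eq: "e n v = - of_real \<eta> * shifted (cnj z) (\<lambda>w. shifted z (F n) w - d w) v" for n v
    by (simp add: e_def F_def \<eta>_def)
  have F_ss: "square_summable (F n)" for n
  proof (induction n)
    case 0
    then show ?case by (simp add: F_def square_summable_def)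
  next
    case (Suc n)
    have "F (Suc n) = (\<lambda>v. F n v - of_real \<eta> * shifted (cnj z) (\<lambda>w. shifted z (F n) w - d w) v)"
      by (auto simp: F_def \<eta>_def)
    then show ?case
      by (simp only:) (intro square_summable_diff square_summable_cmult shifted_l2 Suc d)
  qed
  have e_ss: "square_summable (e n)" for n unfolding e_def by (intro square_summable_diff F_ss)
  \<comment> \<open>The increments satisfy the homogeneous iteration, hence decay
    geometrically.\<close>
  have e_step: "e (Suc n) = (\<lambda>v. e n v - of_real \<eta> * shifted (cnj z) (shifted z (e n)) v)" for n
  proof
    fix v
    have "(\<lambda>w. shifted z (F (Suc n)) w - d w) = (\<lambda>w. (shifted z (F n) w - d w) - (- shifted z (e n) w))"
      unfolding ext[of "e n" "\<lambda>v. F (Suc n) v - F n v", OF e_def] by (auto simp: sh_diff)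
    then have "shifted (cnj z) (\<lambda>w. shifted z (F (Suc n)) w - d w) v
       = shifted (cnj z) (\<lambda>w. shifted z (F n) w - d w) v - shifted (cnj z) (\<lambda>w. - shifted z (e n) w) v"
      by (simp only: sh_diff)
    also have "shifted (cnj z) (\<lambda>w. - shifted z (e n) w) v = - shifted (cnj z) (shifted z (e n)) v"
      using sh_diff[of "cnj z" "\<lambda>_. 0" "shifted z (e n)" v] by (simp add: shifted_def ap_def)
    finally show "e (Suc n) v = e n v - of_real \<eta> * shifted (cnj z) (shifted z (e n)) v"
      unfolding e_eq[of "Suc n"] e_eq[of n v] by (simp add: algebra_simps)
  qed
  have e_bound: "l2_sq (e n) \<le> q ^ n * l2_sq (e 0)" for n
  proof (induction n)
    case (Suc n)
    have "l2_sq (e (Suc n)) \<le> q * l2_sq (e n)"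
      unfolding e_step q_def using normal_step_contracts(1)[OF e_ss \<eta>_def pos] by simp
    also have "\<dots> \<le> q * (q ^ n * l2_sq (e 0))" using q0 Suc by (intro mult_left_mono)
    finally show ?case by simp
  qed simp
  define p where "p = sqrt q"
  define c where "c = sqrt (l2_sq (e 0))"
  have p: "0 \<le> p" "p < 1" using q0 q1 by (auto simp: p_def)
  have e_norm: "sqrt (l2_sq (e n)) \<le> c * p ^ n" for n
  proof -
    have "sqrt (l2_sq (e n)) \<le> sqrt (q ^ n * l2_sq (e 0))" using e_bound by simp
    then show ?thesis by (simp add: real_sqrt_mult real_sqrt_power p_def c_def mult.commute)
  qed
  have geo: "summable (\<lambda>n. c * p ^ n)" using p by (intro summable_mult summable_geometric) auto
  have e_sum: "summable (\<lambda>n. e n v)" for v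
    by (rule summable_comparison_test[OF _ geo])
      (use cmod_le_l2[OF e_ss] e_norm order_trans in blast)
  define f where "f v = (\<Sum>n. e n v)" for v
  have F_sum: "F n v = (\<Sum>j<n. e j v)" for n v
    using sum_lessThan_telescope[of "\<lambda>j. F j v" n] by (simp add: e_def F_def)
  have lim: "(\<lambda>n. F n v) \<longlonglongrightarrow> f v" for v
    unfolding F_sum f_def by (rule summable_LIMSEQ[OF e_sum])
  have L2_sum: "L2_set (\<lambda>v. cmod (F n v)) S \<le> (\<Sum>j<n. c * p ^ j)" if "finite S" for S n
  proof (induction n)
    case 0
    then show ?case by (simp add: F_sum L2_set_def)
  next
    case (Suc n)
    have "L2_set (\<lambda>v. cmod (F (Suc n) v)) S \<le> L2_set (\<lambda>v. cmod (F n v) + cmod (e n v)) S"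
      by (rule L2_set_mono) (auto simp: F_sum intro: norm_triangle_ineq)
    also have "\<dots> \<le> L2_set (\<lambda>v. cmod (F n v)) S + L2_set (\<lambda>v. cmod (e n v)) S"
      by (rule L2_set_triangle_ineq)
    also have "\<dots> \<le> (\<Sum>j<n. c * p ^ j) + c * p ^ n"
      using Suc L2_set_le_l2[OF e_ss that] e_norm order_trans by (intro add_mono) blast+
    finally show ?case by simp
  qed
  \<comment> \<open>So far the limit is only pointwise. Bounds on finite sets pass to the limit, and
    they are uniform in the set.\<close>
  have f_ss: "square_summable f"
  proof (rule l2_bounded(1))
    fix S :: "'v set" assume S: "finite S"
    have "(\<lambda>n. L2_set (\<lambda>v. cmod (F n v)) S) \<longlonglongrightarrow> L2_set (\<lambda>v. cmod (f v)) S"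
      unfolding L2_set_def by (intro tendsto_intros lim)
    then show "L2_set (\<lambda>v. cmod (f v)) S \<le> (\<Sum>j. c * p ^ j)"
    proof (rule LIMSEQ_le_const2, intro exI allI impI)
      fix n
      show "L2_set (\<lambda>v. cmod (F n v)) S \<le> (\<Sum>j. c * p ^ j)"
        using L2_sum[OF S, of n] sum_le_suminf[OF geo, of "{..<n}"] p by (force simp: c_def)
    qed
  qed
  have sh_lim: "(\<lambda>n. shifted w (a n) v) \<longlonglongrightarrow> shifted w b v" if "\<And>v. (\<lambda>n. a n v) \<longlonglongrightarrow> b v" for a b w v
    unfolding shifted_def ap_def by (intro tendsto_intros that)
  define r where "r v = shifted z f v - d v" for v
  \<comment> \<open>The increments tend to 0, so the limit solves the normal equation; injectivity
    of cnj z - t then removes the extra factor.\<close>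
  have "shifted (cnj z) r v = 0" for v
  proof -
    have "(\<lambda>n. shifted (cnj z) (\<lambda>w. shifted z (F n) w - d w) v) \<longlonglongrightarrow> shifted (cnj z) r v"
      unfolding r_def by (intro sh_lim tendsto_intros lim)
    then have "(\<lambda>n. e n v) \<longlonglongrightarrow> - of_real \<eta> * shifted (cnj z) r v"
      unfolding e_eq by (intro tendsto_intros)
    moreover have "(\<lambda>n. e n v) \<longlonglongrightarrow> 0" by (rule summable_LIMSEQ_zero[OF e_sum])
    ultimately have "- of_real \<eta> * shifted (cnj z) r v = 0" using LIMSEQ_unique by blast
    then show ?thesis using \<eta>0 by simp
  qed
  then have "r v = 0" for v
    using shifted_zero[of r "cnj z" v] z f_ss d unfolding r_def by (auto intro: square_summable_diff shifted_l2)
  then show ?thesis using that[of f] f_ss lim by (simp add: r_def F_def)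
qed

section \<open>Powers of the kernel, finite expansion and remainder\<close>

lemma iter_lin: "(ap ^^ k) (\<lambda>v. a * f v + b * g v) = (\<lambda>v. a * (ap ^^ k) f v + b * (ap ^^ k) g v)"
  by (induction k) (auto simp: ap_lin)

lemma iter_l2: "square_summable f \<Longrightarrow> square_summable ((ap ^^ k) f)"
  by (induction k) (auto intro: ap_l2)

lemma iter_symmetric:
  "square_summable f \<Longrightarrow> square_summable g \<Longrightarrow> l2_ip ((ap ^^ k) f) g = l2_ip f ((ap ^^ k) g)"
proof (induction k arbitrary: g)
  case (Suc k)
  have "l2_ip ((ap ^^ Suc k) f) g = l2_ip ((ap ^^ k) f) (ap g)"
    using ap_symmetric[OF iter_l2[OF Suc.prems(1)] Suc.prems(2)] by simp
  also have "\<dots> = l2_ip f ((ap ^^ k) (ap g))" by (rule Suc.IH[OF Suc.prems(1) ap_l2(1)[OF Suc.prems(2)]])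
  finally show ?case by (simp add: funpow_swap1)
qed simp

text \<open>An exact finite identity for any solution \<open>f\<close>. No series has to converge,
  which matters because |z| may be smaller than the norm of the kernel.\<close>

lemma neumann_expansion:
  assumes "\<And>v. shifted z f v = d v" "z \<noteq> 0"
  shows "f v = (\<Sum>k<K. (ap ^^ k) d v / z ^ Suc k) + (ap ^^ K) f v / z ^ K"
proof (induction K)
  case (Suc K)
  have "f = (\<lambda>v. (1 / z) * d v + (1 / z) * ap f v)"
    using assms by (auto simp: shifted_def field_simps)
  then have "(ap ^^ K) f v = (1 / z) * (ap ^^ K) d v + (1 / z) * (ap ^^ K) (ap f) v"
    using iter_lin[of K "1 / z" d "1 / z" "ap f"] by metis
  then show ?case using Suc assms(2) by (simp add: funpow_swap1 field_simps)
qed simp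

lemma iter_delta_even:
  fixes i :: 'v
  defines "d \<equiv> (\<lambda>v. if v = i then 1 else 0 :: complex)"
  shows "(ap ^^ (2 * j)) d i = of_real (l2_sq ((ap ^^ j) d))"
proof -
  have d: "square_summable d" by (rule square_summable_finite_support[of "{i}"]) (auto simp: d_def)
  have pt: "l2_ip g d = g i" for g :: "'v \<Rightarrow> complex"
    using l2_ip_finite_support[of "{i}" d g] by (auto simp: d_def)
  have "(ap ^^ (2 * j)) d = (ap ^^ j) ((ap ^^ j) d)" by (simp add: mult_2 funpow_add)
  then have "(ap ^^ (2 * j)) d i = l2_ip ((ap ^^ j) ((ap ^^ j) d)) d" by (simp add: pt)
  also have "\<dots> = of_real (l2_sq ((ap ^^ j) d))"
    using iter_symmetric[OF iter_l2[OF d] d] l2_ip_self[OF iter_l2[OF d]] by simp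
  finally show ?thesis .
qed

text \<open>Half of the powers is moved across the inner product. As t^j f solves the equation with
  right-hand side t^j d, the energy bound controls it by t^j d, whose squared norm is an even
  moment. This is why expansions are cut at an even order.\<close>

lemma resolvent_remainder:
  fixes i :: 'v
  defines "d \<equiv> (\<lambda>v. if v = i then 1 else 0 :: complex)"
  assumes f: "square_summable f" and eq: "\<And>v. shifted z f v = d v" and z: "Im z > 0"
  shows "cmod ((ap ^^ (2 * j)) f i) \<le> Re ((ap ^^ (2 * j)) d i) / Im z"
proof -
  have d: "square_summable d" by (rule square_summable_finite_support[of "{i}"]) (auto simp: d_def)
  have pt: "l2_ip g d = g i" for g :: "'v \<Rightarrow> complex"
    using l2_ip_finite_support[of "{i}" d g] by (auto simp: d_def)
  have sh: "shifted z ((ap ^^ j) f) = (ap ^^ j) d"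
  proof -
    have "(ap ^^ j) (\<lambda>v. z * f v + (-1) * ap f v) = (\<lambda>v. z * (ap ^^ j) f v + (-1) * (ap ^^ j) (ap f) v)"
      by (rule iter_lin)
    moreover have "(\<lambda>v. z * f v + (-1) * ap f v) = d" using eq by (auto simp: shifted_def)
    ultimately show ?thesis by (auto simp: shifted_def funpow_swap1)
  qed
  have "(ap ^^ (2 * j)) f = (ap ^^ j) ((ap ^^ j) f)" by (simp add: mult_2 funpow_add)
  then have "(ap ^^ (2 * j)) f i = l2_ip ((ap ^^ j) f) ((ap ^^ j) d)"
    using iter_symmetric[OF iter_l2[OF f] d] by (simp add: pt[symmetric])
  then have "cmod ((ap ^^ (2 * j)) f i) \<le> sqrt (l2_sq ((ap ^^ j) f)) * sqrt (l2_sq ((ap ^^ j) d))"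
    using l2_Cauchy_Schwarz[OF iter_l2[OF f] iter_l2[OF d]] by simp
  also have "sqrt (l2_sq ((ap ^^ j) f)) \<le> sqrt (l2_sq ((ap ^^ j) d)) / Im z"
    using energy_bound[OF iter_l2[OF f], of z j] z unfolding sh by (simp add: field_simps)
  also have "sqrt (l2_sq ((ap ^^ j) d)) / Im z * sqrt (l2_sq ((ap ^^ j) d)) = Re ((ap ^^ (2 * j)) d i) / Im z"
    using iter_delta_even[of j i] by (simp add: d_def)
  finally show ?thesis by (simp add: mult_right_mono)
qed

lemma resolvent_entry_bound:
  fixes i :: 'v
  assumes f: "square_summable f" and eq: "\<And>v. shifted z f v = (if v = i then 1 else 0)" and z: "Im z > 0"
  shows "cmod (f i) \<le> 1 / Im z"
  using resolvent_remainder[OF f eq z, of 0] by simp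

end

section \<open>Walks that do not close up\<close>

text \<open>A stack is a tree vertex seen from the start \<open>i\<close> instead of the root, with
  the latest letter at the head; the empty stack is the start itself. The index type is arbitrary,
  so the classes of a coincidence pattern can serve as indices.\<close>

definition stack_index :: "'v \<Rightarrow> (sym \<times> 'v) list \<Rightarrow> 'v" where
  "stack_index i \<sigma> = (if \<sigma> = [] then i else snd (hd \<sigma>))"

text \<open>The vertex at which the s-block of the stack is attached: a top letter s means that the
  stack is a proper member of that block.\<close>

definition stack_base :: "sym \<Rightarrow> (sym \<times> 'v) list \<Rightarrow> (sym \<times> 'v) list" where
  "stack_base s \<sigma> = (if \<sigma> \<noteq> [] \<and> fst (hd \<sigma>) = s then tl \<sigma> else \<sigma>)"

definition stack_step :: "'v \<Rightarrow> (sym \<times> 'v) list \<Rightarrow> sym \<times> 'v \<Rightarrow> (sym \<times> 'v) list" where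
  "stack_step i \<sigma> sc = (let u = stack_base (fst sc) \<sigma> in if snd sc = stack_index i u then u else sc # u)"

text \<open>The reduced path from the starting vertex to the end of the lift of a walk, most recent
  step first.\<close>

definition stack_run :: "'v \<Rightarrow> (sym \<times> 'v) list \<Rightarrow> (sym \<times> 'v) list" where
  "stack_run i p = foldl (stack_step i) [] p"

fun stack_reduced :: "'v \<Rightarrow> (sym \<times> 'v) list \<Rightarrow> bool" where
  "stack_reduced i [] \<longleftrightarrow> True"
| "stack_reduced i ((s, c) # \<sigma>) \<longleftrightarrow>
     stack_reduced i \<sigma> \<and> c \<noteq> stack_index i \<sigma> \<and> (\<sigma> \<noteq> [] \<longrightarrow> fst (hd \<sigma>) \<noteq> s)"

definition walk_end :: "'v \<Rightarrow> (sym \<times> 'v) list \<Rightarrow> 'v" where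
  "walk_end i p = (if p = [] then i else snd (last p))"

abbreviation walk_vertices :: "'v \<Rightarrow> (sym \<times> 'v) list \<Rightarrow> 'v set" where
  "walk_vertices i p \<equiv> insert i (snd ` set p)"

lemma stack_base_idem: "stack_reduced i \<sigma> \<Longrightarrow> stack_base s (stack_base s \<sigma>) = stack_base s \<sigma>"
  by (cases \<sigma>) (auto simp: stack_base_def)

lemma stack_reduced_step: "stack_reduced i \<sigma> \<Longrightarrow> stack_reduced i (stack_step i \<sigma> sc)"
  by (cases \<sigma>; cases sc; cases "tl \<sigma>") (auto simp: stack_step_def stack_base_def Let_def)

lemma stack_index_step: "stack_index i (stack_step i \<sigma> sc) = snd sc"
  by (auto simp: stack_step_def Let_def stack_index_def)

lemma stack_base_step:
  assumes "stack_reduced i \<sigma>"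
  shows "stack_base s (stack_step i \<sigma> (s, c)) = stack_base s \<sigma>"
  using stack_base_idem[OF assms, of s] by (auto simp: stack_step_def Let_def) (auto simp: stack_base_def)

text \<open>Inside a block a vertex is determined by its index.\<close>

lemma stack_step_unique:
  assumes "stack_reduced i \<tau>" "stack_base s \<sigma> = stack_base s \<tau>"
  shows "stack_step i \<sigma> (s, stack_index i \<tau>) = \<tau>"
  using assms
  by (cases \<tau>) (auto simp: stack_step_def Let_def stack_base_def stack_index_def split: if_splits)

lemma stack_run_snoc: "stack_run i (p @ [sc]) = stack_step i (stack_run i p) sc"
  by (simp add: stack_run_def)

lemma stack_reduced_run: "stack_reduced i (stack_run i p)"
  by (induction p rule: rev_induct) (auto simp: stack_run_snoc stack_reduced_step stack_run_def[of i "[]"])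

lemma walk_end_in: "walk_end i p \<in> walk_vertices i p"
  by (auto simp: walk_end_def)

section \<open>Label classes met along a walk\<close>

fun label_compatible :: "(sym \<Rightarrow> 'v \<Rightarrow> 'l) \<Rightarrow> 'v \<Rightarrow> (sym \<times> 'v) list \<Rightarrow> bool" where
  "label_compatible lab u [] \<longleftrightarrow> True"
| "label_compatible lab u ((s, c) # p) \<longleftrightarrow> lab s u = lab s c \<and> label_compatible lab c p"

lemma label_compatible_append:
  "label_compatible lab u (p @ q) \<longleftrightarrow> label_compatible lab u p \<and> label_compatible lab (walk_end u p) q"
  by (induction lab u p rule: label_compatible.induct) (auto simp: walk_end_def)

lemma label_compatible_nth:
  "label_compatible lab u r \<longleftrightarrow>
    (\<forall>l<length r. lab (fst (r ! l)) (if l = 0 then u else snd (r ! (l - 1))) = lab (fst (r ! l)) (snd (r ! l)))"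
proof (induction lab u r rule: label_compatible.induct)
  case (2 lab u s c p)
  show ?case unfolding label_compatible.simps 2 length_Cons All_less_Suc2
    by (auto simp: nth_Cons' split: if_splits)
qed auto

definition label_count :: "(sym \<Rightarrow> 'v \<Rightarrow> 'l) \<Rightarrow> 'v set \<Rightarrow> nat" where
  "label_count lab V = card (lab SymA ` V) + card (lab SymB ` V)"

text \<open>A vertex reached from \<open>u\<close> by an s-step shares the s-label of
  \<open>u\<close>, so if it is new it can create a class for the other letter only.\<close>

lemma label_count_insert:
  assumes "finite V" "u \<in> V" "lab s u = lab s c"
  shows "label_count lab (insert c V) + card V \<le> label_count lab V + card (insert c V)"
proof (cases "c \<in> V")
  case False
  have "lab s c \<in> lab s ` V" using assms by (metis imageI)
  then have "lab s ` insert c V = lab s ` V" by auto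
  moreover have "card (lab t ` insert c V) \<le> Suc (card (lab t ` V))" for t
    using assms(1) by (simp add: card_insert_if)
  ultimately show ?thesis using assms(1) False
    by (cases s) (auto simp: label_count_def)
qed (simp add: insert_absorb)

lemma label_count_append:
  assumes "label_compatible lab i (p @ q)"
  shows "label_count lab (walk_vertices i (p @ q)) + card (walk_vertices i p)
       \<le> label_count lab (walk_vertices i p) + card (walk_vertices i (p @ q))"
  using assms
proof (induction q rule: rev_induct)
  case (snoc sc q)
  obtain s c where sc: "sc = (s, c)" by (cases sc)
  have c: "label_compatible lab i (p @ q)" "lab s (walk_end i (p @ q)) = lab s c"
    using snoc.prems label_compatible_append[of lab i "p @ q" "[sc]"] by (auto simp: sc)
  have "walk_vertices i (p @ q @ [sc]) = insert c (walk_vertices i (p @ q))"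
    by (auto simp: sc)
  then show ?case
    using snoc.IH[OF c(1)] label_count_insert[where lab = lab and s = s and c = c, OF _ walk_end_in[of i "p @ q"] c(2)]
    by simp
qed simp

text \<open>The start has one label for each letter, and every further vertex adds at most one. In
  other words, the bipartite graph joining each vertex to its two label classes is connected, and
  equality means that it is a tree.\<close>

lemma walk_label_count:
  assumes "label_compatible lab i p"
  shows "label_count lab (walk_vertices i p) \<le> card (walk_vertices i p) + 1"
  using label_count_append[of lab i "[]" p] assms by (simp add: label_count_def)

text \<open>If equality holds in the label count, each newly visited vertex starts a new label class,
  so that the lift factors through the visited vertices.\<close>

lemma tight_label_count_lift:
  assumes "label_compatible lab i p"
    and "card (walk_vertices i p) + 1 \<le> label_count lab (walk_vertices i p)"
  shows "\<exists>\<psi>. \<psi> i = [] \<and> stack_run i p = \<psi> (walk_end i p) \<and>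
     (\<forall>c\<in>walk_vertices i p. stack_reduced i (\<psi> c) \<and> stack_index i (\<psi> c) = c) \<and>
     (\<forall>s. \<forall>c\<in>walk_vertices i p. \<forall>c'\<in>walk_vertices i p. lab s c = lab s c' \<longrightarrow>
        stack_base s (\<psi> c) = stack_base s (\<psi> c'))"
  using assms
proof (induction p rule: rev_induct)
  case Nil
  show ?case by (rule exI[of _ "\<lambda>_. []"]) (auto simp: stack_run_def stack_index_def)
next
  case (snoc sc p)
  obtain s c where sc: "sc = (s, c)" by (cases sc)
  define V where "V = walk_vertices i p"
  define u where "u = walk_end i p"
  have finV: "finite V" and uV: "u \<in> V" and iV: "i \<in> V" using walk_end_in[of i p] by (auto simp: V_def u_def)
  have V': "walk_vertices i (p @ [sc]) = insert c V" by (auto simp: sc V_def)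
  have c: "label_compatible lab i p" "lab s u = lab s c"
    using snoc.prems label_compatible_append[of lab i p "[sc]"] by (auto simp: sc u_def)
  have tight': "card (insert c V) + 1 \<le> label_count lab (insert c V)"
    using snoc.prems(2) by (simp only: V')
  have le: "label_count lab V \<le> card V + 1" using walk_label_count[OF c(1)] by (simp add: V_def)
  have tight: "card V + 1 \<le> label_count lab V"
    using label_count_insert[where lab = lab and s = s and c = c, OF finV uV c(2)] tight' by linarith
  have "\<exists>\<psi>. \<psi> i = [] \<and> stack_run i p = \<psi> u \<and>
     (\<forall>c\<in>V. stack_reduced i (\<psi> c) \<and> stack_index i (\<psi> c) = c) \<and>
     (\<forall>s. \<forall>c\<in>V. \<forall>c'\<in>V. lab s c = lab s c' \<longrightarrow> stack_base s (\<psi> c) = stack_base s (\<psi> c'))"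
    using snoc.IH[OF c(1) tight[unfolded V_def]] unfolding V_def u_def .
  then obtain \<psi> where \<psi>0: "\<psi> i = [] \<and> stack_run i p = \<psi> u \<and>
     (\<forall>c\<in>V. stack_reduced i (\<psi> c) \<and> stack_index i (\<psi> c) = c) \<and>
     (\<forall>s. \<forall>c\<in>V. \<forall>c'\<in>V. lab s c = lab s c' \<longrightarrow> stack_base s (\<psi> c) = stack_base s (\<psi> c'))" ..
  have \<psi>: "\<psi> i = []" "stack_run i p = \<psi> u"
    "\<And>c. c \<in> V \<Longrightarrow> stack_reduced i (\<psi> c)" "\<And>c. c \<in> V \<Longrightarrow> stack_index i (\<psi> c) = c"
    using \<psi>0[THEN conjunct1] \<psi>0[THEN conjunct2, THEN conjunct1]
      \<psi>0[THEN conjunct2, THEN conjunct2, THEN conjunct1] by auto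
  have \<psi>5: "stack_base s (\<psi> c) = stack_base s (\<psi> c')"
    if "c \<in> V" "c' \<in> V" "lab s c = lab s c'" for s c c'
    by (rule \<psi>0[THEN conjunct2, THEN conjunct2, THEN conjunct2, rule_format, OF that])
  have end': "walk_end i (p @ [sc]) = c" by (simp add: walk_end_def sc)
  show ?case
  proof (cases "c \<in> V")
    case True
    \<comment> \<open>A return to a visited vertex of the same s-class: its lift has the same
      s-base, and within a block the index decides.\<close>
    have "stack_base s (\<psi> u) = stack_base s (\<psi> c)" by (rule \<psi>5[OF uV True c(2)])
    from stack_step_unique[OF \<psi>(3)[OF True] this]
    have run: "stack_run i (p @ [sc]) = \<psi> c"
      by (simp add: stack_run_snoc \<psi>(2) sc \<psi>(4)[OF True])
    have cV: "insert c V = V" using True by auto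
    show ?thesis unfolding V' end' cV
      by (intro exI[of _ \<psi>] conjI \<psi>(1) run \<psi>0[THEN conjunct2, THEN conjunct2, THEN conjunct1]
          \<psi>0[THEN conjunct2, THEN conjunct2, THEN conjunct2])
  next
    case False
    \<comment> \<open>A new vertex is lifted by the step that reaches it. The only old class it
      belongs to is its s-class, and the step keeps the s-base.\<close>
    define \<psi>' where "\<psi>' = \<psi>(c := stack_step i (\<psi> u) (s, c))"
    have same: "lab s ` insert c V = lab s ` V" using c(2) uV by (metis image_insert imageI insert_absorb)
    \<comment> \<open>An old label for the other letter would leave the label count unchanged while
      the vertex count grows, against equality.\<close>
    have new: "lab t c \<notin> lab t ` V" if "t \<noteq> s" for t
    proof
      assume "lab t c \<in> lab t ` V"
      then have "lab t ` insert c V = lab t ` V" by auto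
      with same that have "label_count lab (insert c V) = label_count lab V"
        by (cases s; cases t) (auto simp: label_count_def)
      then show False using tight' le finV False by simp
    qed
    have \<psi>'V: "\<psi>' x = \<psi> x" if "x \<in> V" for x using that False by (auto simp: \<psi>'_def)
    have \<psi>'c: "\<psi>' c = stack_step i (\<psi> u) (s, c)" by (simp add: \<psi>'_def)
    have base_c: "stack_base t (\<psi>' c) = stack_base t (\<psi>' x)" if x: "x \<in> V" "lab t c = lab t x" for x t
    proof -
      have "t = s" using new[of t] x by (metis imageI)
      then have "stack_base t (\<psi>' c) = stack_base s (\<psi> u)"
        using stack_base_step[OF \<psi>(3)[OF uV]] by (simp add: \<psi>'c)
      also have "\<dots> = stack_base s (\<psi> x)" using \<psi>5[OF uV x(1), of s] c(2) x(2) \<open>t = s\<close> by simp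
      finally show ?thesis using \<psi>'V[OF x(1)] \<open>t = s\<close> by simp
    qed
    show ?thesis unfolding V' end'
    proof (intro exI[of _ \<psi>'] conjI allI ballI impI)
      show "\<psi>' i = []" using \<psi>'V[OF iV] \<psi>(1) by simp
      show "stack_run i (p @ [sc]) = \<psi>' c" by (simp add: stack_run_snoc \<psi>(2) sc \<psi>'c)
    next
      fix x assume "x \<in> insert c V"
      then show "stack_reduced i (\<psi>' x)" "stack_index i (\<psi>' x) = x"
        using \<psi>(3)[of x] \<psi>(4)[of x] \<psi>'V[of x] \<psi>'c stack_reduced_step[OF \<psi>(3)[OF uV], of "(s, c)"]
          stack_index_step[of i "\<psi> u" "(s, c)"]
        by (cases "x = c"; simp)+
    next
      fix t x y assume xy: "x \<in> insert c V" "y \<in> insert c V" "lab t x = lab t y"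
      show "stack_base t (\<psi>' x) = stack_base t (\<psi>' y)"
      proof (cases "x = c")
        case True
        then show ?thesis using base_c[of y t] xy by (cases "y = c") auto
      next
        case xc: False
        show ?thesis
        proof (cases "y = c")
          case True
          then show ?thesis using base_c[of x t] xy xc by auto
        next
          case False
          then show ?thesis using xc xy \<psi>5[of x y t] \<psi>'V by simp
        qed
      qed
    qed
  qed
qed

text \<open>Equality for the whole walk would pass to its initial part \<open>p\<close>, whose lift
  would then end at the lift of \<open>i\<close>, the empty stack.\<close>

lemma nonclosed_label_count:
  assumes "label_compatible lab i (p @ q)" "walk_end i p = i" "stack_run i p \<noteq> []"
  shows "label_count lab (walk_vertices i (p @ q)) \<le> card (walk_vertices i (p @ q))"
proof (rule ccontr)
  assume "\<not> ?thesis"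
  then have tight: "card (walk_vertices i p) + 1 \<le> label_count lab (walk_vertices i p)"
    using label_count_append[OF assms(1)] by linarith
  have "label_compatible lab i p" using assms(1) by (simp add: label_compatible_append)
  from tight_label_count_lift[OF this tight] show False
    using assms(2,3) by (elim exE conjE) simp
qed

text \<open>Steps only test indices for equality, so the lift commutes with injective relabelling.
  Non-closing is thus a property of the coincidence pattern.\<close>

lemma stack_run_map:
  assumes "inj_on \<phi> (walk_vertices i p)"
  shows "stack_run (\<phi> i) (map (map_prod id \<phi>) p) = map (map_prod id \<phi>) (stack_run i p)"
    and "snd ` set (stack_run i p) \<subseteq> snd ` set p"
proof -
  have base: "stack_base s (map (map_prod id \<phi>) \<sigma>) = map (map_prod id \<phi>) (stack_base s \<sigma>)" for s \<sigma>
    by (cases \<sigma>) (auto simp: stack_base_def)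
  have index: "stack_index (\<phi> i) (map (map_prod id \<phi>) \<sigma>) = \<phi> (stack_index i \<sigma>)" for \<sigma>
    by (cases \<sigma>) (auto simp: stack_index_def)
  have "stack_run (\<phi> i) (map (map_prod id \<phi>) p) = map (map_prod id \<phi>) (stack_run i p) \<and>
    snd ` set (stack_run i p) \<subseteq> snd ` set p"
    using assms
  proof (induction p rule: rev_induct)
    case (snoc sc p)
    obtain s c where sc: "sc = (s, c)" by (cases sc)
    have "inj_on \<phi> (walk_vertices i p)" using snoc.prems by (rule inj_on_subset) auto
    note IH = snoc.IH[OF this]
    define u where "u = stack_base s (stack_run i p)"
    have sub: "snd ` set u \<subseteq> snd ` set p"
      using IH unfolding u_def stack_base_def by (auto dest: list.set_sel(2))
    have "stack_index i u \<in> walk_vertices i p"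
      using sub by (cases u) (auto simp: stack_index_def)
    then have e1: "\<phi> c = \<phi> (stack_index i u) \<longleftrightarrow> c = stack_index i u"
      using inj_on_eq_iff[OF snoc.prems, of c "stack_index i u"] by (auto simp: sc)
    have e2: "stack_run i (p @ [sc]) = (if c = stack_index i u then u else sc # u)"
      by (simp add: stack_run_snoc stack_step_def u_def sc Let_def)
    have e3: "stack_run (\<phi> i) (map (map_prod id \<phi>) (p @ [sc]))
       = (if \<phi> c = \<phi> (stack_index i u) then map (map_prod id \<phi>) u else (s, \<phi> c) # map (map_prod id \<phi>) u)"
      unfolding map_append list.map stack_run_snoc conjunct1[OF IH] stack_step_def base index Let_def
      by (simp add: sc u_def base index)
    show ?case unfolding e3 e2 using e1 sub by (cases "c = stack_index i u") (auto simp: sc)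
  qed (simp add: stack_run_def)
  then show "stack_run (\<phi> i) (map (map_prod id \<phi>) p) = map (map_prod id \<phi>) (stack_run i p)"
    "snd ` set (stack_run i p) \<subseteq> snd ` set p" by auto
qed

text \<open>Step l of a closed walk runs from position l - 1 to position l, cyclically, so the start
  of the walk sits at position n - 1.\<close>

definition cyclic_pred :: "nat \<Rightarrow> nat \<Rightarrow> nat" where
  "cyclic_pred n l = (if l = 0 then n - 1 else l - 1)"

lemma bij_cyclic_pred: "bij_betw (cyclic_pred n) {..<n} {..<n}"
proof (rule bij_betwI[where g = "\<lambda>l. if l = n - 1 then 0 else Suc l"])
qed (auto simp: cyclic_pred_def)

text \<open>Here a power of N is gained. Without odd vertices the trails are as many as the label
  classes, at most |V| because the first k steps do not close. Otherwise both letters have the same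
  odd vertices, as total degrees of a closed walk are even; identifying these keeps all labels, and
  \<open>walk_label_count\<close> on the smaller vertex set gives the same bound.\<close>

lemma trails_count_nonclosed:
  fixes f :: "nat \<Rightarrow> 'v" and ls :: "nat \<Rightarrow> sym" and n :: nat
  defines "E s \<equiv> {l. l < n \<and> ls l = s}"
    and "r \<equiv> map (\<lambda>l. (ls l, f l)) [0..<n]"
  assumes A: "minimal_trails (f \<circ> cyclic_pred n) f V (E SymA) QA"
    and B: "minimal_trails (f \<circ> cyclic_pred n) f V (E SymB) QB"
    and V: "V = f ` {..<n}"
    and k: "0 < k" "k \<le> n" "f (k - 1) = f (n - 1)"
    and nonclosed: "stack_run (f (n - 1)) (take k r) \<noteq> []"
  shows "size QA + size QB \<le> card V"
proof -
  interpret A: minimal_trails "f \<circ> cyclic_pred n" f V "E SymA" QA by (rule A)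
  interpret B: minimal_trails "f \<circ> cyclic_pred n" f V "E SymB" QB by (rule B)
  define i where "i = f (n - 1)"
  define lab where "lab s = (if s = SymA then A.label else B.label)" for s
  have n0: "0 < n" using k by auto
  have finV: "finite V" by (simp add: V)
  have len: "length r = n" by (simp add: r_def)
  have verts: "walk_vertices i r = V"
    using n0 by (auto simp: V r_def i_def image_image)
  have lab_step: "lab (ls l) (f (cyclic_pred n l)) = lab (ls l) (f l)" if "l < n" for l
  proof (cases "ls l")
    case SymA
    then show ?thesis using A.label_edge[of l] that by (simp add: lab_def E_def)
  next
    case SymB
    then show ?thesis using B.label_edge[of l] that by (simp add: lab_def E_def)
  qed
  have deg: "even (A.degree x + B.degree x)" for x
  proof -
    let ?g = "\<lambda>l. of_bool (f (cyclic_pred n l) = x) + of_bool (f l = x) :: nat"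
    have "A.degree x + B.degree x = sum ?g (E SymA) + sum ?g (E SymB)"
      by (simp add: A.degree_def B.degree_def)
    also have "\<dots> = sum ?g (E SymA \<union> E SymB)"
      by (rule sum.union_disjoint[symmetric]) (auto simp: E_def)
    also have "E SymA \<union> E SymB = {..<n}" using sym.exhaust by (auto simp: E_def)
    also have "sum ?g {..<n} = (\<Sum>l<n. of_bool (f (cyclic_pred n l) = x)) + (\<Sum>l<n. of_bool (f l = x))"
      by (rule sum.distrib)
    also have "(\<Sum>l<n. of_bool (f (cyclic_pred n l) = x)) = (\<Sum>l<n. of_bool (f l = x))"
      by (rule sum.reindex_bij_betw[OF bij_cyclic_pred])
    finally have eq: "A.degree x + B.degree x = (\<Sum>l<n. of_bool (f l = x)) + (\<Sum>l<n. of_bool (f l = x))" .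
    show ?thesis unfolding eq by simp
  qed
  have odd_eq: "A.odd_vertices = B.odd_vertices"
    unfolding A.odd_vertices_def B.odd_vertices_def using deg by auto
  define O' where "O' = B.odd_vertices"
  have O': "O' \<subseteq> V" by (auto simp: O'_def B.odd_vertices_def)
  \<comment> \<open>The 4 is 2 for each letter, since the odd set is nonempty for both letters at
    once.\<close>
  have cards: "2 * label_count lab V + 2 * card O'
      = 2 * (size QA + size QB) + (if O' = {} then 0 else 4)"
    using A.card_labels B.card_labels unfolding O'_def odd_eq
    by (cases "B.odd_vertices = {}") (simp_all add: label_count_def lab_def)
  \<comment> \<open>Stated for a relabelling \<open>\<kappa>\<close> so that it covers the walk
    itself and its image after the odd vertices are identified.\<close>
  have comp: "label_compatible lab u r'"
    if "u = \<kappa> i" "r' = map (map_prod id \<kappa>) r" "\<And>s x. lab s (\<kappa> x) = lab s x" for \<kappa> u r'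
    unfolding label_compatible_nth
  proof (intro allI impI)
    fix l assume "l < length r'"
    then have l: "l < n" using len that by simp
    have rl: "r' ! j = (ls j, \<kappa> (f j))" if "j < n" for j
      using that \<open>r' = map (map_prod id \<kappa>) r\<close> by (simp add: r_def)
    have "(if l = 0 then u else snd (r' ! (l - 1))) = \<kappa> (f (cyclic_pred n l))"
      using l rl[of "l - 1"] that(1) by (auto simp: cyclic_pred_def i_def)
    then show "lab (fst (r' ! l)) (if l = 0 then u else snd (r' ! (l - 1))) = lab (fst (r' ! l)) (snd (r' ! l))"
      using lab_step[OF l] rl[OF l] that(3) by simp
  qed
  show ?thesis
  proof (cases "O' = {}")
    case True
    have lc: "label_compatible lab i (take k r @ drop k r)"
      by (rule comp[of i id]) (auto intro!: map_idI[symmetric])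
    have "walk_end i (take k r) = i"
    proof -
      have "take k r \<noteq> []" "last (take k r) = r ! (k - 1)"
        using k len by auto (subst last_conv_nth, auto simp: min_def)
      then show ?thesis using k by (auto simp: walk_end_def r_def i_def)
    qed
    from nonclosed_label_count[OF lc this nonclosed[folded i_def]]
    have "label_count lab V \<le> card V" by (simp add: verts)
    then show ?thesis using cards True by simp
  next
    case False
    then obtain o' where o': "o' \<in> O'" by auto
    \<comment> \<open>All odd vertices are collapsed to \<open>o'\<close>. They share the label
      \<open>None\<close> for both letters, so the walk stays compatible while |O'| - 1 vertices
      disappear.\<close>
    define \<kappa> where "\<kappa> x = (if x \<in> O' then o' else x)" for x
    have labO: "lab s x = None" if "x \<in> O'" for s x
      using that A.label_odd B.label_odd odd_eq by (auto simp: lab_def O'_def)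
    have lab\<kappa>: "lab s (\<kappa> x) = lab s x" for s x
      using labO o' by (simp add: \<kappa>_def)
    have vk: "walk_vertices (\<kappa> i) (map (map_prod id \<kappa>) r) = \<kappa> ` V"
      using verts by (auto simp: image_image)
    have "label_compatible lab (\<kappa> i) (map (map_prod id \<kappa>) r)"
      by (rule comp[where \<kappa> = \<kappa>]) (auto simp: lab\<kappa>)
    from walk_label_count[OF this] have "label_count lab (\<kappa> ` V) \<le> card (\<kappa> ` V) + 1"
      unfolding vk .
    moreover have "label_count lab (\<kappa> ` V) = label_count lab V"
      by (simp add: label_count_def image_image lab\<kappa>)
    moreover have "card (\<kappa> ` V) + card O' = card V + 1"
    proof -
      have "\<kappa> ` V = insert o' (V - O')" using o' O' by (auto simp: \<kappa>_def)
      then have "card (\<kappa> ` V) = Suc (card (V - O'))" using finV o' by simp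
      then show ?thesis
        using card_Diff_subset[OF finite_subset[OF O' finV] O'] card_mono[OF finV O'] by simp
    qed
    ultimately show ?thesis using cards False by simp
  qed
qed

section \<open>Walks on the vertex tree\<close>

text \<open>The base of the s-block containing the vertex: an s-word hangs below the word without
  its last index, which carries the other letter, and any other vertex opens its own
  s-block.\<close>

fun vertex_base :: "sym \<Rightarrow> vertex \<Rightarrow> vertex" where
  "vertex_base s Root = Root"
| "vertex_base s (Word js s') =
     (if s' = s then (if length js \<le> 1 then Root else Word (butlast js) (other_sym s)) else Word js s')"

definition vertex_step :: "nat \<Rightarrow> vertex \<Rightarrow> sym \<times> nat \<Rightarrow> vertex" where
  "vertex_step x v sk = (let u = vertex_base (fst sk) v in
     if snd sk = last_index x u then u else extend u (snd sk) (fst sk))"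

lemma Root_in_vertices [simp]: "Root \<in> vertices N x"
  by (auto simp: vertices_def level_def)

lemma Word_in_vertices [simp]:
  "Word js s \<in> vertices N x \<longleftrightarrow> js \<noteq> [] \<and> set js \<subseteq> {..<N} \<and> distinct_adj (x # js)"
  by (auto simp: vertices_def level_def split: if_splits)

lemma distinct_adj_Cons_snoc:
  "js \<noteq> [] \<Longrightarrow> distinct_adj (x # js @ [k]) \<longleftrightarrow> distinct_adj (x # js) \<and> last js \<noteq> k"
  using distinct_adj_append_iff[of "x # js" "[k]"] by simp

lemma snoc_cases: obtains "js = []" | j where "js = [j]" | js' j where "js = js' @ [j]" "js' \<noteq> []"
  by (cases js rule: rev_cases) auto

lemma last_index_less: "v \<in> vertices N x \<Longrightarrow> x < N \<Longrightarrow> last_index x v < N"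
  by (cases v) (auto dest: last_in_set)

lemma other_sym_neq [simp]: "other_sym s \<noteq> s" "s \<noteq> other_sym s"
  by (cases s; simp)+

lemma sym_neq_iff: "s' \<noteq> s \<longleftrightarrow> s' = other_sym s"
  by (cases s; cases s') auto

lemma vertex_base_in: "v \<in> vertices N x \<Longrightarrow> vertex_base s v \<in> vertices N x"
proof (cases v)
  case (Word js s')
  assume "v \<in> vertices N x"
  then show ?thesis
    by (cases js rule: snoc_cases) (auto simp: Word distinct_adj_Cons_snoc)
qed simp

lemma vertex_base_idem: "vertex_base s (vertex_base s v) = vertex_base s v"
  by (cases v) auto

lemma vertex_base_extend:
  assumes "v \<in> vertices N x" "vertex_base s v = v"
  shows "vertex_base s (extend v k s) = v"
  using assms by (cases v) (auto simp: sym_neq_iff split: if_splits)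

lemma last_index_extend [simp]: "last_index x (extend v k s) = k"
  by (cases v) auto

lemma extend_in: "v \<in> vertices N x \<Longrightarrow> k < N \<Longrightarrow> k \<noteq> last_index x v \<Longrightarrow> extend v k s \<in> vertices N x"
  by (cases v) (auto simp: distinct_adj_Cons_snoc)

lemma vertex_step_in: "v \<in> vertices N x \<Longrightarrow> snd sk < N \<Longrightarrow> vertex_step x v sk \<in> vertices N x"
  by (auto simp: vertex_step_def Let_def intro: vertex_base_in extend_in)

lemma last_index_step: "last_index x (vertex_step x v sk) = snd sk"
  by (auto simp: vertex_step_def Let_def)

lemma vertex_base_step:
  "v \<in> vertices N x \<Longrightarrow> vertex_base s (vertex_step x v (s, k)) = vertex_base s v"
  using vertex_base_extend[OF vertex_base_in vertex_base_idem]
  by (auto simp: vertex_step_def Let_def vertex_base_idem)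

lemma vertex_extend_base:
  assumes "v \<in> vertices N x"
  shows "v = vertex_base s v \<or>
    v = extend (vertex_base s v) (last_index x v) s \<and> last_index x v \<noteq> last_index x (vertex_base s v)"
proof (cases v)
  case (Word js s')
  then show ?thesis using assms
    by (cases js rule: snoc_cases) (auto simp: distinct_adj_Cons_snoc)
qed simp

lemma vertex_step_unique:
  assumes "w \<in> vertices N x" "vertex_base s v = vertex_base s w"
  shows "vertex_step x v (s, last_index x w) = w"
  using vertex_extend_base[OF assms(1), of s] assms(2)
  by (auto simp: vertex_step_def Let_def)

lemma vertex_step_base_cong:
  "vertex_base s v = vertex_base s w \<Longrightarrow> vertex_step x v (s, k) = vertex_step x w (s, k)"
  by (simp add: vertex_step_def)

text \<open>Bases of s-blocks are recognised as fixed points of \<open>vertex_base s\<close>, so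
  that lying in a common block becomes equality of bases.\<close>

lemma level_other_iff:
  "(\<exists>n. u \<in> level N x n (other_sym s)) \<longleftrightarrow> u \<in> vertices N x \<and> vertex_base s u = u"
  by (cases u) (auto simp: level_def vertices_def sym_neq_iff split: if_splits)

lemma block_iff:
  assumes u: "u \<in> vertices N x" "vertex_base s u = u"
  shows "v \<in> block N x s u \<longleftrightarrow> v \<in> vertices N x \<and> vertex_base s v = u"
proof
  assume "v \<in> block N x s u"
  then show "v \<in> vertices N x \<and> vertex_base s v = u"
    using u vertex_base_extend[OF u] by (auto simp: block_def intro: extend_in)
next
  assume v: "v \<in> vertices N x \<and> vertex_base s v = u"
  have "last_index x v < N \<or> v = Root"
    using v by (cases v) (auto dest: last_in_set)
  then show "v \<in> block N x s u"
    using vertex_extend_base[of v N x s] v by (auto simp: block_def)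
qed

lemma same_block_iff:
  "same_block N x s v w \<longleftrightarrow> v \<in> vertices N x \<and> w \<in> vertices N x \<and> vertex_base s v = vertex_base s w"
proof
  assume "same_block N x s v w"
  then obtain n u where u: "u \<in> level N x n (other_sym s)" "v \<in> block N x s u" "w \<in> block N x s u"
    by (auto simp: same_block_def)
  then have "u \<in> vertices N x" "vertex_base s u = u" using level_other_iff by blast+
  from block_iff[OF this] u show "v \<in> vertices N x \<and> w \<in> vertices N x \<and> vertex_base s v = vertex_base s w" by auto
next
  assume a: "v \<in> vertices N x \<and> w \<in> vertices N x \<and> vertex_base s v = vertex_base s w"
  define u where "u = vertex_base s v"
  have u: "u \<in> vertices N x" "vertex_base s u = u"
    using a by (auto simp: u_def vertex_base_in vertex_base_idem)
  then obtain n where "u \<in> level N x n (other_sym s)" using level_other_iff by blast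
  moreover have "v \<in> block N x s u" "w \<in> block N x s u" using block_iff[OF u] a by (auto simp: u_def)
  ultimately show "same_block N x s v w" by (auto simp: same_block_def)
qed

section \<open>Lifting index walks to the vertex tree\<close>

definition walks :: "nat \<Rightarrow> nat \<Rightarrow> (sym \<times> nat) list set" where
  "walks N k = {p. set p \<subseteq> UNIV \<times> {..<N} \<and> length p = k}"

lemma UNIV_sym: "(UNIV :: sym set) = {SymA, SymB}"
  using sym.exhaust by auto

lemma finite_walks [simp]: "finite (walks N k)"
  unfolding walks_def by (rule finite_lists_length_eq) (simp add: UNIV_sym)

fun walk_weight :: "(sym \<Rightarrow> nat \<Rightarrow> nat \<Rightarrow> complex) \<Rightarrow> nat \<Rightarrow> (sym \<times> nat) list \<Rightarrow> complex" where
  "walk_weight X i [] = 1"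
| "walk_weight X i ((s, k) # p) = X s k i * walk_weight X k p"

lemma foldl_vertex_in:
  "v \<in> vertices N x \<Longrightarrow> snd ` set p \<subseteq> {..<N} \<Longrightarrow> foldl (vertex_step x) v p \<in> vertices N x"
  by (induction p arbitrary: v) (auto simp: vertex_step_in)

lemma last_index_foldl: "last_index x (foldl (vertex_step x) v p) = walk_end (last_index x v) p"
  by (induction p rule: rev_induct) (auto simp: walk_end_def last_index_step)

lemma foldl_stack_index:
  "last_index x (foldl (vertex_step x) v (rev \<sigma>)) = stack_index (last_index x v) \<sigma>"
  by (cases \<sigma>) (auto simp: stack_index_def last_index_step)

text \<open>Replaying only the reduced path reaches the same vertex: consecutive steps in one block
  merge, and a step to the index of the base cancels its predecessor.\<close>

lemma foldl_vertex_stack: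
  assumes v: "v \<in> vertices N x" and p: "snd ` set p \<subseteq> {..<N}"
  shows "foldl (vertex_step x) v p = foldl (vertex_step x) v (rev (stack_run (last_index x v) p))"
  using p
proof (induction p rule: rev_induct)
  case Nil
  show ?case by (simp add: stack_run_def)
next
  case (snoc sc p)
  obtain s c where sc: "sc = (s, c)" by (cases sc)
  define \<sigma> where "\<sigma> = stack_run (last_index x v) p"
  define L where "L = foldl (vertex_step x) v (rev \<sigma>)"
  have IH: "foldl (vertex_step x) v p = L" using snoc by (simp add: L_def \<sigma>_def)
  have p: "snd ` set p \<subseteq> {..<N}" using snoc.prems by auto
  have \<sigma>N: "snd ` set \<sigma> \<subseteq> {..<N}"
    using stack_run_map(2)[of id "last_index x v" p] p by (auto simp: \<sigma>_def)
  have L_in: "L \<in> vertices N x" unfolding L_def by (rule foldl_vertex_in[OF v]) (use \<sigma>N in auto)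
  have "vertex_step x L (s, c) = foldl (vertex_step x) v (rev (stack_step (last_index x v) \<sigma> (s, c)))"
  proof (cases "\<sigma> \<noteq> [] \<and> fst (hd \<sigma>) = s")
    case True
    then obtain d u where u: "\<sigma> = (s, d) # u" by (cases \<sigma>) auto
    define U where "U = foldl (vertex_step x) v (rev u)"
    have U_in: "U \<in> vertices N x" unfolding U_def by (rule foldl_vertex_in[OF v]) (use \<sigma>N u in auto)
    have LU: "L = vertex_step x U (s, d)" by (simp add: L_def U_def u)
    have base: "vertex_base s L = vertex_base s U" unfolding LU by (rule vertex_base_step[OF U_in])
    have idx: "last_index x U = stack_index (last_index x v) u" unfolding U_def by (rule foldl_stack_index)
    show ?thesis
    proof (cases "c = stack_index (last_index x v) u")
      case True
      then show ?thesis using vertex_step_unique[OF U_in base] idx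
        by (simp add: stack_step_def stack_base_def u U_def)
    next
      case False
      then show ?thesis using vertex_step_base_cong[OF base, of x c]
        by (simp add: stack_step_def stack_base_def u U_def)
    qed
  next
    case False
    then have b: "stack_base s \<sigma> = \<sigma>" by (auto simp: stack_base_def)
    have idx: "last_index x L = stack_index (last_index x v) \<sigma>" unfolding L_def by (rule foldl_stack_index)
    show ?thesis
    proof (cases "c = stack_index (last_index x v) \<sigma>")
      case True
      then show ?thesis using vertex_step_unique[OF L_in refl, of s] idx
        by (simp add: stack_step_def b L_def)
    next
      case False
      then show ?thesis by (simp add: stack_step_def b L_def Let_def)
    qed
  qed
  then show ?case by (simp add: IH stack_run_snoc sc \<sigma>_def)
qed

fun vertex_word :: "vertex \<Rightarrow> nat list" where
  "vertex_word Root = []"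
| "vertex_word (Word js s) = js"

text \<open>In a reduced path letters alternate and consecutive indices differ, so no step goes
  back. The hypothesis on \<open>v\<close> says that the first step, the last entry of the stack,
  opens a block based at \<open>v\<close>.\<close>

lemma foldl_reduced_grows:
  assumes "v = Root \<or> (\<exists>js s'. v = Word js s' \<and> js \<noteq> [] \<and> s' \<noteq> fst (last \<sigma>))"
    and "stack_reduced (last_index x v) \<sigma>" "\<sigma> \<noteq> []"
  shows "foldl (vertex_step x) v (rev \<sigma>) = Word (vertex_word v @ rev (map snd \<sigma>)) (fst (hd \<sigma>))"
  using assms
proof (induction \<sigma>)
  case (Cons sc u)
  obtain s c where sc: "sc = (s, c)" by (cases sc)
  show ?case
  proof (cases "u = []")
    case True
    then have "vertex_base s v = v" "c \<noteq> last_index x v"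
      using Cons.prems by (auto simp: sc stack_index_def)
    then show ?thesis using Cons.prems(1)
      by (cases v) (auto simp: True sc vertex_step_def)
  next
    case False
    have red: "stack_reduced (last_index x v) u" "c \<noteq> stack_index (last_index x v) u" "fst (hd u) \<noteq> s"
      using Cons.prems(2) False by (auto simp: sc)
    define W where "W = vertex_word v @ rev (map snd u)"
    have L: "foldl (vertex_step x) v (rev u) = Word W (fst (hd u))"
      unfolding W_def using Cons.IH Cons.prems(1) red(1) False by auto
    have c: "c \<noteq> last W"
      using red(2) False by (cases u) (auto simp: stack_index_def W_def)
    have "foldl (vertex_step x) v (rev (sc # u)) = vertex_step x (Word W (fst (hd u))) (s, c)"
      by (simp add: sc L)
    also have "\<dots> = Word (W @ [c]) s" using red(3) c by (simp add: vertex_step_def)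
    finally show ?thesis by (simp add: sc W_def)
  qed
qed simp

lemma stack_reduced_snoc:
  "stack_reduced i (\<sigma> @ [(s, c)]) \<Longrightarrow>
     stack_reduced c \<sigma> \<and> c \<noteq> i \<and> (\<sigma> \<noteq> [] \<longrightarrow> fst (last \<sigma>) \<noteq> s)"
proof (induction \<sigma>)
  case (Cons sc u)
  then show ?case by (cases sc; cases u) (auto simp: stack_index_def)
qed (simp add: stack_index_def)

lemma last_index_diag [simp]: "last_index x (diag_vertex x i) = i"
  by (simp add: diag_vertex_def)

lemma diag_in_vertices: "i < N \<Longrightarrow> diag_vertex x i \<in> vertices N x"
  by (auto simp: diag_vertex_def)

text \<open>The delicate case is a start \<open>Word [i] SymA\<close> left by an a-step. It moves
  inside the block of the root, to the root or to a sibling; from there the path grows and cannot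
  return.\<close>

lemma foldl_reduced_neq:
  assumes red: "stack_reduced i \<sigma>" and ne: "\<sigma> \<noteq> []"
  shows "foldl (vertex_step x) (diag_vertex x i) (rev \<sigma>) \<noteq> diag_vertex x i"
proof (cases "i = x \<or> fst (last \<sigma>) \<noteq> SymA")
  case True
  have "foldl (vertex_step x) (diag_vertex x i) (rev \<sigma>)
      = Word (vertex_word (diag_vertex x i) @ rev (map snd \<sigma>)) (fst (hd \<sigma>))"
    by (rule foldl_reduced_grows) (use True red ne in \<open>auto simp: diag_vertex_def\<close>)
  then show ?thesis using ne by (auto simp: diag_vertex_def)
next
  case False
  obtain \<sigma>' c where \<sigma>': "\<sigma> = \<sigma>' @ [(SymA, c)]" using ne False by (cases \<sigma> rule: rev_cases) auto
  have r: "stack_reduced c \<sigma>'" "c \<noteq> i" "\<sigma>' \<noteq> [] \<Longrightarrow> fst (last \<sigma>') \<noteq> SymA"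
    using stack_reduced_snoc[OF red[unfolded \<sigma>']] by auto
  define v where "v = (if c = x then Root else Word [c] SymA)"
  have v: "vertex_step x (diag_vertex x i) (SymA, c) = v"
    using False by (auto simp: v_def diag_vertex_def vertex_step_def)
  have step: "foldl (vertex_step x) (diag_vertex x i) (rev \<sigma>) = foldl (vertex_step x) v (rev \<sigma>')"
    by (simp add: \<sigma>' v)
  show ?thesis
  proof (cases "\<sigma>' = []")
    case True
    then show ?thesis using step r(2) False by (auto simp: v_def diag_vertex_def)
  next
    case ne': False
    have "foldl (vertex_step x) v (rev \<sigma>') = Word (vertex_word v @ rev (map snd \<sigma>')) (fst (hd \<sigma>'))"
      by (rule foldl_reduced_grows) (use r ne' in \<open>auto simp: v_def\<close>)
    moreover have "Word (vertex_word v @ rev (map snd \<sigma>')) (fst (hd \<sigma>')) \<noteq> Word [i] SymA"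
    \<comment> \<open>A word of length one can only arise after a single remaining step, and then it
      carries the letter of that step, which is not \<open>SymA\<close>.\<close>
    proof (cases "length \<sigma>' = 1")
      case True
      then obtain sc where "\<sigma>' = [sc]" by (auto simp: length_Suc_conv)
      then show ?thesis using r(3) by auto
    next
      case False
      then have "length (vertex_word v @ rev (map snd \<sigma>')) \<noteq> length [i]" using ne'
        by (cases \<sigma>') auto
      then show ?thesis by (metis vertex.inject)
    qed
    ultimately show ?thesis using step False by (auto simp: diag_vertex_def)
  qed
qed

text \<open>The right-hand side does not mention \<open>x\<close>: closing is the same question for
  every root.\<close>

lemma lift_closed_iff:
  assumes "i < N" "x < N" "snd ` set p \<subseteq> {..<N}"
  shows "foldl (vertex_step x) (diag_vertex x i) p = diag_vertex x i \<longleftrightarrow> stack_run i p = []"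
  using foldl_vertex_stack[OF diag_in_vertices[OF assms(1)] assms(3)]
    foldl_reduced_neq[OF stack_reduced_run, of i p x] by auto

lemma (in hermitian_kernel) iter_sum:
  assumes "finite J"
  shows "(ap ^^ k) (\<lambda>w. \<Sum>j\<in>J. c j * g j w) = (\<lambda>w. \<Sum>j\<in>J. c j * (ap ^^ k) (g j) w)"
  using assms
proof (induction J)
  case empty
  show ?case using iter_lin[of k 0 "\<lambda>_. 0" 0 "\<lambda>_. 0"] by simp
next
  case (insert j J)
  then show ?case using iter_lin[of k "c j" "g j" 1 "\<lambda>w. \<Sum>j\<in>J. c j * g j w"] by simp
qed

lemma sum_walks_Suc:
  "(\<Sum>p\<in>walks N (Suc k). F p) = (\<Sum>sc\<in>UNIV \<times> {..<N}. \<Sum>p\<in>walks N k. F (sc # p))"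
proof -
  have "(\<Sum>p\<in>walks N (Suc k). F p) = (\<Sum>(sc, p)\<in>(UNIV \<times> {..<N}) \<times> walks N k. F (sc # p))"
    by (rule sum.reindex_bij_witness[of _ "\<lambda>(sc, p). sc # p" "\<lambda>p. (hd p, tl p)"])
      (auto simp: walks_def length_Suc_conv)
  then show ?thesis by (simp add: sum.cartesian_product)
qed

text \<open>Abstract in the states \<open>Q\<close> and the step \<open>st\<close>, so that one
  expansion over labelled walks serves the matrix sum, where states are indices, and the tree, where
  they are vertices.\<close>

lemma (in hermitian_kernel) iter_delta_walks:
  assumes step: "\<And>v w. v \<in> Q \<Longrightarrow> ap (delta v) w = (\<Sum>(s, k)\<in>UNIV \<times> {..<N}. X s k (idx v) * delta (st v (s, k)) w)"
    and Q: "\<And>v s k. v \<in> Q \<Longrightarrow> k < N \<Longrightarrow> st v (s, k) \<in> Q \<and> idx (st v (s, k)) = k"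
    and v: "v \<in> Q"
  shows "(ap ^^ k) (delta v) w = (\<Sum>p\<in>walks N k. walk_weight X (idx v) p * delta (foldl st v p) w)"
  using v
proof (induction k arbitrary: v)
  case 0
  have "walks N 0 = {[]}" by (auto simp: walks_def)
  then show ?case by simp
next
  case (Suc k)
  have fin: "finite (UNIV \<times> {..<N} :: (sym \<times> nat) set)" by (simp add: UNIV_sym)
  have ap1: "ap (delta v) = (\<lambda>w. \<Sum>sc\<in>UNIV \<times> {..<N}. X (fst sc) (snd sc) (idx v) * delta (st v sc) w)"
    using step[OF Suc.prems] by (auto simp: case_prod_unfold)
  have "(ap ^^ Suc k) (delta v) w = (ap ^^ k) (ap (delta v)) w" by (simp add: funpow_swap1)
  also have "\<dots> = (\<Sum>sc\<in>UNIV \<times> {..<N}. X (fst sc) (snd sc) (idx v) * (ap ^^ k) (delta (st v sc)) w)"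
    unfolding ap1 iter_sum[OF fin] ..
  also have "\<dots> = (\<Sum>sc\<in>UNIV \<times> {..<N}. \<Sum>p\<in>walks N k.
      walk_weight X (idx v) (sc # p) * delta (foldl st v (sc # p)) w)"
  proof (rule sum.cong[OF refl])
    fix sc assume "sc \<in> (UNIV :: sym set) \<times> {..<N}"
    then obtain s c where sc: "sc = (s, c)" "c < N" by auto
    then show "X (fst sc) (snd sc) (idx v) * (ap ^^ k) (delta (st v sc)) w
       = (\<Sum>p\<in>walks N k. walk_weight X (idx v) (sc # p) * delta (foldl st v (sc # p)) w)"
      using Suc.IH[of "st v (s, c)"] Q[OF Suc.prems, of c s] by (simp add: sum_distrib_left mult.assoc)
  qed
  finally show ?case unfolding sum_walks_Suc .
qed

section \<open>The matrix sum and the free sum as kernels\<close>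

lemma mat_adjoint_index:
  "i < dim_col A \<Longrightarrow> j < dim_row A \<Longrightarrow> mat_adjoint A $$ (i, j) = cnj (A $$ (j, i))" for A :: "complex mat"
  unfolding mat_adjoint_def by (simp add: mat_of_rows_index cols_def)

lemma mat_inv_eqI:
  assumes "Z \<in> carrier_mat N N" "G \<in> carrier_mat N N" "Z * G = 1\<^sub>m N"
  shows "mat_inv Z = G"
proof -
  have GZ: "G * Z = 1\<^sub>m N" by (rule mat_mult_left_right_inverse[OF assms])
  obtain H where H: "mat_inverse Z = Some H"
    using mat_inverse(1)[OF assms(1)] assms GZ by (cases "mat_inverse Z") (auto simp: Units_def ring_mat_simps)
  have HZ: "H * Z = 1\<^sub>m N" "H \<in> carrier_mat N N" using mat_inverse(2)[OF assms(1) H] by auto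
  have "H = H * (Z * G)" using assms HZ by simp
  also have "\<dots> = (H * Z) * G" by (rule assoc_mult_mat[symmetric]) (use HZ assms in auto)
  also have "\<dots> = G" using HZ assms by simp
  finally show ?thesis using H by (simp add: mat_inv_def)
qed

definition pair_entries :: "complex mat \<Rightarrow> complex mat \<Rightarrow> sym \<Rightarrow> nat \<Rightarrow> nat \<Rightarrow> complex" where
  "pair_entries A B s i j = (case s of SymA \<Rightarrow> A | SymB \<Rightarrow> B) $$ (i, j)"

definition free_kernel :: "nat \<Rightarrow> nat \<Rightarrow> (sym \<Rightarrow> nat \<Rightarrow> nat \<Rightarrow> complex) \<Rightarrow> vertex \<Rightarrow> vertex \<Rightarrow> complex" where
  "free_kernel N x X v w = (if v \<in> vertices N x \<and> w \<in> vertices N x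
     then \<Sum>s\<in>UNIV. if vertex_base s v = vertex_base s w then X s (last_index x v) (last_index x w) else 0 else 0)"

definition free_nb :: "nat \<Rightarrow> nat \<Rightarrow> vertex \<Rightarrow> vertex set" where
  "free_nb N x v = (if v \<in> vertices N x then vertex_step x v ` (UNIV \<times> {..<N}) else {})"

definition sum_kernel :: "nat \<Rightarrow> (sym \<Rightarrow> nat \<Rightarrow> nat \<Rightarrow> complex) \<Rightarrow> nat \<Rightarrow> nat \<Rightarrow> complex" where
  "sum_kernel N X i j = (if i < N \<and> j < N then \<Sum>s\<in>UNIV. X s i j else 0)"

text \<open>A crude row bound common to both kernels. It is finite for each realisation and
  measurable; its size enters no final estimate.\<close>

definition kernel_bound :: "nat \<Rightarrow> (sym \<Rightarrow> nat \<Rightarrow> nat \<Rightarrow> complex) \<Rightarrow> real" where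
  "kernel_bound N X = (\<Sum>s\<in>UNIV. \<Sum>i<N. \<Sum>j<N. cmod (X s i j))"

definition nonclosed_walks :: "nat \<Rightarrow> nat \<Rightarrow> nat \<Rightarrow> (sym \<times> nat) list set" where
  "nonclosed_walks N k i = {p \<in> walks N k. walk_end i p = i \<and> stack_run i p \<noteq> []}"

definition nonclosed_sum :: "nat \<Rightarrow> (sym \<Rightarrow> nat \<Rightarrow> nat \<Rightarrow> complex) \<Rightarrow> nat \<Rightarrow> nat \<Rightarrow> complex" where
  "nonclosed_sum N X k i = (\<Sum>p\<in>nonclosed_walks N k i. walk_weight X i p)"

locale hermitian_pair =
  fixes N x :: nat and X :: "sym \<Rightarrow> nat \<Rightarrow> nat \<Rightarrow> complex"
  assumes X_herm: "i < N \<Longrightarrow> j < N \<Longrightarrow> X s i j = cnj (X s j i)" and xN: "x < N"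
begin

lemma finite_UNIV_sym: "finite (UNIV :: sym set)"
  by (simp add: UNIV_sym)

lemma kernel_row_le: "i < N \<Longrightarrow> (\<Sum>s\<in>UNIV. \<Sum>j<N. cmod (X s i j)) \<le> kernel_bound N X"
  unfolding kernel_bound_def
proof (rule sum_mono)
  fix s assume "i < N"
  then show "(\<Sum>j<N. cmod (X s i j)) \<le> (\<Sum>i<N. \<Sum>j<N. cmod (X s i j))"
    by (intro member_le_sum[of i "{..<N}" "\<lambda>i. \<Sum>j<N. cmod (X s i j)"]) (auto intro: sum_nonneg)
qed

lemma kernel_bound_nonneg: "0 \<le> kernel_bound N X"
  unfolding kernel_bound_def by (intro sum_nonneg) auto

sublocale S: hermitian_kernel "sum_kernel N X" "\<lambda>_. {..<N}" "kernel_bound N X"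
proof
  show "sum_kernel N X j i = cnj (sum_kernel N X i j)" for i j
  proof (cases "i < N \<and> j < N")
    case True
    then have "(\<Sum>s\<in>UNIV. X s j i) = (\<Sum>s\<in>UNIV. cnj (X s i j))"
      by (intro sum.cong[OF refl] X_herm) auto
    then show ?thesis using True by (simp add: sum_kernel_def)
  qed (auto simp: sum_kernel_def)
  show "(\<Sum>j<N. cmod (sum_kernel N X i j)) \<le> kernel_bound N X" for i
  proof (cases "i < N")
    case True
    have "(\<Sum>j<N. cmod (sum_kernel N X i j)) \<le> (\<Sum>j<N. \<Sum>s\<in>UNIV. cmod (X s i j))"
      using True by (intro sum_mono) (auto simp: sum_kernel_def intro: norm_sum)
    also have "\<dots> = (\<Sum>s\<in>UNIV. \<Sum>j<N. cmod (X s i j))" by (rule sum.swap)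
    also have "\<dots> \<le> kernel_bound N X" by (rule kernel_row_le[OF True])
    finally show ?thesis .
  qed (simp add: sum_kernel_def kernel_bound_nonneg)
qed (auto simp: sum_kernel_def)

text \<open>A block contains each index at most once, so row sums over a block are bounded by row
  sums of the matrix.\<close>

lemma same_base_inj: "inj_on (last_index x) {w \<in> vertices N x. vertex_base s w = u}"
proof (rule inj_onI)
  fix v w
  assume v: "v \<in> {w \<in> vertices N x. vertex_base s w = u}" and w: "w \<in> {w \<in> vertices N x. vertex_base s w = u}"
    and e: "last_index x v = last_index x w"
  have "v = vertex_step x v (s, last_index x v)"
    using v by (intro vertex_step_unique[symmetric]) auto
  also have "\<dots> = vertex_step x v (s, last_index x w)" by (simp only: e)
  also have "\<dots> = w" using v w by (intro vertex_step_unique) auto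
  finally show "v = w" .
qed

sublocale T: hermitian_kernel "free_kernel N x X" "free_nb N x" "kernel_bound N X"
proof
  show "finite (free_nb N x v)" for v by (auto simp: free_nb_def finite_UNIV_sym)
  show "free_kernel N x X v w = 0" if "w \<notin> free_nb N x v" for v w
  proof -
    have "vertex_base s v \<noteq> vertex_base s w" if "v \<in> vertices N x" "w \<in> vertices N x" for s
    proof
      assume "vertex_base s v = vertex_base s w"
      then have "w = vertex_step x v (s, last_index x w)" using vertex_step_unique that by simp
      moreover have "last_index x w < N" using last_index_less that xN by simp
      ultimately have "w \<in> free_nb N x v" using that by (auto simp: free_nb_def)
      then show False using \<open>w \<notin> free_nb N x v\<close> by simp
    qed
    then show ?thesis by (simp add: free_kernel_def)
  qed
  show "free_kernel N x X w v = cnj (free_kernel N x X v w)" for v w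
  proof (cases "v \<in> vertices N x \<and> w \<in> vertices N x")
    case True
    have "(\<Sum>s\<in>UNIV. if vertex_base s w = vertex_base s v then X s (last_index x w) (last_index x v) else 0)
       = (\<Sum>s\<in>UNIV. cnj (if vertex_base s v = vertex_base s w then X s (last_index x v) (last_index x w) else 0))"
    proof (rule sum.cong[OF refl])
      fix s
      have "X s (last_index x w) (last_index x v) = cnj (X s (last_index x v) (last_index x w))"
        using True xN last_index_less by (intro X_herm) auto
      then show "(if vertex_base s w = vertex_base s v then X s (last_index x w) (last_index x v) else 0)
        = cnj (if vertex_base s v = vertex_base s w then X s (last_index x v) (last_index x w) else 0)"
        by (cases "vertex_base s w = vertex_base s v") simp_all
    qed
    then show ?thesis using True by (simp add: free_kernel_def)
  qed (auto simp: free_kernel_def)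
  show "(\<Sum>w\<in>free_nb N x v. cmod (free_kernel N x X v w)) \<le> kernel_bound N X" for v
  proof (cases "v \<in> vertices N x")
    case True
    define nb where "nb = free_nb N x v"
    have nb: "finite nb" "nb \<subseteq> vertices N x"
      using True by (auto simp: nb_def free_nb_def finite_UNIV_sym intro: vertex_step_in)
    have "(\<Sum>w\<in>nb. cmod (free_kernel N x X v w))
        \<le> (\<Sum>w\<in>nb. \<Sum>s\<in>UNIV. if vertex_base s v = vertex_base s w then cmod (X s (last_index x v) (last_index x w)) else 0)"
    proof (rule sum_mono)
      fix w assume "w \<in> nb"
      then have "free_kernel N x X v w = (\<Sum>s\<in>UNIV. if vertex_base s v = vertex_base s w then X s (last_index x v) (last_index x w) else 0)"
        using True nb by (auto simp: free_kernel_def)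
      also have "cmod \<dots> \<le> (\<Sum>s\<in>UNIV. cmod (if vertex_base s v = vertex_base s w then X s (last_index x v) (last_index x w) else 0))"
        by (rule norm_sum)
      also have "\<dots> = (\<Sum>s\<in>UNIV. if vertex_base s v = vertex_base s w then cmod (X s (last_index x v) (last_index x w)) else 0)"
        by (intro sum.cong) auto
      finally show "cmod (free_kernel N x X v w) \<le> \<dots>" .
    qed
    also have "\<dots> = (\<Sum>s\<in>UNIV. \<Sum>w\<in>nb. if vertex_base s v = vertex_base s w then cmod (X s (last_index x v) (last_index x w)) else 0)"
      by (rule sum.swap)
    also have "\<dots> \<le> (\<Sum>s\<in>UNIV. \<Sum>j<N. cmod (X s (last_index x v) j))"
    proof (rule sum_mono)
      fix s
      define W where "W = {w \<in> nb. vertex_base s v = vertex_base s w}"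
      have inj: "inj_on (last_index x) W"
        by (rule inj_on_subset[OF same_base_inj[of s "vertex_base s v"]]) (use nb in \<open>auto simp: W_def\<close>)
      have "(\<Sum>w\<in>nb. if vertex_base s v = vertex_base s w then cmod (X s (last_index x v) (last_index x w)) else 0)
          = (\<Sum>w\<in>W. cmod (X s (last_index x v) (last_index x w)))"
        unfolding W_def using nb(1) by (rule sum.inter_filter[symmetric])
      also have "\<dots> = (\<Sum>j\<in>last_index x ` W. cmod (X s (last_index x v) j))"
        by (simp add: sum.reindex[OF inj])
      also have "\<dots> \<le> (\<Sum>j<N. cmod (X s (last_index x v) j))"
        by (rule sum_mono2) (use nb last_index_less xN in \<open>auto simp: W_def\<close>)
      finally show "(\<Sum>w\<in>nb. if vertex_base s v = vertex_base s w then cmod (X s (last_index x v) (last_index x w)) else 0)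
          \<le> (\<Sum>j<N. cmod (X s (last_index x v) j))" .
    qed
    also have "\<dots> \<le> kernel_bound N X"
      by (rule kernel_row_le) (use last_index_less True xN in auto)
    finally show ?thesis by (simp add: nb_def)
  qed (simp add: free_nb_def kernel_bound_nonneg)
qed

lemma T_ap_delta:
  assumes v: "v \<in> vertices N x"
  shows "T.ap (delta v) w = (\<Sum>(s, k)\<in>UNIV \<times> {..<N}. X s k (last_index x v) * delta (vertex_step x v (s, k)) w)"
proof (cases "w \<in> vertices N x")
  case True
  have "T.ap (delta v) w = (\<Sum>u\<in>free_nb N x w. free_kernel N x X w u * delta v u)" by (simp add: T.ap_def)
  also have "\<dots> = (\<Sum>u\<in>free_nb N x w \<union> {v}. free_kernel N x X w u * delta v u)"
    by (rule sum.mono_neutral_left) (use T.fin T.supp in auto)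
  also have "\<dots> = (\<Sum>u\<in>{v}. free_kernel N x X w u * delta v u)"
    by (rule sum.mono_neutral_right) (use T.fin in \<open>auto simp: delta_def\<close>)
  also have "\<dots> = (\<Sum>s\<in>UNIV. if vertex_base s w = vertex_base s v then X s (last_index x w) (last_index x v) else 0)"
    using True v by (simp add: free_kernel_def delta_def)
  also have "\<dots> = (\<Sum>s\<in>UNIV. \<Sum>k<N. X s k (last_index x v) * delta (vertex_step x v (s, k)) w)"
  proof (rule sum.cong[OF refl])
    fix s
    have iff: "w = vertex_step x v (s, k) \<longleftrightarrow> vertex_base s w = vertex_base s v \<and> k = last_index x w" for k
      using vertex_base_step[OF v, of s k] last_index_step[of x v "(s, k)"] vertex_step_unique[OF True, of s v]
      by auto
    have lw: "last_index x w < N" using last_index_less[OF True xN] .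
    show "(if vertex_base s w = vertex_base s v then X s (last_index x w) (last_index x v) else 0)
      = (\<Sum>k<N. X s k (last_index x v) * delta (vertex_step x v (s, k)) w)"
    proof (cases "vertex_base s w = vertex_base s v")
      case True
      then have "(\<Sum>k<N. X s k (last_index x v) * delta (vertex_step x v (s, k)) w)
         = (\<Sum>k<N. if k = last_index x w then X s k (last_index x v) else 0)"
        by (intro sum.cong) (auto simp: delta_def iff)
      then show ?thesis using True lw by simp
    qed (auto simp: delta_def iff)
  qed
  finally show ?thesis by (simp add: sum.cartesian_product)
next
  case False
  then have "T.ap (delta v) w = 0" by (simp add: T.ap_def free_nb_def)
  moreover have "delta (vertex_step x v (s, k)) w = 0" if "k < N" for s k
    using vertex_step_in[OF v, of "(s, k)"] that False by (auto simp: delta_def)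
  then have "(\<Sum>(s, k)\<in>UNIV \<times> {..<N}. X s k (last_index x v) * delta (vertex_step x v (s, k)) w) = 0"
    by (intro sum.neutral) auto
  ultimately show ?thesis by simp
qed

lemma S_ap_delta:
  assumes i: "i < N"
  shows "S.ap (delta i) j = (\<Sum>(s, k)\<in>UNIV \<times> {..<N}. X s k i * delta k j)"
proof -
  have "S.ap (delta i) j = (\<Sum>k<N. if k = i then sum_kernel N X j k else 0)"
    by (simp add: S.ap_def delta_def if_distrib cong: if_cong)
  also have "\<dots> = sum_kernel N X j i" using i by simp
  also have "\<dots> = (\<Sum>s\<in>UNIV. \<Sum>k<N. X s k i * delta k j)"
    using i by (auto simp: sum_kernel_def delta_def if_distrib[of "\<lambda>y. _ * y"] sum.neutral cong: if_cong)
  finally show ?thesis by (simp add: sum.cartesian_product)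
qed

lemma foldl_snd: "foldl (\<lambda>i sk. snd sk) i p = walk_end i p"
  by (induction p rule: rev_induct) (auto simp: walk_end_def)

lemma walks_indices: "p \<in> walks N k \<Longrightarrow> snd ` set p \<subseteq> {..<N}"
  by (auto simp: walks_def)

text \<open>A walk whose lift closes also closes on indices. Both moments expand over the same
  walks, and the terms with closed lift cancel.\<close>

lemma moment_difference:
  assumes i: "i < N"
  shows "(S.ap ^^ k) (delta i) i - (T.ap ^^ k) (delta (diag_vertex x i)) (diag_vertex x i) = nonclosed_sum N X k i"
proof -
  define v where "v = diag_vertex x i"
  have S: "(S.ap ^^ k) (delta i) i = (\<Sum>p\<in>walks N k. walk_weight X i p * delta (walk_end i p) i)"
    using S.iter_delta_walks[of "{..<N}" X "\<lambda>i. i" "\<lambda>i sk. snd sk" N i k i] S_ap_delta i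
    by (simp add: foldl_snd)
  have T: "(T.ap ^^ k) (delta v) v = (\<Sum>p\<in>walks N k. walk_weight X i p * delta (foldl (vertex_step x) v p) v)"
    using T.iter_delta_walks[of "vertices N x" X "last_index x" "vertex_step x" N v k v]
      T_ap_delta vertex_step_in last_index_step diag_in_vertices[OF i]
    by (simp add: v_def)
  have "(S.ap ^^ k) (delta i) i - (T.ap ^^ k) (delta v) v
      = (\<Sum>p\<in>walks N k. if walk_end i p = i \<and> stack_run i p \<noteq> [] then walk_weight X i p else 0)"
    unfolding S T sum_subtractf[symmetric]
  proof (rule sum.cong[OF refl])
    fix p assume p: "p \<in> walks N k"
    have c: "foldl (vertex_step x) v p = v \<longleftrightarrow> stack_run i p = []"
      unfolding v_def by (rule lift_closed_iff[OF i xN walks_indices[OF p]])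
    have e: "walk_end i p = i" if "foldl (vertex_step x) v p = v"
      using last_index_foldl[of x v p] that by (simp add: v_def)
    show "walk_weight X i p * delta (walk_end i p) i - walk_weight X i p * delta (foldl (vertex_step x) v p) v
        = (if walk_end i p = i \<and> stack_run i p \<noteq> [] then walk_weight X i p else 0)"
    proof (cases "stack_run i p = []")
      case True
      then show ?thesis using c e by (simp add: delta_def)
    next
      case False
      then have "foldl (vertex_step x) v p \<noteq> v" using c by simp
      then show ?thesis using False by (simp add: delta_def)
    qed
  qed
  also have "\<dots> = nonclosed_sum N X k i"
    unfolding nonclosed_sum_def nonclosed_walks_def by (rule sum.inter_filter[symmetric]) simp
  finally show ?thesis by (simp add: v_def)
qed

lemma delta_square_summable: "square_summable (delta v)"
  by (rule square_summable_finite_support[of "{v}"]) (auto simp: delta_def)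

text \<open>In the remainder of the tree resolvent the moment is rewritten as the matrix moment
  minus the non-closed sum. This gives the factor 2 and the extra non-closed term.\<close>

lemma resolvent_difference:
  assumes i: "i < N" and z: "Im z > 0"
    and f: "square_summable f" "\<And>v. T.shifted z f v = delta (diag_vertex x i) v"
    and g: "square_summable g" "\<And>j. S.shifted z g j = delta i j"
  shows "cmod (f (diag_vertex x i) - g i) \<le> (\<Sum>k<2 * m. cmod (nonclosed_sum N X k i) / cmod z ^ Suc k)
     + (2 * Re ((S.ap ^^ (2 * m)) (delta i) i) + cmod (nonclosed_sum N X (2 * m) i)) / Im z / cmod z ^ (2 * m)"
proof -
  define v where "v = diag_vertex x i"
  have z0: "z \<noteq> 0" using z by auto
  let ?K = "2 * m"
  define d where "d k = nonclosed_sum N X k i" for k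
  define s where "s k = (S.ap ^^ k) (delta i) i" for k
  have dk: "(T.ap ^^ k) (delta v) v = s k - d k" for k
    using moment_difference[OF i, of k] by (simp add: d_def s_def v_def algebra_simps)
  have F: "f v = (\<Sum>k<?K. (T.ap ^^ k) (delta v) v / z ^ Suc k) + (T.ap ^^ ?K) f v / z ^ ?K"
    by (rule T.neumann_expansion) (use f z0 in \<open>auto simp: v_def\<close>)
  have G: "g i = (\<Sum>k<?K. s k / z ^ Suc k) + (S.ap ^^ ?K) g i / z ^ ?K"
    unfolding s_def by (rule S.neumann_expansion) (use g z0 in auto)
  have sums: "(\<Sum>k<?K. (T.ap ^^ k) (delta v) v / z ^ Suc k)
      = (\<Sum>k<?K. s k / z ^ Suc k) + (\<Sum>k<?K. - d k / z ^ Suc k)"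
    unfolding dk sum.distrib[symmetric] by (rule sum.cong[OF refl]) (simp add: diff_divide_distrib)
  have "f v - g i = ((\<Sum>k<?K. (T.ap ^^ k) (delta v) v / z ^ Suc k) + (T.ap ^^ ?K) f v / z ^ ?K)
      - ((\<Sum>k<?K. s k / z ^ Suc k) + (S.ap ^^ ?K) g i / z ^ ?K)"
    by (rule arg_cong2[where f = "(-)", OF F G])
  also have "\<dots> = (\<Sum>k<?K. - d k / z ^ Suc k) + ((T.ap ^^ ?K) f v - (S.ap ^^ ?K) g i) / z ^ ?K"
    unfolding sums by (simp only: diff_divide_distrib) simp
  finally have FG: "f v - g i = (\<Sum>k<?K. - d k / z ^ Suc k) + ((T.ap ^^ ?K) f v - (S.ap ^^ ?K) g i) / z ^ ?K" .
  have "cmod (f v - g i) \<le> cmod (\<Sum>k<?K. - d k / z ^ Suc k) + cmod (((T.ap ^^ ?K) f v - (S.ap ^^ ?K) g i) / z ^ ?K)"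
    unfolding FG by (rule norm_triangle_ineq)
  moreover have "cmod (\<Sum>k<?K. - d k / z ^ Suc k) \<le> (\<Sum>k<?K. cmod (d k) / cmod z ^ Suc k)"
    by (rule order_trans[OF norm_sum]) (simp add: norm_divide norm_power norm_mult)
  moreover have "cmod (((T.ap ^^ ?K) f v - (S.ap ^^ ?K) g i) / z ^ ?K)
      \<le> (2 * Re (s ?K) + cmod (d ?K)) / Im z / cmod z ^ ?K"
  proof -
    have "cmod ((T.ap ^^ ?K) f v) \<le> Re ((T.ap ^^ ?K) (delta v) v) / Im z"
      using T.resolvent_remainder[OF f(1), of z v m] f(2) z by (simp add: v_def delta_def)
    also have "\<dots> \<le> (Re (s ?K) + cmod (d ?K)) / Im z"
      unfolding dk using z complex_Re_le_cmod[of "- d ?K"] by (intro divide_right_mono) auto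
    finally have "cmod ((T.ap ^^ ?K) f v) \<le> (Re (s ?K) + cmod (d ?K)) / Im z" .
    moreover have "cmod ((S.ap ^^ ?K) g i) \<le> Re (s ?K) / Im z"
      using S.resolvent_remainder[OF g(1), of z i m] g(2) z by (simp add: s_def delta_def)
    ultimately have "cmod ((T.ap ^^ ?K) f v - (S.ap ^^ ?K) g i) \<le> (2 * Re (s ?K) + cmod (d ?K)) / Im z"
      using norm_triangle_ineq4[of "(T.ap ^^ ?K) f v" "(S.ap ^^ ?K) g i"] by (simp add: add_divide_distrib)
    then show ?thesis unfolding norm_divide norm_power by (intro divide_right_mono) auto
  qed
  ultimately show ?thesis unfolding v_def d_def s_def by linarith
qed

lemma infsum_vertices: "(\<Sum>\<^sub>\<infinity>v\<in>vertices N x. g v * cnj (delta (diag_vertex x i) v)) = g (diag_vertex x i)"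
  if "i < N"
proof -
  have "(\<Sum>\<^sub>\<infinity>v\<in>vertices N x. g v * cnj (delta (diag_vertex x i) v))
      = (\<Sum>\<^sub>\<infinity>v\<in>{diag_vertex x i}. g v * cnj (delta (diag_vertex x i) v))"
    by (rule infsum_cong_neutral) (use diag_in_vertices[OF that] in \<open>auto simp: delta_def\<close>)
  then show ?thesis by (simp add: delta_def)
qed

text \<open>Identifies the \<open>inv_into\<close> of the definition with the solution constructed
  above: that solution vanishes off the vertices because the kernel does and z is nonzero, and
  uniqueness excludes any other preimage.\<close>

lemma free_resolvent:
  assumes z: "Im z \<noteq> 0" and T: "\<And>f. TT f = T.ap f" and v: "v \<in> vertices N x"
  shows "square_summable (op_resolvent (vertices N x) TT z (delta v))"
    and "T.shifted z (op_resolvent (vertices N x) TT z (delta v)) w = delta v w"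
    and "(\<lambda>n. T.richardson z (delta v) n w) \<longlonglongrightarrow> op_resolvent (vertices N x) TT z (delta v) w"
proof -
  have op: "(\<lambda>f v. z * f v - TT f v) = T.shifted z"
    by (intro ext) (simp add: T T.shifted_def)
  have ell2_ss: "square_summable f" if "f \<in> ell2 (vertices N x)" for f :: "vertex \<Rightarrow> complex"
  proof -
    have "(\<lambda>v. (cmod (f v))\<^sup>2) summable_on vertices N x" using that by (simp add: ell2_def)
    then show ?thesis unfolding square_summable_def
      by (rule iffD1[OF summable_on_cong_neutral, rotated -1]) (use that in \<open>auto simp: ell2_def\<close>)
  qed
  obtain f where f: "square_summable f" "\<And>w. T.shifted z f w = delta v w"
    "\<And>w. (\<lambda>n. T.richardson z (delta v) n w) \<longlonglongrightarrow> f w"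
    using T.resolvent_exists[OF delta_square_summable z, of v] by blast
  have "f w = 0" if "w \<notin> vertices N x" for w
  proof -
    have "T.ap f w = 0" using that by (simp add: T.ap_def free_nb_def)
    moreover have "delta v w = 0" using that v by (auto simp: delta_def)
    ultimately have "z * f w = 0" using f(2)[of w] by (simp add: T.shifted_def)
    then show ?thesis using z by auto
  qed
  moreover have "(\<lambda>v. (cmod (f v))\<^sup>2) summable_on vertices N x"
    using f(1) unfolding square_summable_def by (rule summable_on_subset_banach) simp
  ultimately have "f \<in> ell2 (vertices N x)" by (simp add: ell2_def)
  moreover have "T.shifted z f = delta v" using f(2) by auto
  ultimately have im: "delta v \<in> T.shifted z ` ell2 (vertices N x)" by force
  define g where "g = op_resolvent (vertices N x) TT z (delta v)"
  have g: "g \<in> ell2 (vertices N x)" "T.shifted z g = delta v"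
    using inv_into_into[OF im] f_inv_into_f[OF im] by (auto simp: g_def op_resolvent_def op)
  have "g = f" by (rule T.resolvent_unique[OF ell2_ss[OF g(1)] f(1) z]) (simp add: g(2) f(2))
  then show "square_summable (op_resolvent (vertices N x) TT z (delta v))"
    "T.shifted z (op_resolvent (vertices N x) TT z (delta v)) w = delta v w"
    "(\<lambda>n. T.richardson z (delta v) n w) \<longlonglongrightarrow> op_resolvent (vertices N x) TT z (delta v) w"
    using f by (simp_all add: g_def)
qed

end

section \<open>The two Cauchy transforms as resolvent entries of the kernels\<close>

locale hermitian_matrices =
  fixes N x :: nat and A B :: "complex mat"
  assumes A: "A \<in> carrier_mat N N" "hermitian_mat A" and B: "B \<in> carrier_mat N N" "hermitian_mat B"
    and x: "x < N"
begin

abbreviation "X \<equiv> pair_entries A B"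

sublocale hermitian_pair N x X
proof
  fix i j s assume ij: "i < N" "j < N"
  have "Y $$ (i, j) = cnj (Y $$ (j, i))" if "Y \<in> carrier_mat N N" "hermitian_mat Y" for Y
    using mat_adjoint_index[of i Y j] that ij by (simp add: hermitian_mat_def)
  then show "X s i j = cnj (X s j i)"
    using A B by (cases s) (auto simp: pair_entries_def)
qed (rule x)

text \<open>The s-block of \<open>v\<close> contains exactly one vertex of each index, so the
  infinite sum collapses to a row of the matrix.\<close>

lemma block_operator_eq:
  "block_operator N x s Y f v = (if v \<in> vertices N x
     then \<Sum>k<N. Y $$ (last_index x v, k) * f (vertex_step x v (s, k)) else 0)"
proof (cases "v \<in> vertices N x")
  case True
  define W where "W = vertex_step x v ` ({s} \<times> {..<N})"
  have W: "finite W" "W \<subseteq> vertices N x" using True by (auto simp: W_def intro: vertex_step_in)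
  have "block_operator N x s Y f v = (\<Sum>\<^sub>\<infinity>w\<in>vertices N x. block_coeff N x s Y w v * f w)"
    by (simp add: block_operator_def)
  also have "\<dots> = (\<Sum>\<^sub>\<infinity>w\<in>W. block_coeff N x s Y w v * f w)"
  proof (rule infsum_cong_neutral)
    fix w assume w: "w \<in> vertices N x - W"
    have "vertex_base s w \<noteq> vertex_base s v"
    proof
      assume "vertex_base s w = vertex_base s v"
      then have "vertex_step x v (s, last_index x w) = w" using w vertex_step_unique[of w N x s v] by auto
      moreover have "last_index x w < N" using w last_index_less x by auto
      ultimately show False using w by (force simp: W_def)
    qed
    then show "block_coeff N x s Y w v * f w = 0" by (simp add: block_coeff_def same_block_iff)
  qed (use W in auto)
  also have "\<dots> = (\<Sum>w\<in>W. block_coeff N x s Y w v * f w)" using W by simp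
  also have "W = (\<lambda>k. vertex_step x v (s, k)) ` {..<N}" by (auto simp: W_def)
  also have "(\<Sum>w\<in>(\<lambda>k. vertex_step x v (s, k)) ` {..<N}. block_coeff N x s Y w v * f w)
      = (\<Sum>k<N. block_coeff N x s Y (vertex_step x v (s, k)) v * f (vertex_step x v (s, k)))"
    by (subst sum.reindex) (auto intro!: inj_onI dest: arg_cong[of _ _ "last_index x"] simp: last_index_step)
  also have "\<dots> = (\<Sum>k<N. Y $$ (last_index x v, k) * f (vertex_step x v (s, k)))"
    using True by (intro sum.cong) (auto simp: block_coeff_def same_block_iff vertex_step_in vertex_base_step last_index_step)
  finally show ?thesis using True by simp
next
  case False
  then show ?thesis by (simp add: block_operator_def block_coeff_def same_block_iff)
qed

lemma free_sum_eq: "free_sum N x A B f = T.ap f"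
proof
  fix v
  show "free_sum N x A B f v = T.ap f v"
  proof (cases "v \<in> vertices N x")
    case True
    define nb where "nb = free_nb N x v"
    have fin: "finite nb" unfolding nb_def by (rule T.fin)
    have part: "(\<Sum>k<N. X s (last_index x v) k * f (vertex_step x v (s, k)))
        = (\<Sum>w\<in>nb. (if vertex_base s v = vertex_base s w then X s (last_index x v) (last_index x w) else 0) * f w)" for s
    proof -
      define W where "W = (\<lambda>k. vertex_step x v (s, k)) ` {..<N}"
      have "(\<Sum>w\<in>nb. (if vertex_base s v = vertex_base s w then X s (last_index x v) (last_index x w) else 0) * f w)
          = (\<Sum>w\<in>W. (if vertex_base s v = vertex_base s w then X s (last_index x v) (last_index x w) else 0) * f w)"
      proof (rule sum.mono_neutral_right[OF fin])
        show "W \<subseteq> nb" using True by (auto simp: W_def nb_def free_nb_def)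
        show "\<forall>w\<in>nb - W. (if vertex_base s v = vertex_base s w then X s (last_index x v) (last_index x w) else 0) * f w = 0"
        proof
          fix w assume w: "w \<in> nb - W"
          then have "w \<in> vertices N x" using True by (auto simp: nb_def free_nb_def intro: vertex_step_in)
          have "vertex_base s v \<noteq> vertex_base s w"
          proof
            assume "vertex_base s v = vertex_base s w"
            then have "vertex_step x v (s, last_index x w) = w"
              using \<open>w \<in> vertices N x\<close> vertex_step_unique[of w N x s v] by auto
            moreover have "last_index x w < N" using \<open>w \<in> vertices N x\<close> last_index_less x by auto
            ultimately show False using w by (force simp: W_def)
          qed
          then show "(if vertex_base s v = vertex_base s w then X s (last_index x v) (last_index x w) else 0) * f w = 0"
            by simp
        qed
      qed
      also have "\<dots> = (\<Sum>k<N. X s (last_index x v) k * f (vertex_step x v (s, k)))"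
        unfolding W_def using True
        by (subst sum.reindex)
          (auto intro!: inj_onI dest: arg_cong[of _ _ "last_index x"] simp: last_index_step vertex_base_step)
      finally show ?thesis by simp
    qed
    have "free_sum N x A B f v = (\<Sum>s\<in>UNIV. \<Sum>k<N. X s (last_index x v) k * f (vertex_step x v (s, k)))"
      using True by (simp add: free_sum_def block_operator_eq UNIV_sym pair_entries_def)
    also have "\<dots> = (\<Sum>w\<in>nb. \<Sum>s\<in>UNIV. (if vertex_base s v = vertex_base s w then X s (last_index x v) (last_index x w) else 0) * f w)"
      unfolding part by (rule sum.swap)
    also have "\<dots> = (\<Sum>w\<in>nb. free_kernel N x X v w * f w)"
    proof (rule sum.cong[OF refl])
      fix w assume "w \<in> nb"
      then have "w \<in> vertices N x" using True by (auto simp: nb_def free_nb_def intro: vertex_step_in)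
      then show "(\<Sum>s\<in>UNIV. (if vertex_base s v = vertex_base s w then X s (last_index x v) (last_index x w) else 0) * f w)
         = free_kernel N x X v w * f w"
        using True by (simp add: free_kernel_def sum_distrib_right)
    qed
    finally show ?thesis by (simp add: T.ap_def nb_def)
  next
    case False
    then show ?thesis by (simp add: free_sum_def block_operator_eq T.ap_def free_nb_def)
  qed
qed

text \<open>The solutions for the delta functions are the columns of a right inverse, which shows
  that \<open>mat_inv\<close> is meaningful here.\<close>

lemma cauchy_matrix_entry:
  assumes z: "Im z \<noteq> 0" and i: "i < N"
  obtains g where "square_summable g" "\<And>j. S.shifted z g j = delta i j"
    "cauchy_matrix_sum N A B z $$ (i, i) = g i" "cauchy_matrix_sum N A B z \<in> carrier_mat N N"
    "(\<lambda>n. S.richardson z (delta i) n i) \<longlonglongrightarrow> g i"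
proof -
  have "\<exists>g. square_summable g \<and> (\<forall>j. S.shifted z g j = delta c j) \<and> (\<forall>j. (\<lambda>n. S.richardson z (delta c) n j) \<longlonglongrightarrow> g j)" for c
    using S.resolvent_exists[OF delta_square_summable z, of c] by metis
  then obtain g where g: "\<And>c. square_summable (g c)" "\<And>c j. S.shifted z (g c) j = delta c j"
    "\<And>c j. (\<lambda>n. S.richardson z (delta c) n j) \<longlonglongrightarrow> g c j" by metis
  define Z where "Z = z \<cdot>\<^sub>m 1\<^sub>m N - A - B"
  define G where "G = mat N N (\<lambda>(r, c). g c r)"
  have dims: "Z \<in> carrier_mat N N" "G \<in> carrier_mat N N" using A B by (auto simp: Z_def G_def)
  have ZG: "Z * G = 1\<^sub>m N"
  proof (rule eq_matI)
    fix r c assume "r < dim_row (1\<^sub>m N :: complex mat)" "c < dim_col (1\<^sub>m N :: complex mat)"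
    then have rc: "r < N" "c < N" by auto
    have "(Z * G) $$ (r, c) = (\<Sum>k<N. Z $$ (r, k) * g c k)"
      using rc dims by (simp add: scalar_prod_def G_def atLeast0LessThan)
    also have "\<dots> = (\<Sum>k<N. (if k = r then z * g c k else 0) - sum_kernel N X r k * g c k)"
      using rc A B by (intro sum.cong) (auto simp: Z_def sum_kernel_def UNIV_sym pair_entries_def algebra_simps)
    also have "\<dots> = S.shifted z (g c) r"
      using rc by (simp add: sum_subtractf S.shifted_def S.ap_def)
    finally show "(Z * G) $$ (r, c) = 1\<^sub>m N $$ (r, c)" using rc g(2) by (simp add: delta_def)
  qed (use dims in auto)
  have inv: "mat_inv Z = G" by (rule mat_inv_eqI[OF dims ZG])
  have "cauchy_matrix_sum N A B z $$ (i, i) = g i i"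
    using i by (simp add: cauchy_matrix_sum_def diag_part_def Z_def[symmetric] inv) (simp add: G_def)
  moreover have "cauchy_matrix_sum N A B z \<in> carrier_mat N N"
    using dims by (simp add: cauchy_matrix_sum_def diag_part_def Z_def[symmetric] inv)
  ultimately show ?thesis using that[of "g i"] g by blast
qed

lemma cauchy_free_entry:
  assumes z: "Im z \<noteq> 0" and i: "i < N"
  obtains f where "square_summable f" "\<And>v. T.shifted z f v = delta (diag_vertex x i) v"
    "cauchy_free_sum N x A B z $$ (i, i) = f (diag_vertex x i)"
    "(\<lambda>n. T.richardson z (delta (diag_vertex x i)) n (diag_vertex x i)) \<longlonglongrightarrow> f (diag_vertex x i)"
proof -
  note r = free_resolvent[of z "free_sum N x A B", OF z free_sum_eq diag_in_vertices[OF i, of x]]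
  show ?thesis
    by (rule that[OF r(1,2)])
      (use i r(3) infsum_vertices[OF i] in \<open>auto simp: cauchy_free_sum_def diag_expectation_def ell2_inner_def\<close>)
qed

end

section \<open>Colourings and patterns\<close>

definition inj_maps :: "'v set \<Rightarrow> nat \<Rightarrow> ('v \<Rightarrow> nat) set" where
  "inj_maps V N = {\<phi> \<in> V \<rightarrow>\<^sub>E {..<N}. inj_on \<phi> V}"

lemma finite_inj_maps: "finite V \<Longrightarrow> finite (inj_maps V N)"
  unfolding inj_maps_def by (rule finite_subset[of _ "V \<rightarrow>\<^sub>E {..<N}"]) (auto intro: finite_PiE)

lemma card_inj_PiE:
  assumes "finite S" "finite T"
  shows "card {\<phi> \<in> S \<rightarrow>\<^sub>E T. inj_on \<phi> S} = (\<Prod>i<card S. card T - i)"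
  using assms(1)
proof (induction S)
  case empty
  have "{\<phi> \<in> {} \<rightarrow>\<^sub>E T. inj_on \<phi> {}} = {\<lambda>_. undefined}" by auto
  then show ?case by simp
next
  case (insert x S)
  let ?I = "{\<phi> \<in> S \<rightarrow>\<^sub>E T. inj_on \<phi> S}"
  have finI: "finite ?I"
    by (rule finite_subset[of _ "S \<rightarrow>\<^sub>E T"]) (use insert assms in \<open>auto intro: finite_PiE\<close>)
  have "bij_betw (\<lambda>(\<phi>, a). \<phi>(x := a)) (SIGMA \<phi>:?I. T - \<phi> ` S) {\<phi> \<in> insert x S \<rightarrow>\<^sub>E T. inj_on \<phi> (insert x S)}"
  proof (rule bij_betwI[where g = "\<lambda>\<psi>. (\<psi>(x := undefined), \<psi> x)"])
    show "(\<lambda>(\<phi>, a). \<phi>(x := a)) \<in> (SIGMA \<phi>:?I. T - \<phi> ` S) \<rightarrow> {\<phi> \<in> insert x S \<rightarrow>\<^sub>E T. inj_on \<phi> (insert x S)}"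
    proof
      fix p assume p: "p \<in> (SIGMA \<phi>:?I. T - \<phi> ` S)"
      obtain \<phi> a where e: "p = (\<phi>, a)" by (cases p)
      have \<phi>: "\<phi> \<in> S \<rightarrow>\<^sub>E T" "inj_on \<phi> S" "a \<in> T" "a \<notin> \<phi> ` S" using p e by auto
      have "inj_on (\<phi>(x := a)) S" using \<phi>(2) insert(2) by (auto simp: inj_on_def)
      moreover have "(\<phi>(x := a)) x \<notin> (\<phi>(x := a)) ` S" using \<phi>(4) insert(2) by auto
      ultimately have "inj_on (\<phi>(x := a)) (insert x S)" using insert(2) by simp
      moreover have "\<phi>(x := a) \<in> insert x S \<rightarrow>\<^sub>E T" using \<phi> by (auto simp: PiE_iff extensional_def)
      ultimately show "(case p of (\<phi>, a) \<Rightarrow> \<phi>(x := a)) \<in> {\<phi> \<in> insert x S \<rightarrow>\<^sub>E T. inj_on \<phi> (insert x S)}"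
        by (simp add: e)
    qed
    show "(\<lambda>\<psi>. (\<psi>(x := undefined), \<psi> x)) \<in> {\<phi> \<in> insert x S \<rightarrow>\<^sub>E T. inj_on \<phi> (insert x S)} \<rightarrow> (SIGMA \<phi>:?I. T - \<phi> ` S)"
    proof
      fix \<psi> assume "\<psi> \<in> {\<phi> \<in> insert x S \<rightarrow>\<^sub>E T. inj_on \<phi> (insert x S)}"
      then have \<psi>: "\<psi> \<in> insert x S \<rightarrow>\<^sub>E T" "inj_on \<psi> (insert x S)" by auto
      have "inj_on (\<psi>(x := undefined)) S" using \<psi>(2) insert(2) by (auto simp: inj_on_def)
      moreover have "\<psi>(x := undefined) \<in> S \<rightarrow>\<^sub>E T" using \<psi>(1) insert(2) by (auto simp: PiE_iff extensional_def)
      moreover have "\<psi> x \<in> T - (\<psi>(x := undefined)) ` S" using \<psi> insert(2) by (auto simp: inj_on_def)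
      ultimately show "(\<psi>(x := undefined), \<psi> x) \<in> (SIGMA \<phi>:?I. T - \<phi> ` S)" by auto
    qed
    show "(\<lambda>\<psi>. (\<psi>(x := undefined), \<psi> x)) ((\<lambda>(\<phi>, a). \<phi>(x := a)) p) = p" if "p \<in> (SIGMA \<phi>:?I. T - \<phi> ` S)" for p
    proof -
      obtain \<phi> a where e: "p = (\<phi>, a)" by (cases p)
      have "\<phi> x = undefined" using that e insert(2) by (auto simp: PiE_iff extensional_def)
      then show ?thesis by (auto simp: e)
    qed
  qed auto
  then have "card {\<phi> \<in> insert x S \<rightarrow>\<^sub>E T. inj_on \<phi> (insert x S)} = card (SIGMA \<phi>:?I. T - \<phi> ` S)"
    by (rule bij_betw_same_card[symmetric])
  also have "\<dots> = (\<Sum>\<phi>\<in>?I. card (T - \<phi> ` S))"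
    using finI assms(2) by (intro card_SigmaI) auto
  also have "\<dots> = (\<Sum>\<phi>\<in>?I. card T - card S)"
  proof (rule sum.cong[OF refl])
    fix \<phi> assume \<phi>: "\<phi> \<in> ?I"
    then have "\<phi> ` S \<subseteq> T" by auto
    then have "card (T - \<phi> ` S) = card T - card (\<phi> ` S)" using insert(1) by (intro card_Diff_subset) auto
    then show "card (T - \<phi> ` S) = card T - card S" using \<phi> by (simp add: card_image)
  qed
  also have "\<dots> = (\<Prod>i<card (insert x S). card T - i)" using insert by (simp add: mult.commute)
  finally show ?case .
qed

lemma card_inj_maps: "card (inj_maps {..<m} N) = (\<Prod>i<m. N - i)"
  using card_inj_PiE[of "{..<m}" "{..<N}"] by (simp add: inj_maps_def)

text \<open>Each factor N - i with i < m is at least N / 2. The loss 2 ^ m is only exponential in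
  the length of the walk.\<close>

lemma card_inj_maps_ge:
  assumes "2 * m \<le> N"
  shows "(real N / 2) ^ m \<le> real (card (inj_maps {..<m} N))"
proof -
  have "(real N / 2) ^ m = (\<Prod>i<m. real N / 2)" by simp
  also have "\<dots> \<le> (\<Prod>i<m. real (N - i))"
    using assms by (intro prod_mono) (auto simp: of_nat_diff)
  finally show ?thesis by (simp add: card_inj_maps)
qed

text \<open>Colour \<open>{..<N}\<close> uniformly at random with the elements of \<open>V\<close>. A map \<open>\<phi>\<close> respects the colours
  with probability \<open>card V ^ (- card V)\<close> if it is injective, and never otherwise.\<close>

lemma injective_sum_by_colouring:
  fixes F :: "('v \<Rightarrow> nat) \<Rightarrow> complex"
  assumes V: "finite V" and C: "\<And>S. (\<And>v. S v \<subseteq> {..<N}) \<Longrightarrow> cmod (\<Sum>\<phi>\<in>PiE V S. F \<phi>) \<le> C"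
  shows "cmod (\<Sum>\<phi>\<in>inj_maps V N. F \<phi>) \<le> real (card V) ^ card V * C"
proof -
  define m where "m = card V"
  have C0: "0 \<le> C" using C[of "\<lambda>_. {}"] norm_ge_zero order_trans by blast
  consider "m = 0" | "inj_maps V N = {}" | "m > 0" "inj_maps V N \<noteq> {}" by blast
  then show ?thesis
  proof cases
    case 1
    then have "V = {}" using V by (simp add: m_def)
    then show ?thesis using C[of "\<lambda>_. {}"] by (simp add: inj_maps_def)
  next
    case 2
    then show ?thesis using C0 by simp
  next
    case 3
    have mN: "m \<le> N"
    proof -
      obtain \<phi> where "\<phi> \<in> V \<rightarrow>\<^sub>E {..<N}" "inj_on \<phi> V" using 3 by (auto simp: inj_maps_def)
      then have "card V \<le> card {..<N}" by (intro card_inj_on_le[of \<phi>]) auto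
      then show ?thesis by (simp add: m_def)
    qed
    define Col where "Col = {..<N} \<rightarrow>\<^sub>E V"
    \<comment> \<open>For a fixed colouring, the maps that respect it form a full product of colour
      classes, to which the assumption applies.\<close>
    define S where "S col v = {j \<in> {..<N}. col j = v}" for col :: "nat \<Rightarrow> 'v" and v
    have finCol: "finite Col" using V by (auto simp: Col_def intro: finite_PiE)
    have finA: "finite (V \<rightarrow>\<^sub>E {..<N})" using V by (auto intro: finite_PiE)
    have PiE_S: "PiE V (S col) = {\<phi> \<in> V \<rightarrow>\<^sub>E {..<N}. \<forall>v\<in>V. col (\<phi> v) = v}" for col
      by (auto simp: S_def PiE_iff extensional_def)
    \<comment> \<open>An injective \<open>\<phi>\<close> prescribes the colours of m points and
      leaves N - m free, whereas a collision would demand two colours of one point.\<close>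
    have fibre: "card {col \<in> Col. \<forall>v\<in>V. col (\<phi> v) = v} = (if inj_on \<phi> V then m ^ (N - m) else 0)"
      if \<phi>: "\<phi> \<in> V \<rightarrow>\<^sub>E {..<N}" for \<phi>
    proof (cases "inj_on \<phi> V")
      case False
      have e: "{col \<in> Col. \<forall>v\<in>V. col (\<phi> v) = v} = {}"
      proof (rule ccontr)
        assume "{col \<in> Col. \<forall>v\<in>V. col (\<phi> v) = v} \<noteq> {}"
        then obtain col where "\<forall>v\<in>V. col (\<phi> v) = v" by auto
        then have "inj_on \<phi> V" by (metis inj_onI)
        then show False using False by simp
      qed
      show ?thesis using False by (simp only: e card.empty if_False)
    next
      case True
      have im: "\<phi> ` V \<subseteq> {..<N}" using \<phi> by auto
      have "{col \<in> Col. \<forall>v\<in>V. col (\<phi> v) = v} = PiE {..<N} (\<lambda>j. if j \<in> \<phi> ` V then {inv_into V \<phi> j} else V)"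
        (is "?L = ?R")
      proof
        show "?L \<subseteq> ?R" using True by (auto simp: Col_def PiE_iff extensional_def)
        show "?R \<subseteq> ?L"
        proof
          fix col assume col: "col \<in> ?R"
          have "col (\<phi> v) = v" if "v \<in> V" for v
            using PiE_mem[OF col, of "\<phi> v"] that im True by auto
          moreover have "col j \<in> V" if "j < N" for j
          proof (cases "j \<in> \<phi> ` V")
            case True
            then have "col j = inv_into V \<phi> j" using PiE_mem[OF col, of j] that by simp
            then show ?thesis using inv_into_into[OF True] by simp
          next
            case False
            then show ?thesis using PiE_mem[OF col, of j] that by simp
          qed
          ultimately show "col \<in> ?L" using col by (auto simp: Col_def PiE_iff)
        qed
      qed
      then have "card ?L = (\<Prod>j<N. card (if j \<in> \<phi> ` V then {inv_into V \<phi> j} else V))"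
        by (simp add: card_PiE)
      also have "\<dots> = (\<Prod>j<N. if j \<in> \<phi> ` V then 1 else m)"
        by (intro prod.cong) (auto simp: m_def)
      also have "\<dots> = (\<Prod>j\<in>{..<N} - \<phi> ` V. m)"
        by (rule prod.mono_neutral_cong_right) auto
      also have "\<dots> = m ^ (N - m)"
        using card_Diff_subset[OF finite_imageI[OF V] im] True by (simp add: card_image m_def)
      finally show ?thesis using True by simp
    qed
    have "(\<Sum>col\<in>Col. \<Sum>\<phi>\<in>PiE V (S col). F \<phi>)
        = (\<Sum>col\<in>Col. \<Sum>\<phi>\<in>V \<rightarrow>\<^sub>E {..<N}. if \<forall>v\<in>V. col (\<phi> v) = v then F \<phi> else 0)"
      unfolding PiE_S by (intro sum.cong refl sum.inter_filter finA)
    also have "\<dots> = (\<Sum>\<phi>\<in>V \<rightarrow>\<^sub>E {..<N}. \<Sum>col\<in>Col. if \<forall>v\<in>V. col (\<phi> v) = v then F \<phi> else 0)"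
      by (rule sum.swap)
    also have "\<dots> = (\<Sum>\<phi>\<in>V \<rightarrow>\<^sub>E {..<N}. of_nat (card {col \<in> Col. \<forall>v\<in>V. col (\<phi> v) = v}) * F \<phi>)"
      by (intro sum.cong refl) (simp add: sum.inter_filter[OF finCol, symmetric])
    also have "\<dots> = (\<Sum>\<phi>\<in>V \<rightarrow>\<^sub>E {..<N}. if inj_on \<phi> V then of_nat (m ^ (N - m)) * F \<phi> else 0)"
      by (intro sum.cong refl) (simp add: fibre)
    also have "\<dots> = of_nat (m ^ (N - m)) * (\<Sum>\<phi>\<in>inj_maps V N. F \<phi>)"
      unfolding inj_maps_def sum_distrib_left by (rule sum.inter_filter[symmetric, OF finA])
    finally have eq: "of_nat (m ^ (N - m)) * (\<Sum>\<phi>\<in>inj_maps V N. F \<phi>) = (\<Sum>col\<in>Col. \<Sum>\<phi>\<in>PiE V (S col). F \<phi>)" ..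
    have "real (m ^ (N - m)) * cmod (\<Sum>\<phi>\<in>inj_maps V N. F \<phi>) = cmod (\<Sum>col\<in>Col. \<Sum>\<phi>\<in>PiE V (S col). F \<phi>)"
      unfolding eq[symmetric] norm_mult by (simp only: norm_of_nat)
    also have "\<dots> \<le> real (card Col) * C"
      by (rule sum_norm_bound) (rule C, auto simp: S_def)
    also have "card Col = m ^ (N - m) * m ^ m"
      using mN by (simp add: Col_def card_PiE m_def flip: power_add)
    finally have "real (m ^ (N - m)) * cmod (\<Sum>\<phi>\<in>inj_maps V N. F \<phi>) \<le> real (m ^ (N - m)) * (real m ^ m * C)"
      by (simp add: mult.assoc)
    then show ?thesis using 3(1) by (simp add: m_def)
  qed
qed

section \<open>Coincidence patterns of index sequences\<close>

definition surj_maps :: "nat \<Rightarrow> nat \<Rightarrow> (nat \<Rightarrow> nat) set" where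
  "surj_maps n m = {g \<in> {..<n} \<rightarrow>\<^sub>E {..<m}. g ` {..<n} = {..<m}}"

lemma finite_surj_maps: "finite (surj_maps n m)"
  unfolding surj_maps_def by (rule finite_subset[of _ "{..<n} \<rightarrow>\<^sub>E {..<m}"]) (auto intro: finite_PiE)

lemma card_surj_maps_le: "card (surj_maps n m) \<le> m ^ n"
proof -
  have "card (surj_maps n m) \<le> card ({..<n} \<rightarrow>\<^sub>E {..<m})"
    unfolding surj_maps_def by (intro card_mono) (auto intro: finite_PiE)
  then show ?thesis by (simp add: card_PiE)
qed

text \<open>Every map \<open>f\<close> factors as an injective map after a surjective one; the \<open>fact m\<close> factorisations
  correspond to the enumerations of the range of \<open>f\<close>.\<close>

lemma sum_by_pattern:
  fixes G :: "(nat \<Rightarrow> nat) \<Rightarrow> complex"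
  assumes n: "n \<ge> 1"
  shows "(\<Sum>f\<in>{..<n} \<rightarrow>\<^sub>E {..<N}. G f)
    = (\<Sum>m=1..n. (\<Sum>g\<in>surj_maps n m. \<Sum>\<phi>\<in>inj_maps {..<m} N. G (compose {..<n} \<phi> g)) / fact m)"
proof -
  define F where "F m = {f \<in> {..<n} \<rightarrow>\<^sub>E {..<N}. card (f ` {..<n}) = m}" for m
  have finF: "finite ({..<n} \<rightarrow>\<^sub>E {..<N})" by (auto intro: finite_PiE)
  have "(\<Sum>f\<in>{..<n} \<rightarrow>\<^sub>E {..<N}. G f) = (\<Sum>m\<in>{1..n}. \<Sum>f\<in>F m. G f)"
    unfolding F_def
  proof (rule sum.group[symmetric, OF finF])
    show "(\<lambda>f. card (f ` {..<n})) ` ({..<n} \<rightarrow>\<^sub>E {..<N}) \<subseteq> {1..n}"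
    proof
      fix c assume "c \<in> (\<lambda>f. card (f ` {..<n})) ` ({..<n} \<rightarrow>\<^sub>E {..<N})"
      then obtain f :: "nat \<Rightarrow> nat" where f: "c = card (f ` {..<n})" by auto
      have "card (f ` {..<n}) \<le> n" using card_image_le[of "{..<n}" f] by simp
      moreover have "1 \<le> card (f ` {..<n})"
        using n by (simp add: Suc_le_eq card_gt_0_iff lessThan_empty_iff)
      ultimately show "c \<in> {1..n}" using f by auto
    qed
  qed simp
  also have "\<dots> = (\<Sum>m=1..n. (\<Sum>g\<in>surj_maps n m. \<Sum>\<phi>\<in>inj_maps {..<m} N. G (compose {..<n} \<phi> g)) / fact m)"
  proof (rule sum.cong[OF refl])
    fix m assume "m \<in> {1..n}"
    let ?P = "surj_maps n m \<times> inj_maps {..<m} N"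
    let ?h = "\<lambda>p. compose {..<n} (snd p) (fst p)"
    have finP: "finite ?P" by (simp add: finite_surj_maps finite_inj_maps)
    have finFm: "finite (F m)" using finF by (simp add: F_def)
    have h: "?h ` ?P \<subseteq> F m"
    proof
      fix f assume "f \<in> ?h ` ?P"
      then obtain g \<phi> where g: "g \<in> surj_maps n m" and \<phi>: "\<phi> \<in> inj_maps {..<m} N" and f: "f = compose {..<n} \<phi> g"
        by auto
      have "f ` {..<n} = \<phi> ` (g ` {..<n})" by (auto simp: f compose_def)
      also have "\<dots> = \<phi> ` {..<m}" using g by (simp add: surj_maps_def)
      finally have "card (f ` {..<n}) = m" using \<phi> by (simp add: inj_maps_def card_image)
      moreover have "f \<in> {..<n} \<rightarrow>\<^sub>E {..<N}"
        using g \<phi> by (auto simp: f compose_def surj_maps_def inj_maps_def PiE_iff)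
      ultimately show "f \<in> F m" by (simp add: F_def)
    qed
    have fibre: "card {p \<in> ?P. ?h p = f} = fact m" if f: "f \<in> F m" for f
    proof -
      have fE: "f \<in> {..<n} \<rightarrow>\<^sub>E {..<N}" and cf: "card (f ` {..<n}) = m" using f by (auto simp: F_def)
      let ?B = "{\<phi> \<in> {..<m} \<rightarrow>\<^sub>E f ` {..<n}. inj_on \<phi> {..<m}}"
      have B_im: "\<phi> ` {..<m} = f ` {..<n}" if "\<phi> \<in> ?B" for \<phi>
      proof (rule card_subset_eq)
        show "\<phi> ` {..<m} \<subseteq> f ` {..<n}" using that by auto
        show "card (\<phi> ` {..<m}) = card (f ` {..<n})" using that cf by (simp add: card_image)
      qed simp
      have "bij_betw snd {p \<in> ?P. ?h p = f} ?B"
      proof (rule bij_betwI[where g = "\<lambda>\<phi>. (restrict (\<lambda>l. inv_into {..<m} \<phi> (f l)) {..<n}, \<phi>)"])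
        show "snd \<in> {p \<in> ?P. ?h p = f} \<rightarrow> ?B"
        proof
          fix p assume "p \<in> {p \<in> ?P. ?h p = f}"
          then obtain g \<phi> where p: "p = (g, \<phi>)" and g: "g \<in> surj_maps n m" and \<phi>: "\<phi> \<in> inj_maps {..<m} N"
            and fc: "compose {..<n} \<phi> g = f" by auto
          have "\<phi> ` {..<m} = \<phi> ` (g ` {..<n})" using g by (simp add: surj_maps_def)
          also have "\<dots> = f ` {..<n}" by (auto simp: fc[symmetric] compose_def)
          finally show "snd p \<in> ?B" using \<phi> by (auto simp: p inj_maps_def PiE_iff)
        qed
        show "(\<lambda>\<phi>. (restrict (\<lambda>l. inv_into {..<m} \<phi> (f l)) {..<n}, \<phi>)) \<in> ?B \<rightarrow> {p \<in> ?P. ?h p = f}"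
        proof
          fix \<phi> assume \<phi>: "\<phi> \<in> ?B"
          note im = B_im[OF \<phi>]
          define g where "g = restrict (\<lambda>l. inv_into {..<m} \<phi> (f l)) {..<n}"
          have gl: "g l < m" "\<phi> (g l) = f l" if "l < n" for l
            using inv_into_into[of "f l" \<phi> "{..<m}"] f_inv_into_f[of "f l" \<phi> "{..<m}"] that im
            by (auto simp: g_def)
          have "g ` {..<n} = {..<m}"
          proof
            show "g ` {..<n} \<subseteq> {..<m}" using gl by auto
            show "{..<m} \<subseteq> g ` {..<n}"
            proof
              fix j assume j: "j \<in> {..<m}"
              then have "\<phi> j \<in> f ` {..<n}" using im by auto
              then obtain l where l: "l < n" "\<phi> j = f l" by auto
              have "g l = inv_into {..<m} \<phi> (\<phi> j)" using l(1) by (simp add: g_def l(2))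
              also have "\<dots> = j" using \<phi> j by (intro inv_into_f_f) auto
              finally show "j \<in> g ` {..<n}" using l(1) by (intro image_eqI[of j g l]) auto
            qed
          qed
          then have "g \<in> surj_maps n m" using gl by (auto simp: surj_maps_def g_def PiE_iff)
          moreover have "\<phi> \<in> inj_maps {..<m} N"
          proof -
            have "f ` {..<n} \<subseteq> {..<N}" using fE by auto
            then have "({..<m} \<rightarrow>\<^sub>E f ` {..<n}) \<subseteq> ({..<m} \<rightarrow>\<^sub>E {..<N})" by (intro PiE_mono)
            then show ?thesis using \<phi> unfolding inj_maps_def by blast
          qed
          moreover have "compose {..<n} \<phi> g = f"
            using gl fE by (auto simp: compose_def fun_eq_iff PiE_iff extensional_def)
          ultimately show "(restrict (\<lambda>l. inv_into {..<m} \<phi> (f l)) {..<n}, \<phi>) \<in> {p \<in> ?P. ?h p = f}"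
            by (simp add: g_def[symmetric])
        qed
        show "(restrict (\<lambda>l. inv_into {..<m} (snd p) (f l)) {..<n}, snd p) = p" if p0: "p \<in> {p \<in> ?P. ?h p = f}" for p
        proof -
          obtain g \<phi> where p: "p = (g, \<phi>)" and g: "g \<in> surj_maps n m" and \<phi>: "\<phi> \<in> inj_maps {..<m} N"
            and fc: "compose {..<n} \<phi> g = f" using p0 by auto
          have "restrict (\<lambda>l. inv_into {..<m} \<phi> (f l)) {..<n} = g"
          proof
            fix l
            show "restrict (\<lambda>l. inv_into {..<m} \<phi> (f l)) {..<n} l = g l"
              using g \<phi> by (auto simp: fc[symmetric] compose_def surj_maps_def inj_maps_def PiE_iff extensional_def)
          qed
          then show ?thesis by (simp add: p)
        qed
      qed simp
      then have "card {p \<in> ?P. ?h p = f} = card ?B" by (rule bij_betw_same_card)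
      also have "\<dots> = (\<Prod>i<m. m - i)" using card_inj_PiE[of "{..<m}" "f ` {..<n}"] cf by simp
      also have "\<dots> = fact m" by (simp add: fact_prod_rev atLeast0LessThan)
      finally show ?thesis .
    qed
    have "(\<Sum>g\<in>surj_maps n m. \<Sum>\<phi>\<in>inj_maps {..<m} N. G (compose {..<n} \<phi> g)) = (\<Sum>p\<in>?P. G (?h p))"
      by (simp add: sum.cartesian_product case_prod_unfold)
    also have "\<dots> = (\<Sum>f\<in>F m. \<Sum>p\<in>{p \<in> ?P. ?h p = f}. G (?h p))"
      by (rule sum.group[symmetric, OF finP finFm h])
    also have "\<dots> = (\<Sum>f\<in>F m. \<Sum>p\<in>{p \<in> ?P. ?h p = f}. G f)"
      by (intro sum.cong refl) auto
    also have "\<dots> = (\<Sum>f\<in>F m. fact m * G f)"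
      by (intro sum.cong refl) (simp only: sum_constant fibre of_nat_fact)
    finally show "(\<Sum>f\<in>F m. G f) = (\<Sum>g\<in>surj_maps n m. \<Sum>\<phi>\<in>inj_maps {..<m} N. G (compose {..<n} \<phi> g)) / fact m"
      by (simp add: sum_distrib_left[symmetric])
  qed
  finally show ?thesis .
qed

section \<open>Traces of words\<close>

fun word_entry :: "nat \<Rightarrow> (sym \<Rightarrow> nat \<Rightarrow> nat \<Rightarrow> complex) \<Rightarrow> sym list \<Rightarrow> nat \<Rightarrow> nat \<Rightarrow> complex" where
  "word_entry N X [] i j = (if i = j then 1 else 0)"
| "word_entry N X (s # w) i j = (\<Sum>k<N. X s i k * word_entry N X w k j)"

definition word_trace :: "nat \<Rightarrow> (sym \<Rightarrow> nat \<Rightarrow> nat \<Rightarrow> complex) \<Rightarrow> sym list \<Rightarrow> complex" where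
  "word_trace N X w = (\<Sum>i<N. word_entry N X w i i)"

lemma word_entry_append:
  assumes "i < N"
  shows "word_entry N X (u @ w) i j = (\<Sum>k<N. word_entry N X u i k * word_entry N X w k j)"
  using assms
proof (induction u arbitrary: i)
  case Nil
  then show ?case by (simp add: if_distrib[of "\<lambda>y. y * _"] cong: if_cong)
next
  case (Cons s u)
  have "word_entry N X ((s # u) @ w) i j
      = (\<Sum>k<N. \<Sum>l<N. X s i k * (word_entry N X u k l * word_entry N X w l j))"
    using Cons.IH by (simp add: sum_distrib_left)
  also have "\<dots> = (\<Sum>l<N. \<Sum>k<N. X s i k * (word_entry N X u k l * word_entry N X w l j))"
    by (rule sum.swap)
  finally show ?case by (simp add: sum_distrib_right mult.assoc)
qed

lemma word_trace_append:
  "word_trace N X (u @ w) = (\<Sum>i<N. \<Sum>k<N. word_entry N X u i k * word_entry N X w k i)"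
  by (simp add: word_trace_def word_entry_append)

lemma word_trace_rotate: "word_trace N X (u @ w) = word_trace N X (w @ u)"
  unfolding word_trace_append by (subst sum.swap) (simp add: mult.commute)

definition word_norm_sq :: "nat \<Rightarrow> (sym \<Rightarrow> nat \<Rightarrow> nat \<Rightarrow> complex) \<Rightarrow> sym list \<Rightarrow> real" where
  "word_norm_sq N X w = (\<Sum>i<N. \<Sum>k<N. (cmod (word_entry N X w i k))\<^sup>2)"

lemma word_norm_sq_nonneg: "0 \<le> word_norm_sq N X w"
  unfolding word_norm_sq_def by (intro sum_nonneg) auto

context hermitian_pair
begin

lemma word_entry_rev: "i < N \<Longrightarrow> j < N \<Longrightarrow> word_entry N X (rev w) i j = cnj (word_entry N X w j i)"
proof (induction w arbitrary: i j)
  case (Cons s w)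
  have "word_entry N X (rev (s # w)) i j = (\<Sum>k<N. word_entry N X (rev w) i k * X s k j)"
    using Cons.prems by (simp add: word_entry_append if_distrib[of "\<lambda>y. _ * y"] cong: if_cong)
  also have "\<dots> = (\<Sum>k<N. cnj (word_entry N X w k i) * cnj (X s j k))"
  proof (rule sum.cong[OF refl])
    fix k assume "k \<in> {..<N}"
    then show "word_entry N X (rev w) i k * X s k j = cnj (word_entry N X w k i) * cnj (X s j k)"
      using Cons.IH[of i k] X_herm[of k j s] Cons.prems by simp
  qed
  finally show ?case by (simp add: mult.commute)
qed auto

lemma word_trace_self: "word_trace N X (w @ rev w) = of_real (word_norm_sq N X w)"
  unfolding word_trace_append word_norm_sq_def of_real_sum
  by (intro sum.cong refl) (simp add: word_entry_rev complex_norm_square[symmetric] del: of_real_power)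

lemma word_trace_Cauchy_Schwarz:
  "(cmod (word_trace N X (u @ w)))\<^sup>2 \<le> cmod (word_trace N X (u @ rev u)) * cmod (word_trace N X (w @ rev w))"
proof -
  let ?I = "{..<N} \<times> {..<N}"
  have "cmod (word_trace N X (u @ w)) \<le> (\<Sum>p\<in>?I. cmod (word_entry N X u (fst p) (snd p)) * cmod (word_entry N X w (snd p) (fst p)))"
    unfolding word_trace_append sum.cartesian_product
    by (rule order_trans[OF norm_sum]) (simp add: norm_mult case_prod_unfold)
  then have "(cmod (word_trace N X (u @ w)))\<^sup>2 \<le> (\<Sum>p\<in>?I. cmod (word_entry N X u (fst p) (snd p)) * cmod (word_entry N X w (snd p) (fst p)))\<^sup>2"
    by (intro power_mono) auto
  also have "\<dots> \<le> (\<Sum>p\<in>?I. (cmod (word_entry N X u (fst p) (snd p)))\<^sup>2) * (\<Sum>p\<in>?I. (cmod (word_entry N X w (snd p) (fst p)))\<^sup>2)"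
    by (rule Cauchy_Schwarz_ineq_sum)
  also have "(\<Sum>p\<in>?I. (cmod (word_entry N X u (fst p) (snd p)))\<^sup>2) = word_norm_sq N X u"
    by (simp add: word_norm_sq_def sum.cartesian_product case_prod_unfold)
  also have "(\<Sum>p\<in>?I. (cmod (word_entry N X w (snd p) (fst p)))\<^sup>2) = word_norm_sq N X w"
  proof -
    have "(\<Sum>p\<in>?I. (cmod (word_entry N X w (snd p) (fst p)))\<^sup>2) = (\<Sum>k<N. \<Sum>i<N. (cmod (word_entry N X w i k))\<^sup>2)"
      by (simp add: sum.cartesian_product case_prod_unfold)
    also have "\<dots> = (\<Sum>i<N. \<Sum>k<N. (cmod (word_entry N X w i k))\<^sup>2)" by (rule sum.swap)
    finally show ?thesis by (simp add: word_norm_sq_def)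
  qed
  finally show ?thesis by (simp add: word_trace_self word_norm_sq_nonneg)
qed

text \<open>A word of maximal trace whose initial run is as long as possible is constant: by the
  Cauchy-Schwarz inequality, reflecting a half word that ends with the run again gives a word of
  maximal trace, with a run of twice the length.\<close>

lemma word_trace_le_powers:
  assumes K: "K \<ge> 1" and w: "length w = 2 * K"
  shows "cmod (word_trace N X w) \<le> word_norm_sq N X (replicate K SymA) + word_norm_sq N X (replicate K SymB)"
proof -
  define W where "W = {w :: sym list. length w = 2 * K}"
  define \<mu> where "\<mu> = Max ((\<lambda>w. cmod (word_trace N X w)) ` W)"
  have W_eq: "W = {w. set w \<subseteq> UNIV \<and> length w = 2 * K}" by (simp add: W_def)
  have finW: "finite W" unfolding W_eq by (rule finite_lists_length_eq) (rule finite_UNIV_sym)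
  have wW: "w \<in> W" using w by (simp add: W_def)
  have le: "cmod (word_trace N X v) \<le> \<mu>" if "v \<in> W" for v
    unfolding \<mu>_def using finW that by (intro Max_ge) auto
  have "\<mu> \<in> (\<lambda>w. cmod (word_trace N X w)) ` W"
    unfolding \<mu>_def using finW wW by (intro Max_in) auto
  then obtain w0 where w0: "w0 \<in> W" "cmod (word_trace N X w0) = \<mu>" by auto
  \<comment> \<open>The maximal value cannot exceed the geometric mean of the two reflected values,
    so both reflected halves are maximal again.\<close>
  have reflect: "cmod (word_trace N X (u @ rev u)) = \<mu>"
    if "length u = K" "length v = K" "cmod (word_trace N X (u @ v)) = \<mu>" for u v
  proof -
    have 1: "cmod (word_trace N X (u @ rev u)) \<le> \<mu>" "cmod (word_trace N X (v @ rev v)) \<le> \<mu>"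
      using le[of "u @ rev u"] le[of "v @ rev v"] that(1,2) by (simp_all add: W_def)
    have "\<mu> * \<mu> \<le> cmod (word_trace N X (u @ rev u)) * cmod (word_trace N X (v @ rev v))"
      using word_trace_Cauchy_Schwarz[of u v] that(3) by (simp add: power2_eq_square)
    also have "\<dots> \<le> cmod (word_trace N X (u @ rev u)) * \<mu>"
      using 1 by (intro mult_left_mono) auto
    finally have "\<mu> * \<mu> \<le> cmod (word_trace N X (u @ rev u)) * \<mu>" .
    moreover have "0 \<le> \<mu>" using w0 by auto
    ultimately show ?thesis using 1 by (cases "\<mu> = 0") auto
  qed
  define has_run where "has_run r \<longleftrightarrow> (\<exists>s y. length (replicate r s @ y) = 2 * K \<and> cmod (word_trace N X (replicate r s @ y)) = \<mu>)" for r
  have "has_run 1"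
  proof -
    obtain s y where "w0 = s # y" using w0(1) K by (cases w0) (auto simp: W_def)
    then show ?thesis using w0 unfolding has_run_def W_def by (intro exI[of _ s] exI[of _ y]) auto
  qed
  moreover have "\<forall>r. has_run r \<longrightarrow> r \<le> 2 * K" by (auto simp: has_run_def)
  ultimately obtain r where r: "has_run r" "\<And>r'. has_run r' \<Longrightarrow> r' \<le> r"
    using Nat.ex_has_greatest_nat[of has_run 1 "2 * K"] by blast
  have r1: "1 \<le> r" using r(2)[OF \<open>has_run 1\<close>] .
  obtain s y where sy: "length (replicate r s @ y) = 2 * K" "cmod (word_trace N X (replicate r s @ y)) = \<mu>"
    using r(1) by (auto simp: has_run_def)
  have full: "has_run (2 * K) \<Longrightarrow> ?thesis"
  proof -
    assume "has_run (2 * K)"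
    then obtain t y' where t: "length (replicate (2 * K) t @ y') = 2 * K" "cmod (word_trace N X (replicate (2 * K) t @ y')) = \<mu>"
      unfolding has_run_def by blast
    then have "y' = []" by simp
    moreover have "replicate (2 * K) t = replicate K t @ rev (replicate K t)"
      by (simp add: mult_2 replicate_add)
    ultimately have "\<mu> = word_norm_sq N X (replicate K t)"
      using t(2) by (simp only: append_Nil2 word_trace_self norm_of_real) (simp add: word_norm_sq_nonneg)
    then show ?thesis using le[OF wW] word_norm_sq_nonneg[of N X "replicate K SymA"]
      word_norm_sq_nonneg[of N X "replicate K SymB"] by (cases t) auto
  qed
  show ?thesis
  proof (cases "r \<le> K")
    case True
    define y1 y2 where "y1 = take K y" and "y2 = drop K y"
    have y: "y = y1 @ y2" "length y1 = K" "length y2 = K - r" using sy(1) True by (auto simp: y1_def y2_def)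
    have "word_trace N X (replicate r s @ y) = word_trace N X ((y2 @ replicate r s) @ y1)"
      using word_trace_rotate[of N X "replicate r s @ y1" y2] by (simp add: y(1))
    then have "cmod (word_trace N X ((y2 @ replicate r s) @ rev (y2 @ replicate r s))) = \<mu>"
      using sy(2) y True by (intro reflect[of _ y1]) auto
    moreover have "word_trace N X ((y2 @ replicate r s) @ rev (y2 @ replicate r s))
        = word_trace N X (replicate (2 * r) s @ rev y2 @ y2)"
      using word_trace_rotate[of N X y2 "replicate r s @ rev (y2 @ replicate r s)"]
      by (simp add: mult_2 replicate_add)
    ultimately have "has_run (2 * r)" unfolding has_run_def
      using y True by (intro exI[of _ s] exI[of _ "rev y2 @ y2"]) auto
    then show ?thesis using r(2)[of "2 * r"] r1 by simp
  next
    case False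
    \<comment> \<open>The run fills the first half, so reflecting that half yields a constant
      word.\<close>
    then have "replicate r s @ y = replicate K s @ (replicate (r - K) s @ y)"
      by (metis append.assoc le_add_diff_inverse linorder_le_cases replicate_add)
    then have "cmod (word_trace N X (replicate K s @ rev (replicate K s))) = \<mu>"
      using sy False by (intro reflect[of _ "replicate (r - K) s @ y"]) auto
    then have "has_run (2 * K)" unfolding has_run_def
      by (intro exI[of _ s] exI[of _ "[]"]) (simp add: mult_2 replicate_add)
    then show ?thesis by (rule full)
  qed
qed

lemma sum_lists_Suc:
  "(\<Sum>w\<in>{w :: sym list. length w = Suc n}. F w) = (\<Sum>s\<in>UNIV. \<Sum>w\<in>{w. length w = n}. F (s # w))"
proof -
  have "(\<Sum>w\<in>{w :: sym list. length w = Suc n}. F w) = (\<Sum>(s, w)\<in>UNIV \<times> {w. length w = n}. F (s # w))"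
    by (rule sum.reindex_bij_witness[of _ "\<lambda>(s, w). s # w" "\<lambda>w. (hd w, tl w)"])
      (auto simp: length_Suc_conv)
  then show ?thesis by (simp add: sum.cartesian_product)
qed

lemma iter_sum_words:
  assumes "i < N" "j < N"
  shows "(S.ap ^^ n) (delta i) j = (\<Sum>w\<in>{w. length w = n}. word_entry N X w j i)"
  using assms(2)
proof (induction n arbitrary: j)
  case 0
  then show ?case by (simp add: delta_def)
next
  case (Suc n)
  have "(S.ap ^^ Suc n) (delta i) j = (\<Sum>k<N. sum_kernel N X j k * (S.ap ^^ n) (delta i) k)"
    by (simp add: S.ap_def)
  also have "\<dots> = (\<Sum>k<N. \<Sum>s\<in>UNIV. \<Sum>w\<in>{w. length w = n}. X s j k * word_entry N X w k i)"
    using Suc.prems by (intro sum.cong refl, subst Suc.IH) (auto simp: sum_kernel_def sum_product)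
  also have "\<dots> = (\<Sum>s\<in>UNIV. \<Sum>k<N. \<Sum>w\<in>{w. length w = n}. X s j k * word_entry N X w k i)"
    by (rule sum.swap)
  also have "\<dots> = (\<Sum>s\<in>UNIV. \<Sum>w\<in>{w. length w = n}. \<Sum>k<N. X s j k * word_entry N X w k i)"
    by (intro sum.cong refl) (rule sum.swap)
  finally show ?case by (simp add: sum_lists_Suc)
qed

lemma card_words: "card {w :: sym list. length w = n} = 2 ^ n"
proof -
  have "card (UNIV :: sym set) = 2" by (simp add: UNIV_sym)
  then show ?thesis using card_lists_length_eq[OF finite_UNIV_sym, of n] by simp
qed

text \<open>The 4 ^ K words of length 2 * K are bounded one by one; this is where 4 * C in the
  radius comes from.\<close>

lemma moment_sum_le:
  assumes K: "K \<ge> 1"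
  shows "(\<Sum>i<N. Re ((S.ap ^^ (2 * K)) (delta i) i))
    \<le> 4 ^ K * (word_norm_sq N X (replicate K SymA) + word_norm_sq N X (replicate K SymB))"
proof -
  have "(\<Sum>i<N. (S.ap ^^ (2 * K)) (delta i) i) = (\<Sum>i<N. \<Sum>w\<in>{w. length w = 2 * K}. word_entry N X w i i)"
    by (simp add: iter_sum_words)
  also have "\<dots> = (\<Sum>w\<in>{w. length w = 2 * K}. word_trace N X w)"
    unfolding word_trace_def by (rule sum.swap)
  finally have "(\<Sum>i<N. Re ((S.ap ^^ (2 * K)) (delta i) i)) = Re (\<Sum>w\<in>{w. length w = 2 * K}. word_trace N X w)"
    by (metis Re_sum)
  also have "\<dots> \<le> (\<Sum>w\<in>{w. length w = 2 * K}. cmod (word_trace N X w))"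
    by (rule order_trans[OF complex_Re_le_cmod norm_sum])
  also have "\<dots> \<le> of_nat (card {w :: sym list. length w = 2 * K}) *
      (word_norm_sq N X (replicate K SymA) + word_norm_sq N X (replicate K SymB))"
    by (rule sum_bounded_above) (use word_trace_le_powers[OF K] in auto)
  finally show ?thesis by (simp add: card_words power_mult)
qed

end

text \<open>The interpolation u j <= u 0 powr (1 - j / M) * u M powr (j / M), written without roots
  so that zero values need no separate convention.\<close>

lemma log_convex_power:
  fixes u :: "nat \<Rightarrow> real"
  assumes u: "\<And>j. 0 \<le> u j" and convex: "\<And>j. (u (Suc j))\<^sup>2 \<le> u j * u (Suc (Suc j))"
    and jM: "j \<le> M"
  shows "u j ^ M \<le> u 0 ^ (M - j) * u M ^ j"
proof -
  have step: "u j ^ Suc j \<le> u 0 * u (Suc j) ^ j" for j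
  proof (induction j)
    case (Suc j)
    show ?case
    proof (cases "u (Suc j) = 0")
      case False
      then have pos: "0 < u (Suc j)" using u[of "Suc j"] by simp
      have "u (Suc j) ^ j * u (Suc j) ^ Suc (Suc j) = ((u (Suc j))\<^sup>2) ^ Suc j"
        by (simp add: power_mult[symmetric] power_add[symmetric] mult_2)
      also have "\<dots> \<le> (u j * u (Suc (Suc j))) ^ Suc j" by (intro power_mono convex) auto
      also have "\<dots> = u j ^ Suc j * u (Suc (Suc j)) ^ Suc j" by (simp add: power_mult_distrib)
      also have "\<dots> \<le> (u 0 * u (Suc j) ^ j) * u (Suc (Suc j)) ^ Suc j"
        using Suc u by (intro mult_right_mono) auto
      finally have "u (Suc j) ^ j * u (Suc j) ^ Suc (Suc j) \<le> u (Suc j) ^ j * (u 0 * u (Suc (Suc j)) ^ Suc j)"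
        by (simp add: mult_ac)
      then show ?thesis using pos by (simp only: mult_le_cancel_left_pos zero_less_power)
    qed (use u in auto)
  qed simp
  show ?thesis using jM
  proof (induction M)
    case (Suc M)
    show ?case
    proof (cases "j = Suc M")
      case False
      then have jM: "j \<le> M" using Suc by simp
      show ?thesis
      proof (cases "M = 0")
        case True
        then show ?thesis using jM by simp
      next
        case M0: False
        \<comment> \<open>Raised to the power M, the induction hypothesis and \<open>step\<close> at
          M combine with integer exponents; the power is removed at the end.\<close>
        have "(u j ^ Suc M) ^ M = (u j ^ M) ^ Suc M" by (simp only: power_mult[symmetric] mult.commute)
        also have "\<dots> \<le> (u 0 ^ (M - j) * u M ^ j) ^ Suc M" using Suc.IH[OF jM] u by (intro power_mono) auto
        also have "\<dots> = u 0 ^ ((M - j) * Suc M) * (u M ^ Suc M) ^ j"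
          by (simp only: power_mult_distrib power_mult[symmetric] mult.commute)
        also have "\<dots> \<le> u 0 ^ ((M - j) * Suc M) * (u 0 * u (Suc M) ^ M) ^ j"
          using u by (intro mult_left_mono power_mono step) auto
        also have "\<dots> = u 0 ^ ((M - j) * Suc M + j) * u (Suc M) ^ (M * j)"
          by (simp add: power_mult_distrib power_mult power_add)
        also have "(M - j) * Suc M + j = (Suc M - j) * M"
          using jM by (auto simp: le_iff_add algebra_simps)
        also have "u 0 ^ ((Suc M - j) * M) * u (Suc M) ^ (M * j) = (u 0 ^ (Suc M - j) * u (Suc M) ^ j) ^ M"
          by (simp only: power_mult_distrib power_mult[symmetric] mult.commute)
        finally have "(u j ^ Suc M) ^ M \<le> (u 0 ^ (Suc M - j) * u (Suc M) ^ j) ^ M" .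
        moreover have "0 \<le> u j ^ Suc M" "0 \<le> u 0 ^ (Suc M - j) * u (Suc M) ^ j" using u by auto
        moreover have "0 < M" using M0 by simp
        ultimately show ?thesis by (metis power_mono_iff)
      qed
    qed simp
  qed simp
qed

lemma (in hermitian_kernel) iter_log_convex:
  assumes "square_summable v" "j \<le> M"
  shows "sqrt (l2_sq ((ap ^^ j) v)) ^ M \<le> sqrt (l2_sq v) ^ (M - j) * sqrt (l2_sq ((ap ^^ M) v)) ^ j"
proof -
  define u where "u j = sqrt (l2_sq ((ap ^^ j) v))" for j
  have "u j ^ M \<le> u 0 ^ (M - j) * u M ^ j"
  proof (rule log_convex_power)
    fix j
    have "of_real (l2_sq ((ap ^^ Suc j) v)) = l2_ip (ap ((ap ^^ j) v)) ((ap ^^ Suc j) v)"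
      using l2_ip_self[OF iter_l2[OF assms(1), of "Suc j"]] by simp
    also have "\<dots> = l2_ip ((ap ^^ j) v) ((ap ^^ Suc (Suc j)) v)"
      using ap_symmetric[OF iter_l2[OF assms(1)] iter_l2[OF assms(1)], of j "Suc j"] by simp
    finally have "l2_sq ((ap ^^ Suc j) v) = cmod (l2_ip ((ap ^^ j) v) ((ap ^^ Suc (Suc j)) v))"
      by (metis abs_of_nonneg l2_sq_nonneg norm_of_real)
    then show "(u (Suc j))\<^sup>2 \<le> u j * u (Suc (Suc j))"
      using l2_Cauchy_Schwarz[OF iter_l2[OF assms(1)] iter_l2[OF assms(1)], of j "Suc (Suc j)"]
      by (simp add: u_def)
  qed (use assms in \<open>auto simp: u_def\<close>)
  then show ?thesis by (simp add: u_def)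
qed

section \<open>Words of a single letter and doubled walks\<close>

lemma l2_sq_nat: "(\<And>i. i \<ge> N \<Longrightarrow> f i = 0) \<Longrightarrow> l2_sq f = (\<Sum>i<N. (cmod (f i))\<^sup>2)" for f :: "nat \<Rightarrow> complex"
proof -
  assume f: "\<And>i. i \<ge> N \<Longrightarrow> f i = 0"
  have "l2_sq f = (\<Sum>\<^sub>\<infinity>i\<in>{..<N}. (cmod (f i))\<^sup>2)"
    unfolding l2_sq_def by (rule infsum_cong_neutral) (use f in auto)
  then show ?thesis by simp
qed

text \<open>A concave power lies below its tangent at \<open>\<kappa>\<close>. Being affine in
  \<open>x\<close>, the bound can be averaged directly, which takes the place of Jensen's
  inequality.\<close>

lemma Bernoulli_powr:
  fixes x \<kappa> \<theta> :: real
  assumes "0 \<le> x" "0 < \<kappa>" "0 \<le> \<theta>" "\<theta> \<le> 1"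
  shows "x powr \<theta> \<le> \<kappa> powr \<theta> * (1 + \<theta> * (x / \<kappa> - 1))"
proof -
  have "(x / \<kappa>) powr \<theta> \<le> 1 + \<theta> * (x / \<kappa> - 1)"
  proof (cases "x = 0")
    case False
    define y where "y = x / \<kappa>"
    have y: "0 < y" using assms False by (simp add: y_def)
    have "y powr \<theta> * 1 powr (1 - \<theta>) \<le> \<theta> * y + (1 - \<theta>) * 1"
      using y assms by (intro Youngs_inequality_0) auto
    then show ?thesis unfolding y_def by (simp add: algebra_simps)
  qed (use assms in auto)
  then have "\<kappa> powr \<theta> * (x / \<kappa>) powr \<theta> \<le> \<kappa> powr \<theta> * (1 + \<theta> * (x / \<kappa> - 1))"
    by (intro mult_left_mono) auto
  then show ?thesis using assms by (simp add: powr_divide)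
qed

text \<open>An M-th root is taken. The second alternative is forced by the convention 0 powr 0 =
  0.\<close>

lemma powr_le_of_power_le:
  fixes x y :: real
  assumes "0 \<le> x" "0 \<le> y" "M \<ge> 1" "y ^ M \<le> x ^ K"
  shows "y \<le> x powr (real K / real M) \<or> (x = 0 \<and> K = 0)"
proof (cases "x = 0")
  case True
  show ?thesis
  proof (cases "K = 0")
    case False
    then have "y ^ M \<le> 0" using assms(4) True by (simp add: power_0_left)
    moreover have "0 \<le> y ^ M" using assms(2) by simp
    ultimately have "y ^ M = 0" by linarith
    then show ?thesis by simp
  qed (use True in simp)
next
  case False
  show ?thesis
  proof (cases "y = 0")
    case y: False
    have "(y ^ M) powr (1 / M) \<le> (x ^ K) powr (1 / M)" using assms by (intro powr_mono2) auto
    then show ?thesis using assms False y by (simp add: powr_realpow[symmetric] powr_powr)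
  qed simp
qed

context hermitian_pair
begin

text \<open>The other letter is set to zero, so that the sum kernel is one Hermitian matrix and all
  facts on kernels apply to it.\<close>

abbreviation single :: "sym \<Rightarrow> sym \<Rightarrow> nat \<Rightarrow> nat \<Rightarrow> complex" where
  "single s \<equiv> \<lambda>s' i j. if s' = s then X s i j else 0"

lemma single_pair: "hermitian_pair N x (single s)"
proof
  show "single s s' i j = cnj (single s s' j i)" if "i < N" "j < N" for i j s'
    using X_herm[OF that, of s] by auto
qed (rule xN)

lemma single_kernel: "sum_kernel N (single s) i j = (if i < N \<and> j < N then X s i j else 0)"
  by (cases s) (auto simp: sum_kernel_def UNIV_sym)

lemma single_iter:
  assumes "j < N"
  shows "(hermitian_kernel.ap (sum_kernel N (single s)) (\<lambda>_. {..<N}) ^^ n) v j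
       = (\<Sum>k<N. word_entry N X (replicate n s) j k * v k)"
proof -
  interpret s: hermitian_pair N x "single s" by (rule single_pair)
  show ?thesis using assms
  proof (induction n arbitrary: j)
    case 0
    then show ?case by (simp add: if_distrib[of "\<lambda>y. y * _"] cong: if_cong)
  next
    case (Suc n)
    have "(s.S.ap ^^ Suc n) v j = (\<Sum>l<N. X s j l * (s.S.ap ^^ n) v l)"
      using Suc.prems by (simp add: s.S.ap_def single_kernel)
    also have "\<dots> = (\<Sum>l<N. \<Sum>k<N. X s j l * (word_entry N X (replicate n s) l k * v k))"
      by (intro sum.cong refl, subst Suc.IH) (auto simp: sum_distrib_left)
    also have "\<dots> = (\<Sum>k<N. \<Sum>l<N. X s j l * (word_entry N X (replicate n s) l k * v k))"
      by (rule sum.swap)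
    finally show ?case by (simp add: sum_distrib_right mult.assoc)
  qed
qed

lemma single_iter_support:
  assumes "\<And>i. i \<ge> N \<Longrightarrow> v i = 0" "j \<ge> N"
  shows "(hermitian_kernel.ap (sum_kernel N (single s)) (\<lambda>_. {..<N}) ^^ n) v j = 0"
proof -
  interpret s: hermitian_pair N x "single s" by (rule single_pair)
  show ?thesis using assms by (cases n) (auto simp: s.S.ap_def sum_kernel_def)
qed

text \<open>For Hermitian X the operator norm is the M-th root of the norm of X^M, which is at most
  the Frobenius norm of X^M. Log-convexity along the powers applied to a vector replaces
  diagonalisation, and the other orientation follows by conjugation.\<close>

lemma opnorm_word:
  fixes s :: sym and M :: nat
  assumes M: "M \<ge> 1"
  defines "\<rho> \<equiv> word_norm_sq N X (replicate M s) powr (1 / (2 * real M))"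
  shows "opnorm_le N \<rho> (X s)" "opnorm_le N \<rho> (\<lambda>i j. X s j i)"
proof -
  interpret s: hermitian_pair N x "single s" by (rule single_pair)
  define F where "F = word_norm_sq N X (replicate M s)"
  have F0: "0 \<le> F" by (simp add: F_def word_norm_sq_nonneg)
  have \<rho>0: "0 \<le> \<rho>" by (simp add: \<rho>_def)
  have \<rho>M: "\<rho> ^ M = sqrt F"
  proof (cases "F = 0")
    case True
    then show ?thesis using M by (simp add: \<rho>_def F_def[symmetric] power_0_left)
  next
    case False
    then have "\<rho> ^ M = F powr (1 / 2)"
      using M F0 by (simp add: \<rho>_def F_def[symmetric] powr_realpow[symmetric] powr_powr)
    then show ?thesis using F0 by (simp add: powr_half_sqrt)
  qed
  have main: "(\<Sum>b<N. (cmod (\<Sum>a<N. X s b a * y a))\<^sup>2) \<le> \<rho>\<^sup>2 * (\<Sum>a<N. (cmod (y a))\<^sup>2)" for y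
  proof -
    define v where "v i = (if i < N then y i else 0)" for i
    have v0: "v i = 0" if "i \<ge> N" for i using that by (simp add: v_def)
    have ss: "square_summable v" by (rule square_summable_finite_support[of "{..<N}"]) (auto simp: v_def)
    have l2v: "l2_sq v = (\<Sum>a<N. (cmod (y a))\<^sup>2)" using l2_sq_nat[of N v] v0 by (simp add: v_def)
    have l2ap: "l2_sq (s.S.ap v) = (\<Sum>b<N. (cmod (\<Sum>a<N. X s b a * y a))\<^sup>2)"
    proof -
      have "l2_sq (s.S.ap v) = (\<Sum>b<N. (cmod (s.S.ap v b))\<^sup>2)"
        by (rule l2_sq_nat) (use single_iter_support[where v = v and s = s and n = 1] v0 in auto)
      also have "\<dots> = (\<Sum>b<N. (cmod (\<Sum>a<N. X s b a * y a))\<^sup>2)"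
        by (intro sum.cong refl) (simp add: s.S.ap_def single_kernel v_def)
      finally show ?thesis .
    qed
    have l2M: "l2_sq ((s.S.ap ^^ M) v) \<le> F * l2_sq v"
    proof -
      have "l2_sq ((s.S.ap ^^ M) v) = (\<Sum>b<N. (cmod ((s.S.ap ^^ M) v b))\<^sup>2)"
        by (rule l2_sq_nat) (use single_iter_support[where v = v and s = s and n = M] v0 in auto)
      also have "\<dots> \<le> (\<Sum>b<N. (\<Sum>k<N. (cmod (word_entry N X (replicate M s) b k))\<^sup>2) * (\<Sum>k<N. (cmod (v k))\<^sup>2))"
      proof (rule sum_mono)
        fix b assume b: "b \<in> {..<N}"
        have "cmod ((s.S.ap ^^ M) v b) \<le> (\<Sum>k<N. cmod (word_entry N X (replicate M s) b k) * cmod (v k))"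
          using b by (subst single_iter) (auto simp: norm_mult intro!: order_trans[OF norm_sum])
        then have "(cmod ((s.S.ap ^^ M) v b))\<^sup>2 \<le> (\<Sum>k<N. cmod (word_entry N X (replicate M s) b k) * cmod (v k))\<^sup>2"
          by (intro power_mono) auto
        also have "\<dots> \<le> (\<Sum>k<N. (cmod (word_entry N X (replicate M s) b k))\<^sup>2) * (\<Sum>k<N. (cmod (v k))\<^sup>2)"
          by (rule Cauchy_Schwarz_ineq_sum)
        finally show "(cmod ((s.S.ap ^^ M) v b))\<^sup>2 \<le> \<dots>" .
      qed
      also have "\<dots> = F * l2_sq v"
        unfolding F_def word_norm_sq_def using l2_sq_nat[of N v] v0 by (simp add: sum_distrib_right)
      finally show ?thesis .
    qed
    have "sqrt (l2_sq (s.S.ap v)) ^ M \<le> sqrt (l2_sq v) ^ (M - 1) * sqrt (l2_sq ((s.S.ap ^^ M) v))"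
      using s.S.iter_log_convex[OF ss, of 1 M] M by simp
    also have "\<dots> \<le> sqrt (l2_sq v) ^ (M - 1) * (sqrt F * sqrt (l2_sq v))"
      using l2M by (intro mult_left_mono) (auto simp flip: real_sqrt_mult)
    also have "\<dots> = (\<rho> * sqrt (l2_sq v)) ^ M"
    proof -
      have "sqrt (l2_sq v) ^ (M - 1) * sqrt (l2_sq v) = sqrt (l2_sq v) ^ M"
        using M by (intro power_minus_mult) simp
      then show ?thesis unfolding power_mult_distrib \<rho>M by (metis mult.assoc mult.left_commute)
    qed
    finally have p: "sqrt (l2_sq (s.S.ap v)) ^ M \<le> (\<rho> * sqrt (l2_sq v)) ^ M" .
    have "sqrt (l2_sq (s.S.ap v)) \<le> \<rho> * sqrt (l2_sq v)"
    proof (rule ccontr)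
      assume "\<not> ?thesis"
      then have "(\<rho> * sqrt (l2_sq v)) ^ M < sqrt (l2_sq (s.S.ap v)) ^ M"
        using M \<rho>0 by (intro power_strict_mono) auto
      then show False using p by simp
    qed
    then have "(sqrt (l2_sq (s.S.ap v)))\<^sup>2 \<le> (\<rho> * sqrt (l2_sq v))\<^sup>2" by (intro power_mono) auto
    then show ?thesis unfolding l2v[symmetric] l2ap[symmetric] by (simp add: power_mult_distrib)
  qed
  show "opnorm_le N \<rho> (\<lambda>i j. X s j i)"
    unfolding opnorm_le_def using main \<rho>0 by (simp add: mult.commute)
  have "(\<Sum>b<N. (cmod (\<Sum>a<N. y a * X s a b))\<^sup>2) \<le> \<rho>\<^sup>2 * (\<Sum>a<N. (cmod (y a))\<^sup>2)" for y
  proof -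
    have "cmod (\<Sum>a<N. y a * X s a b) = cmod (\<Sum>a<N. X s b a * cnj (y a))" if "b < N" for b
    proof -
      have "(\<Sum>a<N. y a * X s a b) = (\<Sum>a<N. cnj (X s b a * cnj (y a)))"
      proof (rule sum.cong[OF refl])
        fix a assume "a \<in> {..<N}"
        then have "X s a b = cnj (X s b a)" using that by (intro X_herm) auto
        then show "y a * X s a b = cnj (X s b a * cnj (y a))" by simp
      qed
      also have "\<dots> = cnj (\<Sum>a<N. X s b a * cnj (y a))" by simp
      finally show ?thesis by (simp only: complex_mod_cnj)
    qed
    then have "(\<Sum>b<N. (cmod (\<Sum>a<N. y a * X s a b))\<^sup>2) = (\<Sum>b<N. (cmod (\<Sum>a<N. X s b a * cnj (y a)))\<^sup>2)"
      by simp
    then show ?thesis using main[of "\<lambda>a. cnj (y a)"] by simp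
  qed
  then show "opnorm_le N \<rho> (X s)" unfolding opnorm_le_def using \<rho>0 by simp
qed

text \<open>Column by column, the norm of X^K e_k interpolates between 1 and the norm of X^M e_k.
  The tangent at C ^ M makes the bound affine in the quantity whose mean is known.\<close>

lemma word_norm_interpolation:
  assumes M: "M \<ge> 1" and K: "K \<le> M" and C: "C > 0"
  shows "word_norm_sq N X (replicate K s)
    \<le> C ^ K * (real N * (1 - real K / real M) + real K / real M / C ^ M * word_norm_sq N X (replicate M s))"
\<comment> \<open>Treated apart because 0 powr 0 = 0: the power bound would fail on a column killed
  by the M-th power.\<close>
proof (cases "K = 0")
  case True
  have "word_norm_sq N X [] = (\<Sum>i<N. \<Sum>k<N. if i = k then 1 else 0)"
    unfolding word_norm_sq_def by (intro sum.cong refl) auto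
  then show ?thesis using True by simp
next
  case K0: False
  interpret s: hermitian_pair N x "single s" by (rule single_pair)
  define \<theta> where "\<theta> = real K / real M"
  define z where "z n k = l2_sq ((s.S.ap ^^ n) (delta k))" for n k
  have z_eq: "z n k = (\<Sum>i<N. (cmod (word_entry N X (replicate n s) i k))\<^sup>2)" if "k < N" for n k
  proof -
    have "z n k = (\<Sum>i<N. (cmod ((s.S.ap ^^ n) (delta k) i))\<^sup>2)"
      unfolding z_def by (rule l2_sq_nat) (use single_iter_support[where v = "delta k" and s = s and n = n] that in \<open>auto simp: delta_def\<close>)
    then show ?thesis using that
      by (simp add: single_iter delta_def if_distrib[of "\<lambda>y. _ * y"] cong: if_cong)
  qed
  have norm_eq: "word_norm_sq N X (replicate n s) = (\<Sum>k<N. z n k)" for n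
  proof -
    have "(\<Sum>k<N. z n k) = (\<Sum>k<N. \<Sum>i<N. (cmod (word_entry N X (replicate n s) i k))\<^sup>2)"
      by (simp add: z_eq)
    also have "\<dots> = word_norm_sq N X (replicate n s)" unfolding word_norm_sq_def by (rule sum.swap)
    finally show ?thesis ..
  qed
  have CM: "(C ^ M) powr \<theta> = C ^ K"
    using M C by (simp add: \<theta>_def powr_realpow[symmetric] powr_powr)
  have "z K k \<le> C ^ K * (1 + \<theta> * (z M k / C ^ M - 1))" if "k < N" for k
  proof -
    have "l2_sq (delta k) = (\<Sum>i<N. (cmod (delta k i))\<^sup>2)"
      by (rule l2_sq_nat) (use that in \<open>auto simp: delta_def\<close>)
    also have "\<dots> = (\<Sum>i<N. if i = k then 1 else 0)"
      by (intro sum.cong) (auto simp: delta_def)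
    also have "\<dots> = 1" using that by simp
    finally have "sqrt (z K k) ^ M \<le> sqrt (z M k) ^ K"
      using s.S.iter_log_convex[OF delta_square_summable K, of k] by (simp add: z_def)
    then have "(sqrt (z K k) ^ M)\<^sup>2 \<le> (sqrt (z M k) ^ K)\<^sup>2" by (intro power_mono) (auto simp: z_def)
    then have "z K k ^ M \<le> z M k ^ K"
      by (simp add: z_def power_mult[symmetric] mult.commute[of _ 2]) (simp add: power_mult)
    then have "z K k \<le> z M k powr \<theta>"
      using powr_le_of_power_le[of "z M k" "z K k" M K] M K0 by (simp add: z_def \<theta>_def)
    also have "\<dots> \<le> (C ^ M) powr \<theta> * (1 + \<theta> * (z M k / C ^ M - 1))"
      using K M C by (intro Bernoulli_powr) (auto simp: z_def \<theta>_def)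
    finally show ?thesis by (simp add: CM)
  qed
  then have "(\<Sum>k<N. z K k) \<le> (\<Sum>k<N. C ^ K * (1 + \<theta> * (z M k / C ^ M - 1)))" by (intro sum_mono) auto
  also have "\<dots> = C ^ K * (real N * (1 - \<theta>) + \<theta> / C ^ M * (\<Sum>k<N. z M k))"
    by (simp add: sum_distrib_left[symmetric] sum.distrib sum_subtractf sum_divide_distrib[symmetric] algebra_simps)
  finally show ?thesis unfolding norm_eq \<theta>_def .
qed

end

section \<open>Squared non-closed sums as sums over closed walks of length 2k\<close>

lemma walk_weight_prod:
  "walk_weight X i p = (\<Prod>l<length p. X (fst (p ! l)) (snd (p ! l)) (if l = 0 then i else snd (p ! (l - 1))))"
proof (induction X i p rule: walk_weight.induct)
  case (2 X i s k p)
  have "(\<Prod>l<length ((s, k) # p). X (fst (((s, k) # p) ! l)) (snd (((s, k) # p) ! l)) (if l = 0 then i else snd (((s, k) # p) ! (l - 1))))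
     = X s k i * (\<Prod>l<length p. X (fst (p ! l)) (snd (p ! l)) (snd (((s, k) # p) ! l)))"
    unfolding length_Cons prod.lessThan_Suc_shift by simp
  also have "(\<Prod>l<length p. X (fst (p ! l)) (snd (p ! l)) (snd (((s, k) # p) ! l))) = walk_weight X k p"
    unfolding 2 by (intro prod.cong refl) (auto simp: nth_Cons')
  finally show ?case by simp
qed simp

text \<open>Entry positions along a doubled walk: the first k factors belong to a walk weight,
  target before source, the others to a conjugated weight, where Hermitian symmetry exchanges the
  indices.\<close>

definition index_pair :: "nat \<Rightarrow> nat \<Rightarrow> (nat \<Rightarrow> nat) \<Rightarrow> nat \<Rightarrow> nat \<times> nat" where
  "index_pair n k f l = (if l < k then (f l, f (cyclic_pred n l)) else (f (cyclic_pred n l), f l))"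

definition seq_walk :: "nat \<Rightarrow> (nat \<Rightarrow> sym) \<Rightarrow> (nat \<Rightarrow> nat) \<Rightarrow> (sym \<times> nat) list" where
  "seq_walk n ls f = map (\<lambda>l. (ls l, f l)) [0..<n]"

text \<open>Two non-closed walks from one base point, concatenated. The base is the vertex at
  position n - 1, and the first walk returns to it at position k - 1.\<close>

definition good_pattern :: "nat \<Rightarrow> nat \<Rightarrow> (nat \<Rightarrow> sym) \<Rightarrow> (nat \<Rightarrow> nat) \<Rightarrow> bool" where
  "good_pattern n k ls f \<longleftrightarrow> f (k - 1) = f (n - 1) \<and>
     stack_run (f (n - 1)) (take k (seq_walk n ls f)) \<noteq> [] \<and>
     stack_run (f (n - 1)) (drop k (seq_walk n ls f)) \<noteq> []"

lemma good_pattern_compose: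
  assumes \<phi>: "inj_on \<phi> W" and g: "\<And>l. l < n \<Longrightarrow> g l \<in> W" and k: "0 < k" "k \<le> n"
  shows "good_pattern n k ls (compose {..<n} \<phi> g) \<longleftrightarrow> good_pattern n k ls g"
proof -
  have c: "compose {..<n} \<phi> g l = \<phi> (g l)" if "l < n" for l using that by (simp add: compose_def)
  have sw: "seq_walk n ls (compose {..<n} \<phi> g) = map (map_prod id \<phi>) (seq_walk n ls g)"
    by (auto simp: seq_walk_def c)
  have sub: "walk_vertices (g (n - 1)) p \<subseteq> W" if "set p \<subseteq> set (seq_walk n ls g)" for p
    using that g k by (auto simp: seq_walk_def)
  have run: "stack_run (\<phi> (g (n - 1))) (map (map_prod id \<phi>) p) = [] \<longleftrightarrow> stack_run (g (n - 1)) p = []"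
    if "set p \<subseteq> set (seq_walk n ls g)" for p
    using stack_run_map(1)[OF inj_on_subset[OF \<phi> sub[OF that]]] by (metis map_is_Nil_conv)
  have e: "\<phi> (g (k - 1)) = \<phi> (g (n - 1)) \<longleftrightarrow> g (k - 1) = g (n - 1)"
    using \<phi> g k by (intro inj_on_eq_iff) auto
  show ?thesis
    unfolding good_pattern_def sw take_map drop_map using k
    by (simp add: c e run[OF set_take_subset] run[OF set_drop_subset] del: One_nat_def)
qed

text \<open>The square is a double sum over walks from the same i. As i is recovered as the last
  vertex, triples of i and two walks correspond to sequences of letters and indices of length 2 *
  k.\<close>

lemma (in hermitian_pair) sum_nonclosed_squares:
  assumes k: "k \<ge> 1"
  shows "(\<Sum>i<N. of_real ((cmod (nonclosed_sum N X k i))\<^sup>2)) =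
    (\<Sum>ls\<in>{..<2 * k} \<rightarrow>\<^sub>E UNIV. \<Sum>f\<in>{..<2 * k} \<rightarrow>\<^sub>E {..<N}. if good_pattern (2 * k) k ls f
       then \<Prod>l<2 * k. case_prod (X (ls l)) (index_pair (2 * k) k f l) else 0)"
proof -
  define n where "n = 2 * k"
  have n: "k < n" "n = k + k" using k by (auto simp: n_def)
  define W where "W ls f = (\<Prod>l<n. case_prod (X (ls l)) (index_pair n k f l))" for ls f
  define LF where "LF = {x \<in> ({..<n} \<rightarrow>\<^sub>E (UNIV :: sym set)) \<times> ({..<n} \<rightarrow>\<^sub>E {..<N}). good_pattern n k (fst x) (snd x)}"
  let ?I = "SIGMA i:{..<N}. nonclosed_walks N k i \<times> nonclosed_walks N k i"
  have fin: "finite (nonclosed_walks N k i)" for i by (simp add: nonclosed_walks_def)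
  have "(\<Sum>i<N. of_real ((cmod (nonclosed_sum N X k i))\<^sup>2))
      = (\<Sum>i<N. \<Sum>(p, q)\<in>nonclosed_walks N k i \<times> nonclosed_walks N k i. walk_weight X i p * cnj (walk_weight X i q))"
    by (intro sum.cong refl)
      (simp add: complex_norm_square nonclosed_sum_def sum_product sum.cartesian_product del: of_real_power)
  also have "\<dots> = (\<Sum>(i, p, q)\<in>?I. walk_weight X i p * cnj (walk_weight X i q))"
    by (subst sum.Sigma) (auto simp: fin)
  also have "\<dots> = (\<Sum>(ls, f)\<in>LF. W ls f)"
  proof (rule sum.reindex_bij_witness[where
        j = "\<lambda>(i, p, q). (restrict (\<lambda>l. fst ((p @ q) ! l)) {..<n}, restrict (\<lambda>l. snd ((p @ q) ! l)) {..<n})" and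
        i = "\<lambda>(ls, f). (f (n - 1), take k (seq_walk n ls f), drop k (seq_walk n ls f))"])
    fix t assume "t \<in> ?I"
    then obtain i p q where t: "t = (i, p, q)" and i: "i < N" and p: "p \<in> nonclosed_walks N k i" and q: "q \<in> nonclosed_walks N k i"
      by auto
    have lp: "length p = k" "set p \<subseteq> UNIV \<times> {..<N}" "walk_end i p = i" "stack_run i p \<noteq> []"
      using p by (auto simp: nonclosed_walks_def walks_def)
    have lq: "length q = k" "set q \<subseteq> UNIV \<times> {..<N}" "walk_end i q = i" "stack_run i q \<noteq> []"
      using q by (auto simp: nonclosed_walks_def walks_def)
    define ls where "ls = restrict (\<lambda>l. fst ((p @ q) ! l)) {..<n}"
    define f where "f = restrict (\<lambda>l. snd ((p @ q) ! l)) {..<n}"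
    have sw: "seq_walk n ls f = p @ q"
      by (rule nth_equalityI) (use lp lq n in \<open>auto simp: seq_walk_def ls_def f_def\<close>)
    have fk: "f (k - 1) = i"
    proof -
      have "p \<noteq> []" using lp k by auto
      then have "i = snd (p ! (k - 1))" using lp(1,3) by (simp add: walk_end_def last_conv_nth)
      moreover have "k - 1 < n" "k - 1 < k" using k n by auto
      ultimately show ?thesis using lp(1) by (simp add: f_def nth_append)
    qed
    have fn: "f (n - 1) = i"
    proof -
      have "q \<noteq> []" using lq k by auto
      then have "i = snd (q ! (k - 1))" using lq(1,3) by (simp add: walk_end_def last_conv_nth)
      moreover have "n - 1 < n" "\<not> n - 1 < k" "n - 1 - k = k - 1" using k n by auto
      ultimately show ?thesis using lp(1) by (simp add: f_def nth_append)
    qed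
    show "(case case t of (i, p, q) \<Rightarrow> (restrict (\<lambda>l. fst ((p @ q) ! l)) {..<n}, restrict (\<lambda>l. snd ((p @ q) ! l)) {..<n}) of
        (ls, f) \<Rightarrow> (f (n - 1), take k (seq_walk n ls f), drop k (seq_walk n ls f))) = t"
      using sw fn lp by (simp add: t ls_def[symmetric] f_def[symmetric])
    have "f \<in> {..<n} \<rightarrow>\<^sub>E {..<N}"
    proof (rule PiE_I)
      fix l assume "l \<in> {..<n}"
      then have "(p @ q) ! l \<in> set p \<union> set q" using lp lq n by (metis lessThan_iff length_append nth_mem set_append)
      then show "f l \<in> {..<N}" using lp(2) lq(2) \<open>l \<in> {..<n}\<close> by (auto simp: f_def)
    qed (simp add: f_def)
    moreover have "ls \<in> {..<n} \<rightarrow>\<^sub>E UNIV" by (simp add: ls_def)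
    moreover have "good_pattern n k ls f" unfolding good_pattern_def sw fk fn using lp lq by simp
    ultimately show "(case t of (i, p, q) \<Rightarrow> (restrict (\<lambda>l. fst ((p @ q) ! l)) {..<n}, restrict (\<lambda>l. snd ((p @ q) ! l)) {..<n})) \<in> LF"
      by (simp add: t ls_def[symmetric] f_def[symmetric] LF_def)
    have "W ls f = (\<Prod>l<k. case_prod (X (ls l)) (index_pair n k f l)) * (\<Prod>l=k..<n. case_prod (X (ls l)) (index_pair n k f l))"
      unfolding W_def using prod.atLeastLessThan_concat[of 0 k n "\<lambda>l. case_prod (X (ls l)) (index_pair n k f l)"] n
      by (simp add: lessThan_atLeast0)
    also have "(\<Prod>l<k. case_prod (X (ls l)) (index_pair n k f l)) = walk_weight X i p"
      unfolding walk_weight_prod lp(1)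
    proof (rule prod.cong[OF refl])
      fix l assume "l \<in> {..<k}"
      then have l: "l < k" by simp
      have 1: "ls l = fst (p ! l)" "f l = snd (p ! l)" using l n lp by (auto simp: ls_def f_def nth_append)
      have 2: "f (cyclic_pred n l) = (if l = 0 then i else snd (p ! (l - 1)))"
      proof (cases "l = 0")
        case True
        then show ?thesis using fn by (simp add: cyclic_pred_def)
      next
        case False
        then show ?thesis using l n lp by (auto simp: cyclic_pred_def f_def nth_append)
      qed
      show "case_prod (X (ls l)) (index_pair n k f l) = X (fst (p ! l)) (snd (p ! l)) (if l = 0 then i else snd (p ! (l - 1)))"
        using l by (simp add: index_pair_def 1 2)
    qed
    also have "(\<Prod>l=k..<n. case_prod (X (ls l)) (index_pair n k f l)) = cnj (walk_weight X i q)"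
    proof -
      have "(\<Prod>l=k..<n. case_prod (X (ls l)) (index_pair n k f l)) = (\<Prod>l<k. case_prod (X (ls (l + k))) (index_pair n k f (l + k)))"
        using prod.shift_bounds_nat_ivl[of "\<lambda>l. case_prod (X (ls l)) (index_pair n k f l)" 0 k k] n
        by (simp add: lessThan_atLeast0)
      also have "\<dots> = (\<Prod>l<k. cnj (X (fst (q ! l)) (snd (q ! l)) (if l = 0 then i else snd (q ! (l - 1)))))"
      proof (rule prod.cong[OF refl])
        fix l assume "l \<in> {..<k}"
        then have l: "l < k" by simp
        have 1: "ls (l + k) = fst (q ! l)" "f (l + k) = snd (q ! l)"
          using l n lp by (auto simp: ls_def f_def nth_append)
        have 2: "f (cyclic_pred n (l + k)) = (if l = 0 then i else snd (q ! (l - 1)))"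
        proof (cases "l = 0")
          case True
          then show ?thesis using fk k by (simp add: cyclic_pred_def)
        next
          case False
          then have "\<not> l + k - 1 < k" "l + k - 1 - k = l - 1" "l + k - 1 < n" using l n by auto
          then show ?thesis using False k lp by (simp add: cyclic_pred_def f_def nth_append)
        qed
        have idx: "f (l + k) < N" "f (cyclic_pred n (l + k)) < N"
        proof -
          have qN: "snd (q ! j) < N" if "j < k" for j
          proof -
            have "q ! j \<in> set q" using that lq(1) by simp
            then have "q ! j \<in> UNIV \<times> {..<N}" using lq(2) by (rule subsetD[rotated])
            then show ?thesis by (simp add: mem_Times_iff)
          qed
          show "f (l + k) < N" unfolding 1 by (rule qN[OF l])
          show "f (cyclic_pred n (l + k)) < N" unfolding 2 using i l qN[of "l - 1"] by simp
        qed
        have "X (ls (l + k)) (f (cyclic_pred n (l + k))) (f (l + k)) = cnj (X (ls (l + k)) (f (l + k)) (f (cyclic_pred n (l + k))))"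
          using idx by (intro X_herm)
        then show "case_prod (X (ls (l + k))) (index_pair n k f (l + k))
            = cnj (X (fst (q ! l)) (snd (q ! l)) (if l = 0 then i else snd (q ! (l - 1))))"
          by (simp only: index_pair_def 1 2) simp
      qed
      finally show ?thesis by (simp add: walk_weight_prod lq(1))
    qed
    finally show "(case case t of (i, p, q) \<Rightarrow> (restrict (\<lambda>l. fst ((p @ q) ! l)) {..<n}, restrict (\<lambda>l. snd ((p @ q) ! l)) {..<n}) of
        (ls, f) \<Rightarrow> W ls f) = (case t of (i, p, q) \<Rightarrow> walk_weight X i p * cnj (walk_weight X i q))"
      by (simp add: t ls_def[symmetric] f_def[symmetric])
  next
    fix t assume "t \<in> LF"
    then obtain ls f where t: "t = (ls, f)" and ls: "ls \<in> {..<n} \<rightarrow>\<^sub>E UNIV" and f: "f \<in> {..<n} \<rightarrow>\<^sub>E {..<N}" and good: "good_pattern n k ls f"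
      by (auto simp: LF_def)
    have len: "length (seq_walk n ls f) = n" by (simp add: seq_walk_def)
    have nth: "seq_walk n ls f ! l = (ls l, f l)" if "l < n" for l using that by (simp add: seq_walk_def)
    have r1: "restrict (\<lambda>l. fst (seq_walk n ls f ! l)) {..<n} = ls"
    proof
      fix l
      show "restrict (\<lambda>l. fst (seq_walk n ls f ! l)) {..<n} l = ls l"
        by (cases "l < n") (use PiE_arb[OF ls, of l] nth[of l] in simp_all)
    qed
    have r2: "restrict (\<lambda>l. snd (seq_walk n ls f ! l)) {..<n} = f"
    proof
      fix l
      show "restrict (\<lambda>l. snd (seq_walk n ls f ! l)) {..<n} l = f l"
        by (cases "l < n") (use PiE_arb[OF f, of l] nth[of l] in simp_all)
    qed
    show "(case case t of (ls, f) \<Rightarrow> (f (n - 1), take k (seq_walk n ls f), drop k (seq_walk n ls f)) of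
        (i, p, q) \<Rightarrow> (restrict (\<lambda>l. fst ((p @ q) ! l)) {..<n}, restrict (\<lambda>l. snd ((p @ q) ! l)) {..<n})) = t"
      by (simp add: t r1 r2)
    have fN: "f l < N" if "l < n" for l using PiE_mem[OF f, of l] that by simp
    have set: "set (seq_walk n ls f) \<subseteq> UNIV \<times> {..<N}" using fN by (auto simp: seq_walk_def)
    have ends: "walk_end (f (n - 1)) (take k (seq_walk n ls f)) = f (n - 1)"
      "walk_end (f (n - 1)) (drop k (seq_walk n ls f)) = f (n - 1)"
    proof -
      have "last (take k (seq_walk n ls f)) = seq_walk n ls f ! (k - 1)"
        using k n len by (subst last_conv_nth) (auto simp: min_def)
      then show "walk_end (f (n - 1)) (take k (seq_walk n ls f)) = f (n - 1)"
        using good k n nth by (simp add: walk_end_def good_pattern_def)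
      have "last (drop k (seq_walk n ls f)) = seq_walk n ls f ! (n - 1)"
        using k n len by (simp add: last_drop last_conv_nth)
      then show "walk_end (f (n - 1)) (drop k (seq_walk n ls f)) = f (n - 1)"
        using k n nth by (simp add: walk_end_def)
    qed
    have "take k (seq_walk n ls f) \<in> nonclosed_walks N k (f (n - 1))"
      unfolding nonclosed_walks_def walks_def
      using good ends(1) len n order_trans[OF set_take_subset set] by (simp add: good_pattern_def)
    moreover have "drop k (seq_walk n ls f) \<in> nonclosed_walks N k (f (n - 1))"
      unfolding nonclosed_walks_def walks_def
      using good ends(2) len n order_trans[OF set_drop_subset set] by (simp add: good_pattern_def)
    moreover have "f (n - 1) < N" using fN n by simp
    ultimately show "(case t of (ls, f) \<Rightarrow> (f (n - 1), take k (seq_walk n ls f), drop k (seq_walk n ls f))) \<in> ?I"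
      by (simp add: t)
  qed
  also have "\<dots> = (\<Sum>(ls, f)\<in>({..<n} \<rightarrow>\<^sub>E UNIV) \<times> ({..<n} \<rightarrow>\<^sub>E {..<N}). if good_pattern n k ls f then W ls f else 0)"
  proof -
    let ?S = "({..<n} \<rightarrow>\<^sub>E (UNIV :: sym set)) \<times> ({..<n} \<rightarrow>\<^sub>E {..<N})"
    have fin: "finite ?S" using finite_UNIV_sym by (intro finite_cartesian_product finite_PiE) auto
    show ?thesis unfolding LF_def case_prod_unfold by (rule sum.inter_filter[OF fin])
  qed
  finally show ?thesis unfolding W_def n_def sum.cartesian_product .
qed

section \<open>Random Hermitian pairs\<close>

lemma permutation_extending:
  assumes \<phi>: "\<phi> \<in> inj_maps {..<m} N" and \<psi>: "\<psi> \<in> inj_maps {..<m} N"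
  obtains \<sigma> where "\<sigma> permutes {..<N}" "\<And>v. v < m \<Longrightarrow> \<sigma> (\<phi> v) = \<psi> v"
proof -
  define U where "U = \<phi> ` {..<m}"
  define W where "W = \<psi> ` {..<m}"
  have inj: "inj_on \<phi> {..<m}" "inj_on \<psi> {..<m}" and sub: "U \<subseteq> {..<N}" "W \<subseteq> {..<N}"
    using \<phi> \<psi> by (auto simp: inj_maps_def U_def W_def)
  have "card U = card W" using inj by (simp add: U_def W_def card_image)
  then have "card ({..<N} - U) = card ({..<N} - W)"
    using sub by (simp add: card_Diff_subset finite_subset)
  then obtain \<beta> where \<beta>: "bij_betw \<beta> ({..<N} - U) ({..<N} - W)"
    using finite_same_card_bij[of "{..<N} - U" "{..<N} - W"] by auto
  define \<alpha> where "\<alpha> = \<psi> \<circ> inv_into {..<m} \<phi>"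
  have \<alpha>: "bij_betw \<alpha> U W"
    unfolding \<alpha>_def U_def W_def
    by (rule bij_betw_trans[OF bij_betw_inv_into]) (use inj in \<open>auto simp: inj_on_imp_bij_betw\<close>)
  define \<sigma> where "\<sigma> x = (if x \<in> U then \<alpha> x else if x < N then \<beta> x else x)" for x
  have "bij_betw \<sigma> U W" using \<alpha> by (rule iffD1[OF bij_betw_cong, rotated]) (simp add: \<sigma>_def)
  moreover have "bij_betw \<sigma> ({..<N} - U) ({..<N} - W)"
    using \<beta> by (rule iffD1[OF bij_betw_cong, rotated]) (simp add: \<sigma>_def)
  ultimately have "bij_betw \<sigma> (U \<union> ({..<N} - U)) (W \<union> ({..<N} - W))"
    by (rule bij_betw_combine) auto
  moreover have "U \<union> ({..<N} - U) = {..<N}" "W \<union> ({..<N} - W) = {..<N}" using sub by auto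
  ultimately have "\<sigma> permutes {..<N}"
    using sub by (intro bij_imp_permutes) (auto simp: \<sigma>_def)
  moreover have "\<sigma> (\<phi> v) = \<psi> v" if "v < m" for v
    using that inj by (simp add: \<sigma>_def \<alpha>_def U_def)
  ultimately show ?thesis using that by blast
qed

lemma measurable_entry:
  assumes "random_matrix P N Y" "i < N" "j < N"
  shows "(\<lambda>\<omega>. Y \<omega> $$ (i, j)) \<in> borel_measurable P"
proof -
  have m: "(\<lambda>\<omega>. entries N (Y \<omega>)) \<in> P \<rightarrow>\<^sub>M (\<Pi>\<^sub>M _\<in>{..<N} \<times> {..<N}. borel)"
    using assms(1) by (simp add: random_matrix_def entry_space_def)
  have "(\<lambda>\<omega>. entries N (Y \<omega>) (i, j)) \<in> borel_measurable P"
    by (rule measurable_compose[OF m measurable_component_singleton]) (use assms in simp)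
  then show ?thesis using assms by (simp add: entries_def)
qed

lemma measurable_entry_product:
  assumes "\<And>l. l \<in> E \<Longrightarrow> u l \<in> {..<N} \<times> {..<N}"
  shows "(\<lambda>e. \<Prod>l\<in>E. e (u l)) \<in> borel_measurable (entry_space N)"
  unfolding entry_space_def by (intro borel_measurable_prod measurable_component_singleton assms)

lemma mult_entry:
  assumes "Y \<in> carrier_mat N N" "Z \<in> carrier_mat N N" "i < N" "j < N"
  shows "(Y * Z) $$ (i, j) = (\<Sum>k<N. Y $$ (i, k) * Z $$ (k, j))"
  using assms by (simp add: scalar_prod_def atLeast0LessThan)

lemma mat_inv_perm_mat:
  assumes \<sigma>: "\<sigma> permutes {..<N}"
  shows "mat_inv (perm_mat N \<sigma>) = perm_mat N (inv_into UNIV \<sigma>)"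
proof (rule mat_inv_eqI)
  show "perm_mat N \<sigma> * perm_mat N (inv_into UNIV \<sigma>) = 1\<^sub>m N"
  proof (rule eq_matI)
    fix i j assume "i < dim_row (1\<^sub>m N :: complex mat)" "j < dim_col (1\<^sub>m N :: complex mat)"
    then have ij: "i < N" "j < N" by auto
    have "(perm_mat N \<sigma> * perm_mat N (inv_into UNIV \<sigma>)) $$ (i, j)
        = (\<Sum>k<N. (if i = \<sigma> k then 1 else 0) * (if k = inv_into UNIV \<sigma> j then 1 else 0))"
      using ij by (simp add: perm_mat_def scalar_prod_def atLeast0LessThan)
    also have "\<dots> = (\<Sum>k<N. if k = inv_into UNIV \<sigma> j then (if i = \<sigma> k then 1 else 0) else 0)"
      by (intro sum.cong) auto
    also have "\<dots> = (if i = \<sigma> (inv_into UNIV \<sigma> j) then 1 else 0)"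
      using permutes_in_image[OF permutes_inv[OF \<sigma>], of j] ij by simp
    also have "\<sigma> (inv_into UNIV \<sigma> j) = j" using permutes_inverses(1)[OF \<sigma>] .
    finally show "(perm_mat N \<sigma> * perm_mat N (inv_into UNIV \<sigma>)) $$ (i, j) = 1\<^sub>m N $$ (i, j)" using ij by simp
  qed (auto simp: perm_mat_def)
qed (auto simp: perm_mat_def)

lemma conjugate_perm_entry:
  assumes \<sigma>: "\<sigma> permutes {..<N}" and Y: "Y \<in> carrier_mat N N" and ij: "i < N" "j < N"
  shows "(perm_mat N \<sigma> * Y * mat_inv (perm_mat N \<sigma>)) $$ (\<sigma> i, \<sigma> j) = Y $$ (i, j)"
proof -
  have \<sigma>N: "\<sigma> i < N" "\<sigma> j < N"
    using permutes_in_image[OF \<sigma>, of i] permutes_in_image[OF \<sigma>, of j] ij by auto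
  have \<sigma>eq: "\<sigma> a = \<sigma> b \<longleftrightarrow> a = b" for a b using permutes_inj[OF \<sigma>] by (auto dest: injD)
  have Vc: "perm_mat N \<tau> \<in> carrier_mat N N" for \<tau> by (simp add: perm_mat_def)
  have 1: "(perm_mat N \<sigma> * Y) $$ (\<sigma> i, c) = Y $$ (i, c)" if "c < N" for c
  proof -
    have "(perm_mat N \<sigma> * Y) $$ (\<sigma> i, c) = (\<Sum>k<N. perm_mat N \<sigma> $$ (\<sigma> i, k) * Y $$ (k, c))"
      by (rule mult_entry[OF Vc Y \<sigma>N(1) that])
    also have "\<dots> = (\<Sum>k<N. if k = i then Y $$ (k, c) else 0)"
      using \<sigma>N by (intro sum.cong) (auto simp: perm_mat_def \<sigma>eq)
    finally show ?thesis using ij by simp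
  qed
  have "(perm_mat N \<sigma> * Y * perm_mat N (inv_into UNIV \<sigma>)) $$ (\<sigma> i, \<sigma> j)
      = (\<Sum>c<N. (perm_mat N \<sigma> * Y) $$ (\<sigma> i, c) * perm_mat N (inv_into UNIV \<sigma>) $$ (c, \<sigma> j))"
    by (rule mult_entry[OF mult_carrier_mat[OF Vc Y] Vc \<sigma>N])
  also have "\<dots> = (\<Sum>c<N. if c = j then Y $$ (i, c) else 0)"
    using \<sigma>N permutes_inverses(2)[OF \<sigma>] by (intro sum.cong) (auto simp: perm_mat_def[of N "inv_into UNIV \<sigma>"] 1)
  also have "\<dots> = Y $$ (i, j)" using ij by simp
  finally show ?thesis by (simp add: mat_inv_perm_mat[OF \<sigma>])
qed

text \<open>Invariance is given for laws of entry families, so the product is pushed forward to the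
  entries, where the law of Y may be replaced by that of its conjugate.\<close>

lemma permutation_invariant_product:
  assumes P: "permutation_invariant P N Y" and rY: "random_matrix P N Y" and \<sigma>: "\<sigma> permutes {..<N}"
    and u: "\<And>l. l \<in> E \<Longrightarrow> u l \<in> {..<N} \<times> {..<N}"
  shows "(\<integral>\<omega>. (\<Prod>l\<in>E. Y \<omega> $$ (\<sigma> (fst (u l)), \<sigma> (snd (u l)))) \<partial>P) = (\<integral>\<omega>. (\<Prod>l\<in>E. Y \<omega> $$ u l) \<partial>P)"
proof -
  let ?Z = "\<lambda>\<omega>. perm_mat N \<sigma> * Y \<omega> * mat_inv (perm_mat N \<sigma>)"
  define v where "v l = (\<sigma> (fst (u l)), \<sigma> (snd (u l)))" for l
  have v: "v l \<in> {..<N} \<times> {..<N}" if "l \<in> E" for l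
    using u[OF that] permutes_in_image[OF \<sigma>, of "fst (u l)"] permutes_in_image[OF \<sigma>, of "snd (u l)"]
    by (simp add: v_def mem_Times_iff)
  have carrier: "Y \<omega> \<in> carrier_mat N N" if "\<omega> \<in> space P" for \<omega>
    using rY that by (auto simp: random_matrix_def)
  have meas_Y: "(\<lambda>\<omega>. entries N (Y \<omega>)) \<in> P \<rightarrow>\<^sub>M entry_space N" using rY by (simp add: random_matrix_def)
  have meas_Z: "(\<lambda>\<omega>. entries N (?Z \<omega>)) \<in> P \<rightarrow>\<^sub>M entry_space N"
  proof -
    have "(\<lambda>\<omega>. \<lambda>p\<in>{..<N} \<times> {..<N}. ?Z \<omega> $$ p) \<in> P \<rightarrow>\<^sub>M entry_space N"
      unfolding entry_space_def
    proof (rule measurable_restrict)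
      fix p :: "nat \<times> nat" assume "p \<in> {..<N} \<times> {..<N}"
      then obtain i j where p: "p = (\<sigma> i, \<sigma> j)" "i < N" "j < N"
        unfolding mem_Times_iff using permutes_image[OF \<sigma>] by (cases p) (metis fst_conv snd_conv imageE lessThan_iff)
      have "(\<lambda>\<omega>. Y \<omega> $$ (i, j)) \<in> borel_measurable P" by (rule measurable_entry[OF rY p(2,3)])
      then show "(\<lambda>\<omega>. ?Z \<omega> $$ p) \<in> borel_measurable P"
        by (rule iffD1[OF measurable_cong, rotated]) (simp add: p(1) conjugate_perm_entry[OF \<sigma> carrier p(2,3)])
    qed
    then show ?thesis by (simp add: entries_def)
  qed
  define h where "h e = (\<Prod>l\<in>E. e (v l) :: complex)" for e
  have h: "h \<in> borel_measurable (entry_space N)" unfolding h_def by (rule measurable_entry_product[OF v])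
  have ent: "entries N W (v l) = W $$ v l" if "l \<in> E" for W l using v[OF that] by (simp add: entries_def)
  have "(\<integral>\<omega>. (\<Prod>l\<in>E. Y \<omega> $$ v l) \<partial>P) = (\<integral>\<omega>. h (entries N (Y \<omega>)) \<partial>P)"
    unfolding h_def by (intro Bochner_Integration.integral_cong prod.cong refl) (simp add: ent)
  also have "\<dots> = (\<integral>e. h e \<partial>matrix_law P N Y)"
    unfolding matrix_law_def by (rule integral_distr[symmetric, OF meas_Y h])
  also have "matrix_law P N Y = matrix_law P N ?Z" using P \<sigma> by (simp add: permutation_invariant_def)
  also have "(\<integral>e. h e \<partial>matrix_law P N ?Z) = (\<integral>\<omega>. h (entries N (?Z \<omega>)) \<partial>P)"
    unfolding matrix_law_def by (rule integral_distr[OF meas_Z h])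
  also have "\<dots> = (\<integral>\<omega>. (\<Prod>l\<in>E. Y \<omega> $$ u l) \<partial>P)"
    unfolding h_def
  proof (intro Bochner_Integration.integral_cong prod.cong refl)
    fix \<omega> l assume \<omega>: "\<omega> \<in> space P" and l: "l \<in> E"
    have "fst (u l) < N" "snd (u l) < N" using u[OF l] by auto
    from conjugate_perm_entry[OF \<sigma> carrier[OF \<omega>] this]
    show "entries N (?Z \<omega>) (v l) = Y \<omega> $$ u l" unfolding ent[OF l] by (simp add: v_def)
  qed
  finally show ?thesis by (simp add: v_def)
qed

lemma opnorm_le_entry:
  assumes "opnorm_le N r Y" "i < N" "j < N"
  shows "cmod (Y i j) \<le> r"
proof -
  let ?y = "\<lambda>a. if a = i then 1 else 0 :: complex"
  have "(cmod (Y i j))\<^sup>2 \<le> (\<Sum>b<N. (cmod (Y i b))\<^sup>2)" using assms(3) by (intro member_le_sum) auto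
  also have "\<dots> = (\<Sum>b<N. (cmod (\<Sum>a<N. ?y a * Y a b))\<^sup>2)"
    using assms(2) by (simp add: if_distrib[of "\<lambda>y. y * _"] cong: if_cong)
  also have "\<dots> \<le> r\<^sup>2 * (\<Sum>a<N. (cmod (?y a))\<^sup>2)" 
    using spec[OF conjunct2[OF assms(1)[unfolded opnorm_le_def]], of ?y] .
  also have "(\<Sum>a<N. (cmod (?y a))\<^sup>2) = (\<Sum>a<N. if a = i then 1 else 0)" by (intro sum.cong) auto
  also have "\<dots> = 1" using assms(2) by simp
  finally show ?thesis using assms(1) by (simp add: opnorm_le_def power2_le_iff_abs_le)
qed

lemma word_entry_power:
  assumes Y: "Y \<in> carrier_mat N N" and s: "\<And>i j. i < N \<Longrightarrow> j < N \<Longrightarrow> X s i j = Y $$ (i, j)" and ij: "i < N" "j < N"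
  shows "(Y ^\<^sub>m n) $$ (i, j) = word_entry N X (replicate n s) i j"
  using ij
proof (induction n arbitrary: i j)
  case (Suc n)
  have "(Y ^\<^sub>m Suc n) $$ (i, j) = (\<Sum>k<N. (Y ^\<^sub>m n) $$ (i, k) * Y $$ (k, j))"
    using Suc.prems Y by (simp add: scalar_prod_def atLeast0LessThan)
  also have "\<dots> = (\<Sum>k<N. word_entry N X (replicate n s) i k * word_entry N X [s] k j)"
    using Suc s by (intro sum.cong) (auto simp: if_distrib[of "\<lambda>y. _ * y"] cong: if_cong)
  also have "\<dots> = word_entry N X (replicate (Suc n) s) i j"
    using Suc.prems by (simp only: word_entry_append[symmetric] replicate_append_same replicate_Suc)
  finally show ?case .
qed (use Y in auto)

lemma frobenius_norm_square:
  assumes "Y \<in> carrier_mat N N"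
  shows "(frobenius_norm Y)\<^sup>2 = (\<Sum>i<N. \<Sum>k<N. (cmod (Y $$ (i, k)))\<^sup>2)"
proof -
  have adj: "mat_adjoint Y \<in> carrier_mat N N" using assms by (simp add: mat_adjoint_def mat_of_rows_def)
  have "mat_trace (Y * mat_adjoint Y) = (\<Sum>i<N. \<Sum>k<N. Y $$ (i, k) * cnj (Y $$ (i, k)))"
    using assms adj by (simp add: mat_trace_def scalar_prod_def atLeast0LessThan mat_adjoint_index)
  also have "\<dots> = of_real (\<Sum>i<N. \<Sum>k<N. (cmod (Y $$ (i, k)))\<^sup>2)"
    unfolding of_real_sum by (intro sum.cong refl) (simp add: complex_norm_square[symmetric] del: of_real_power)
  finally show ?thesis
    by (simp add: frobenius_norm_def sum_nonneg)
qed

section \<open>Fixed N: random norms, their moments, and factorised means\<close>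

locale random_pair = prob_space P for P :: "'w measure" +
  fixes N M :: nat and A B :: "'w \<Rightarrow> complex mat" and C :: real
  assumes N1: "N \<ge> 1" and M1: "M \<ge> 1" and C0: "C > 0"
    and rA: "random_matrix P N A" and rB: "random_matrix P N B"
    and hA: "\<And>\<omega>. \<omega> \<in> space P \<Longrightarrow> hermitian_mat (A \<omega>)" and hB: "\<And>\<omega>. \<omega> \<in> space P \<Longrightarrow> hermitian_mat (B \<omega>)"
    and indep: "independent_matrices P N A B"
    and frobA: "integrable P (\<lambda>\<omega>. 1 / real N * (frobenius_norm (A \<omega> ^\<^sub>m M))\<^sup>2)"
      "(\<integral>\<omega>. 1 / real N * (frobenius_norm (A \<omega> ^\<^sub>m M))\<^sup>2 \<partial>P) \<le> C ^ M"
    and frobB: "integrable P (\<lambda>\<omega>. 1 / real N * (frobenius_norm (B \<omega> ^\<^sub>m M))\<^sup>2)"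
      "(\<integral>\<omega>. 1 / real N * (frobenius_norm (B \<omega> ^\<^sub>m M))\<^sup>2 \<partial>P) \<le> C ^ M"
    and perm: "permutation_invariant P N A \<or> permutation_invariant P N B"
begin

definition mt :: "sym \<Rightarrow> 'w \<Rightarrow> complex mat" where
  "mt s = (case s of SymA \<Rightarrow> A | SymB \<Rightarrow> B)"

definition X :: "'w \<Rightarrow> sym \<Rightarrow> nat \<Rightarrow> nat \<Rightarrow> complex" where
  "X \<omega> = pair_entries (A \<omega>) (B \<omega>)"

lemma X_mt: "X \<omega> s i j = mt s \<omega> $$ (i, j)"
  by (cases s) (auto simp: X_def mt_def pair_entries_def)

lemma random_mt: "random_matrix P N (mt s)"
  using rA rB by (cases s) (auto simp: mt_def)

lemma mt_carrier: "\<omega> \<in> space P \<Longrightarrow> mt s \<omega> \<in> carrier_mat N N"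
  using random_mt by (auto simp: random_matrix_def)

lemma matrices: "\<omega> \<in> space P \<Longrightarrow> x < N \<Longrightarrow> hermitian_matrices N x (A \<omega>) (B \<omega>)"
  using hA hB mt_carrier[of \<omega> SymA] mt_carrier[of \<omega> SymB] by unfold_locales (auto simp: mt_def)

lemma pair:
  assumes "\<omega> \<in> space P"
  shows "hermitian_pair N 0 (X \<omega>)"
proof -
  interpret H: hermitian_matrices N 0 "A \<omega>" "B \<omega>" by (rule matrices[OF assms]) (use N1 in simp)
  show ?thesis unfolding X_def by (rule H.hermitian_pair_axioms)
qed

definition FF :: "sym \<Rightarrow> 'w \<Rightarrow> real" where
  "FF s \<omega> = word_norm_sq N (X \<omega>) (replicate M s)"

lemma FF_nonneg [simp]: "0 \<le> FF s \<omega>"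
  by (simp add: FF_def word_norm_sq_nonneg)

lemma FF_frobenius: "\<omega> \<in> space P \<Longrightarrow> FF s \<omega> = real N * (1 / real N * (frobenius_norm (mt s \<omega> ^\<^sub>m M))\<^sup>2)"
proof -
  assume \<omega>: "\<omega> \<in> space P"
  note Y = mt_carrier[OF \<omega>, of s]
  have "(frobenius_norm (mt s \<omega> ^\<^sub>m M))\<^sup>2 = (\<Sum>i<N. \<Sum>k<N. (cmod ((mt s \<omega> ^\<^sub>m M) $$ (i, k)))\<^sup>2)"
    by (rule frobenius_norm_square) (use Y in auto)
  also have "\<dots> = FF s \<omega>"
    unfolding FF_def word_norm_sq_def
    by (intro sum.cong refl) (simp add: word_entry_power[OF Y, of "X \<omega>" s] X_mt)
  finally show ?thesis using N1 by simp
qed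

lemma FF_integrable: "integrable P (FF s)" "(\<integral>\<omega>. FF s \<omega> \<partial>P) \<le> real N * C ^ M"
proof -
  have f: "integrable P (\<lambda>\<omega>. 1 / real N * (frobenius_norm (mt s \<omega> ^\<^sub>m M))\<^sup>2)"
    "(\<integral>\<omega>. 1 / real N * (frobenius_norm (mt s \<omega> ^\<^sub>m M))\<^sup>2 \<partial>P) \<le> C ^ M"
    using frobA frobB by (cases s; simp add: mt_def)+
  have "integrable P (\<lambda>\<omega>. real N * (1 / real N * (frobenius_norm (mt s \<omega> ^\<^sub>m M))\<^sup>2))"
    by (rule integrable_mult_right) (rule f(1))
  then show "integrable P (FF s)"
    by (rule iffD1[OF Bochner_Integration.integrable_cong, rotated -1]) (auto simp: FF_frobenius)
  have "(\<integral>\<omega>. FF s \<omega> \<partial>P) = (\<integral>\<omega>. real N * (1 / real N * (frobenius_norm (mt s \<omega> ^\<^sub>m M))\<^sup>2) \<partial>P)"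
    by (intro Bochner_Integration.integral_cong refl) (rule FF_frobenius)
  also have "\<dots> = real N * (\<integral>\<omega>. 1 / real N * (frobenius_norm (mt s \<omega> ^\<^sub>m M))\<^sup>2 \<partial>P)"
    by (rule integral_mult_right_zero)
  also have "\<dots> \<le> real N * C ^ M" using f(2) by (intro mult_left_mono) auto
  finally show "(\<integral>\<omega>. FF s \<omega> \<partial>P) \<le> real N * C ^ M" .
qed

text \<open>The random norm bound of \<open>opnorm_word\<close>, valid for the matrix and its
  transpose.\<close>

definition rho :: "sym \<Rightarrow> 'w \<Rightarrow> real" where
  "rho s \<omega> = FF s \<omega> powr (1 / (2 * real M))"

text \<open>An upper bound for the mean of \<open>FF\<close>. Thus \<open>rho\<close> behaves in the
  mean like sqrt C times N powr (1 / (2 * M)).\<close>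

definition \<kappa> :: real where "\<kappa> = real N * C ^ M"

lemma \<kappa>_pos: "0 < \<kappa>"
  using N1 C0 by (simp add: \<kappa>_def)

lemma rho_nonneg [simp]: "0 \<le> rho s \<omega>"
  by (simp add: rho_def)

lemma rho_measurable [measurable]: "rho s \<in> borel_measurable P"
  unfolding rho_def using borel_measurable_integrable[OF FF_integrable(1), of s] by measurable

text \<open>Jensen's inequality through the tangent at \<open>\<kappa>\<close>; the exponent e / (2
  * M) must not exceed 1, which caps the number of factors of one letter.\<close>

lemma rho_power_integrable:
  assumes e: "e \<le> 2 * M"
  shows "integrable P (\<lambda>\<omega>. rho s \<omega> ^ e)" "(\<integral>\<omega>. rho s \<omega> ^ e \<partial>P) \<le> \<kappa> powr (real e / (2 * real M))"
proof -
  define \<theta> where "\<theta> = real e / (2 * real M)"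
  have \<theta>: "0 \<le> \<theta>" "\<theta> \<le> 1" using e M1 by (auto simp: \<theta>_def)
  let ?b = "\<lambda>\<omega>. \<kappa> powr \<theta> * (1 + \<theta> * (FF s \<omega> / \<kappa> - 1))"
  have ib: "integrable P ?b" using FF_integrable(1)[of s] by simp
  have le: "rho s \<omega> ^ e \<le> ?b \<omega>" for \<omega>
  proof (cases "e = 0")
    case True
    then show ?thesis using \<kappa>_pos by (simp add: \<theta>_def)
  next
    case False
    have "rho s \<omega> ^ e = FF s \<omega> powr \<theta>"
    proof (cases "FF s \<omega> = 0")
      case True
      then show ?thesis using False by (simp add: rho_def)
    next
      case False
      then show ?thesis by (simp add: rho_def powr_realpow[symmetric] powr_powr \<theta>_def less_le)
    qed
    then show ?thesis using Bernoulli_powr[of "FF s \<omega>" \<kappa> \<theta>] \<kappa>_pos \<theta> by simp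
  qed
  show i: "integrable P (\<lambda>\<omega>. rho s \<omega> ^ e)"
    by (rule Bochner_Integration.integrable_bound[OF ib])
      (use le in \<open>auto intro!: AE_I2 order_trans[OF le abs_ge_self]\<close>)
  have "(\<integral>\<omega>. rho s \<omega> ^ e \<partial>P) \<le> (\<integral>\<omega>. ?b \<omega> \<partial>P)"
    by (rule integral_mono[OF i ib le])
  also have "\<dots> = \<kappa> powr \<theta> * (1 + \<theta> * ((\<integral>\<omega>. FF s \<omega> \<partial>P) / \<kappa> - 1))"
    using FF_integrable(1)[of s] by (simp add: prob_space)
  also have "\<dots> \<le> \<kappa> powr \<theta> * (1 + \<theta> * (1 - 1))"
    using FF_integrable(2)[of s] \<kappa>_pos \<theta> by (intro mult_left_mono add_left_mono diff_right_mono) (auto simp: \<kappa>_def field_simps)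
  finally show "(\<integral>\<omega>. rho s \<omega> ^ e \<partial>P) \<le> \<kappa> powr (real e / (2 * real M))" by (simp add: \<theta>_def)
qed

lemma X_opnorm:
  assumes "\<omega> \<in> space P"
  shows "opnorm_le N (rho s \<omega>) (X \<omega> s)" "opnorm_le N (rho s \<omega>) (\<lambda>i j. X \<omega> s j i)"
  using hermitian_pair.opnorm_word[OF pair[OF assms] M1, of s] by (simp_all add: rho_def FF_def)

lemma X_measurable: "i < N \<Longrightarrow> j < N \<Longrightarrow> (\<lambda>\<omega>. X \<omega> s i j) \<in> borel_measurable P"
  unfolding X_mt by (rule measurable_entry[OF random_mt])

definition mean_product :: "sym \<Rightarrow> nat set \<Rightarrow> (nat \<Rightarrow> nat \<times> nat) \<Rightarrow> complex" where
  "mean_product s E u = (\<integral>\<omega>. (\<Prod>l\<in>E. case_prod (X \<omega> s) (u l)) \<partial>P)"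

lemma product_integrable:
  assumes "finite E" "card E \<le> 2 * M" "\<And>l. l \<in> E \<Longrightarrow> u l \<in> {..<N} \<times> {..<N}"
  shows "integrable P (\<lambda>\<omega>. \<Prod>l\<in>E. case_prod (X \<omega> s) (u l))"
proof (rule Bochner_Integration.integrable_bound[OF rho_power_integrable(1)[OF assms(2), of s]])
  show "(\<lambda>\<omega>. \<Prod>l\<in>E. case_prod (X \<omega> s) (u l)) \<in> borel_measurable P"
    using assms(3) by (intro borel_measurable_prod) (auto simp: case_prod_unfold mem_Times_iff intro!: X_measurable)
  show "AE \<omega> in P. norm (\<Prod>l\<in>E. case_prod (X \<omega> s) (u l)) \<le> norm (rho s \<omega> ^ card E)"
  proof (rule AE_I2)
    fix \<omega> assume \<omega>: "\<omega> \<in> space P"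
    have "norm (\<Prod>l\<in>E. case_prod (X \<omega> s) (u l)) = (\<Prod>l\<in>E. norm (case_prod (X \<omega> s) (u l)))"
      by (rule prod_norm[symmetric])
    also have "\<dots> \<le> (\<Prod>l\<in>E. rho s \<omega>)"
      using assms(3) opnorm_le_entry[OF X_opnorm(1)[OF \<omega>]]
      by (intro prod_mono) (auto simp: case_prod_unfold mem_Times_iff)
    finally show "norm (\<Prod>l\<in>E. case_prod (X \<omega> s) (u l)) \<le> norm (rho s \<omega> ^ card E)" by simp
  qed
qed

lemma mean_product_independent:
  assumes "finite E1" "card E1 \<le> 2 * M" "\<And>l. l \<in> E1 \<Longrightarrow> u l \<in> {..<N} \<times> {..<N}"
    and "finite E2" "card E2 \<le> 2 * M" "\<And>l. l \<in> E2 \<Longrightarrow> u l \<in> {..<N} \<times> {..<N}"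
  shows "(\<integral>\<omega>. (\<Prod>l\<in>E1. case_prod (X \<omega> SymA) (u l)) * (\<Prod>l\<in>E2. case_prod (X \<omega> SymB) (u l)) \<partial>P)
      = mean_product SymA E1 u * mean_product SymB E2 u"
    and "integrable P (\<lambda>\<omega>. (\<Prod>l\<in>E1. case_prod (X \<omega> SymA) (u l)) * (\<Prod>l\<in>E2. case_prod (X \<omega> SymB) (u l)))"
proof -
  have eq: "(\<lambda>e. \<Prod>l\<in>E. e (u l)) \<circ> (\<lambda>\<omega>. entries N (mt s \<omega>)) = (\<lambda>\<omega>. \<Prod>l\<in>E. case_prod (X \<omega> s) (u l))"
    if "\<And>l. l \<in> E \<Longrightarrow> u l \<in> {..<N} \<times> {..<N}" for E s
    using that by (auto simp: fun_eq_iff entries_def X_mt case_prod_unfold intro!: prod.cong)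
  have "indep_var (entry_space N) (\<lambda>\<omega>. entries N (mt SymA \<omega>)) (entry_space N) (\<lambda>\<omega>. entries N (mt SymB \<omega>))"
    using indep by (simp add: independent_matrices_def mt_def)
  then have "indep_var borel ((\<lambda>e. \<Prod>l\<in>E1. e (u l)) \<circ> (\<lambda>\<omega>. entries N (mt SymA \<omega>)))
     borel ((\<lambda>e. \<Prod>l\<in>E2. e (u l)) \<circ> (\<lambda>\<omega>. entries N (mt SymB \<omega>)))"
    by (rule indep_var_compose[OF _ measurable_entry_product[OF assms(3)] measurable_entry_product[OF assms(6)]])
  then have iv: "indep_var borel (\<lambda>\<omega>. \<Prod>l\<in>E1. case_prod (X \<omega> SymA) (u l)) borel (\<lambda>\<omega>. \<Prod>l\<in>E2. case_prod (X \<omega> SymB) (u l))"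
    by (simp only: eq[OF assms(3)] eq[OF assms(6)])
  have I: "integrable P (\<lambda>\<omega>. \<Prod>l\<in>E1. case_prod (X \<omega> SymA) (u l))" "integrable P (\<lambda>\<omega>. \<Prod>l\<in>E2. case_prod (X \<omega> SymB) (u l))"
    by (rule product_integrable; use assms in simp)+
  show "(\<integral>\<omega>. (\<Prod>l\<in>E1. case_prod (X \<omega> SymA) (u l)) * (\<Prod>l\<in>E2. case_prod (X \<omega> SymB) (u l)) \<partial>P)
      = mean_product SymA E1 u * mean_product SymB E2 u"
    unfolding mean_product_def
    by (rule indep_var_lebesgue_integral[OF iv I])
  show "integrable P (\<lambda>\<omega>. (\<Prod>l\<in>E1. case_prod (X \<omega> SymA) (u l)) * (\<Prod>l\<in>E2. case_prod (X \<omega> SymB) (u l)))"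
    by (rule indep_var_integrable[OF iv I])
qed

end

section \<open>Second moments of the non-closed walk sums\<close>

context random_pair
begin

text \<open>Any two injective labellings differ by a permutation of the indices, so the mean for the
  invariant letter depends on the pattern \<open>g\<close> alone.\<close>

lemma mean_product_permute:
  assumes P: "permutation_invariant P N (mt s)"
    and \<phi>: "\<phi> \<in> inj_maps {..<m} N" and \<psi>: "\<psi> \<in> inj_maps {..<m} N"
    and g: "\<And>l. l < n \<Longrightarrow> g l < m" and E: "E \<subseteq> {..<n}"
  shows "mean_product s E (index_pair n k (compose {..<n} \<phi> g)) = mean_product s E (index_pair n k (compose {..<n} \<psi> g))"
proof -
  obtain \<sigma> where \<sigma>: "\<sigma> permutes {..<N}" "\<And>v. v < m \<Longrightarrow> \<sigma> (\<phi> v) = \<psi> v"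
    using permutation_extending[OF \<phi> \<psi>] by blast
  define u where "u = index_pair n k (compose {..<n} \<phi> g)"
  have pred: "cyclic_pred n l < n" if "l < n" for l using that by (auto simp: cyclic_pred_def)
  have c: "compose {..<n} \<theta> g l = \<theta> (g l)" if "l < n" for l \<theta> using that by (simp add: compose_def)
  have u: "u l \<in> {..<N} \<times> {..<N}" if "l \<in> E" for l
  proof -
    have l: "l < n" using that E by auto
    have "\<phi> (g l) < N" "\<phi> (g (cyclic_pred n l)) < N"
      using \<phi> g[OF l] g[OF pred[OF l]] by (auto simp: inj_maps_def)
    then show ?thesis using l pred[OF l] by (auto simp: u_def index_pair_def c)
  qed
  have v: "index_pair n k (compose {..<n} \<psi> g) l = (\<sigma> (fst (u l)), \<sigma> (snd (u l)))" if "l \<in> E" for l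
  proof -
    have l: "l < n" using that E by auto
    show ?thesis using l pred[OF l] g[OF l] g[OF pred[OF l]] by (simp add: u_def index_pair_def c \<sigma>(2))
  qed
  have "mean_product s E (index_pair n k (compose {..<n} \<psi> g))
      = (\<integral>\<omega>. (\<Prod>l\<in>E. mt s \<omega> $$ (\<sigma> (fst (u l)), \<sigma> (snd (u l)))) \<partial>P)"
    unfolding mean_product_def
    by (intro Bochner_Integration.integral_cong prod.cong refl) (simp add: v X_mt)
  also have "\<dots> = (\<integral>\<omega>. (\<Prod>l\<in>E. mt s \<omega> $$ u l) \<partial>P)"
    by (rule permutation_invariant_product[OF P random_mt \<sigma>(1) u])
  also have "\<dots> = mean_product s E u"
    unfolding mean_product_def by (simp add: X_mt case_prod_unfold)
  finally show ?thesis by (simp add: u_def)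
qed

text \<open>The trail bound holds for each realisation with the random norm \<open>rho\<close>,
  first on colour classes and then, at the price m ^ m, on injective labellings. The expectation is
  taken only afterwards.\<close>

lemma injective_mean_bound:
  assumes g: "g \<in> surj_maps n m" and m: "m \<ge> 1" and n: "n \<le> 2 * M"
    and Q: "minimal_trails (g \<circ> cyclic_pred n) g {..<m} E Q" and E: "E \<subseteq> {..<n}"
  shows "cmod (\<Sum>\<phi>\<in>inj_maps {..<m} N. mean_product s E (index_pair n k (compose {..<n} \<phi> g)))
    \<le> real m ^ m * (real N ^ size Q * \<kappa> powr (real (card E) / (2 * real M)))"
proof -
  interpret Q: minimal_trails "g \<circ> cyclic_pred n" g "{..<m}" E Q by (rule Q)
  have finE: "finite E" using E finite_subset by blast
  have cE: "card E \<le> 2 * M" using card_mono[OF _ E] n by simp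
  have pred: "cyclic_pred n l < n" if "l < n" for l using that by (auto simp: cyclic_pred_def)
  have gm: "g l < m" if "l < n" for l using g that by (auto simp: surj_maps_def)
  define F where "F \<omega> \<phi> = (\<Prod>l\<in>E. case_prod (X \<omega> s) (index_pair n k (compose {..<n} \<phi> g) l))" for \<omega> \<phi>
  have u: "index_pair n k (compose {..<n} \<phi> g) l \<in> {..<N} \<times> {..<N}" if "\<phi> \<in> inj_maps {..<m} N" "l \<in> E" for \<phi> l
  proof -
    have l: "l < n" using that E by auto
    have "\<phi> (g l) < N" "\<phi> (g (cyclic_pred n l)) < N"
      using that(1) gm[OF l] gm[OF pred[OF l]] by (auto simp: inj_maps_def)
    then show ?thesis using l pred[OF l] by (auto simp: index_pair_def compose_def)
  qed
  have intF: "integrable P (\<lambda>\<omega>. F \<omega> \<phi>)" if "\<phi> \<in> inj_maps {..<m} N" for \<phi>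
    unfolding F_def by (rule product_integrable) (use finE cE u[OF that] in auto)
  have ptw: "cmod (\<Sum>\<phi>\<in>inj_maps {..<m} N. F \<omega> \<phi>) \<le> real m ^ m * (real N ^ size Q * rho s \<omega> ^ card E)"
    if \<omega>: "\<omega> \<in> space P" for \<omega>
  proof -
    \<comment> \<open>Edge l runs from the previous vertex to the current one. In the first half the
      entry is read against this direction, hence the transpose.\<close>
    define Y where "Y l = (if l < k then (\<lambda>i j. X \<omega> s j i) else X \<omega> s)" for l
    have FY: "F \<omega> \<phi> = (\<Prod>l\<in>E. Y l (\<phi> ((g \<circ> cyclic_pred n) l)) (\<phi> (g l)))" for \<phi>
      unfolding F_def
    proof (rule prod.cong[OF refl])
      fix l assume "l \<in> E"
      then have "l < n" using E by auto
      then show "case_prod (X \<omega> s) (index_pair n k (compose {..<n} \<phi> g) l) = Y l (\<phi> ((g \<circ> cyclic_pred n) l)) (\<phi> (g l))"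
        using pred[of l] by (simp add: index_pair_def compose_def Y_def)
    qed
    have "cmod (\<Sum>\<phi>\<in>inj_maps {..<m} N. F \<omega> \<phi>) \<le> real (card {..<m}) ^ card {..<m} * (real N ^ size Q * rho s \<omega> ^ card E)"
    proof (rule injective_sum_by_colouring)
      fix S :: "nat \<Rightarrow> nat set" assume S: "\<And>v. S v \<subseteq> {..<N}"
      show "cmod (\<Sum>\<phi>\<in>PiE {..<m} S. F \<omega> \<phi>) \<le> real N ^ size Q * rho s \<omega> ^ card E"
        unfolding FY
      proof (rule Q.trail_sum_bound)
        show "opnorm_le N (rho s \<omega>) (Y l) \<and> opnorm_le N (rho s \<omega>) (\<lambda>i j. Y l j i)" for l
          using X_opnorm[OF \<omega>, of s] by (simp add: Y_def)
        show "{..<m} \<noteq> {}" using m by (auto simp: lessThan_empty_iff)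
      qed (rule S)
    qed simp
    then show ?thesis by simp
  qed
  have "(\<Sum>\<phi>\<in>inj_maps {..<m} N. mean_product s E (index_pair n k (compose {..<n} \<phi> g)))
      = (\<integral>\<omega>. (\<Sum>\<phi>\<in>inj_maps {..<m} N. F \<omega> \<phi>) \<partial>P)"
    unfolding mean_product_def F_def[symmetric] by (rule Bochner_Integration.integral_sum[symmetric]) (rule intF)
  also have "cmod \<dots> \<le> (\<integral>\<omega>. cmod (\<Sum>\<phi>\<in>inj_maps {..<m} N. F \<omega> \<phi>) \<partial>P)"
    by (rule integral_norm_bound)
  also have "\<dots> \<le> (\<integral>\<omega>. real m ^ m * (real N ^ size Q * rho s \<omega> ^ card E) \<partial>P)"
  proof (rule integral_mono)
    show "integrable P (\<lambda>\<omega>. cmod (\<Sum>\<phi>\<in>inj_maps {..<m} N. F \<omega> \<phi>))"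
      by (intro integrable_norm Bochner_Integration.integrable_sum intF)
    show "integrable P (\<lambda>\<omega>. real m ^ m * (real N ^ size Q * rho s \<omega> ^ card E))"
      by (intro integrable_mult_right rho_power_integrable(1) cE)
  qed (rule ptw)
  also have "\<dots> = real m ^ m * (real N ^ size Q * (\<integral>\<omega>. rho s \<omega> ^ card E \<partial>P))" by simp
  also have "\<dots> \<le> real m ^ m * (real N ^ size Q * \<kappa> powr (real (card E) / (2 * real M)))"
    by (intro mult_left_mono rho_power_integrable(2) cE) auto
  finally show ?thesis .
qed

text \<open>As the mean for the invariant letter is constant in the labelling, the sum of products
  is the product of the two sums divided by the number of labellings, at least (N / 2) ^ m. The
  trails number at most m, so only the powers of N coming from the norms survive.\<close>

lemma pattern_bound:
  assumes k: "k \<ge> 1" "k \<le> M" and n: "n = 2 * k" and N: "4 * k \<le> N"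
    and g: "g \<in> surj_maps n m" and m: "1 \<le> m" "m \<le> n" and good: "good_pattern n k ls g"
  defines "E s \<equiv> {l. l < n \<and> ls l = s}"
  shows "cmod (\<Sum>\<phi>\<in>inj_maps {..<m} N. mean_product SymA (E SymA) (index_pair n k (compose {..<n} \<phi> g))
      * mean_product SymB (E SymB) (index_pair n k (compose {..<n} \<phi> g)))
    \<le> real m ^ (2 * m) * 2 ^ m * (real N powr (real k / real M) * C ^ k)"
proof -
  have Esub: "E s \<subseteq> {..<n}" for s by (auto simp: E_def)
  have finE: "finite (E s)" for s using Esub finite_subset by blast
  have gm: "g l < m" if "l < n" for l using g that by (auto simp: surj_maps_def)
  have pred: "cyclic_pred n l < n" if "l < n" for l using that by (auto simp: cyclic_pred_def)
  have im: "{..<m} = g ` {..<n}" using g by (simp add: surj_maps_def)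
  have "\<exists>Q. minimal_trails (g \<circ> cyclic_pred n) g {..<m} (E s) Q" for s
    by (rule minimal_trails_exist) (use finE gm pred in \<open>auto simp: E_def\<close>)
  then obtain Q where Q: "\<And>s. minimal_trails (g \<circ> cyclic_pred n) g {..<m} (E s) (Q s)" by metis
  have cards: "card (E SymA) + card (E SymB) = n"
  proof -
    have "card (E SymA \<union> E SymB) = card (E SymA) + card (E SymB)"
      by (rule card_Un_disjoint) (auto simp: finE E_def)
    moreover have "E SymA \<union> E SymB = {..<n}" using sym.exhaust by (auto simp: E_def)
    ultimately show ?thesis by simp
  qed
  have sizes: "size (Q SymA) + size (Q SymB) \<le> m"
  proof -
    have "size (Q SymA) + size (Q SymB) \<le> card {..<m}"
    proof (rule trails_count_nonclosed[where f = g and ls = ls and n = n and k = k])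
      show "stack_run (g (n - 1)) (take k (map (\<lambda>l. (ls l, g l)) [0..<n])) \<noteq> []"
        using good by (simp add: good_pattern_def seq_walk_def)
      show "g (k - 1) = g (n - 1)" using good by (simp add: good_pattern_def)
    qed (use Q[unfolded E_def] im k n in auto)
    then show ?thesis by simp
  qed
  define c where "c s \<phi> = mean_product s (E s) (index_pair n k (compose {..<n} \<phi> g))" for s \<phi>
  define T where "T s = (\<Sum>\<phi>\<in>inj_maps {..<m} N. c s \<phi>)" for s
  define I where "I = inj_maps {..<m} N"
  have T: "cmod (T s) \<le> real m ^ m * (real N ^ size (Q s) * \<kappa> powr (real (card (E s)) / (2 * real M)))" for s
    unfolding T_def c_def by (rule injective_mean_bound[OF g m(1) _ Q Esub]) (use k n in simp)
  have "permutation_invariant P N (mt SymA) \<or> permutation_invariant P N (mt SymB)"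
    using perm by (simp add: mt_def)
  then obtain s where s: "permutation_invariant P N (mt s)" by blast
  have prod: "of_nat (card I) * (\<Sum>\<phi>\<in>I. c SymA \<phi> * c SymB \<phi>) = T SymA * T SymB"
  proof (cases "I = {}")
    case True
    then show ?thesis by (simp add: T_def I_def)
  next
    case False
    then obtain \<phi>0 where \<phi>0: "\<phi>0 \<in> I" by auto
    have const: "c s \<phi> = c s \<phi>0" if "\<phi> \<in> I" for \<phi>
      unfolding c_def by (rule mean_product_permute[OF s _ _ _ Esub]) (use that \<phi>0 gm in \<open>auto simp: I_def\<close>)
    have Ts: "T s = of_nat (card I) * c s \<phi>0" by (simp add: T_def I_def[symmetric] const)
    have swap: "c SymA \<phi> * c SymB \<phi> = c s \<phi> * c (other_sym s) \<phi>" for \<phi> by (cases s) auto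
    have "(\<Sum>\<phi>\<in>I. c SymA \<phi> * c SymB \<phi>) = (\<Sum>\<phi>\<in>I. c s \<phi>0 * c (other_sym s) \<phi>)"
      unfolding swap by (intro sum.cong refl) (simp add: const)
    also have "\<dots> = c s \<phi>0 * T (other_sym s)" by (simp add: T_def I_def sum_distrib_left)
    finally have "of_nat (card I) * (\<Sum>\<phi>\<in>I. c SymA \<phi> * c SymB \<phi>) = T s * T (other_sym s)"
      by (simp add: Ts)
    then show ?thesis by (cases s) auto
  qed
  have mN: "2 * m \<le> N" using m n N by simp
  define D where "D = cmod (\<Sum>\<phi>\<in>I. c SymA \<phi> * c SymB \<phi>)"
  have "(real N / 2) ^ m * D \<le> real (card I) * D"
    using card_inj_maps_ge[OF mN] by (intro mult_right_mono) (auto simp: D_def I_def)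
  also have "\<dots> = cmod (T SymA) * cmod (T SymB)"
    unfolding D_def using arg_cong[OF prod, of cmod] by (simp add: norm_mult)
  also have "\<dots> \<le> (real m ^ m * (real N ^ size (Q SymA) * \<kappa> powr (real (card (E SymA)) / (2 * real M))))
     * (real m ^ m * (real N ^ size (Q SymB) * \<kappa> powr (real (card (E SymB)) / (2 * real M))))"
    by (intro mult_mono T) auto
  also have "\<dots> = real m ^ (2 * m) * real N ^ (size (Q SymA) + size (Q SymB)) * \<kappa> powr (real k / real M)"
  proof -
    have "real (card (E SymA)) / (2 * real M) + real (card (E SymB)) / (2 * real M) = real k / real M"
      using arg_cong[OF cards, of real] M1 n by (simp add: field_simps)
    then have "\<kappa> powr (real (card (E SymA)) / (2 * real M)) * \<kappa> powr (real (card (E SymB)) / (2 * real M)) = \<kappa> powr (real k / real M)"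
      by (simp flip: powr_add)
    from this[symmetric] show ?thesis
      by (simp only: mult_2[of m] power_add) (simp only: mult_ac)
  qed
  also have "\<dots> \<le> real m ^ (2 * m) * real N ^ m * \<kappa> powr (real k / real M)"
    using sizes N1 by (intro mult_right_mono mult_left_mono power_increasing) auto
  finally have "(real N / 2) ^ m * D \<le> real N ^ m * (real m ^ (2 * m) * \<kappa> powr (real k / real M))"
    by (simp add: mult_ac)
  then have "real N ^ m * D \<le> real N ^ m * (2 ^ m * (real m ^ (2 * m) * \<kappa> powr (real k / real M)))"
    by (simp add: power_divide field_simps)
  then have "D \<le> 2 ^ m * (real m ^ (2 * m) * \<kappa> powr (real k / real M))"
    using N1 by (subst (asm) mult_le_cancel_left_pos) auto
  moreover have "\<kappa> powr (real k / real M) = real N powr (real k / real M) * C ^ k"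
    unfolding \<kappa>_def using C0 M1 by (simp add: powr_mult powr_realpow[symmetric] powr_powr)
  ultimately show ?thesis by (simp add: D_def I_def c_def mult_ac)
qed

text \<open>A single term of the exponential series. It lets the \<open>fact m\<close> of the
  pattern sum absorb one m ^ m up to exp m.\<close>

lemma power_self_le_fact: "real m ^ m \<le> fact m * exp (real m)"
proof -
  have "real m ^ m / fact m \<le> exp (real m)"
    using sum_le_suminf[of "\<lambda>i. real m ^ i /\<^sub>R fact i" "{m}"] summable_exp_generic[of "real m"]
    by (simp add: exp_def divide_inverse mult.commute)
  then show ?thesis by (simp add: divide_le_eq mult.commute)
qed

text \<open>The base 4 * exp 1 collects 2 from the choice of letters, 2 from N / 2 in the count of
  labellings and exp 1 from the factorial. The power (2 * k) ^ (4 * k) is n ^ n surjections times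
  the m ^ m that is left.\<close>

lemma second_moment:
  assumes k: "k \<ge> 1" "k \<le> M" and N: "4 * k \<le> N"
  shows "i < N \<Longrightarrow> integrable P (\<lambda>\<omega>. (cmod (nonclosed_sum N (X \<omega>) k i))\<^sup>2)"
    and "(\<Sum>i<N. \<integral>\<omega>. (cmod (nonclosed_sum N (X \<omega>) k i))\<^sup>2 \<partial>P)
      \<le> real (2 * k) * (4 * exp 1) ^ (2 * k) * real (2 * k) ^ (4 * k) * (real N powr (real k / real M) * C ^ k)"
proof -
  define n where "n = 2 * k"
  define E where "E ls s = {l. l < n \<and> ls l = s}" for ls :: "nat \<Rightarrow> sym" and s
  define W where "W ls f \<omega> = (\<Prod>l<n. case_prod (X \<omega> (ls l)) (index_pair n k f l))" for ls f \<omega>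
  define LS where "LS = {..<n} \<rightarrow>\<^sub>E (UNIV :: sym set)"
  define FS where "FS = {..<n} \<rightarrow>\<^sub>E {..<N}"
  define c where "c ls f = mean_product SymA (E ls SymA) (index_pair n k f) * mean_product SymB (E ls SymB) (index_pair n k f)" for ls f
  have E: "E ls s \<subseteq> {..<n}" "finite (E ls s)" "card (E ls s) \<le> 2 * M" for ls s
  proof -
    show 1: "E ls s \<subseteq> {..<n}" by (auto simp: E_def)
    show "finite (E ls s)" using 1 finite_subset by blast
    show "card (E ls s) \<le> 2 * M" using card_mono[OF _ 1] k by (simp add: n_def)
  qed
  have u: "index_pair n k f l \<in> {..<N} \<times> {..<N}" if "f \<in> FS" "l < n" for f l
  proof -
    have "cyclic_pred n l < n" using that(2) by (auto simp: cyclic_pred_def)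
    then have "f l < N" "f (cyclic_pred n l) < N" using that PiE_mem[of f "{..<n}" "\<lambda>_. {..<N}"] by (auto simp: FS_def)
    then show ?thesis by (simp add: index_pair_def)
  qed
  have W_split: "W ls f \<omega> = (\<Prod>l\<in>E ls SymA. case_prod (X \<omega> SymA) (index_pair n k f l)) *
      (\<Prod>l\<in>E ls SymB. case_prod (X \<omega> SymB) (index_pair n k f l))" for ls f \<omega>
  proof -
    have un: "{..<n} = E ls SymA \<union> E ls SymB" using sym.exhaust by (auto simp: E_def)
    have "W ls f \<omega> = (\<Prod>l\<in>E ls SymA. case_prod (X \<omega> (ls l)) (index_pair n k f l)) *
      (\<Prod>l\<in>E ls SymB. case_prod (X \<omega> (ls l)) (index_pair n k f l))"
      unfolding W_def un by (rule prod.union_disjoint[OF E(2) E(2)]) (auto simp: E_def)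
    moreover have "(\<Prod>l\<in>E ls s. case_prod (X \<omega> (ls l)) (index_pair n k f l)) = (\<Prod>l\<in>E ls s. case_prod (X \<omega> s) (index_pair n k f l))" for s
      by (rule prod.cong) (auto simp: E_def)
    ultimately show ?thesis by (simp only:)
  qed
  have W_int: "integrable P (W ls f)" "(\<integral>\<omega>. W ls f \<omega> \<partial>P) = c ls f" if "f \<in> FS" for ls f
  proof -
    have ux: "\<And>l. l \<in> E ls s \<Longrightarrow> index_pair n k f l \<in> {..<N} \<times> {..<N}" for s
      using u[OF that] E(1) by blast
    have "integrable P (\<lambda>\<omega>. (\<Prod>l\<in>E ls SymA. case_prod (X \<omega> SymA) (index_pair n k f l)) *
      (\<Prod>l\<in>E ls SymB. case_prod (X \<omega> SymB) (index_pair n k f l)))"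
      by (rule mean_product_independent(2)) (use E ux in auto)
    then show "integrable P (W ls f)" unfolding W_split[abs_def] .
    have "(\<integral>\<omega>. (\<Prod>l\<in>E ls SymA. case_prod (X \<omega> SymA) (index_pair n k f l)) *
      (\<Prod>l\<in>E ls SymB. case_prod (X \<omega> SymB) (index_pair n k f l)) \<partial>P) = c ls f"
      unfolding c_def by (rule mean_product_independent(1)) (use E ux in auto)
    then show "(\<integral>\<omega>. W ls f \<omega> \<partial>P) = c ls f" by (simp add: W_split)
  qed
  have W_if: "integrable P (\<lambda>\<omega>. if G then W ls f \<omega> else 0)"
    "(\<integral>\<omega>. (if G then W ls f \<omega> else 0) \<partial>P) = (if G then c ls f else 0)" if "f \<in> FS" for ls f G
    using W_int[OF that, of ls] by (cases G; simp)+
  define H where "H \<omega> = (\<Sum>ls\<in>LS. \<Sum>f\<in>FS. if good_pattern n k ls f then W ls f \<omega> else 0)" for \<omega>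
  have H_int: "integrable P H" unfolding H_def by (intro Bochner_Integration.integrable_sum W_if(1))
  have H_eq: "complex_of_real (\<Sum>i<N. (cmod (nonclosed_sum N (X \<omega>) k i))\<^sup>2) = H \<omega>" if "\<omega> \<in> space P" for \<omega>
    using hermitian_pair.sum_nonclosed_squares[OF pair[OF that] k(1)]
    unfolding H_def LS_def FS_def W_def n_def of_real_sum .
  have D_meas: "(\<lambda>\<omega>. nonclosed_sum N (X \<omega>) k i) \<in> borel_measurable P" if i: "i < N" for i
    unfolding nonclosed_sum_def walk_weight_prod
  proof (intro borel_measurable_sum borel_measurable_prod X_measurable)
    fix p l assume "p \<in> nonclosed_walks N k i" "l \<in> {..<length p}"
    then have p: "set p \<subseteq> UNIV \<times> {..<N}" and l: "l < length p" by (auto simp: nonclosed_walks_def walks_def)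
    have pN: "snd (p ! j) < N" if "j < length p" for j
      using subsetD[OF p nth_mem[OF that]] by (simp add: mem_Times_iff)
    show "snd (p ! l) < N" by (rule pN[OF l])
    show "(if l = 0 then i else snd (p ! (l - 1))) < N" using i l pN[of "l - 1"] by simp
  qed
  show int: "integrable P (\<lambda>\<omega>. (cmod (nonclosed_sum N (X \<omega>) k i))\<^sup>2)" if i: "i < N" for i
  \<comment> \<open>One square is dominated by the sum over all i, which is integrable as a finite
    sum of products of entries.\<close>
  proof (rule Bochner_Integration.integrable_bound[OF H_int])
    show "(\<lambda>\<omega>. (cmod (nonclosed_sum N (X \<omega>) k i))\<^sup>2) \<in> borel_measurable P"
      using D_meas[OF i] by measurable
    show "AE \<omega> in P. norm ((cmod (nonclosed_sum N (X \<omega>) k i))\<^sup>2) \<le> norm (H \<omega>)"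
    proof (rule AE_I2)
      fix \<omega> assume \<omega>: "\<omega> \<in> space P"
      have "(cmod (nonclosed_sum N (X \<omega>) k i))\<^sup>2 \<le> (\<Sum>i<N. (cmod (nonclosed_sum N (X \<omega>) k i))\<^sup>2)"
        using i by (intro member_le_sum) auto
      moreover have "norm (H \<omega>) = (\<Sum>i<N. (cmod (nonclosed_sum N (X \<omega>) k i))\<^sup>2)"
        unfolding H_eq[OF \<omega>, symmetric] norm_of_real by (simp add: sum_nonneg)
      ultimately show "norm ((cmod (nonclosed_sum N (X \<omega>) k i))\<^sup>2) \<le> norm (H \<omega>)" by simp
    qed
  qed
  have n1: "n \<ge> 1" using k by (simp add: n_def)
  define K where "K = real N powr (real k / real M) * C ^ k"
  have K0: "0 \<le> K" using C0 by (simp add: K_def)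
  have inner: "cmod (\<Sum>f\<in>FS. if good_pattern n k ls f then c ls f else 0)
      \<le> real n * (exp 1 ^ n * real n ^ (2 * n) * 2 ^ n * K)" for ls
  proof -
    define G where "G f = (if good_pattern n k ls f then c ls f else 0)" for f
    have "(\<Sum>f\<in>FS. G f) = (\<Sum>m=1..n. (\<Sum>g\<in>surj_maps n m. \<Sum>\<phi>\<in>inj_maps {..<m} N. G (compose {..<n} \<phi> g)) / fact m)"
      unfolding FS_def by (rule sum_by_pattern[OF n1])
    also have "cmod \<dots> \<le> (\<Sum>m=1..n. exp 1 ^ n * real n ^ (2 * n) * 2 ^ n * K)"
    proof (rule order_trans[OF norm_sum], rule sum_mono)
      fix m assume m: "m \<in> {1..n}"
      have g_bound: "cmod (\<Sum>\<phi>\<in>inj_maps {..<m} N. G (compose {..<n} \<phi> g)) \<le> real m ^ (2 * m) * 2 ^ m * K"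
        if g: "g \<in> surj_maps n m" for g
      proof -
        have gm: "g l < m" if "l < n" for l using g that by (auto simp: surj_maps_def)
        have inv: "good_pattern n k ls (compose {..<n} \<phi> g) \<longleftrightarrow> good_pattern n k ls g" if "\<phi> \<in> inj_maps {..<m} N" for \<phi>
          by (rule good_pattern_compose[where W = "{..<m}"]) (use that gm k in \<open>auto simp: inj_maps_def n_def\<close>)
        have "(\<Sum>\<phi>\<in>inj_maps {..<m} N. G (compose {..<n} \<phi> g))
          = (\<Sum>\<phi>\<in>inj_maps {..<m} N. if good_pattern n k ls g then c ls (compose {..<n} \<phi> g) else 0)"
          unfolding G_def by (intro sum.cong refl) (simp add: inv)
        also have "cmod \<dots> \<le> real m ^ (2 * m) * 2 ^ m * K"
        proof (cases "good_pattern n k ls g")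
          case True
          then show ?thesis
            using pattern_bound[OF k n_def N g _ _ True] m by (simp add: c_def E_def K_def)
        qed (use K0 in simp)
        finally show ?thesis .
      qed
      have mm: "real m ^ (2 * m) \<le> fact m * exp (real m) * real m ^ m"
        using mult_right_mono[OF power_self_le_fact[of m], of "real m ^ m"] by (simp add: mult_2 power_add)
      have "cmod (\<Sum>g\<in>surj_maps n m. \<Sum>\<phi>\<in>inj_maps {..<m} N. G (compose {..<n} \<phi> g))
          \<le> real (card (surj_maps n m)) * (real m ^ (2 * m) * 2 ^ m * K)"
        by (rule sum_norm_bound) (rule g_bound)
      also have "\<dots> \<le> real n ^ n * ((fact m * exp (real m) * real m ^ m) * 2 ^ m * K)"
      proof (intro mult_mono mult_right_mono mm)
        have "real (card (surj_maps n m)) \<le> real (m ^ n)" using card_surj_maps_le of_nat_mono by blast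
        also have "\<dots> \<le> real n ^ n" using m by (simp add: power_mono)
        finally show "real (card (surj_maps n m)) \<le> real n ^ n" .
      qed (use K0 in auto)
      also have "\<dots> = fact m * (exp (real m) * (real n ^ n * real m ^ m) * 2 ^ m * K)" by (simp add: mult_ac)
      also have "\<dots> \<le> fact m * (exp (real n) * (real n ^ n * real n ^ n) * 2 ^ n * K)"
      proof (intro mult_left_mono mult_right_mono mult_mono)
        have "real m ^ m \<le> real n ^ m" using m by (intro power_mono) auto
        also have "\<dots> \<le> real n ^ n" using m n1 by (intro power_increasing) auto
        finally show "real m ^ m \<le> real n ^ n" .
        show "(2::real) ^ m \<le> 2 ^ n" using m by (intro power_increasing) auto
      qed (use m K0 in auto)
      finally have "cmod (\<Sum>g\<in>surj_maps n m. \<Sum>\<phi>\<in>inj_maps {..<m} N. G (compose {..<n} \<phi> g))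
          \<le> fact m * (exp (real n) * (real n ^ n * real n ^ n) * 2 ^ n * K)" .
      then have "cmod ((\<Sum>g\<in>surj_maps n m. \<Sum>\<phi>\<in>inj_maps {..<m} N. G (compose {..<n} \<phi> g)) / fact m)
          \<le> exp (real n) * (real n ^ n * real n ^ n) * 2 ^ n * K"
        by (simp add: norm_divide divide_le_eq mult.commute)
      then show "cmod ((\<Sum>g\<in>surj_maps n m. \<Sum>\<phi>\<in>inj_maps {..<m} N. G (compose {..<n} \<phi> g)) / fact m)
          \<le> exp 1 ^ n * real n ^ (2 * n) * 2 ^ n * K"
        by (simp add: exp_of_nat_mult[symmetric] mult_2 power_add flip: exp_of_nat_mult)
    qed
    finally show ?thesis by (simp add: G_def)
  qed
  have "complex_of_real (\<Sum>i<N. \<integral>\<omega>. (cmod (nonclosed_sum N (X \<omega>) k i))\<^sup>2 \<partial>P)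
      = complex_of_real (\<integral>\<omega>. (\<Sum>i<N. (cmod (nonclosed_sum N (X \<omega>) k i))\<^sup>2) \<partial>P)"
    by (subst Bochner_Integration.integral_sum) (auto intro: int)
  also have "\<dots> = (\<integral>\<omega>. H \<omega> \<partial>P)"
    unfolding integral_complex_of_real[symmetric]
    by (intro Bochner_Integration.integral_cong refl) (rule H_eq)
  also have "\<dots> = (\<Sum>ls\<in>LS. \<Sum>f\<in>FS. \<integral>\<omega>. (if good_pattern n k ls f then W ls f \<omega> else 0) \<partial>P)"
    unfolding H_def
    by (subst Bochner_Integration.integral_sum; (intro Bochner_Integration.integrable_sum W_if(1)
          sum.cong refl Bochner_Integration.integral_sum; assumption)?)
  also have "\<dots> = (\<Sum>ls\<in>LS. \<Sum>f\<in>FS. if good_pattern n k ls f then c ls f else 0)"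
    by (intro sum.cong refl W_if(2))
  finally have eq: "complex_of_real (\<Sum>i<N. \<integral>\<omega>. (cmod (nonclosed_sum N (X \<omega>) k i))\<^sup>2 \<partial>P)
      = (\<Sum>ls\<in>LS. \<Sum>f\<in>FS. if good_pattern n k ls f then c ls f else 0)" .
  have "(\<Sum>i<N. \<integral>\<omega>. (cmod (nonclosed_sum N (X \<omega>) k i))\<^sup>2 \<partial>P)
      \<le> cmod (\<Sum>ls\<in>LS. \<Sum>f\<in>FS. if good_pattern n k ls f then c ls f else 0)"
    unfolding eq[symmetric] norm_of_real by simp
  also have "\<dots> \<le> real (card LS) * (real n * (exp 1 ^ n * real n ^ (2 * n) * 2 ^ n * K))"
    by (rule sum_norm_bound) (rule inner)
  also have "card LS = 2 ^ n" by (simp add: LS_def card_PiE UNIV_sym numeral_2_eq_2)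
  also have "real (2 ^ n) * (real n * (exp 1 ^ n * real n ^ (2 * n) * 2 ^ n * K))
      = real n * (4 * exp 1) ^ n * real n ^ (2 * n) * K"
  proof -
    have "(4 * exp 1 :: real) ^ n = 2 ^ n * 2 ^ n * exp 1 ^ n"
      unfolding power_mult_distrib[of 4] power_mult_distrib[of 2 2, symmetric] by simp
    then show ?thesis by (simp only: of_nat_power of_nat_numeral mult_ac)
  qed
  finally show "(\<Sum>i<N. \<integral>\<omega>. (cmod (nonclosed_sum N (X \<omega>) k i))\<^sup>2 \<partial>P)
      \<le> real (2 * k) * (4 * exp 1) ^ (2 * k) * real (2 * k) ^ (4 * k) * (real N powr (real k / real M) * C ^ k)"
    by (simp add: n_def K_def)
qed

end

section \<open>Comparison of the Cauchy transforms\<close>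

text \<open>The resolvent is given by \<open>inv_into\<close>, which says nothing about
  measurability; its approximants are finite algebraic expressions in the entries and in
  \<open>R\<close>.\<close>

lemma richardson_measurable:
  fixes t :: "'w \<Rightarrow> 'v \<Rightarrow> 'v \<Rightarrow> complex"
  assumes ker: "\<And>\<omega>. \<omega> \<in> space P \<Longrightarrow> hermitian_kernel (t \<omega>) nb (R \<omega>)"
    and t: "\<And>v w. (\<lambda>\<omega>. t \<omega> v w) \<in> borel_measurable P" and R: "R \<in> borel_measurable P"
  shows "(\<lambda>\<omega>. hermitian_kernel.richardson (t \<omega>) nb (R \<omega>) z d n v) \<in> borel_measurable P"
proof (induction n arbitrary: v)
  case 0
  have "(\<lambda>\<omega>. 0 :: complex) \<in> borel_measurable P" by simp
  then show ?case
    by (rule iffD1[OF measurable_cong, rotated]) (simp add: hermitian_kernel.richardson.simps(1)[OF ker])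
next
  case (Suc n)
  define r where "r \<omega> = hermitian_kernel.richardson (t \<omega>) nb (R \<omega>) z d n" for \<omega>
  define q where "q \<omega> w = z * r \<omega> w - (\<Sum>u\<in>nb w. t \<omega> w u * r \<omega> u) - d w" for \<omega> w
  have r: "(\<lambda>\<omega>. r \<omega> w) \<in> borel_measurable P" for w unfolding r_def by (rule Suc.IH)
  have q: "(\<lambda>\<omega>. q \<omega> w) \<in> borel_measurable P" for w
    unfolding q_def
    by (intro borel_measurable_diff borel_measurable_times borel_measurable_sum borel_measurable_const r t)
  have \<eta>: "(\<lambda>\<omega>. complex_of_real (1 / (cmod z + R \<omega>)\<^sup>2)) \<in> borel_measurable P" using R by measurable
  have "(\<lambda>\<omega>. r \<omega> v - of_real (1 / (cmod z + R \<omega>)\<^sup>2) * (cnj z * q \<omega> v - (\<Sum>w\<in>nb v. t \<omega> v w * q \<omega> w))) \<in> borel_measurable P"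
    by (intro borel_measurable_diff borel_measurable_times borel_measurable_sum borel_measurable_const r t q \<eta>)
  then show ?case
    by (rule iffD1[OF measurable_cong, rotated])
      (simp add: hermitian_kernel.richardson.simps(2)[OF ker] hermitian_kernel.shifted_def[OF ker]
        hermitian_kernel.ap_def[OF ker] r_def q_def)
qed

context random_pair
begin

lemma kernel_bound_measurable: "(\<lambda>\<omega>. kernel_bound N (X \<omega>)) \<in> borel_measurable P"
  unfolding kernel_bound_def by (intro borel_measurable_sum measurable_compose[OF X_measurable borel_measurable_norm]) auto

lemma sum_kernel_measurable: "(\<lambda>\<omega>. sum_kernel N (X \<omega>) i j) \<in> borel_measurable P"
  unfolding sum_kernel_def by (cases "i < N \<and> j < N") (auto intro!: borel_measurable_sum X_measurable)

lemma free_kernel_measurable: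
  assumes "x < N"
  shows "(\<lambda>\<omega>. free_kernel N x (X \<omega>) v w) \<in> borel_measurable P"
proof (cases "v \<in> vertices N x \<and> w \<in> vertices N x")
  case True
  have "(\<lambda>\<omega>. X \<omega> s (last_index x v) (last_index x w)) \<in> borel_measurable P" for s
    by (intro X_measurable last_index_less[OF _ assms]) (use True in auto)
  then have "(\<lambda>\<omega>. if vertex_base s v = vertex_base s w then X \<omega> s (last_index x v) (last_index x w) else 0)
      \<in> borel_measurable P" for s
    by (cases "vertex_base s v = vertex_base s w") simp_all
  then have "(\<lambda>\<omega>. \<Sum>s\<in>UNIV. if vertex_base s v = vertex_base s w then X \<omega> s (last_index x v) (last_index x w) else 0)
      \<in> borel_measurable P"
    by (intro borel_measurable_sum)
  then show ?thesis unfolding free_kernel_def if_P[OF True] .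
next
  case False
  show ?thesis unfolding free_kernel_def if_not_P[OF False] by simp
qed

definition entry_error :: "nat \<Rightarrow> complex \<Rightarrow> nat \<Rightarrow> 'w \<Rightarrow> complex" where
  "entry_error x z i \<omega> = cauchy_free_sum N x (A \<omega>) (B \<omega>) z $$ (i, i) - cauchy_matrix_sum N (A \<omega>) (B \<omega>) z $$ (i, i)"

lemma entry_error_measurable:
  assumes x: "x < N" and i: "i < N" and z: "Im z \<noteq> 0"
  shows "entry_error x z i \<in> borel_measurable P"
proof -
  have kers: "hermitian_kernel (free_kernel N x (X \<omega>)) (free_nb N x) (kernel_bound N (X \<omega>))"
    "hermitian_kernel (sum_kernel N (X \<omega>)) (\<lambda>_. {..<N}) (kernel_bound N (X \<omega>))" if "\<omega> \<in> space P" for \<omega>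
  proof -
    interpret H: hermitian_matrices N x "A \<omega>" "B \<omega>" by (rule matrices[OF that x])
    show "hermitian_kernel (free_kernel N x (X \<omega>)) (free_nb N x) (kernel_bound N (X \<omega>))"
      unfolding X_def by (rule H.T.hermitian_kernel_axioms)
    show "hermitian_kernel (sum_kernel N (X \<omega>)) (\<lambda>_. {..<N}) (kernel_bound N (X \<omega>))"
      unfolding X_def by (rule H.S.hermitian_kernel_axioms)
  qed
  have "(\<lambda>\<omega>. cauchy_free_sum N x (A \<omega>) (B \<omega>) z $$ (i, i)) \<in> borel_measurable P"
  proof (rule borel_measurable_LIMSEQ_metric)
    show "(\<lambda>\<omega>. hermitian_kernel.richardson (free_kernel N x (X \<omega>)) (free_nb N x) (kernel_bound N (X \<omega>)) z
        (delta (diag_vertex x i)) n (diag_vertex x i)) \<in> borel_measurable P" for n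
      by (rule richardson_measurable[OF kers(1) free_kernel_measurable[OF x] kernel_bound_measurable])
    fix \<omega> assume \<omega>: "\<omega> \<in> space P"
    interpret H: hermitian_matrices N x "A \<omega>" "B \<omega>" by (rule matrices[OF \<omega> x])
    show "(\<lambda>n. hermitian_kernel.richardson (free_kernel N x (X \<omega>)) (free_nb N x) (kernel_bound N (X \<omega>)) z
        (delta (diag_vertex x i)) n (diag_vertex x i)) \<longlonglongrightarrow> cauchy_free_sum N x (A \<omega>) (B \<omega>) z $$ (i, i)"
      using H.cauchy_free_entry[OF z i] unfolding X_def by metis
  qed
  moreover have "(\<lambda>\<omega>. cauchy_matrix_sum N (A \<omega>) (B \<omega>) z $$ (i, i)) \<in> borel_measurable P"
  proof (rule borel_measurable_LIMSEQ_metric)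
    show "(\<lambda>\<omega>. hermitian_kernel.richardson (sum_kernel N (X \<omega>)) (\<lambda>_. {..<N}) (kernel_bound N (X \<omega>)) z
        (delta i) n i) \<in> borel_measurable P" for n
      by (rule richardson_measurable[OF kers(2) sum_kernel_measurable kernel_bound_measurable])
    fix \<omega> assume \<omega>: "\<omega> \<in> space P"
    interpret H: hermitian_matrices N x "A \<omega>" "B \<omega>" by (rule matrices[OF \<omega> x])
    show "(\<lambda>n. hermitian_kernel.richardson (sum_kernel N (X \<omega>)) (\<lambda>_. {..<N}) (kernel_bound N (X \<omega>)) z
        (delta i) n i) \<longlonglongrightarrow> cauchy_matrix_sum N (A \<omega>) (B \<omega>) z $$ (i, i)"
      using H.cauchy_matrix_entry[OF z i] unfolding X_def by metis
  qed
  ultimately show ?thesis unfolding entry_error_def[abs_def] by (rule borel_measurable_diff)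
qed

text \<open>A deterministic bound that makes the squared error integrable.\<close>

lemma entry_error_le:
  assumes x: "x < N" and i: "i < N" and z: "Im z > 0" and \<omega>: "\<omega> \<in> space P"
  shows "cmod (entry_error x z i \<omega>) \<le> 2 / Im z"
proof -
  interpret H: hermitian_matrices N x "A \<omega>" "B \<omega>" by (rule matrices[OF \<omega> x])
  have z0: "Im z \<noteq> 0" using z by simp
  obtain f where f: "square_summable f" "\<And>v. H.T.shifted z f v = delta (diag_vertex x i) v"
    "cauchy_free_sum N x (A \<omega>) (B \<omega>) z $$ (i, i) = f (diag_vertex x i)"
    using H.cauchy_free_entry[OF z0 i] by metis
  obtain g where g: "square_summable g" "\<And>j. H.S.shifted z g j = delta i j"
    "cauchy_matrix_sum N (A \<omega>) (B \<omega>) z $$ (i, i) = g i"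
    using H.cauchy_matrix_entry[OF z0 i] by metis
  have "cmod (f (diag_vertex x i)) \<le> 1 / Im z"
    by (rule H.T.resolvent_entry_bound[OF f(1) _ z]) (use f(2) in \<open>simp add: delta_def\<close>)
  moreover have "cmod (g i) \<le> 1 / Im z"
    by (rule H.S.resolvent_entry_bound[OF g(1) _ z]) (use g(2) in \<open>simp add: delta_def\<close>)
  ultimately show ?thesis
    using norm_triangle_ineq4[of "f (diag_vertex x i)" "g i"] by (simp add: entry_error_def f(3) g(3))
qed

text \<open>The matrix moment in the remainder becomes \<open>s\<close>, because the error will be
  squared: s^2 is at most the moment of order 4 * m, and the sum of these over i is a sum of traces
  of words.\<close>

lemma entry_error_moments:
  assumes x: "x < N" and i: "i < N" and z: "Im z > 0" and \<omega>: "\<omega> \<in> space P"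
  obtains s :: real where "s\<^sup>2 \<le> Re ((hermitian_kernel.ap (sum_kernel N (X \<omega>)) (\<lambda>_. {..<N}) ^^ (4 * m)) (delta i) i)"
    "cmod (entry_error x z i \<omega>) \<le> (\<Sum>k<2 * m. cmod (nonclosed_sum N (X \<omega>) k i) / cmod z ^ Suc k)
     + (2 * s + cmod (nonclosed_sum N (X \<omega>) (2 * m) i)) / Im z / cmod z ^ (2 * m)"
proof -
  interpret H: hermitian_matrices N x "A \<omega>" "B \<omega>" by (rule matrices[OF \<omega> x])
  have z0: "Im z \<noteq> 0" using z by simp
  obtain f where f: "square_summable f" "\<And>v. H.T.shifted z f v = delta (diag_vertex x i) v"
    "cauchy_free_sum N x (A \<omega>) (B \<omega>) z $$ (i, i) = f (diag_vertex x i)"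
    using H.cauchy_free_entry[OF z0 i] by metis
  obtain g where g: "square_summable g" "\<And>j. H.S.shifted z g j = delta i j"
    "cauchy_matrix_sum N (A \<omega>) (B \<omega>) z $$ (i, i) = g i"
    using H.cauchy_matrix_entry[OF z0 i] by metis
  define u where "u = (H.S.ap ^^ (2 * m)) (delta i)"
  have d: "delta i = (\<lambda>v. if v = i then 1 else 0)" by (rule ext) (simp add: delta_def)
  have "square_summable ((H.S.ap ^^ n) (delta i))" for n
    by (induction n) (simp_all add: H.delta_square_summable H.S.ap_l2(1))
  then have ssu: "square_summable u" by (simp add: u_def)
  have "(Re (u i))\<^sup>2 \<le> (cmod (u i))\<^sup>2" using abs_Re_le_cmod by (simp add: abs_le_square_iff[symmetric])
  also have "\<dots> \<le> l2_sq u"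
    using power_mono[OF cmod_le_l2[OF ssu, of i], of 2] by (simp add: real_sqrt_pow2_iff l2_sq_def infsum_nonneg)
  also have "\<dots> = Re ((H.S.ap ^^ (4 * m)) (delta i) i)"
    using H.S.iter_delta_even[of "2 * m" i, folded d] by (simp add: u_def)
  finally have "(Re (u i))\<^sup>2 \<le> Re ((H.S.ap ^^ (4 * m)) (delta i) i)" .
  moreover have "cmod (entry_error x z i \<omega>) \<le> (\<Sum>k<2 * m. cmod (nonclosed_sum N (X \<omega>) k i) / cmod z ^ Suc k)
     + (2 * Re (u i) + cmod (nonclosed_sum N (X \<omega>) (2 * m) i)) / Im z / cmod z ^ (2 * m)"
    using H.resolvent_difference[OF i z f(1,2) g(1,2), of m] by (simp add: entry_error_def f(3) g(3) u_def X_def)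
  ultimately show ?thesis using that[of "Re (u i)"] by (simp add: X_def)
qed

lemma frobenius_error:
  assumes x: "x < N" and z: "Im z \<noteq> 0" and \<omega>: "\<omega> \<in> space P"
  shows "(frobenius_norm (cauchy_free_sum N x (A \<omega>) (B \<omega>) z - cauchy_matrix_sum N (A \<omega>) (B \<omega>) z))\<^sup>2
    = (\<Sum>i<N. (cmod (entry_error x z i \<omega>))\<^sup>2)"
proof -
  interpret H: hermitian_matrices N x "A \<omega>" "B \<omega>" by (rule matrices[OF \<omega> x])
  let ?F = "cauchy_free_sum N x (A \<omega>) (B \<omega>) z" and ?G = "cauchy_matrix_sum N (A \<omega>) (B \<omega>) z"
  have F: "?F \<in> carrier_mat N N" by (simp add: cauchy_free_sum_def diag_expectation_def)
  have G: "?G \<in> carrier_mat N N" by (rule H.cauchy_matrix_entry[OF z x])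
  have F0: "?F $$ (i, k) = 0" if "i < N" "k < N" "i \<noteq> k" for i k
    using that by (simp add: cauchy_free_sum_def diag_expectation_def)
  have G0: "?G $$ (i, k) = 0" if "i < N" "k < N" "i \<noteq> k" for i k
    using that G unfolding cauchy_matrix_sum_def diag_part_def carrier_mat_def by simp
  have "(frobenius_norm (?F - ?G))\<^sup>2 = (\<Sum>i<N. \<Sum>k<N. (cmod ((?F - ?G) $$ (i, k)))\<^sup>2)"
    by (rule frobenius_norm_square) (use F G in auto)
  also have "\<dots> = (\<Sum>i<N. \<Sum>k<N. if k = i then (cmod (entry_error x z i \<omega>))\<^sup>2 else 0)"
  proof (intro sum.cong refl)
    fix i k assume "i \<in> {..<N}" "k \<in> {..<N}"
    then have ik: "i < N" "k < N" by auto
    have "(?F - ?G) $$ (i, k) = ?F $$ (i, k) - ?G $$ (i, k)" using ik F G by simp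
    then show "(cmod ((?F - ?G) $$ (i, k)))\<^sup>2 = (if k = i then (cmod (entry_error x z i \<omega>))\<^sup>2 else 0)"
      using ik F0[of i k] G0[of i k] by (cases "k = i") (simp_all add: entry_error_def)
  qed
  finally show ?thesis by simp
qed

lemma nonclosed_sum_0: "nonclosed_sum N Y 0 i = 0"
  by (simp add: nonclosed_sum_def nonclosed_walks_def walks_def stack_run_def)

text \<open>Remainder and non-closed sums are squared separately. The number \<open>q\<close> bounds
  all powers of 1 / |z| at once by q ^ (K + 1), also when |z| < 1.\<close>

lemma mean_error_bound:
  assumes x: "x < N" and z: "Im z > 0" and K: "K = 2 * m" "m \<ge> 1" "K \<le> M" "4 * K \<le> N"
    and q: "q \<ge> 1" "1 \<le> q * cmod z"
    and \<beta>: "\<And>k. 1 \<le> k \<Longrightarrow> k \<le> K \<Longrightarrow>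
      real (2 * k) * (4 * exp 1) ^ (2 * k) * real (2 * k) ^ (4 * k) * (real N powr (real k / real M) * C ^ k) \<le> real N * \<beta>"
  defines "err \<equiv> (\<lambda>\<omega>. 1 / real N * (frobenius_norm (cauchy_free_sum N x (A \<omega>) (B \<omega>) z -
      cauchy_matrix_sum N (A \<omega>) (B \<omega>) z))\<^sup>2)"
  shows "integrable P err"
    and "(\<integral>\<omega>. err \<omega> \<partial>P) \<le> 16 / (Im z)\<^sup>2 * (4 * C / (cmod z)\<^sup>2) ^ K
      + 2 * (q ^ (K + 1) * (1 + 1 / Im z))\<^sup>2 * (real K)\<^sup>2 * \<beta>"
proof -
  have z0: "cmod z > 0" using z by auto
  define err' where "err' \<omega> = 1 / real N * (\<Sum>i<N. (cmod (entry_error x z i \<omega>))\<^sup>2)" for \<omega>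
  have err: "err \<omega> = err' \<omega>" if "\<omega> \<in> space P" for \<omega>
    using frobenius_error[OF x _ that] z by (simp add: err_def err'_def)
  have int_entry: "integrable P (\<lambda>\<omega>. (cmod (entry_error x z i \<omega>))\<^sup>2)" if i: "i < N" for i
  proof (rule integrable_const_bound[where B = "(2 / Im z)\<^sup>2"])
    show "AE \<omega> in P. norm ((cmod (entry_error x z i \<omega>))\<^sup>2) \<le> (2 / Im z)\<^sup>2"
      using entry_error_le[OF x i z] by (intro AE_I2) (simp add: power_mono)
    have "Im z \<noteq> 0" using z by simp
    then show "(\<lambda>\<omega>. (cmod (entry_error x z i \<omega>))\<^sup>2) \<in> borel_measurable P"
      by (intro borel_measurable_power measurable_compose[OF entry_error_measurable borel_measurable_norm] x i)
  qed
  have int': "integrable P err'"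
    unfolding err'_def by (intro integrable_mult_right Bochner_Integration.integrable_sum) (simp add: int_entry)
  then show "integrable P err"
    by (rule iffD1[OF Bochner_Integration.integrable_cong, rotated -1]) (auto simp: err)
  \<comment> \<open>Dominates both coefficients of non-closed sums: 1 / |z| ^ (k + 1) from the
    expansion and 1 / (Im z * |z| ^ K) from the remainder.\<close>
  define c0 where "c0 = q ^ (K + 1) * (1 + 1 / Im z)"
  have c0: "0 \<le> c0" using q z by (simp add: c0_def)
  have inv_pow: "1 / cmod z ^ k \<le> q ^ (K + 1)" if "k \<le> K + 1" for k
  proof -
    have "1 / cmod z ^ k = (1 / cmod z) ^ k" by (simp add: power_one_over)
    also have "\<dots> \<le> q ^ k" using q(2) z0 by (intro power_mono) (auto simp: field_simps)
    also have "\<dots> \<le> q ^ (K + 1)" using q(1) that by (intro power_increasing)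
    finally show ?thesis .
  qed
  define mom where "mom \<omega> i = Re ((hermitian_kernel.ap (sum_kernel N (X \<omega>)) (\<lambda>_. {..<N}) ^^ (2 * K)) (delta i) i)" for \<omega> i
  define b where "b = 1 / (Im z * cmod z ^ K)"
  have b: "0 \<le> b" using z by (simp add: b_def)
  define dd where "dd \<omega> k i = cmod (nonclosed_sum N (X \<omega>) k i)" for \<omega> k i
  have ptw: "(cmod (entry_error x z i \<omega>))\<^sup>2 \<le> 8 * b\<^sup>2 * mom \<omega> i + 2 * c0\<^sup>2 * real K * (\<Sum>k=1..K. (dd \<omega> k i)\<^sup>2)"
    if \<omega>: "\<omega> \<in> space P" and i: "i < N" for \<omega> i
  proof -
    obtain s where s: "s\<^sup>2 \<le> mom \<omega> i"
      and le: "cmod (entry_error x z i \<omega>) \<le> (\<Sum>k<K. dd \<omega> k i / cmod z ^ Suc k) + (2 * s + dd \<omega> K i) / Im z / cmod z ^ K"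
      using entry_error_moments[OF x i z \<omega>, of m] K(1) by (auto simp: mom_def dd_def)
    have "dd \<omega> k i / cmod z ^ Suc k \<le> c0 * dd \<omega> k i" if "k < K" for k
    proof -
      have "q ^ (K + 1) * 1 \<le> c0" unfolding c0_def using q z by (intro mult_left_mono) auto
      with inv_pow[of "Suc k"] that have "1 / cmod z ^ Suc k \<le> c0" by simp
      from mult_right_mono[OF this, of "dd \<omega> k i"] show ?thesis by (simp add: dd_def)
    qed
    then have "(\<Sum>k<K. dd \<omega> k i / cmod z ^ Suc k) \<le> (\<Sum>k<K. c0 * dd \<omega> k i)" by (intro sum_mono) auto
    moreover have "dd \<omega> K i / Im z / cmod z ^ K \<le> c0 * dd \<omega> K i"
    proof -
      have "1 / Im z * (1 / cmod z ^ K) \<le> 1 / Im z * q ^ (K + 1)"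
        using inv_pow[of K] z by (intro mult_left_mono) auto
      also have "\<dots> \<le> c0" using q by (simp add: c0_def algebra_simps)
      finally have "1 / Im z * (1 / cmod z ^ K) \<le> c0" .
      from mult_right_mono[OF this, of "dd \<omega> K i"] show ?thesis by (simp add: dd_def)
    qed
    moreover have "(2 * s + dd \<omega> K i) / Im z / cmod z ^ K = 2 * b * s + dd \<omega> K i / Im z / cmod z ^ K"
      by (simp add: b_def add_divide_distrib)
    ultimately have "cmod (entry_error x z i \<omega>) \<le> 2 * b * s + ((\<Sum>k<K. c0 * dd \<omega> k i) + c0 * dd \<omega> K i)"
      using le by linarith
    also have "(\<Sum>k<K. c0 * dd \<omega> k i) + c0 * dd \<omega> K i = (\<Sum>k\<le>K. c0 * dd \<omega> k i)"
      by (simp add: lessThan_Suc_atMost[symmetric])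
    also have "\<dots> = c0 * (\<Sum>k=1..K. dd \<omega> k i)"
      by (simp add: atMost_atLeast0 sum.atLeast_Suc_atMost dd_def nonclosed_sum_0 sum_distrib_left)
    finally have "(cmod (entry_error x z i \<omega>))\<^sup>2 \<le> (2 * b * s + c0 * (\<Sum>k=1..K. dd \<omega> k i))\<^sup>2"
      by (intro power_mono) auto
    also have "\<dots> \<le> 2 * (2 * b * s)\<^sup>2 + 2 * (c0 * (\<Sum>k=1..K. dd \<omega> k i))\<^sup>2"
      using sum_squares_bound[of "2 * b * s" "c0 * (\<Sum>k=1..K. dd \<omega> k i)"] by (simp add: power2_sum)
    also have "\<dots> = 8 * b\<^sup>2 * s\<^sup>2 + 2 * c0\<^sup>2 * (\<Sum>k=1..K. dd \<omega> k i)\<^sup>2" by (simp add: power_mult_distrib)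
    also have "\<dots> \<le> 8 * b\<^sup>2 * mom \<omega> i + 2 * c0\<^sup>2 * (real K * (\<Sum>k=1..K. (dd \<omega> k i)\<^sup>2))"
    proof (intro add_mono mult_left_mono s)
      show "(\<Sum>k=1..K. dd \<omega> k i)\<^sup>2 \<le> real K * (\<Sum>k=1..K. (dd \<omega> k i)\<^sup>2)"
        using sum_squared_le_sum_of_squares[of "\<lambda>k. dd \<omega> k i" "{1..K}"] by (simp add: mult.commute)
    qed auto
    finally show ?thesis by (simp add: mult_ac)
  qed
  define \<theta> where "\<theta> = real K / real M"
  \<comment> \<open>The interpolated bounds for both letters. Being affine in \<open>FF\<close>,
    they have mean at most N * C ^ K each.\<close>
  define wb where "wb \<omega> = C ^ K * (real N * (1 - \<theta>) + \<theta> / C ^ M * FF SymA \<omega>)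
      + C ^ K * (real N * (1 - \<theta>) + \<theta> / C ^ M * FF SymB \<omega>)" for \<omega>
  have \<theta>: "0 \<le> \<theta>" "\<theta> \<le> 1" using K M1 by (auto simp: \<theta>_def)
  have mom_sum: "(\<Sum>i<N. mom \<omega> i) \<le> 4 ^ K * wb \<omega>" if "\<omega> \<in> space P" for \<omega>
  proof -
    interpret H: hermitian_pair N 0 "X \<omega>" by (rule pair[OF that])
    have "(\<Sum>i<N. mom \<omega> i) \<le> 4 ^ K * (word_norm_sq N (X \<omega>) (replicate K SymA) + word_norm_sq N (X \<omega>) (replicate K SymB))"
      unfolding mom_def by (rule H.moment_sum_le) (use K in simp)
    also have "\<dots> \<le> 4 ^ K * wb \<omega>"
      unfolding wb_def FF_def \<theta>_def by (intro mult_left_mono add_mono H.word_norm_interpolation M1 K(3) C0) auto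
    finally show ?thesis .
  qed
  have wb_int: "integrable P wb"
    unfolding wb_def using FF_integrable(1) by (intro Bochner_Integration.integrable_add integrable_mult_right) auto
  have wb_mean: "(\<integral>\<omega>. wb \<omega> \<partial>P) \<le> 2 * real N * C ^ K"
  proof -
    have "(\<integral>\<omega>. wb \<omega> \<partial>P) = C ^ K * (real N * (1 - \<theta>) + \<theta> / C ^ M * (\<integral>\<omega>. FF SymA \<omega> \<partial>P))
      + C ^ K * (real N * (1 - \<theta>) + \<theta> / C ^ M * (\<integral>\<omega>. FF SymB \<omega> \<partial>P))"
      unfolding wb_def using FF_integrable(1) by (simp add: prob_space)
    also have "\<dots> \<le> C ^ K * (real N * (1 - \<theta>) + \<theta> / C ^ M * (real N * C ^ M))
      + C ^ K * (real N * (1 - \<theta>) + \<theta> / C ^ M * (real N * C ^ M))"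
      using C0 \<theta> by (intro add_mono mult_left_mono FF_integrable(2) order_refl) auto
    also have "\<dots> = 2 * real N * C ^ K" using C0 by (simp add: algebra_simps)
    finally show ?thesis .
  qed
  define bound where "bound \<omega> = 1 / real N * (8 * b\<^sup>2 * (4 ^ K * wb \<omega>)
      + 2 * c0\<^sup>2 * real K * (\<Sum>k=1..K. \<Sum>i<N. (dd \<omega> k i)\<^sup>2))" for \<omega>
  have dd_int: "integrable P (\<lambda>\<omega>. (dd \<omega> k i)\<^sup>2)" if "k \<in> {1..K}" "i < N" for k i
    unfolding dd_def by (rule second_moment(1)) (use that K in auto)
  have dd_sum_int: "integrable P (\<lambda>\<omega>. \<Sum>k=1..K. \<Sum>i<N. (dd \<omega> k i)\<^sup>2)"
    by (intro Bochner_Integration.integrable_sum dd_int) auto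
  have dd_sum_mean: "(\<integral>\<omega>. (\<Sum>k=1..K. \<Sum>i<N. (dd \<omega> k i)\<^sup>2) \<partial>P) \<le> real K * (real N * \<beta>)"
  proof -
    have "(\<integral>\<omega>. (\<Sum>k=1..K. \<Sum>i<N. (dd \<omega> k i)\<^sup>2) \<partial>P) = (\<Sum>k=1..K. \<integral>\<omega>. (\<Sum>i<N. (dd \<omega> k i)\<^sup>2) \<partial>P)"
      by (intro Bochner_Integration.integral_sum Bochner_Integration.integrable_sum dd_int) auto
    also have "\<dots> = (\<Sum>k=1..K. \<Sum>i<N. \<integral>\<omega>. (dd \<omega> k i)\<^sup>2 \<partial>P)"
      by (intro sum.cong refl Bochner_Integration.integral_sum dd_int) auto
    also have "\<dots> \<le> (\<Sum>k=1..K. real N * \<beta>)"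
    proof (rule sum_mono)
      fix k assume k: "k \<in> {1..K}"
      have "(\<Sum>i<N. \<integral>\<omega>. (dd \<omega> k i)\<^sup>2 \<partial>P)
          \<le> real (2 * k) * (4 * exp 1) ^ (2 * k) * real (2 * k) ^ (4 * k) * (real N powr (real k / real M) * C ^ k)"
        unfolding dd_def by (rule second_moment(2)) (use k K in auto)
      also have "\<dots> \<le> real N * \<beta>" by (rule \<beta>) (use k in auto)
      finally show "(\<Sum>i<N. \<integral>\<omega>. (dd \<omega> k i)\<^sup>2 \<partial>P) \<le> real N * \<beta>" .
    qed
    finally show ?thesis by simp
  qed
  have le_bound: "err' \<omega> \<le> bound \<omega>" if \<omega>: "\<omega> \<in> space P" for \<omega>
  proof -
    have "(\<Sum>i<N. (cmod (entry_error x z i \<omega>))\<^sup>2)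
        \<le> (\<Sum>i<N. 8 * b\<^sup>2 * mom \<omega> i + 2 * c0\<^sup>2 * real K * (\<Sum>k=1..K. (dd \<omega> k i)\<^sup>2))"
      using ptw[OF \<omega>] by (intro sum_mono) auto
    also have "\<dots> = 8 * b\<^sup>2 * (\<Sum>i<N. mom \<omega> i) + 2 * c0\<^sup>2 * real K * (\<Sum>i<N. \<Sum>k=1..K. (dd \<omega> k i)\<^sup>2)"
      by (simp add: sum.distrib sum_distrib_left)
    also have "(\<Sum>i<N. \<Sum>k=1..K. (dd \<omega> k i)\<^sup>2) = (\<Sum>k=1..K. \<Sum>i<N. (dd \<omega> k i)\<^sup>2)" by (rule sum.swap)
    also have "8 * b\<^sup>2 * (\<Sum>i<N. mom \<omega> i) + 2 * c0\<^sup>2 * real K * (\<Sum>k=1..K. \<Sum>i<N. (dd \<omega> k i)\<^sup>2)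
        \<le> 8 * b\<^sup>2 * (4 ^ K * wb \<omega>) + 2 * c0\<^sup>2 * real K * (\<Sum>k=1..K. \<Sum>i<N. (dd \<omega> k i)\<^sup>2)"
      by (intro add_right_mono mult_left_mono mom_sum \<omega>) auto
    finally show ?thesis unfolding err'_def bound_def by (intro mult_left_mono) auto
  qed
  have bound_int: "integrable P bound"
    unfolding bound_def using wb_int dd_sum_int by (intro integrable_mult_right Bochner_Integration.integrable_add) auto
  have "(\<integral>\<omega>. err \<omega> \<partial>P) = (\<integral>\<omega>. err' \<omega> \<partial>P)"
    by (intro Bochner_Integration.integral_cong refl err)
  also have "\<dots> \<le> (\<integral>\<omega>. bound \<omega> \<partial>P)" by (rule integral_mono[OF int' bound_int le_bound])
  also have "\<dots> = 1 / real N * (8 * b\<^sup>2 * (4 ^ K * (\<integral>\<omega>. wb \<omega> \<partial>P))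
      + 2 * c0\<^sup>2 * real K * (\<integral>\<omega>. (\<Sum>k=1..K. \<Sum>i<N. (dd \<omega> k i)\<^sup>2) \<partial>P))"
    unfolding bound_def using wb_int dd_sum_int
    by (simp only: integral_mult_right_zero Bochner_Integration.integral_add integrable_mult_right)
  also have "\<dots> \<le> 1 / real N * (8 * b\<^sup>2 * (4 ^ K * (2 * real N * C ^ K)) + 2 * c0\<^sup>2 * real K * (real K * (real N * \<beta>)))"
    by (intro mult_left_mono add_mono wb_mean dd_sum_mean) auto
  also have "\<dots> = 16 * b\<^sup>2 * (4 * C) ^ K + 2 * c0\<^sup>2 * (real K)\<^sup>2 * \<beta>"
    using N1 by (simp add: field_simps power_mult_distrib power2_eq_square)
  also have "16 * b\<^sup>2 * (4 * C) ^ K = 16 / (Im z)\<^sup>2 * (4 * C / (cmod z)\<^sup>2) ^ K"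
    by (simp add: b_def power_divide power_mult_distrib power_mult[symmetric] mult.commute)
  finally show "(\<integral>\<omega>. err \<omega> \<partial>P) \<le> 16 / (Im z)\<^sup>2 * (4 * C / (cmod z)\<^sup>2) ^ K
      + 2 * (q ^ (K + 1) * (1 + 1 / Im z))\<^sup>2 * (real K)\<^sup>2 * \<beta>" by (simp add: c0_def)
qed

end

section \<open>Asymptotics\<close>

text \<open>M = o(ln N) because ln (ln N) tends to infinity. Hence a factor const ^ M stays below
  every positive power of N.\<close>

lemma admissible_speed_linear:
  assumes M: "admissible_speed M" and d: "d > 0"
  shows "\<forall>\<^sub>F N in sequentially. a * real (M N) + b \<le> d * ln (real N)"
proof -
  \<comment> \<open>Once ln (ln N) exceeds \<open>u\<close>, u * M <= ln N, so a * M takes at most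
    half of d * ln N; the other half is for \<open>b\<close>.\<close>
  define u where "u = max 1 (2 * \<bar>a\<bar> / d)"
  have u: "u \<ge> 1" "\<bar>a\<bar> \<le> u * (d / 2)" using d by (auto simp: u_def max_def field_simps)
  have "filterlim (\<lambda>N. ln (ln (real N))) at_top sequentially" "filterlim (\<lambda>N. ln (real N)) at_top sequentially"
    by real_asymp+
  then have "\<forall>\<^sub>F N in sequentially. u \<le> ln (ln (real N))" "\<forall>\<^sub>F N in sequentially. 2 * \<bar>b\<bar> / d + 1 \<le> ln (real N)"
    by (auto simp: filterlim_at_top)
  moreover have "\<forall>\<^sub>F N in sequentially. real (M N) < ln (real N) / ln (ln (real N))"
    using M by (simp add: admissible_speed_def)
  ultimately show ?thesis
  proof eventually_elim
    case (elim N)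
    have "u * real (M N) \<le> ln (ln (real N)) * real (M N)" using elim(1) by (intro mult_right_mono) auto
    also have "\<dots> \<le> ln (real N)" using elim(1,3) u(1) by (simp add: pos_less_divide_eq mult.commute)
    finally have 1: "u * real (M N) \<le> ln (real N)" .
    have "a * real (M N) \<le> \<bar>a\<bar> * real (M N)" by (intro mult_right_mono) auto
    also have "\<dots> \<le> u * (d / 2) * real (M N)" using u(2) by (intro mult_right_mono) auto
    also have "\<dots> = d / 2 * (u * real (M N))" by simp
    also have "\<dots> \<le> d / 2 * ln (real N)" using 1 d by (intro mult_left_mono) auto
    finally have "a * real (M N) \<le> d / 2 * ln (real N)" .
    moreover have "b \<le> d / 2 * ln (real N)"
      using elim(2) d by (simp add: field_simps)
    ultimately show ?case by simp
  qed
qed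

text \<open>From M <= ln N follows M * ln M <= M * ln (ln N) < ln N. Factorial growth in the walk
  length thus costs only powers of N.\<close>

lemma admissible_speed_power:
  assumes M: "admissible_speed M"
  shows "\<forall>\<^sub>F N in sequentially. real (M N) ^ M N \<le> real N"
proof -
  have "filterlim (\<lambda>N. ln (ln (real N))) at_top sequentially" by real_asymp
  then have "\<forall>\<^sub>F N in sequentially. 1 \<le> ln (ln (real N))" by (auto simp: filterlim_at_top)
  moreover have "\<forall>\<^sub>F N in sequentially. real (M N) < ln (real N) / ln (ln (real N))"
    using M by (simp add: admissible_speed_def)
  moreover have "\<forall>\<^sub>F N in sequentially. M N \<ge> 1"
    using M unfolding admissible_speed_def filterlim_at_top by blast
  moreover have "\<forall>\<^sub>F N in sequentially. 2 \<le> N" by (rule eventually_ge_at_top)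
  ultimately show ?thesis
  proof eventually_elim
    case (elim N)
    have lnN: "0 < ln (real N)" using elim(4) by simp
    have lt: "real (M N) * ln (ln (real N)) < ln (real N)"
      using elim(1,2) by (simp add: pos_less_divide_eq)
    have "real (M N) * 1 \<le> real (M N) * ln (ln (real N))" using elim(1) by (intro mult_left_mono) auto
    with lt have "real (M N) \<le> ln (real N)" by simp
    then have "ln (real (M N)) \<le> ln (ln (real N))" using elim(3) lnN by simp
    then have "real (M N) * ln (real (M N)) \<le> real (M N) * ln (ln (real N))" by (intro mult_left_mono) auto
    with lt have "real (M N) * ln (real (M N)) \<le> ln (real N)" by simp
    then have "ln (real (M N) ^ M N) \<le> ln (real N)" using elim(3) by (simp add: ln_realpow)
    then show ?case using elim(3,4) by (subst (asm) ln_le_cancel_iff) auto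
  qed
qed

text \<open>Patterns cost N powr (4 * k / M) and norms N powr (k / M). For 6 * k <= M the exponents
  add up to at most 5 / 6 = 1 - 1 / 6.\<close>

lemma second_moment_rate:
  fixes C :: real
  assumes M: "M \<ge> 1" "real M ^ M \<le> real N" and N: "N \<ge> 1" and C: "C > 0" and k: "1 \<le> k" "6 * k \<le> M"
  shows "real (2 * k) * (4 * exp 1) ^ (2 * k) * real (2 * k) ^ (4 * k) * (real N powr (real k / real M) * C ^ k)
    \<le> real N * (real M * (16 * (exp 1)\<^sup>2 * max 1 C) ^ M * real N powr (- (1 / 6)))"
proof -
  define H where "H = 16 * (exp 1)\<^sup>2 * max 1 C"
  have e2: "1 \<le> (exp 1 :: real)\<^sup>2" by (simp add: one_le_power)
  have H: "1 \<le> H" unfolding H_def using mult_mono[OF e2, of 1 "max 1 C"] by simp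
  have "real (2 * k) ^ (4 * k) \<le> real M ^ (4 * k)" using k by (intro power_mono) auto
  also have "\<dots> = (real M ^ M) powr (real (4 * k) / real M)"
    using M by (simp add: powr_realpow[symmetric] powr_powr)
  also have "\<dots> \<le> real N powr (real (4 * k) / real M)" using M by (intro powr_mono2) auto
  finally have "real (2 * k) ^ (4 * k) * real N powr (real k / real M)
      \<le> real N powr (real (4 * k) / real M) * real N powr (real k / real M)"
    by (intro mult_right_mono) auto
  also have "\<dots> = real N powr (5 * real k / real M)" by (simp add: powr_add[symmetric] add_divide_distrib[symmetric])
  also have "\<dots> \<le> real N powr (1 + (- (1 / 6)))" using k M N by (intro powr_mono) (auto simp: field_simps)
  also have "\<dots> = real N * real N powr (- (1 / 6))" using N by (subst powr_add) simp
  finally have 1: "real (2 * k) ^ (4 * k) * real N powr (real k / real M) \<le> real N * real N powr (- (1 / 6))" .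
  have "(4 * exp 1) ^ (2 * k) * C ^ k = (16 * (exp 1)\<^sup>2 * C) ^ k"
    by (simp add: power_mult power_mult_distrib)
  also have "\<dots> \<le> H ^ k" using C unfolding H_def by (intro power_mono mult_left_mono) auto
  also have "\<dots> \<le> H ^ M" using H k by (intro power_increasing) auto
  finally have 2: "(4 * exp 1) ^ (2 * k) * C ^ k \<le> H ^ M" .
  have "real (2 * k) * ((4 * exp 1) ^ (2 * k) * C ^ k) * (real (2 * k) ^ (4 * k) * real N powr (real k / real M))
      \<le> real M * H ^ M * (real N * real N powr (- (1 / 6)))"
    using k C H by (intro mult_mono 1 2) auto
  then show ?thesis by (simp add: H_def mult_ac)
qed

lemma error_rate:
  fixes r y \<zeta> c C q :: real
  assumes M: "admissible_speed M" and r: "0 < r" "r < 1" and c: "c < 1 / 6" and y: "y > 0" and \<zeta>: "\<zeta> > 0"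
    and C: "C > 0" and q: "q \<ge> 1" and rC: "4 * C / \<zeta>\<^sup>2 \<le> r\<^sup>2"
  defines "K \<equiv> \<lambda>N. 2 * (M N div 12)"
  shows "\<forall>\<^sub>F N in sequentially. 16 / y\<^sup>2 * (4 * C / \<zeta>\<^sup>2) ^ K N
      + 2 * (q ^ (K N + 1) * (1 + 1 / y))\<^sup>2 * (real (K N))\<^sup>2
        * (real (M N) * (16 * (exp 1)\<^sup>2 * max 1 C) ^ M N * real N powr (- (1 / 6)))
    \<le> 4 / \<zeta>\<^sup>2 * r powr (2 * c * real (M N))"
proof -
  have Mtop: "filterlim (\<lambda>N. real (M N)) at_top sequentially"
    using M filterlim_compose[OF filterlim_real_sequentially, of M] by (simp add: admissible_speed_def)
  \<comment> \<open>Exponent to spare: 2 * K is about M / 3, while the target is 2 * c * M.\<close>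
  define \<delta> where "\<delta> = 2 * (1 / 6 - c)"
  have \<delta>: "\<delta> > 0" using c by (simp add: \<delta>_def)
  \<comment> \<open>Chosen so that the first term becomes 2 / \<open>\<zeta>\<^sup>2\<close> times
    the target power, half of the allowance.\<close>
  define b1 where "b1 = 8 * \<zeta>\<^sup>2 / y\<^sup>2"
  have b1: "b1 > 0" using y \<zeta> by (simp add: b1_def)
  define L where "L = - ln r"
  have L: "L > 0" using r by (simp add: L_def)
  have ev1: "\<forall>\<^sub>F N in sequentially. (ln b1 / L + 4) / \<delta> \<le> real (M N)"
    using Mtop by (auto simp: filterlim_at_top)
  define H where "H = 16 * (exp 1)\<^sup>2 * max 1 C"
  have H: "H > 0" by (simp add: H_def)
  define b2 where "b2 = \<zeta>\<^sup>2 * q\<^sup>2 * (1 + 1 / y)\<^sup>2"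
  have b2: "b2 > 0" unfolding b2_def using y \<zeta> q by (intro mult_pos_pos zero_less_power add_pos_pos) auto
  \<comment> \<open>The coefficients: 3 from m ^ 3 <= exp (3 * m), 2 * ln q from the squared power
    of q, ln H from H ^ m, and 2 * |c| * L from the target power.\<close>
  have ev2: "\<forall>\<^sub>F N in sequentially. (3 + 2 * ln q + ln H + 2 * \<bar>c\<bar> * L) * real (M N) + ln b2 \<le> 1 / 6 * ln (real N)"
    by (rule admissible_speed_linear[OF M]) simp
  have ev3: "\<forall>\<^sub>F N in sequentially. 1 \<le> real (M N)" using Mtop unfolding filterlim_at_top by blast
  have ev4: "\<forall>\<^sub>F N in sequentially. 1 \<le> N" by (rule eventually_ge_at_top)
  show ?thesis using ev1 ev2 ev3 ev4
  proof eventually_elim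
    case (elim N)
    define m where "m = real (M N)"
    define R where "R = r powr (2 * c * m)"
    have m: "m \<ge> 1" using elim(3) by (simp add: m_def)
    have R0: "0 < R" using r by (simp add: R_def)
    \<comment> \<open>Rounding down by \<open>div 12\<close> loses at most 11 / 6 in K, simplified
      to 2; twice this is the 4 in the exponents below.\<close>
    have Klow: "m / 6 - 2 \<le> real (K N)" and Kup: "real (K N) \<le> m"
      by (simp_all add: K_def m_def)
    have "(4 * C / \<zeta>\<^sup>2) ^ K N \<le> (r\<^sup>2) ^ K N" using C rC by (intro power_mono) auto
    also have "\<dots> = r powr (2 * real (K N))" using powr_realpow[OF r(1), of "2 * K N"] by (simp add: power_mult)
    also have "\<dots> = R * r powr (2 * real (K N) - 2 * c * m)" by (simp add: R_def powr_add[symmetric])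
    also have "r powr (2 * real (K N) - 2 * c * m) \<le> r powr (\<delta> * m - 4)"
      using r Klow by (intro powr_mono') (auto simp: \<delta>_def algebra_simps)
    also have "r powr (\<delta> * m - 4) \<le> 1 / b1"
    proof -
      have "ln b1 / L \<le> \<delta> * m - 4" using elim(1) \<delta> by (simp add: m_def field_simps)
      then have "ln b1 \<le> L * (\<delta> * m - 4)" using L by (simp add: field_simps)
      then have "exp (- (L * (\<delta> * m - 4))) \<le> exp (- ln b1)" by simp
      then show ?thesis using r b1 by (simp add: powr_def L_def exp_minus inverse_eq_divide mult.commute)
    qed
    finally have "(4 * C / \<zeta>\<^sup>2) ^ K N \<le> R * (1 / b1)" using R0 by simp
    then have "16 / y\<^sup>2 * (4 * C / \<zeta>\<^sup>2) ^ K N \<le> 16 / y\<^sup>2 * (R * (1 / b1))" by (intro mult_left_mono) auto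
    also have "\<dots> = 2 / \<zeta>\<^sup>2 * R" using y \<zeta> by (simp add: b1_def field_simps)
    finally have 1: "16 / y\<^sup>2 * (4 * C / \<zeta>\<^sup>2) ^ K N \<le> 2 / \<zeta>\<^sup>2 * R" .
    have "(q ^ (K N + 1) * (1 + 1 / y))\<^sup>2 * (real (K N))\<^sup>2 * (m * H ^ M N * real N powr (- (1 / 6)))
        \<le> (q powr (m + 1) * (1 + 1 / y))\<^sup>2 * m\<^sup>2 * (m * H ^ M N * real N powr (- (1 / 6)))"
    proof (intro mult_right_mono mult_mono power_mono)
      have "q ^ (K N + 1) = q powr (real (K N) + 1)" using q by (simp add: powr_realpow[symmetric] powr_add)
      also have "\<dots> \<le> q powr (m + 1)" using q Kup by (intro powr_mono) auto
      finally show "q ^ (K N + 1) \<le> q powr (m + 1)" .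
    qed (use m q y H Kup in auto)
    also have "\<dots> = b2 / \<zeta>\<^sup>2 * (q powr (2 * m) * m ^ 3 * H powr m * real N powr (- (1 / 6)))"
    proof -
      have "q powr (m + 1) = q powr m * q" "q powr (2 * m) = q powr m * q powr m"
        using q by (simp_all add: powr_add[symmetric] powr_add[of q m 1])
      moreover have "H powr m = H ^ M N" using H by (simp add: m_def powr_realpow)
      moreover have "b2 / \<zeta>\<^sup>2 = (q * (1 + 1 / y))\<^sup>2" using \<zeta> by (simp add: b2_def power_mult_distrib)
      ultimately show ?thesis
        by (simp only: power_mult_distrib) (simp only: power2_eq_square power3_eq_cube mult_ac)
    qed
    also have "\<dots> \<le> b2 / \<zeta>\<^sup>2 * (q powr (2 * m) * exp (3 * m) * H powr m * real N powr (- (1 / 6)))"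
    proof (intro mult_left_mono mult_right_mono)
      have "m \<le> exp m" using exp_ge_add_one_self[of m] by linarith
      then have "m ^ 3 \<le> exp m ^ 3" using m by (intro power_mono) auto
      then show "m ^ 3 \<le> exp (3 * m)" using exp_of_nat_mult[of 3 m] by simp
    qed (use b2 in auto)
    also have "\<dots> = 1 / \<zeta>\<^sup>2 * exp (ln b2 + 2 * m * ln q + 3 * m + m * ln H - 1 / 6 * ln (real N))"
    proof -
      have e: "ln b2 + 2 * m * ln q + 3 * m + m * ln H - 1 / 6 * ln (real N)
          = ln b2 + (2 * m * ln q + 3 * m + m * ln H + - (1 / 6) * ln (real N))" by simp
      show ?thesis unfolding e exp_add using q H b2 elim(4) by (simp add: powr_def)
    qed
    also have "\<dots> \<le> 1 / \<zeta>\<^sup>2 * R"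
    proof (rule mult_left_mono)
      have "2 * (c * (m * L)) \<le> 2 * (\<bar>c\<bar> * (m * L))" using m L by (intro mult_left_mono mult_right_mono) auto
      then have "ln b2 + 2 * m * ln q + 3 * m + m * ln H - 1 / 6 * ln (real N) \<le> - (2 * c * m * L)"
        using elim(2) by (simp add: m_def algebra_simps)
      then have "exp (ln b2 + 2 * m * ln q + 3 * m + m * ln H - 1 / 6 * ln (real N)) \<le> exp (- (2 * c * m * L))"
        by (simp only: exp_le_cancel_iff)
      also have "\<dots> = R" using r by (simp add: R_def powr_def L_def)
      finally show "exp (ln b2 + 2 * m * ln q + 3 * m + m * ln H - 1 / 6 * ln (real N)) \<le> R" .
    qed auto
    finally have 2: "(q ^ (K N + 1) * (1 + 1 / y))\<^sup>2 * (real (K N))\<^sup>2 * (m * H ^ M N * real N powr (- (1 / 6)))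
        \<le> 1 / \<zeta>\<^sup>2 * R" .
    show ?case using 1 2 by (simp add: m_def R_def H_def field_simps)
  qed
qed

theorem theorem2p6:
  fixes P :: "nat \<Rightarrow> 'w measure"
    and A B :: "nat \<Rightarrow> 'w \<Rightarrow> complex mat"
    and M x :: "nat \<Rightarrow> nat"
    and h\<^sub>1 h\<^sub>2 C c r\<^sub>0 :: real
    and z :: complex
  assumes prob: "\<And>N. N \<ge> 1 \<Longrightarrow> prob_space (P N)"
    and random_A: "\<And>N. N \<ge> 1 \<Longrightarrow> random_matrix (P N) N (A N)"
    and random_B: "\<And>N. N \<ge> 1 \<Longrightarrow> random_matrix (P N) N (B N)"
    and hermitian_A: "\<And>N \<omega>. N \<ge> 1 \<Longrightarrow> \<omega> \<in> space (P N) \<Longrightarrow> hermitian_mat (A N \<omega>)"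
    and hermitian_B: "\<And>N \<omega>. N \<ge> 1 \<Longrightarrow> \<omega> \<in> space (P N) \<Longrightarrow> hermitian_mat (B N \<omega>)"
    and indep: "\<And>N. N \<ge> 1 \<Longrightarrow> independent_matrices (P N) N (A N) (B N)"
    and speed: "admissible_speed M"
    and pos: "h\<^sub>1 > 0" "h\<^sub>2 > 0" "C > 0"
    and trace_A: "injective_trace_assumption P A M h\<^sub>1"
    and trace_B: "injective_trace_assumption P B M h\<^sub>2"
    and frob_A: "frobenius_assumption P A M C"
    and frob_B: "frobenius_assumption P B M C"
    and perm_inv: "(\<forall>N\<ge>1. permutation_invariant (P N) N (A N)) \<or>
                   (\<forall>N\<ge>1. permutation_invariant (P N) N (B N))"
    and root: "\<And>N. N \<ge> 1 \<Longrightarrow> x N < N"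
    and c: "0 \<le> c" "c \<le> 1 / (h\<^sub>1 + h\<^sub>2 + 6)"
    and r\<^sub>0: "r\<^sub>0 = sqrt (max (4 * C) (2 * c\<^sup>2))"
    and z: "Im z > 0" "(cmod z)\<^sup>2 > max (4 * C) (2 * c\<^sup>2)"
  shows "\<forall>\<^sub>F N in sequentially.
    (let f = (\<lambda>\<omega>. 1 / real N * (frobenius_norm
                (cauchy_free_sum N (x N) (A N \<omega>) (B N \<omega>) z -
                 cauchy_matrix_sum N (A N \<omega>) (B N \<omega>) z))\<^sup>2)
     in integrable (P N) f \<and>
        (\<integral>\<omega>. f \<omega> \<partial>P N) \<le> 4 / (cmod z)\<^sup>2 * (r\<^sub>0 / cmod z) powr (2 * c * real (M N)))"
proof -
  define r where "r = r\<^sub>0 / cmod z"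
  define y where "y = Im z"
  \<comment> \<open>Serves small and large |z| alike: q >= 1 and q * |z| >= 1.\<close>
  define q where "q = max 1 (1 / cmod z)"
  have \<zeta>: "cmod z > 0" using z(1) by auto
  have r0: "r\<^sub>0\<^sup>2 = max (4 * C) (2 * c\<^sup>2)" "0 < r\<^sub>0" using r\<^sub>0 pos(3) by (auto simp: less_max_iff_disj le_max_iff_disj)
  have r: "0 < r" using r0 \<zeta> by (simp add: r_def)
  have "r\<^sub>0\<^sup>2 < (cmod z)\<^sup>2" using r0 z(2) by simp
  then have "r\<^sub>0 < cmod z" using \<zeta> by (simp add: power_less_imp_less_base)
  then have r1: "r < 1" using \<zeta> by (simp add: r_def)
  have rC: "4 * C / (cmod z)\<^sup>2 \<le> r\<^sup>2" using r0(1) by (simp add: r_def power_divide divide_right_mono)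
  \<comment> \<open>Positivity of \<open>h\<^sub>1 + h\<^sub>2\<close> makes the inequality strict,
    and the gap to 1 / 6 pays for all constants.\<close>
  have "1 / (h\<^sub>1 + h\<^sub>2 + 6) < 1 / 6" using pos by (intro divide_strict_left_mono) auto
  then have c6: "c < 1 / 6" using c by simp
  have q: "1 \<le> q" "1 \<le> q * cmod z"
  proof -
    have "1 / cmod z * cmod z \<le> q * cmod z" by (intro mult_right_mono) (auto simp: q_def)
    then show "1 \<le> q * cmod z" using \<zeta> by simp
  qed (simp add: q_def)
  have Mbig: "\<forall>\<^sub>F N in sequentially. 12 \<le> M N"
    using speed unfolding admissible_speed_def filterlim_at_top by blast
  \<comment> \<open>Gives M <= ln N <= N, from which 4 * K <= N follows.\<close>
  have Mlog: "\<forall>\<^sub>F N in sequentially. 1 * real (M N) + 0 \<le> 1 * ln (real N)"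
    by (rule admissible_speed_linear[OF speed]) simp
  have N1: "\<forall>\<^sub>F N in sequentially. 1 \<le> N" by (rule eventually_ge_at_top)
  show ?thesis
    using error_rate[OF speed r r1 c6 z(1) \<zeta> pos(3) q(1) rC] admissible_speed_power[OF speed] Mbig Mlog N1
  proof eventually_elim
    case (elim N)
    \<comment> \<open>The largest even K with 6 * K <= M: even for the remainder estimate, and
      within the range of \<open>second_moment_rate\<close>.\<close>
    define K where "K = 2 * (M N div 12)"
    define \<beta> where "\<beta> = real (M N) * (16 * (exp 1)\<^sup>2 * max 1 C) ^ M N * real N powr (- (1 / 6))"
    have N: "N \<ge> 1" by (rule elim(5))
    interpret prob_space "P N" by (rule prob[OF N])
    interpret random_pair "P N" N "M N" "A N" "B N" C
    proof
      show "permutation_invariant (P N) N (A N) \<or> permutation_invariant (P N) N (B N)" using perm_inv N by blast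
    qed (use N elim(3) pos(3) random_A random_B hermitian_A hermitian_B indep frob_A frob_B in
        \<open>auto simp: frobenius_assumption_def Let_def\<close>)
    have "real (M N) \<le> real N"
      using elim(4) ln_bound[of "real N"] N by simp
    then have MN: "M N \<le> N" by simp
    have KM: "6 * K \<le> M N" and K1: "M N div 12 \<ge> 1" using elim(3) by (auto simp: K_def)
    have rate: "real (2 * k) * (4 * exp 1) ^ (2 * k) * real (2 * k) ^ (4 * k) * (real N powr (real k / real (M N)) * C ^ k)
        \<le> real N * \<beta>" if "1 \<le> k" "k \<le> K" for k
      unfolding \<beta>_def by (rule second_moment_rate) (use that KM elim(2,3) N pos(3) in auto)
    have "K \<le> M N" "4 * K \<le> N" using KM MN by auto
    note bound = mean_error_bound[OF root[OF N] z(1) K_def K1 this q rate]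
    show ?case unfolding Let_def
    proof
      show "integrable (P N) (\<lambda>\<omega>. 1 / real N * (frobenius_norm (cauchy_free_sum N (x N) (A N \<omega>) (B N \<omega>) z
          - cauchy_matrix_sum N (A N \<omega>) (B N \<omega>) z))\<^sup>2)" by (rule bound(1))
      have "(\<integral>\<omega>. 1 / real N * (frobenius_norm (cauchy_free_sum N (x N) (A N \<omega>) (B N \<omega>) z
          - cauchy_matrix_sum N (A N \<omega>) (B N \<omega>) z))\<^sup>2 \<partial>P N)
        \<le> 16 / (Im z)\<^sup>2 * (4 * C / (cmod z)\<^sup>2) ^ K + 2 * (q ^ (K + 1) * (1 + 1 / Im z))\<^sup>2 * (real K)\<^sup>2 * \<beta>"
        by (rule bound(2))
      also have "\<dots> \<le> 4 / (cmod z)\<^sup>2 * r powr (2 * c * real (M N))"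
        using elim(1) unfolding K_def \<beta>_def .
      finally show "(\<integral>\<omega>. 1 / real N * (frobenius_norm (cauchy_free_sum N (x N) (A N \<omega>) (B N \<omega>) z
          - cauchy_matrix_sum N (A N \<omega>) (B N \<omega>) z))\<^sup>2 \<partial>P N)
        \<le> 4 / (cmod z)\<^sup>2 * (r\<^sub>0 / cmod z) powr (2 * c * real (M N))" by (simp add: r_def)
    qed
  qed
qed

end
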